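(* Let $\epsilon\in\{\pm1\}$, and let $\mathrm{Mat}_\epsilon(2d)$ be the space of symmetric ($\epsilon=1$) or skew-symmetric ($\epsilon=-1$) $2d\times2d$ matrices, on which $GL(2d)$ acts by $g\cdot A=gAg^t$; let $B\subset GL(2d)$ be the Borel subgroup of lower triangular matrices. Then there exist a symmetric quiver $Q$ of Dynkin type $A$ with symmetric dimension vector $\mathbf{d}$, and a $G(\mathbf{d})$-stable open subvariety $U\subset\mathrm{srep}_Q(\mathbf{d})$ such that the following hold. (i) There is an injective, order preserving map of partially ordered sets (ordered by inclusion) $$\{B\text{-orbit closures in }\mathrm{Mat}_\epsilon(2d)\}\to\{G(\mathbf{d})\text{-orbit closures in }\mathrm{srep}_Q(\mathbf{d})\},$$ denoted $\mathscr{O}\mapsto\mathscr{O}'$ below. The image of the map is the set of orbit closures which have nontrivial intersection with $U$. (ii) Any smooth equivalence class of singularity occurring in $\mathscr{O}$ also occurs in $\mathscr{O}'$. (iii) There is a homomorphism of equivariant Grothendieck groups $$f\colon K_{G(\mathbf{d})}(\mathrm{srep}_Q(\mathbf{d}))\to K_T(\mathrm{Mat}_\epsilon(2d)),$$ where $T$ is the maximal torus of diagonal matrices in $GL(2d)$, such that $[\mathcal{O}_{\mathscr{O}}]=f([\mathcal{O}_{\mathscr{O}'}])$, where $\mathcal{O}$ denotes the structure sheaf in each case.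
   Context: Work over an algebraically closed field $\Bbbk$ of characteristic not $2$. Symmetric type $A$ quivers. Let $Q$ be a quiver whose underlying graph is a Dynkin diagram of type $A$, with vertex set $Q_0$ and arrow set $Q_1$; $ta$, $ha$ denote tail and head of an arrow $a$. A symmetric type $A$ quiver is such a $Q$ together with the involution $\tau$ of $Q_0$ and $Q_1$ induced by the nontrivial automorphism of the underlying graph, required to reverse orientation ($\tau(ha)=t\tau(a)$, $\tau(ta)=h\tau(a)$), and a sign $s\in\{\pm1\}$ attached to the unique $\tau$-fixed vertex (if $|Q_0|$ is odd) or unique $\tau$-fixed arrow (if $|Q_0|$ is even). One writes $Q_i=Q_i^+\sqcup Q_i^\tau\sqcup Q_i^-$ ($i=0,1$), where $Q_i^\tau$ is the set of $\tau$-fixed elements, $\tau(Q_i^{\pm})=Q_i^{\mp}$, and $Q^+$, $Q^-$ are the two halves of the diagram exchanged by $\tau$ (arrows in $Q_1^+$ have endpoints in $Q_0^+\cup Q_0^\tau$). A dimension vector $\mathbf{d}\colon Q_0\to\mathbb{Z}_{\ge0}$ is symmetric if $\mathbf{d}(z)=\mathbf{d}(\tau(z))$ for all $z$. Representation spaces. $\mathrm{Mat}_s(m,m)$ is the space of symmetric ($s=1$) or skew-symmetric ($s=-1$) $m\times m$ matrices. If there is a fixed vertex $z\in Q_0^\tau$, fix $\Omega_z\in GL(\mathbf{d}(z))$ symmetric if $s=1$, skew-symmetric if $s=-1$, and let $K_z=\{g\in GL(\mathbf{d}(z)) : g^t\Omega_z g=\Omega_z\}$. Set $$\mathrm{srep}_Q(\mathbf{d})=\prod_{a\in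 Q_1^+}\mathrm{Mat}(\mathbf{d}(ha),\mathbf{d}(ta))\times\prod_{a\in Q_1^\tau}\mathrm{Mat}_{s}(\mathbf{d}(ha),\mathbf{d}(ta)),\qquad G(\mathbf{d})=\prod_{z\in Q_0^+}GL(\mathbf{d}(z))\times\prod_{z\in Q_0^\tau}K_z,$$ with action $g\cdot V=(g_{ha}V_ag_{ta}^{-1})_{a\in Q_1^+\cup Q_1^\tau}$, where $g_z:=g_{\tau(z)}^{-t}$ for $z\in Q_0^-$. $K_H(Z)$ is the Grothendieck group of $H$-equivariant coherent sheaves on $Z$. Orbit closures carry the reduced structure. Pointed varieties $(X_1,x_1)$, $(X_2,x_2)$ are smoothly equivalent if there are a pointed variety $(Z,z)$ and smooth morphisms $Z\to X_i$ with $z\mapsto x_i$, $i=1,2$. *)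

theory Defs
  imports
    "HOL-Analysis.Abstract_Topology"
    "HOL-Library.Poly_Mapping"
    "HOL-Algebra.Group_Action"
    "HOL-Algebra.Product_Groups"
    "HOL-Algebra.Free_Abelian_Groups"
    "HOL-Algebra.Module"
    "Jordan_Normal_Form.Matrix"
    "Jordan_Normal_Form.Determinant"
    "Graph_Theory.Digraph"
begin

section \<open>Algebras of functions and varieties\<close>

text \<open>
  Everything is done over an algebraically closed field, so a variety (a reduced separated scheme of
  finite type, not necessarily irreducible) is the same as its set of closed points together
  with a Zariski topology and a sheaf of field-valued functions.  A function on a set \<open>X\<close> is always
  taken to be \<^const>\<open>extensional\<close> on \<open>X\<close>, so that rings of functions are honest sets of functions.
\<close>

inductive_set gen_alg :: "'p set \<Rightarrow> ('p \<Rightarrow> 'k::comm_ring_1) set \<Rightarrow> ('p \<Rightarrow> 'k) set"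
  for X :: "'p set" and C :: "('p \<Rightarrow> 'k) set" where
  const: "(\<lambda>x\<in>X. c) \<in> gen_alg X C"
| gen: "f \<in> C \<Longrightarrow> restrict f X \<in> gen_alg X C"
| add: "f \<in> gen_alg X C \<Longrightarrow> g \<in> gen_alg X C \<Longrightarrow> (\<lambda>x\<in>X. f x + g x) \<in> gen_alg X C"
| mult: "f \<in> gen_alg X C \<Longrightarrow> g \<in> gen_alg X C \<Longrightarrow> (\<lambda>x\<in>X. f x * g x) \<in> gen_alg X C"

definition fun_ring :: "'p set \<Rightarrow> ('p \<Rightarrow> 'k::comm_ring_1) set \<Rightarrow> ('p \<Rightarrow> 'k) ring" where
  "fun_ring X A =
    \<lparr>carrier = A, monoid.mult = (\<lambda>f g. \<lambda>x\<in>X. f x * g x), one = (\<lambda>x\<in>X. 1),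
     zero = (\<lambda>x\<in>X. 0), add = (\<lambda>f g. \<lambda>x\<in>X. f x + g x)\<rparr>"

text \<open>
  An affine variety: a finitely generated algebra \<open>A\<close> of functions on \<open>X\<close> such that the points
  of \<open>X\<close> are exactly the algebra homomorphisms from \<open>A\<close> to the ground field.
\<close>

definition affine_variety :: "'p set \<Rightarrow> ('p \<Rightarrow> 'k::field) set \<Rightarrow> bool" where
  "affine_variety X A \<longleftrightarrow>
    (\<exists>C. finite C \<and> A = gen_alg X C) \<and>
    (\<forall>\<chi> :: ('p \<Rightarrow> 'k) \<Rightarrow> 'k.
      (\<forall>c. \<chi> (\<lambda>x\<in>X. c) = c) \<and>
      (\<forall>f\<in>A. \<forall>g\<in>A. \<chi> (\<lambda>x\<in>X. f x + g x) = \<chi> f + \<chi> g \<and> \<chi> (\<lambda>x\<in>X. f x * g x) = \<chi> f * \<chi> g)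
      \<longrightarrow> (\<exists>!x. x \<in> X \<and> (\<forall>f\<in>A. \<chi> f = f x)))"

definition zariski :: "'p set \<Rightarrow> ('p \<Rightarrow> 'k::field) set \<Rightarrow> 'p topology" where
  "zariski X A = topology (\<lambda>U. \<exists>S\<subseteq>A. U = {x\<in>X. \<exists>f\<in>S. f x \<noteq> 0})"

lemma openin_zariski:
  assumes "A = gen_alg X C"
  shows "openin (zariski X A) U \<longleftrightarrow> (\<exists>S\<subseteq>A. U = {x\<in>X. \<exists>f\<in>S. f x \<noteq> 0})"
proof -
  define N where "N S = {x\<in>X. \<exists>f\<in>S. f x \<noteq> 0}" for S :: "('a \<Rightarrow> 'b) set"
  have "istopology (\<lambda>U. \<exists>S\<subseteq>A. U = N S)"
    unfolding istopology_def
  proof (intro conjI allI impI)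
    fix U V assume "\<exists>S\<subseteq>A. U = N S" "\<exists>S\<subseteq>A. V = N S"
    then obtain S T where S: "S \<subseteq> A" "U = N S" and T: "T \<subseteq> A" "V = N T"
      by (elim exE conjE) (rule that)
    let ?W = "(\<lambda>(f, g). \<lambda>x\<in>X. f x * g x) ` (S \<times> T)"
    have "?W \<subseteq> A" using S(1) T(1) assms by (auto intro: gen_alg.mult)
    moreover have "N S \<inter> N T = N ?W"
      by (auto simp: N_def)
    ultimately show "\<exists>S\<subseteq>A. U \<inter> V = N S"
      using S(2) T(2) by (intro exI[of _ ?W] conjI) simp_all
  next
    fix K assume "\<forall>U\<in>K. \<exists>S\<subseteq>A. U = N S"
    from bchoice[OF this]
    obtain S where "\<forall>U\<in>K. S U \<subseteq> A \<and> U = N (S U)" ..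
    then have S: "U \<in> K \<Longrightarrow> S U \<subseteq> A" "U \<in> K \<Longrightarrow> U = N (S U)" for U by simp_all
    have "\<Union>K = (\<Union>U\<in>K. N (S U))" using S(2) by simp
    also have "\<dots> = N (\<Union>U\<in>K. S U)" by (auto simp: N_def)
    finally have "\<Union>K = N (\<Union>U\<in>K. S U)" .
    moreover have "(\<Union>U\<in>K. S U) \<subseteq> A" using S(1) by (rule UN_least)
    ultimately show "\<exists>S\<subseteq>A. \<Union>K = N S"
      by (intro exI[of _ "\<Union>U\<in>K. S U"] conjI)
  qed
  then show ?thesis unfolding zariski_def N_def by (simp only: topology_inverse')
qed

record ('p, 'k) kspace =
  ktop :: "'p topology"
  kreg :: "'p set \<Rightarrow> ('p \<Rightarrow> 'k) set"

definition regular_on :: "'p set \<Rightarrow> ('p \<Rightarrow> 'k::field) set \<Rightarrow> 'p set \<Rightarrow> ('p \<Rightarrow> 'k) set" where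
  "regular_on X A U =
    {f \<in> extensional U. \<forall>x\<in>U. \<exists>a\<in>A. \<exists>b\<in>A. \<exists>V. openin (zariski X A) V \<and> x \<in> V \<and> V \<subseteq> U \<and>
       (\<forall>y\<in>V. b y \<noteq> 0 \<and> f y = a y / b y)}"

definition affine_kspace :: "'p set \<Rightarrow> ('p \<Rightarrow> 'k::field) set \<Rightarrow> ('p, 'k) kspace" where
  "affine_kspace X A = \<lparr>ktop = zariski X A, kreg = regular_on X A\<rparr>"

definition affine_open :: "('p, 'k::field) kspace \<Rightarrow> 'p set \<Rightarrow> bool" where
  "affine_open X U \<longleftrightarrow>
    openin (ktop X) U \<and> affine_variety U (kreg X U) \<and>
    (\<forall>W\<subseteq>U. openin (ktop X) W \<longleftrightarrow> openin (zariski U (kreg X U)) W) \<and>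
    (\<forall>W\<subseteq>U. openin (ktop X) W \<longrightarrow> kreg X W = regular_on U (kreg X U) W)"

text \<open>
  The last conjunct of the following definition is separatedness: the diagonal is closed in the
  product variety, whose topology has as a basis the sets
  \<open>{(x, y) \<in> U \<times> V. (\<Sum>i<n. f i x * g i y) \<noteq> 0}\<close> with \<open>f i\<close>, \<open>g i\<close> regular on \<open>U\<close>, \<open>V\<close>.
\<close>

definition variety :: "('p, 'k::field) kspace \<Rightarrow> bool" where
  "variety X \<longleftrightarrow>
    (\<forall>W. openin (ktop X) W \<longrightarrow> kreg X W \<subseteq> extensional W) \<and>
    (\<forall>W V f. openin (ktop X) W \<and> openin (ktop X) V \<and> V \<subseteq> W \<and> f \<in> kreg X W
       \<longrightarrow> restrict f V \<in> kreg X V) \<and>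
    (\<forall>W f. openin (ktop X) W \<and> f \<in> extensional W \<and>
       (\<forall>x\<in>W. \<exists>V. openin (ktop X) V \<and> x \<in> V \<and> V \<subseteq> W \<and> restrict f V \<in> kreg X V)
       \<longrightarrow> f \<in> kreg X W) \<and>
    (\<exists>\<U>. finite \<U> \<and> (\<forall>U\<in>\<U>. affine_open X U) \<and> \<Union>\<U> = topspace (ktop X)) \<and>
    (\<forall>x\<in>topspace (ktop X). \<forall>y\<in>topspace (ktop X). x \<noteq> y \<longrightarrow>
       (\<exists>U V. openin (ktop X) U \<and> openin (ktop X) V \<and> x \<in> U \<and> y \<in> V \<and>
         (\<exists>(n::nat) f g. (\<forall>i<n. f i \<in> kreg X U \<and> g i \<in> kreg X V) \<and>
            (\<Sum>i<n. f i x * g i y) \<noteq> 0 \<and> (\<forall>w\<in>U \<inter> V. (\<Sum>i<n. f i w * g i w) = 0))))"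

definition morphism ::
  "('p, 'k::field) kspace \<Rightarrow> ('q, 'k) kspace \<Rightarrow> ('p \<Rightarrow> 'q) \<Rightarrow> bool" where
  "morphism X Y p \<longleftrightarrow>
    continuous_map (ktop X) (ktop Y) p \<and>
    (\<forall>V g. openin (ktop Y) V \<and> g \<in> kreg Y V \<longrightarrow>
       (\<lambda>x \<in> {x \<in> topspace (ktop X). p x \<in> V}. g (p x))
         \<in> kreg X {x \<in> topspace (ktop X). p x \<in> V})"

section \<open>Smooth morphisms and smooth equivalence\<close>

type_synonym 'k mpoly = "(nat \<Rightarrow>\<^sub>0 nat) \<Rightarrow>\<^sub>0 'k"

definition mpoly_eval :: "'k::comm_ring_1 mpoly \<Rightarrow> (nat \<Rightarrow> 'k) \<Rightarrow> 'k" where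
  "mpoly_eval P x =
    (\<Sum>\<alpha>\<in>Poly_Mapping.keys P. Poly_Mapping.lookup P \<alpha> * (\<Prod>i\<in>Poly_Mapping.keys \<alpha>. x i ^ Poly_Mapping.lookup \<alpha> i))"

definition mpoly_deriv :: "nat \<Rightarrow> 'k::comm_ring_1 mpoly \<Rightarrow> 'k mpoly" where
  "mpoly_deriv j P =
    (\<Sum>\<alpha>\<in>Poly_Mapping.keys P.
       Poly_Mapping.single (\<alpha> - Poly_Mapping.single j 1) (of_nat (Poly_Mapping.lookup \<alpha> j) * Poly_Mapping.lookup P \<alpha>))"

text \<open>
  The polynomial ring \<open>A[x\<^sub>0, \<dots>, x\<^sub>n\<^sub>-\<^sub>1]\<close> over a ring \<open>A\<close> of functions on \<open>V\<close>, an element being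
  represented by the family of its specialisations at the points of \<open>V\<close> (values outside \<open>V\<close> are
  irrelevant).
\<close>

definition rel_poly ::
  "'p set \<Rightarrow> ('p \<Rightarrow> 'k::comm_ring_1) set \<Rightarrow> nat \<Rightarrow> ('p \<Rightarrow> 'k mpoly) set" where
  "rel_poly V A n =
    {P. \<exists>S. finite S \<and> (\<forall>\<alpha>\<in>S. Poly_Mapping.keys \<alpha> \<subseteq> {..<n}) \<and>
       (\<forall>v\<in>V. Poly_Mapping.keys (P v) \<subseteq> S) \<and> (\<forall>\<alpha>. (\<lambda>v\<in>V. Poly_Mapping.lookup (P v) \<alpha>) \<in> A)}"

text \<open>
  The comorphism \<open>A \<rightarrow> B\<close> of \<open>p : U \<rightarrow> V\<close> is a standard smooth ring map:
  \<open>B = A[x\<^sub>0, \<dots>, x\<^sub>n\<^sub>-\<^sub>1] / (F\<^sub>0, \<dots>, F\<^sub>c\<^sub>-\<^sub>1)\<close>, where \<open>det (\<partial>F\<^sub>i / \<partial>x\<^sub>j)\<close> for \<open>i, j < c\<close> is a unit of \<open>B\<close>;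
  \<open>\<xi> i\<close> is the image of \<open>x\<^sub>i\<close> in \<open>B\<close>.
\<close>

definition standard_smooth ::
  "'q set \<Rightarrow> ('q \<Rightarrow> 'k::field) set \<Rightarrow> 'p set \<Rightarrow> ('p \<Rightarrow> 'k) set \<Rightarrow> ('p \<Rightarrow> 'q) \<Rightarrow> bool" where
  "standard_smooth V A U B p \<longleftrightarrow>
    (\<exists>n c (\<xi> :: nat \<Rightarrow> 'p \<Rightarrow> 'k) (F :: nat \<Rightarrow> 'q \<Rightarrow> 'k mpoly).
      c \<le> n \<and> (\<forall>i<n. \<xi> i \<in> B) \<and> (\<forall>i<c. F i \<in> rel_poly V A n) \<and>
      (\<forall>b\<in>B. \<exists>P\<in>rel_poly V A n. \<forall>u\<in>U. b u = mpoly_eval (P (p u)) (\<lambda>i. \<xi> i u)) \<and>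
      (\<forall>P\<in>rel_poly V A n.
         (\<forall>u\<in>U. mpoly_eval (P (p u)) (\<lambda>i. \<xi> i u) = 0) \<longleftrightarrow>
         (\<exists>H. (\<forall>i<c. H i \<in> rel_poly V A n) \<and> (\<forall>v\<in>V. P v = (\<Sum>i<c. H i v * F i v)))) \<and>
      (\<exists>b\<in>B. \<forall>u\<in>U.
         b u * det (mat c c (\<lambda>(i, j). mpoly_eval (mpoly_deriv j (F i (p u))) (\<lambda>l. \<xi> l u))) = 1))"

text \<open>A morphism is smooth iff it is standard smooth locally on source and target.\<close>

definition smooth_morphism ::
  "('p, 'k::field) kspace \<Rightarrow> ('q, 'k) kspace \<Rightarrow> ('p \<Rightarrow> 'q) \<Rightarrow> bool" where
  "smooth_morphism X Y p \<longleftrightarrow>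
    morphism X Y p \<and>
    (\<forall>x\<in>topspace (ktop X). \<exists>U V. affine_open X U \<and> affine_open Y V \<and> x \<in> U \<and> p ` U \<subseteq> V \<and>
       standard_smooth V (kreg Y V) U (kreg X U) p)"

text \<open>
  Over an infinite field a variety has at most as many points as the field, so every variety is
  isomorphic to one whose points are of type \<^typ>\<open>nat \<Rightarrow> 'k\<close>; fixing this type for \<open>Z\<close> is no
  restriction.
\<close>

definition smoothly_equivalent ::
  "('p, 'k::field) kspace \<Rightarrow> 'p \<Rightarrow> ('q, 'k) kspace \<Rightarrow> 'q \<Rightarrow> bool" where
  "smoothly_equivalent X x Y y \<longleftrightarrow>
    (\<exists>(Z :: (nat \<Rightarrow> 'k, 'k) kspace) z p q.
       variety Z \<and> z \<in> topspace (ktop Z) \<and>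
       smooth_morphism Z X p \<and> p z = x \<and> smooth_morphism Z Y q \<and> q z = y)"

section \<open>Affine varieties with a group action\<close>

text \<open>An affine algebraic group \<open>grp\<close> with coordinate ring \<open>grp_fun\<close> acting on an affine variety.\<close>

record ('h, 'p, 'k) gvar =
  grp :: "'h monoid"
  grp_fun :: "('h \<Rightarrow> 'k) set"
  pts :: "'p set"
  pts_fun :: "('p \<Rightarrow> 'k) set"
  gact :: "'h \<Rightarrow> 'p \<Rightarrow> 'p"

definition gvar_top :: "('h, 'p, 'k::field) gvar \<Rightarrow> 'p topology" where
  "gvar_top X = zariski (pts X) (pts_fun X)"

definition orbit_closures :: "('h, 'p, 'k::field) gvar \<Rightarrow> 'p set set" where
  "orbit_closures X = (\<lambda>x. gvar_top X closure_of Group_Action.orbit (grp X) (gact X) x) ` pts X"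

definition sub_fun :: "('h, 'p, 'k::field) gvar \<Rightarrow> 'p set \<Rightarrow> ('p \<Rightarrow> 'k) set" where
  "sub_fun X Z = (\<lambda>f. restrict f Z) ` pts_fun X"

definition closed_sub :: "('h, 'p, 'k::field) gvar \<Rightarrow> 'p set \<Rightarrow> ('p, 'k) kspace" where
  "closed_sub X Z = affine_kspace Z (sub_fun X Z)"

section \<open>Equivariant K-theory of affine varieties\<close>

text \<open>
  On an affine variety \<open>X\<close> a coherent sheaf is given by its module of global sections, a finitely
  generated \<open>k[X]\<close>-module \<open>M\<close>.  An equivariant structure is then a coaction \<open>M \<rightarrow> k[H] \<otimes> M\<close>
  compatible with that of \<open>k[X]\<close>; as \<open>H\<close> is reduced this is the same as a linear
  action of the points of \<open>H\<close> which is rational and satisfies \<open>h (a m) = (h a) (h m)\<close>.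
  The fields \<open>monoid.mult\<close> and \<open>one\<close> inherited from the library's record type \<open>module\<close> are unused.
\<close>

record ('a, 'm, 'h) eqmod = "('a, 'm) module" +
  mact :: "'h \<Rightarrow> 'm \<Rightarrow> 'm"

abbreviation coord_ring :: "('h, 'p, 'k::field) gvar \<Rightarrow> ('p \<Rightarrow> 'k) ring" where
  "coord_ring X \<equiv> fun_ring (pts X) (pts_fun X)"

definition coherent_eqmod ::
  "('h, 'p, 'k::field) gvar \<Rightarrow> ('p \<Rightarrow> 'k, 'm, 'h) eqmod \<Rightarrow> bool" where
  "coherent_eqmod X M \<longleftrightarrow>
    module (coord_ring X) M \<and>
    (\<exists>S. finite S \<and> S \<subseteq> carrier M \<and>
       (\<forall>m\<in>carrier M. \<exists>r. r \<in> S \<rightarrow> pts_fun X \<and> m = finsum M (\<lambda>s. r s \<odot>\<^bsub>M\<^esub> s) S)) \<and>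
    (\<forall>m\<in>carrier M. mact M \<one>\<^bsub>grp X\<^esub> m = m) \<and>
    (\<forall>h\<in>carrier (grp X). \<forall>m\<in>carrier M.
       mact M h m \<in> carrier M \<and>
       (\<forall>g\<in>carrier (grp X). mact M (g \<otimes>\<^bsub>grp X\<^esub> h) m = mact M g (mact M h m)) \<and>
       (\<forall>m'\<in>carrier M. mact M h (m \<oplus>\<^bsub>M\<^esub> m') = mact M h m \<oplus>\<^bsub>M\<^esub> mact M h m') \<and>
       (\<forall>a\<in>pts_fun X.
          mact M h (a \<odot>\<^bsub>M\<^esub> m) =
          (\<lambda>x\<in>pts X. a (gact X (inv\<^bsub>grp X\<^esub> h) x)) \<odot>\<^bsub>M\<^esub> mact M h m)) \<and>
    (\<forall>m\<in>carrier M. \<exists>(n::nat) c w. (\<forall>i<n. c i \<in> grp_fun X \<and> w i \<in> carrier M) \<and>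
       (\<forall>h\<in>carrier (grp X).
          mact M h m = finsum M (\<lambda>i. (\<lambda>x\<in>pts X. c i h) \<odot>\<^bsub>M\<^esub> w i) {..<n}))"

definition eqmod_hom ::
  "('h, 'p, 'k::field) gvar \<Rightarrow> ('p \<Rightarrow> 'k, 'm, 'h) eqmod \<Rightarrow> ('p \<Rightarrow> 'k, 'n, 'h) eqmod
    \<Rightarrow> ('m \<Rightarrow> 'n) \<Rightarrow> bool" where
  "eqmod_hom X M N \<alpha> \<longleftrightarrow>
    (\<forall>m\<in>carrier M. \<alpha> m \<in> carrier N \<and>
       (\<forall>m'\<in>carrier M. \<alpha> (m \<oplus>\<^bsub>M\<^esub> m') = \<alpha> m \<oplus>\<^bsub>N\<^esub> \<alpha> m') \<and>
       (\<forall>a\<in>pts_fun X. \<alpha> (a \<odot>\<^bsub>M\<^esub> m) = a \<odot>\<^bsub>N\<^esub> \<alpha> m) \<and>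
       (\<forall>h\<in>carrier (grp X). \<alpha> (mact M h m) = mact N h (\<alpha> m)))"

definition short_exact ::
  "('h, 'p, 'k::field) gvar \<Rightarrow> ('p \<Rightarrow> 'k, 'm, 'h) eqmod \<Rightarrow> ('p \<Rightarrow> 'k, 'n, 'h) eqmod
    \<Rightarrow> ('p \<Rightarrow> 'k, 'l, 'h) eqmod \<Rightarrow> bool" where
  "short_exact X M' M M'' \<longleftrightarrow>
    (\<exists>\<alpha> \<beta>. eqmod_hom X M' M \<alpha> \<and> eqmod_hom X M M'' \<beta> \<and>
       inj_on \<alpha> (carrier M') \<and> \<beta> ` carrier M = carrier M'' \<and>
       \<alpha> ` carrier M' = {m\<in>carrier M. \<beta> m = \<zero>\<^bsub>M''\<^esub>})"

text \<open>
  The Grothendieck group is generated by the modules whose elements are of type \<open>'p \<Rightarrow> 'k\<close> (not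
  necessarily with pointwise operations).  For cardinality reasons every finitely generated module
  over a coordinate ring is isomorphic to such a module, and the type contains the coordinate
  rings of closed subvarieties literally.  Isomorphic modules get identified by the relations.
\<close>

type_synonym ('h, 'p, 'k) fun_eqmod = "('p \<Rightarrow> 'k, 'p \<Rightarrow> 'k, 'h) eqmod"

definition K_free :: "('h, 'p, 'k::field) gvar \<Rightarrow> (('h, 'p, 'k) fun_eqmod \<Rightarrow>\<^sub>0 int) monoid" where
  "K_free X = free_Abelian_group {M. coherent_eqmod X M}"

definition K_rel :: "('h, 'p, 'k::field) gvar \<Rightarrow> (('h, 'p, 'k) fun_eqmod \<Rightarrow>\<^sub>0 int) set" where
  "K_rel X = generate (K_free X)
    {frag_of M - frag_of M' - frag_of M'' | M M' M''.
       coherent_eqmod X M \<and> coherent_eqmod X M' \<and> coherent_eqmod X M'' \<and> short_exact X M' M M''}"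

definition K_group ::
  "('h, 'p, 'k::field) gvar \<Rightarrow> (('h, 'p, 'k) fun_eqmod \<Rightarrow>\<^sub>0 int) set monoid" where
  "K_group X = K_free X Mod K_rel X"

definition K_class ::
  "('h, 'p, 'k::field) gvar \<Rightarrow> ('h, 'p, 'k) fun_eqmod \<Rightarrow> (('h, 'p, 'k) fun_eqmod \<Rightarrow>\<^sub>0 int) set"
  where "K_class X M = K_rel X #>\<^bsub>K_free X\<^esub> frag_of M"

text \<open>The structure sheaf of a stable closed subvariety \<open>Z\<close> (extended by zero to \<open>X\<close>).\<close>

definition structure_sheaf ::
  "('h, 'p, 'k::field) gvar \<Rightarrow> 'p set \<Rightarrow> ('h, 'p, 'k) fun_eqmod" where
  "structure_sheaf X Z =
    \<lparr>carrier = sub_fun X Z, monoid.mult = (\<lambda>f g. \<lambda>x\<in>Z. f x * g x), one = (\<lambda>x\<in>Z. 1),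
     zero = (\<lambda>x\<in>Z. 0), add = (\<lambda>f g. \<lambda>x\<in>Z. f x + g x),
     module.smult = (\<lambda>a f. \<lambda>x\<in>Z. a x * f x),
     mact = (\<lambda>h f. \<lambda>x\<in>Z. f (gact X (inv\<^bsub>grp X\<^esub> h) x))\<rparr>"

section \<open>Spaces of symmetric and skew-symmetric matrices\<close>

definition GL :: "nat \<Rightarrow> 'k::field mat monoid" where
  "GL n = units_of (ring_mat TYPE('k) n ())"

text \<open>Symmetric (\<open>s = 1\<close>) or skew-symmetric (\<open>s = -1\<close>); the characteristic is not 2.\<close>

definition eps_symmetric :: "int \<Rightarrow> 'k::field mat \<Rightarrow> bool" where
  "eps_symmetric s A \<longleftrightarrow> transpose_mat A = of_int s \<cdot>\<^sub>m A"

definition eps_mat :: "int \<Rightarrow> nat \<Rightarrow> 'k::field mat set" where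
  "eps_mat s m = {A \<in> carrier_mat m m. eps_symmetric s A}"

definition eps_mat_gvar :: "int \<Rightarrow> nat \<Rightarrow> 'k::field mat set \<Rightarrow> ('k mat, 'k mat, 'k) gvar" where
  "eps_mat_gvar s m H =
    \<lparr>grp = GL m\<lparr>carrier := H\<rparr>,
     grp_fun = gen_alg H ({\<lambda>g. g $$ (i, j) | i j. i < m \<and> j < m} \<union> {\<lambda>g. inverse (det g)}),
     pts = eps_mat s m,
     pts_fun = gen_alg (eps_mat s m) {\<lambda>A. A $$ (i, j) | i j. i < m \<and> j < m},
     gact = (\<lambda>g A. g * A * transpose_mat g)\<rparr>"

definition lower_borel :: "nat \<Rightarrow> 'k::field mat set" where
  "lower_borel m = {g \<in> carrier (GL m). \<forall>i j. i < j \<and> j < m \<longrightarrow> g $$ (i, j) = 0}"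

definition diag_torus :: "nat \<Rightarrow> 'k::field mat set" where
  "diag_torus m = {g \<in> carrier (GL m). diagonal_mat g}"

section \<open>Symmetric quivers of type A and their representations\<close>

record ('v, 'a) sym_quiver = "('v, 'a) pre_digraph" +
  tau0 :: "'v \<Rightarrow> 'v"
  tau1 :: "'a \<Rightarrow> 'a"
  qsign :: int
  pos0 :: "'v set"
  pos1 :: "'a set"

text \<open>
  The enumerations \<open>v\<close>, \<open>e\<close> identify the underlying graph with the Dynkin diagram \<open>A\<^sub>n\<close>, the edge
  \<open>e i\<close> joining \<open>v i\<close> and \<open>v (i + 1)\<close>.  As an enumeration may be reversed, either
  half of the diagram can play the role of \<open>Q\<^sup>+\<close>.  The diagram \<open>A\<^sub>1\<close> has no nontrivial automorphism.
\<close>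

definition symmetric_type_A :: "('v, 'a) sym_quiver \<Rightarrow> bool" where
  "symmetric_type_A Q \<longleftrightarrow>
    fin_digraph (pre_digraph.truncate Q) \<and> qsign Q \<in> {1, -1} \<and>
    (\<exists>(n::nat) v e. 2 \<le> n \<and>
       bij_betw v {1..n} (verts Q) \<and> bij_betw e {1..<n} (arcs Q) \<and>
       (\<forall>i\<in>{1..<n}. {tail Q (e i), head Q (e i)} = {v i, v (i + 1)}) \<and>
       (\<forall>i\<in>{1..n}. tau0 Q (v i) = v (n + 1 - i)) \<and>
       (\<forall>i\<in>{1..<n}. tau1 Q (e i) = e (n - i)) \<and>
       pos0 Q = v ` {i\<in>{1..n}. 2 * i < n + 1} \<and>
       pos1 Q = e ` {i\<in>{1..<n}. 2 * i < n}) \<and>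
    (\<forall>a\<in>arcs Q. tau0 Q (head Q a) = tail Q (tau1 Q a) \<and> tau0 Q (tail Q a) = head Q (tau1 Q a))"

definition fix0 :: "('v, 'a) sym_quiver \<Rightarrow> 'v set" where
  "fix0 Q = {z \<in> verts Q. tau0 Q z = z}"

definition fix1 :: "('v, 'a) sym_quiver \<Rightarrow> 'a set" where
  "fix1 Q = {a \<in> arcs Q. tau1 Q a = a}"

definition symmetric_dimvec :: "('v, 'a) sym_quiver \<Rightarrow> ('v \<Rightarrow> nat) \<Rightarrow> bool" where
  "symmetric_dimvec Q d \<longleftrightarrow> (\<forall>z\<in>verts Q. d (tau0 Q z) = d z)"

definition form_choice ::
  "('v, 'a) sym_quiver \<Rightarrow> ('v \<Rightarrow> nat) \<Rightarrow> ('v \<Rightarrow> 'k::field mat) \<Rightarrow> bool" where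
  "form_choice Q d \<Omega> \<longleftrightarrow>
    (\<forall>z\<in>fix0 Q. \<Omega> z \<in> carrier (GL (d z)) \<and> eps_symmetric (qsign Q) (\<Omega> z))"

definition quiver_group ::
  "('v, 'a) sym_quiver \<Rightarrow> ('v \<Rightarrow> nat) \<Rightarrow> ('v \<Rightarrow> 'k::field mat) \<Rightarrow> ('v \<Rightarrow> 'k mat) monoid" where
  "quiver_group Q d \<Omega> = product_group (pos0 Q \<union> fix0 Q)
    (\<lambda>z. if z \<in> fix0 Q
         then GL (d z)\<lparr>carrier := {g \<in> carrier (GL (d z)). transpose_mat g * \<Omega> z * g = \<Omega> z}\<rparr>
         else GL (d z))"

definition srep :: "('v, 'a) sym_quiver \<Rightarrow> ('v \<Rightarrow> nat) \<Rightarrow> ('a \<Rightarrow> 'k::field mat) set" where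
  "srep Q d = (\<Pi>\<^sub>E a\<in>pos1 Q \<union> fix1 Q.
    if a \<in> fix1 Q then {A \<in> carrier_mat (d (head Q a)) (d (tail Q a)). eps_symmetric (qsign Q) A}
    else carrier_mat (d (head Q a)) (d (tail Q a)))"

text \<open>The component \<open>g\<^sub>z\<close> of a group element, with \<open>g\<^sub>z = g\<^sub>\<tau>\<^sub>(\<^sub>z\<^sub>)\<close> transpose inverse on \<open>Q\<^sub>0\<^sup>-\<close>.\<close>

definition gcomp ::
  "('v, 'a) sym_quiver \<Rightarrow> ('v \<Rightarrow> nat) \<Rightarrow> ('v \<Rightarrow> 'k::field mat) \<Rightarrow> 'v \<Rightarrow> 'k mat" where
  "gcomp Q d g z =
    (if z \<in> pos0 Q \<union> fix0 Q then g z
     else transpose_mat (inv\<^bsub>GL (d (tau0 Q z))\<^esub> g (tau0 Q z)))"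

definition srep_gvar ::
  "('v, 'a) sym_quiver \<Rightarrow> ('v \<Rightarrow> nat) \<Rightarrow> ('v \<Rightarrow> 'k::field mat)
    \<Rightarrow> ('v \<Rightarrow> 'k mat, 'a \<Rightarrow> 'k mat, 'k) gvar" where
  "srep_gvar Q d \<Omega> =
    \<lparr>grp = quiver_group Q d \<Omega>,
     grp_fun = gen_alg (carrier (quiver_group Q d \<Omega>))
       ({\<lambda>g. g z $$ (i, j) | z i j. z \<in> pos0 Q \<union> fix0 Q \<and> i < d z \<and> j < d z} \<union>
        {\<lambda>g. inverse (det (g z)) | z. z \<in> pos0 Q \<union> fix0 Q}),
     pts = srep Q d,
     pts_fun = gen_alg (srep Q d)
       {\<lambda>V. V a $$ (i, j) | a i j.
          a \<in> pos1 Q \<union> fix1 Q \<and> i < d (head Q a) \<and> j < d (tail Q a)},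
     gact = (\<lambda>g V. \<lambda>a\<in>pos1 Q \<union> fix1 Q.
       gcomp Q d g (head Q a) * V a * inv\<^bsub>GL (d (tail Q a))\<^esub> gcomp Q d g (tail Q a))\<rparr>"

end

theory Submission
  imports Defs "HOL-Computational_Algebra.Polynomial" "HOL-Library.Function_Algebras"
begin

text \<open>
  The space of symmetric or skew-symmetric matrices is a slice in a space of representations of a quiver
  whose group action recovers, along the slice, the action of the Borel subgroup. Put \<open>m = 2d\<close> and let \<open>Q\<close>
  be the linearly oriented quiver \<open>0 \<rightarrow> 1 \<rightarrow> \<dots> \<rightarrow> 2m + 1\<close> with dimension vector \<open>0, 1, \<dots>, m, m, \<dots>, 1, 0\<close>. The middle
  arrow \<open>m \<rightarrow> m + 1\<close> is fixed by the involution, so a symmetric representation consists of \<open>(a + 1) \<times> a\<close> matrices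
  \<open>V\<^sub>a\<close> for \<open>a < m\<close> and of a form \<open>V\<^sub>m\<close> on \<open>k\<^sup>m\<close>, and the group is the product of the \<open>GL\<^sub>z\<close> for \<open>z \<le> m\<close>. If the \<open>V\<^sub>a\<close> are
  injective, they describe a complete flag of \<open>k\<^sup>m\<close>, and some group element moves them to the standard inclusions.
  What remains of the symmetry is the stabilizer of the standard flag, the group of upper triangular
  matrices \<open>u\<close> acting on forms by \<open>A \<mapsto> u\<^sup>-\<^sup>T A u\<^sup>-\<^sup>1\<close>; with \<open>b = u\<^sup>-\<^sup>T\<close> this is the lower triangular group acting by congruence.

  The argument needs this in algebraic form. From \<open>V\<close> one builds polynomially square matrices \<open>M\<^sub>0, \<dots>, M\<^sub>m\<close> by
  \<open>M\<^sub>i\<^sub>+\<^sub>1 = (V\<^sub>i M\<^sub>i | e\<^sub>i\<^sub>+\<^sub>1)\<close>. Let \<open>\<Delta>\<close> be the product of their determinants and \<open>r V = M\<^sub>m\<^sup>T V\<^sub>m M\<^sub>m\<close>. Where \<open>\<Delta> \<noteq> 0\<close>, the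
  group element \<open>\<sigma> V = (M\<^sub>i)\<^sub>i\<close> moves the point \<open>\<iota> (r V)\<close>, that is the standard inclusions with the form \<open>r V\<close>, to \<open>V\<close>.
  The locale \<open>slice\<close> collects what is used about \<open>\<iota>\<close>, \<open>r\<close>, \<open>\<Delta>\<close>, \<open>\<sigma>\<close> and the homomorphism \<open>\<phi>\<close> from the smaller group to
  the larger one; \<open>slice_flag\<close>, \<open>flag_transversal\<close> and \<open>coordinate_slice_flag\<close> verify it for the quiver.

  (i) The map sends \<open>C\<close> to the closure \<open>sat C\<close> of the union of the orbits through \<open>\<iota> C\<close>, and \<open>U\<close> is the union of the orbits
  meeting \<open>\<Delta> \<noteq> 0\<close>. If \<open>f\<close> vanishes on \<open>C\<close>, then \<open>\<Delta> \<cdot> (f \<circ> r)\<close> vanishes on \<open>sat C\<close> (\<open>sat_vanishing\<close>), so \<open>C\<close> can be read off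
  from \<open>sat C\<close>.

  (ii) The entries of the \<open>V\<^sub>a\<close> with \<open>a < m\<close> together with \<open>r\<close> identify the open set \<open>\<Delta> \<noteq> 0\<close> of \<open>sat C\<close> with the product of
  \<open>C\<close> and an open subset of an affine space. This open set is therefore smooth over \<open>C\<close> as well as over \<open>sat C\<close>
  (\<open>smoothly_equivalent_sat\<close>). Both maps are obtained by adjoining free variables and the inverse of one function;
  that they are standard smooth is \<open>standard_smooth_localized\<close>, a relative form of Rabinowitsch's trick.
  The Nullstellensatz enters because the functions on an affine variety are defined by local conditions.

  (iii) The homomorphism \<open>f\<close> restricts a module \<open>M\<close> to the slice, as \<open>M / I M\<close> where \<open>I\<close> is the ideal of the slice; the torus
  acts through \<open>\<phi>\<close>. This is exact on equivariant modules (\<open>module_ideal_reflected\<close>), because a section which vanishes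
  on the slice has translates that vanish on all of \<open>\<Delta> \<noteq> 0\<close>. By \<open>sat_vanishing\<close> it takes the structure sheaf of \<open>sat C\<close>
  to that of \<open>C\<close> (\<open>restriction_structure_sheaf\<close>).
\<close>

section \<open>Extending homomorphisms to finitely generated algebras\<close>

definition subring_set :: "'r::comm_ring_1 set => bool" where
  "subring_set A \<longleftrightarrow> 1 \<in> A \<and> (\<forall>x\<in>A. \<forall>y\<in>A. x - y \<in> A \<and> x * y \<in> A)"

lemma subring_setD:
  assumes "subring_set A"
  shows "1 \<in> A" "0 \<in> A" "x \<in> A ==> y \<in> A ==> x - y \<in> A" "x \<in> A ==> - x \<in> A"
    "x \<in> A ==> y \<in> A ==> x + y \<in> A" "x \<in> A ==> y \<in> A ==> x * y \<in> A"
    "x \<in> A ==> x ^ n \<in> A"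
proof -
  show 1: "1 \<in> A" and m: "x \<in> A ==> y \<in> A ==> x - y \<in> A" and t: "x \<in> A ==> y \<in> A ==> x * y \<in> A" for x y
    using assms by (auto simp: subring_set_def)
  show 0: "0 \<in> A" using m[OF 1 1] by simp
  show u: "x \<in> A ==> - x \<in> A" for x using m[OF 0] by simp
  show "x \<in> A ==> y \<in> A ==> x + y \<in> A" using m[of x "- y"] u[of y] by simp
  show "x \<in> A ==> x ^ n \<in> A" by (induction n) (auto simp: 1 t)
qed

lemma subring_set_sum:
  assumes "subring_set A" "\<And>i. i \<in> I ==> f i \<in> A"
  shows "sum f I \<in> A"
  using assms(2) by (induction I rule: infinite_finite_induct) (auto simp: subring_setD[OF assms(1)])

abbreviation polys_over :: "'r::comm_ring_1 set => 'r poly set" where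
  "polys_over A \<equiv> {f. \<forall>i. coeff f i \<in> A}"

definition adjoin :: "'r::comm_ring_1 set => 'r => 'r set" where
  "adjoin A x = (\<lambda>f. poly f x) ` polys_over A"

lemma polys_over_closed:
  assumes "subring_set A"
  shows "f \<in> polys_over A ==> g \<in> polys_over A ==> f - g \<in> polys_over A"
    "f \<in> polys_over A ==> g \<in> polys_over A ==> f + g \<in> polys_over A"
    "f \<in> polys_over A ==> g \<in> polys_over A ==> f * g \<in> polys_over A"
    "a \<in> A ==> monom a n \<in> polys_over A" "a \<in> A ==> [:a:] \<in> polys_over A"
    "a \<in> A ==> f \<in> polys_over A ==> smult a f \<in> polys_over A"
  by (auto simp: subring_setD[OF assms] coeff_mult coeff_pCons split: nat.splits intro!: subring_set_sum[OF assms])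

lemma subring_adjoin:
  assumes "subring_set A"
  shows "subring_set (adjoin A x)"
  unfolding subring_set_def adjoin_def
proof (intro conjI ballI)
  show "1 \<in> (\<lambda>f. poly f x) ` polys_over A"
    by (rule image_eqI[of _ _ "[:1:]"]) (use polys_over_closed(5)[OF assms subring_setD(1)[OF assms]] in auto)
next
  fix y z assume "y \<in> (\<lambda>f. poly f x) ` polys_over A" "z \<in> (\<lambda>f. poly f x) ` polys_over A"
  then obtain f g where f: "f \<in> polys_over A" "y = poly f x" and g: "g \<in> polys_over A" "z = poly g x"
    by blast
  show "y - z \<in> (\<lambda>f. poly f x) ` polys_over A"
    by (rule image_eqI[of _ _ "f - g"]) (use polys_over_closed(1)[OF assms f(1) g(1)] f g in auto)
  show "y * z \<in> (\<lambda>f. poly f x) ` polys_over A"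
    by (rule image_eqI[of _ _ "f * g"]) (use polys_over_closed(3)[OF assms f(1) g(1)] f g in auto)
qed

lemma adjoin_superset:
  assumes "subring_set A"
  shows "A \<subseteq> adjoin A x"
proof
  fix a assume "a \<in> A"
  then show "a \<in> adjoin A x" unfolding adjoin_def
    by (intro image_eqI[of _ _ "[:a:]"]) (use polys_over_closed(5)[OF assms] in auto)
qed

lemma adjoin_gen:
  assumes "subring_set A"
  shows "x \<in> adjoin A x"
proof -
  have "monom 1 1 \<in> polys_over A" by (rule polys_over_closed(4)[OF assms subring_setD(1)[OF assms]])
  then show ?thesis unfolding adjoin_def by (intro image_eqI[of _ _ "monom 1 1"]) (simp_all add: poly_monom)
qed

text \<open>Division by a polynomial whose leading coefficient is not a unit: multiplying the dividend by a power of
  that coefficient keeps all coefficients in the subring.\<close>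

lemma pseudo_division_over:
  assumes A: "subring_set A" and h: "h \<in> polys_over A" and f: "f \<in> polys_over A"
  shows "\<exists>n q r. q \<in> polys_over A \<and> r \<in> polys_over A \<and> smult (lead_coeff h ^ n) f = q * h + r \<and>
    (r = 0 \<or> degree r < degree h)"
  using f
proof (induction "degree f" arbitrary: f rule: less_induct)
  case less
  show ?case
  proof (cases "f = 0 \<or> degree f < degree h")
    case True
    show ?thesis
      by (rule exI[of _ 0], rule exI[of _ 0], rule exI[of _ f]) (use True less.prems subring_setD(2)[OF A] in auto)
  next
    case False
    define g where "g = smult (lead_coeff h) f - monom (lead_coeff f) (degree f - degree h) * h"
    have gA: "g \<in> polys_over A" unfolding g_def
      using less.prems h by (intro polys_over_closed[OF A]) auto
    have dle: "degree g \<le> degree f" unfolding g_def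
      by (rule degree_diff_le, rule degree_smult_le, rule order.trans[OF degree_mult_le])
         (use False in \<open>auto intro: order.trans[OF add_mono[OF degree_monom_le order.refl]]\<close>)
    have c0: "coeff g (degree f) = 0"
      using False by (simp add: g_def coeff_monom_mult)
    show ?thesis
    proof (cases "degree g < degree f")
      case True
      from less.hyps[OF this gA] obtain n q r where q: "q \<in> polys_over A" "r \<in> polys_over A"
        "smult (lead_coeff h ^ n) g = q * h + r" "r = 0 \<or> degree r < degree h" by blast
      have "smult (lead_coeff h ^ Suc n) f =
          smult (lead_coeff h ^ n) (g + monom (lead_coeff f) (degree f - degree h) * h)"
        by (simp add: g_def mult.commute)
      also have "\<dots> = (q + smult (lead_coeff h ^ n) (monom (lead_coeff f) (degree f - degree h))) * h + r"
        by (simp add: smult_add_right q(3) algebra_simps)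
      finally have e: "smult (lead_coeff h ^ Suc n) f = (q + smult (lead_coeff h ^ n) (monom (lead_coeff f) (degree f - degree h))) * h + r" .
      have m: "q + smult (lead_coeff h ^ n) (monom (lead_coeff f) (degree f - degree h)) \<in> polys_over A"
        using q(1) h less.prems by (intro polys_over_closed[OF A] subring_setD(7)[OF A]) auto
      show ?thesis using e m q(2,4) by blast
    next
      case False
      with dle have "degree g = degree f" by simp
      with c0 have "g = 0" by (metis leading_coeff_0_iff)
      then have "smult (lead_coeff h ^ 1) f = monom (lead_coeff f) (degree f - degree h) * h + 0"
        by (simp add: g_def)
      moreover have "monom (lead_coeff f) (degree f - degree h) \<in> polys_over A" "0 \<in> polys_over A"
        using less.prems subring_setD(2)[OF A] by (auto intro!: polys_over_closed[OF A])
      ultimately show ?thesis by blast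
    qed
  qed
qed

definition hom_on :: "'r::comm_ring_1 set => ('r => 'k::field) => bool" where
  "hom_on A \<phi> \<longleftrightarrow> \<phi> 1 = 1 \<and> (\<forall>x\<in>A. \<forall>y\<in>A. \<phi> (x + y) = \<phi> x + \<phi> y \<and> \<phi> (x * y) = \<phi> x * \<phi> y)"

definition prime_in :: "'r::comm_ring_1 set => 'r set => bool" where
  "prime_in A P \<longleftrightarrow> 0 \<in> P \<and> P \<subseteq> A \<and> 1 \<notin> P \<and> (\<forall>x\<in>P. \<forall>y\<in>P. x - y \<in> P) \<and>
    (\<forall>a\<in>A. \<forall>x\<in>P. a * x \<in> P) \<and> (\<forall>a\<in>A. \<forall>b\<in>A. a * b \<in> P \<longrightarrow> a \<in> P \<or> b \<in> P)"

lemma hom_on_0: assumes "subring_set A" "hom_on A \<phi>" shows "\<phi> 0 = 0"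
proof -
  have "\<phi> (0 + 0) = \<phi> 0 + \<phi> 0" using assms subring_setD(2)[OF assms(1)] unfolding hom_on_def by blast
  then show ?thesis by (metis add.right_neutral add_cancel_right_right)
qed

lemma hom_on_sum:
  assumes "subring_set A" "hom_on A \<phi>" "\<And>i. i \<in> I ==> f i \<in> A"
  shows "\<phi> (sum f I) = (\<Sum>i\<in>I. \<phi> (f i))"
  using assms(3)
proof (induction I rule: infinite_finite_induct)
  case (insert i I)
  have "\<phi> (f i + sum f I) = \<phi> (f i) + \<phi> (sum f I)"
    using assms(2) insert.prems subring_set_sum[OF assms(1), of I f] unfolding hom_on_def by blast
  with insert show ?case by simp
qed (auto simp: hom_on_0[OF assms(1,2)])

lemma hom_on_power:
  assumes "subring_set A" "hom_on A \<phi>" "a \<in> A"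
  shows "\<phi> (a ^ n) = \<phi> a ^ n"
proof (induction n)
  case 0 then show ?case using assms by (simp add: hom_on_def)
next
  case (Suc n)
  have "\<phi> (a * a ^ n) = \<phi> a * \<phi> (a ^ n)"
    using assms subring_setD(7)[OF assms(1,3)] unfolding hom_on_def by blast
  with Suc show ?case by simp
qed

lemma map_poly_hom:
  assumes A: "subring_set A" and \<phi>: "hom_on A \<phi>"
  shows "f \<in> polys_over A ==> g \<in> polys_over A ==> map_poly \<phi> (f + g) = map_poly \<phi> f + map_poly \<phi> g"
    "f \<in> polys_over A ==> g \<in> polys_over A ==> map_poly \<phi> (f * g) = map_poly \<phi> f * map_poly \<phi> g"
    "a \<in> A ==> f \<in> polys_over A ==> map_poly \<phi> (smult a f) = smult (\<phi> a) (map_poly \<phi> f)"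
    "map_poly \<phi> [:a:] = [:\<phi> a:]"
proof -
  note z = hom_on_0[OF A \<phi>]
  assume f: "f \<in> polys_over A"
  show "a \<in> A ==> map_poly \<phi> (smult a f) = smult (\<phi> a) (map_poly \<phi> f)"
    using f \<phi> by (intro poly_eqI) (auto simp: coeff_map_poly z hom_on_def)
  assume g: "g \<in> polys_over A"
  show "map_poly \<phi> (f + g) = map_poly \<phi> f + map_poly \<phi> g"
    using f g \<phi> by (intro poly_eqI) (auto simp: coeff_map_poly z hom_on_def)
  show "map_poly \<phi> (f * g) = map_poly \<phi> f * map_poly \<phi> g"
  proof (intro poly_eqI)
    fix n
    have "\<phi> (\<Sum>i\<le>n. coeff f i * coeff g (n - i)) = (\<Sum>i\<le>n. \<phi> (coeff f i * coeff g (n - i)))"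
      using f g by (intro hom_on_sum[OF A \<phi>] subring_setD(6)[OF A]) auto
    also have "\<dots> = (\<Sum>i\<le>n. \<phi> (coeff f i) * \<phi> (coeff g (n - i)))"
      using f g \<phi> by (auto simp: hom_on_def)
    finally show "coeff (map_poly \<phi> (f * g)) n = coeff (map_poly \<phi> f * map_poly \<phi> g) n"
      by (simp add: coeff_map_poly z coeff_mult)
  qed
next
  show "map_poly \<phi> [:a:] = [:\<phi> a:]"
    by (intro poly_eqI) (auto simp: coeff_map_poly hom_on_0[OF A \<phi>] coeff_pCons split: nat.splits)
qed

lemma poly_in_ideal:
  assumes "\<And>i. coeff f i \<in> P" "x \<in> B" "subring_set B" "0 \<in> P"
    "\<And>p q. p \<in> P ==> q \<in> P ==> p - q \<in> P" "\<And>b p. b \<in> B ==> p \<in> P ==> b * p \<in> P"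
  shows "poly f x \<in> P"
proof -
  have add: "p + q \<in> P" if "p \<in> P" "q \<in> P" for p q
    using assms(5)[OF that(1) assms(5)[OF assms(4) that(2)]] by simp
  have "x ^ i * coeff f i \<in> P" for i
    using assms(1,6) subring_setD(7)[OF assms(3,2)] by blast
  then have "sum (\<lambda>i. coeff f i * x ^ i) I \<in> P" for I :: "nat set"
    by (induction I rule: infinite_finite_induct) (auto simp: assms(4) add mult.commute)
  then show ?thesis by (simp add: poly_altdef)
qed

text \<open>A ring homomorphism \<open>A[x]/P \<rightarrow> k\<close> is the same as a point of the line at which all reductions of
  the relations of \<open>x\<close> modulo \<open>P\<close> vanish.\<close>

lemma extend_by_value:
  assumes A: "subring_set A" and \<phi>: "hom_on A \<phi>"
    and \<xi>: "\<And>f. f \<in> polys_over A ==> poly f x \<in> P ==> poly (map_poly \<phi> f) \<xi> = 0" and "0 \<in> P"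
  obtains \<psi> where "hom_on (adjoin A x) \<psi>" "\<And>f. f \<in> polys_over A ==> \<psi> (poly f x) = poly (map_poly \<phi> f) \<xi>"
    "\<And>a. a \<in> A ==> \<psi> a = \<phi> a" "\<And>p. p \<in> P \<inter> adjoin A x ==> \<psi> p = 0"
proof -
  define rep where "rep y = (SOME f. f \<in> polys_over A \<and> poly f x = y)" for y
  define \<psi> where "\<psi> y = poly (map_poly \<phi> (rep y)) \<xi>" for y
  have val: "\<psi> (poly f x) = poly (map_poly \<phi> f) \<xi>" if f: "f \<in> polys_over A" for f
  proof -
    have r: "rep (poly f x) \<in> polys_over A \<and> poly (rep (poly f x)) x = poly f x"
      unfolding rep_def by (rule someI[of _ f]) (use f in simp)
    define d where "d = rep (poly f x) - f"
    have d: "d \<in> polys_over A" unfolding d_def using r f by (intro polys_over_closed[OF A]) auto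
    have "poly d x \<in> P" using r by (simp add: d_def \<open>0 \<in> P\<close>)
    then have "poly (map_poly \<phi> d) \<xi> = 0" using \<xi> d by blast
    moreover have "map_poly \<phi> (d + f) = map_poly \<phi> d + map_poly \<phi> f"
      by (rule map_poly_hom(1)[OF A \<phi> d f])
    ultimately show ?thesis by (simp add: \<psi>_def d_def)
  qed
  have c: "\<psi> a = \<phi> a" if "a \<in> A" for a
    using val[of "[:a:]"] polys_over_closed(5)[OF A that] map_poly_hom(4)[OF A \<phi>] by simp
  have "hom_on (adjoin A x) \<psi>"
    unfolding hom_on_def
  proof (intro conjI ballI)
    show "\<psi> 1 = 1" using c[OF subring_setD(1)[OF A]] \<phi> by (simp add: hom_on_def)
    fix y z assume "y \<in> adjoin A x" "z \<in> adjoin A x"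
    then obtain f g where f: "f \<in> polys_over A" "y = poly f x" and g: "g \<in> polys_over A" "z = poly g x"
      unfolding adjoin_def by blast
    show "\<psi> (y + z) = \<psi> y + \<psi> z"
      using val[OF polys_over_closed(2)[OF A f(1) g(1)]] val[OF f(1)] val[OF g(1)]
      by (simp add: f(2) g(2) map_poly_hom(1)[OF A \<phi> f(1) g(1)])
    show "\<psi> (y * z) = \<psi> y * \<psi> z"
      using val[OF polys_over_closed(3)[OF A f(1) g(1)]] val[OF f(1)] val[OF g(1)]
      by (simp add: f(2) g(2) map_poly_hom(2)[OF A \<phi> f(1) g(1)])
  qed
  moreover have "\<psi> p = 0" if "p \<in> P \<inter> adjoin A x" for p
    using that val \<xi> unfolding adjoin_def by auto
  ultimately show ?thesis using that val c by blast
qed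

lemma infinite_alg_closed: "infinite (UNIV :: 'k::alg_closed_field set)"
proof
  assume f: "finite (UNIV :: 'k set)"
  define p :: "'k poly" where "p = (\<Prod>a\<in>UNIV. [:- a, 1:]) + 1"
  have d: "degree (\<Prod>a\<in>(UNIV::'k set). [:- a, 1:]) = card (UNIV :: 'k set)"
    by (subst degree_prod_eq_sum_degree) auto
  have "card (UNIV :: 'k set) > 0" using f by (simp add: card_gt_0_iff)
  then have "degree p > 0" unfolding p_def
    by (subst degree_add_eq_left) (auto simp: d)
  then obtain z where "poly p z = 0" using alg_closed_imp_poly_has_root by blast
  moreover have "poly (\<Prod>a\<in>(UNIV::'k set). [:- a, 1:]) z = 0"
    using f by (auto simp: poly_prod intro: prod_zero)
  ultimately show False by (simp add: p_def)
qed

text \<open>If \<open>x\<close> is transcendental over \<open>A\<close> modulo \<open>P\<close>, it may be sent to any element which is not a root of the image of a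
  polynomial representing \<open>b\<close>. Otherwise let \<open>p\<close> be a relation of minimal degree. Then \<open>x\<close> may be sent to any root
  of the image of \<open>p\<close>, provided that its leading coefficient does not become zero; and the value of \<open>b\<close> is not zero if
  some multiple of \<open>b\<close> is congruent to an element \<open>c\<close> of \<open>A\<close> whose image is not zero. The product of the leading
  coefficient and \<open>c\<close> expresses both conditions.\<close>

lemma hom_extension:
  fixes A P :: "'r::comm_ring_1 set" and x b :: 'r
  assumes A: "subring_set A" and P: "prime_in (adjoin A x) P" and b: "b \<in> adjoin A x" "b \<notin> P"
  shows "\<exists>a\<in>A - P. \<forall>\<phi> :: 'r => 'k::alg_closed_field. hom_on A \<phi> \<and> (\<forall>p\<in>A \<inter> P. \<phi> p = 0) \<and> \<phi> a \<noteq> 0 \<longrightarrow>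
    (\<exists>\<psi>. hom_on (adjoin A x) \<psi> \<and> (\<forall>p\<in>P. \<psi> p = 0) \<and> \<psi> b \<noteq> 0 \<and> (\<forall>c\<in>A. \<psi> c = \<phi> c))"
proof -
  let ?B = "adjoin A x"
  note B = subring_adjoin[OF A, of x]
  note AB = adjoin_superset[OF A, of x]
  have P0: "0 \<in> P" and PB: "P \<subseteq> ?B" and P1: "1 \<notin> P" using P by (auto simp: prime_in_def)
  have Pd: "p - q \<in> P" if "p \<in> P" "q \<in> P" for p q using P that by (auto simp: prime_in_def)
  have Pm: "c * p \<in> P" if "c \<in> ?B" "p \<in> P" for c p using P that unfolding prime_in_def by blast
  have Pp: "c \<in> P \<or> c' \<in> P" if "c * c' \<in> P" "c \<in> ?B" "c' \<in> ?B" for c c' using P that unfolding prime_in_def by blast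
  have Pa: "p + q \<in> P" if "p \<in> P" "q \<in> P" for p q using Pd[OF that(1) Pd[OF P0 that(2)]] by simp
  have Pu: "- p \<in> P" if "p \<in> P" for p using Pd[OF P0 that] by simp
  have Ps: "sum f I \<in> P" if "\<And>i. i \<in> I ==> f i \<in> P" for f and I :: "nat set"
    using that by (induction I rule: infinite_finite_induct) (auto simp: P0 Pa)
  have Ppow: "c ^ n \<notin> P" if "c \<in> ?B" "c \<notin> P" for c n
  proof (induction n)
    case (Suc n) then show ?case using Pp[of c "c ^ n"] that subring_setD(7)[OF B that(1)] by auto
  qed (use P1 in simp)
  have eval: "poly f x \<in> P" if "\<And>i. coeff f i \<in> P" for f
    by (rule poly_in_ideal[OF that adjoin_gen[OF A] B P0 Pd Pm])
  have inB: "poly f x \<in> ?B" if "f \<in> polys_over A" for f using that unfolding adjoin_def by blast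
  obtain g where g: "g \<in> polys_over A" "b = poly g x" using b(1) unfolding adjoin_def by blast
  have g_coeff: "\<exists>i. coeff g i \<notin> P" using eval[of g] g(2) b(2) by blast
  define red where "red f = map_poly (\<lambda>a. if a \<in> P then 0 else a) f" for f :: "'r poly"
  have red_coeff: "coeff (red f) i = (if coeff f i \<in> P then 0 else coeff f i)" for f i
    by (simp add: red_def coeff_map_poly)
  have red_A: "red f \<in> polys_over A" if "f \<in> polys_over A" for f
    using that subring_setD(2)[OF A] by (auto simp: red_coeff)
  have red_lc: "lead_coeff (red f) \<notin> P" if "red f \<noteq> 0" for f
    using that by (metis red_coeff leading_coeff_0_iff)
  have red_0: "red f = 0 \<longleftrightarrow> (\<forall>i. coeff f i \<in> P)" for f
    by (auto simp: poly_eq_iff red_coeff P0 split: if_splits)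
  have red_deg: "degree (red f) \<le> degree f" for f
    unfolding red_def by (rule map_poly_degree_leq)
  have red_eval: "poly f x - poly (red f) x \<in> P" for f
  proof -
    have "coeff (f - red f) i \<in> P" for i by (simp add: red_coeff P0)
    from eval[OF this] show ?thesis by simp
  qed
  show ?thesis
  proof (cases "\<forall>f\<in>polys_over A. poly f x \<in> P \<longrightarrow> red f = 0")
    case True
    \<comment> \<open>The residue of \<open>x\<close> is transcendental over that of \<open>A\<close>, so its value may be chosen freely.\<close>
    obtain i where i: "coeff g i \<notin> P" using g_coeff by blast
    show ?thesis
    proof (intro bexI[of _ "coeff g i"] allI impI)
      fix \<phi> :: "'r => 'k" assume \<phi>: "hom_on A \<phi> \<and> (\<forall>p\<in>A \<inter> P. \<phi> p = 0) \<and> \<phi> (coeff g i) \<noteq> 0"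
      then have h: "hom_on A \<phi>" by blast
      have "coeff (map_poly \<phi> g) i \<noteq> 0" using \<phi> by (simp add: coeff_map_poly hom_on_0[OF A h])
      then have "map_poly \<phi> g \<noteq> 0" by auto
      then have "finite {\<xi>. poly (map_poly \<phi> g) \<xi> = 0}" by (rule poly_roots_finite)
      then obtain \<xi> where \<xi>: "poly (map_poly \<phi> g) \<xi> \<noteq> 0"
        using infinite_alg_closed[where 'k='k] by (metis (mono_tags, lifting) UNIV_I finite_subset mem_Collect_eq subsetI)
      have z: "poly (map_poly \<phi> f) \<xi> = 0" if "f \<in> polys_over A" "poly f x \<in> P" for f
      proof -
        have "\<forall>i. coeff f i \<in> P" using True that red_0 by blast
        then have "map_poly \<phi> f = 0" using \<phi> that(1)
          by (intro poly_eqI) (auto simp: coeff_map_poly hom_on_0[OF A h])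
        then show ?thesis by simp
      qed
      from extend_by_value[OF A h z P0] obtain \<psi> where \<psi>: "hom_on ?B \<psi>"
        "\<And>f. f \<in> polys_over A ==> \<psi> (poly f x) = poly (map_poly \<phi> f) \<xi>"
        "\<And>a. a \<in> A ==> \<psi> a = \<phi> a" "\<And>p. p \<in> P \<inter> ?B ==> \<psi> p = 0" by blast
      show "\<exists>\<psi>. hom_on ?B \<psi> \<and> (\<forall>p\<in>P. \<psi> p = 0) \<and> \<psi> b \<noteq> 0 \<and> (\<forall>c\<in>A. \<psi> c = \<phi> c)"
        using \<psi> PB \<xi> g by (intro exI[of _ \<psi>]) auto
    qed (use i g in auto)
  next
    case False
    \<comment> \<open>The relations of \<open>x\<close> which are nontrivial modulo \<open>P\<close>.\<close>
    define N where "N = {f \<in> polys_over A. poly f x \<in> P \<and> red f \<noteq> 0}"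
    define p0 where "p0 = arg_min (\<lambda>f. degree f) (\<lambda>f. f \<in> N)"
    have "\<exists>f. f \<in> N" using False unfolding N_def by blast
    then have p0: "p0 \<in> N" "\<And>f. f \<in> N ==> degree p0 \<le> degree f"
      unfolding p0_def by (metis arg_min_natI, metis arg_min_nat_le)
    define p where "p = red p0"
    have rr: "red (red f) = red f" for f by (rule poly_eqI) (simp add: red_coeff P0)
    have pA: "p \<in> polys_over A" unfolding p_def using p0 by (intro red_A) (auto simp: N_def)
    have pP: "poly p x \<in> P" using red_eval[of p0] p0(1) Pd[of "poly p0 x" "poly p0 x - poly p x"]
      by (simp add: N_def p_def)
    have pl: "lead_coeff p \<notin> P" and pn: "p \<noteq> 0" using p0(1) red_lc by (auto simp: N_def p_def)
    have pmin: "red f = 0" if "f \<in> polys_over A" "poly f x \<in> P" "degree f < degree p" for f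
      using p0(2)[of f] that red_deg[of p0] by (auto simp: N_def p_def)
    have pd: "degree p > 0"
    proof (rule ccontr)
      assume "\<not> degree p > 0"
      then obtain c where "p = [:c:]" by (metis degree_eq_zeroE gr0I)
      then show False using pl pP by simp
    qed
    have lpB: "lead_coeff p \<in> ?B" using pA AB by blast
    \<comment> \<open>The polynomials whose value at \<open>x\<close> is a multiple of \<open>b\<close> modulo \<open>P\<close>. One of minimal degree is constant,
      since otherwise division by it would factor \<open>p\<close> modulo the prime \<open>P\<close>.\<close>
    define J where "J = {h \<in> polys_over A. red h \<noteq> 0 \<and> (\<exists>v\<in>polys_over A. poly h x - poly v x * b \<in> P)}"
    define h0 where "h0 = arg_min (\<lambda>f. degree f) (\<lambda>f. f \<in> J)"
    have "[:1:] \<in> polys_over A" by (rule polys_over_closed(5)[OF A subring_setD(1)[OF A]])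
    moreover have "red g \<noteq> 0" using g_coeff red_0 by blast
    moreover have "poly g x - poly [:1:] x * b \<in> P" using g(2) P0 by simp
    ultimately have gJ: "g \<in> J" unfolding J_def using g(1) by blast
    then have h0: "h0 \<in> J" "\<And>f. f \<in> J ==> degree h0 \<le> degree f"
      unfolding h0_def by (metis arg_min_natI, metis arg_min_nat_le)
    define h where "h = red h0"
    have hA: "h \<in> polys_over A" unfolding h_def using h0 by (intro red_A) (auto simp: J_def)
    have hl: "lead_coeff h \<notin> P" and hn: "h \<noteq> 0" using h0(1) red_lc by (auto simp: J_def h_def)
    obtain v where v: "v \<in> polys_over A" "poly h0 x - poly v x * b \<in> P" using h0(1) by (auto simp: J_def)
    have hv: "poly h x - poly v x * b \<in> P"
      using Pd[OF v(2) red_eval[of h0]] by (simp add: h_def)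
    have hmin: "red f = 0" if f: "f \<in> polys_over A" "degree f < degree h"
      and w: "w \<in> polys_over A" "poly f x - poly w x * b \<in> P" for f w
      using h0(2)[of f] f w red_deg[of h0] by (auto simp: J_def h_def)
    have lhB: "lead_coeff h \<in> ?B" using hA AB by blast
    have dh_less: "degree h < degree p"
    proof -
      obtain n q r where q: "q \<in> polys_over A" "r \<in> polys_over A"
        "smult (lead_coeff p ^ n) g = q * p + r" "r = 0 \<or> degree r < degree p"
        using pseudo_division_over[OF A pA g(1)] by blast
      have e: "lead_coeff p ^ n * b = poly q x * poly p x + poly r x"
        using arg_cong[OF q(3), of "\<lambda>f. poly f x"] g(2) by simp
      have "red r \<noteq> 0"
      proof
        assume "red r = 0"
        then have "poly r x \<in> P" using red_0 eval by blast
        then have "lead_coeff p ^ n * b \<in> P" unfolding e by (intro Pa Pm pP inB q(1))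
        then show False using Pp b Ppow[OF lpB pl] subring_setD(7)[OF B lpB] by blast
      qed
      moreover have "[:lead_coeff p ^ n:] \<in> polys_over A"
        using pA by (intro polys_over_closed[OF A] subring_setD(7)[OF A]) auto
      moreover have "poly r x - poly [:lead_coeff p ^ n:] x * b \<in> P"
      proof -
        have "poly r x - poly [:lead_coeff p ^ n:] x * b = - (poly q x * poly p x)" using e by simp
        then show ?thesis using Pu[OF Pm[OF inB[OF q(1)] pP]] by simp
      qed
      ultimately have "r \<in> J" using q(2) unfolding J_def by blast
      then have "degree h0 \<le> degree r" by (rule h0(2))
      then show ?thesis using q(4) \<open>red r \<noteq> 0\<close> red_deg[of h0] P0 by (auto simp: h_def red_0)
    qed
    have hxP: "poly h x \<notin> P"
      using pmin[OF hA _ dh_less] h0(1) rr by (auto simp: h_def J_def)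
    have dh: "degree h = 0"
    proof (rule ccontr)
      assume nz: "degree h \<noteq> 0"
      obtain n q r where q: "q \<in> polys_over A" "r \<in> polys_over A"
        "smult (lead_coeff h ^ n) p = q * h + r" "r = 0 \<or> degree r < degree h"
        using pseudo_division_over[OF A hA pA] by blast
      have e: "lead_coeff h ^ n * poly p x = poly q x * poly h x + poly r x"
        using arg_cong[OF q(3), of "\<lambda>f. poly f x"] by simp
      have lhn: "lead_coeff h ^ n \<in> ?B" by (rule subring_setD(7)[OF B lhB])
      have rr0: "red r = 0"
      proof (cases "r = 0")
        case True then show ?thesis by (simp add: red_0 P0)
      next
        case False
        define w where "w = - (q * v)"
        have "poly r x - poly w x * b = lead_coeff h ^ n * poly p x - poly q x * (poly h x - poly v x * b)"
          using e by (simp add: w_def algebra_simps)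
        then have "poly r x - poly w x * b \<in> P" by (simp only:) (intro Pd Pm lhn pP inB q(1) hv)
        moreover have "w \<in> polys_over A"
          using polys_over_closed(3)[OF A q(1) v(1)] subring_setD(4)[OF A] by (auto simp: w_def)
        ultimately show ?thesis using hmin q(2,4) False by blast
      qed
      have "poly q x * poly h x \<in> P"
        using Pd[OF Pm[OF lhn pP] eval[of r]] rr0 e by (simp add: red_0)
      then have qP: "poly q x \<in> P" using Pp hxP inB q(1) hA by blast
      define q' where "q' = red q"
      have q'A: "q' \<in> polys_over A" unfolding q'_def by (rule red_A[OF q(1)])
      have c: "coeff (smult (lead_coeff h ^ n) p - q' * h) i \<in> P" for i
      proof -
        have "coeff ((q - q') * h) i \<in> P" unfolding coeff_mult
        proof (rule Ps)
          fix j
          have "coeff h (i - j) \<in> ?B" using hA AB by blast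
          then have "coeff h (i - j) * coeff (q - q') j \<in> P"
            by (rule Pm) (simp add: q'_def red_coeff P0)
          then show "coeff (q - q') j * coeff h (i - j) \<in> P" by (simp add: mult.commute)
        qed
        moreover have "coeff r i \<in> P" using rr0 by (simp add: red_0)
        moreover have "smult (lead_coeff h ^ n) p - q' * h = (q - q') * h + r"
          using q(3) by (simp add: algebra_simps)
        ultimately show ?thesis using Pa by simp
      qed
      show False
      proof (cases "q' = 0")
        case True
        have "lead_coeff h ^ n * lead_coeff p \<in> P" using c[of "degree p"] True by simp
        then show False using Pp lhn lpB pl Ppow[OF lhB hl] by blast
      next
        case False
        have "poly q' x \<in> P" using Pd[OF qP red_eval[of q]] by (simp add: q'_def)
        then have "degree p \<le> degree q'"
          using pmin[OF q'A] False rr by (auto simp: q'_def not_less[symmetric])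
        then have "coeff p (degree q' + degree h) = 0" using nz by (intro coeff_eq_0) simp
        then have "- (lead_coeff q' * lead_coeff h) \<in> P"
          using c[of "degree q' + degree h"] by (simp add: coeff_mult_degree_sum)
        then have "lead_coeff q' * lead_coeff h \<in> P" using Pu by fastforce
        moreover have "lead_coeff q' \<in> ?B" using q'A AB by blast
        moreover have "lead_coeff q' \<notin> P" using False red_lc by (simp add: q'_def)
        ultimately show False using Pp lhB hl by blast
      qed
    qed
    define c where "c = coeff h 0"
    have hc: "h = [:c:]" unfolding c_def using dh by (metis degree_0_id)
    have cA: "c \<in> A" using hA by (simp add: c_def)
    have cP: "c \<notin> P" using hl hc by simp
    have hvx: "c - poly v x * b \<in> P" using hv hc by simp
    show ?thesis
    proof (intro bexI[of _ "lead_coeff p * c"] allI impI)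
      fix \<phi> :: "'r => 'k" assume \<phi>: "hom_on A \<phi> \<and> (\<forall>p\<in>A \<inter> P. \<phi> p = 0) \<and> \<phi> (lead_coeff p * c) \<noteq> 0"
      then have h: "hom_on A \<phi>" by blast
      have lpA: "lead_coeff p \<in> A" using pA by blast
      have nz: "\<phi> (lead_coeff p) \<noteq> 0" "\<phi> c \<noteq> 0"
        using \<phi> cA lpA unfolding hom_on_def by auto
      have "coeff (map_poly \<phi> p) (degree p) \<noteq> 0" using nz by (simp add: coeff_map_poly hom_on_0[OF A h])
      then have "degree (map_poly \<phi> p) > 0" using pd le_degree[of "map_poly \<phi> p" "degree p"] by linarith
      then obtain \<xi> where \<xi>: "poly (map_poly \<phi> p) \<xi> = 0" using alg_closed_imp_poly_has_root by blast
      have z: "poly (map_poly \<phi> f) \<xi> = 0" if f: "f \<in> polys_over A" "poly f x \<in> P" for f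
      proof -
        obtain n q r where q: "q \<in> polys_over A" "r \<in> polys_over A"
          "smult (lead_coeff p ^ n) f = q * p + r" "r = 0 \<or> degree r < degree p"
          using pseudo_division_over[OF A pA f(1)] by blast
        have e: "lead_coeff p ^ n * poly f x = poly q x * poly p x + poly r x"
          using arg_cong[OF q(3), of "\<lambda>f. poly f x"] by simp
        have "poly r x = lead_coeff p ^ n * poly f x - poly q x * poly p x" using e by simp
        then have "poly r x \<in> P"
          by (simp only:) (intro Pd Pm pP f(2) inB q(1) subring_setD(7)[OF B lpB])
        then have "red r = 0" using pmin q(2,4) P0 by (cases "r = 0") (auto simp: red_0)
        then have "map_poly \<phi> r = 0" using \<phi> q(2)
          by (intro poly_eqI) (auto simp: coeff_map_poly hom_on_0[OF A h] red_0)
        moreover have "map_poly \<phi> (smult (lead_coeff p ^ n) f) = smult (\<phi> (lead_coeff p) ^ n) (map_poly \<phi> f)"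
          using map_poly_hom(3)[OF A h subring_setD(7)[OF A lpA] f(1)] hom_on_power[OF A h lpA] by simp
        moreover have "map_poly \<phi> (q * p + r) = map_poly \<phi> q * map_poly \<phi> p + map_poly \<phi> r"
          using map_poly_hom(1)[OF A h polys_over_closed(3)[OF A q(1) pA] q(2)] map_poly_hom(2)[OF A h q(1) pA] by simp
        ultimately have "smult (\<phi> (lead_coeff p) ^ n) (map_poly \<phi> f) = map_poly \<phi> q * map_poly \<phi> p"
          using q(3) by simp
        from arg_cong[OF this, of "\<lambda>f. poly f \<xi>"] show ?thesis using nz \<xi> by simp
      qed
      from extend_by_value[OF A h z P0] obtain \<psi> where \<psi>: "hom_on ?B \<psi>"
        "\<And>f. f \<in> polys_over A ==> \<psi> (poly f x) = poly (map_poly \<phi> f) \<xi>"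
        "\<And>a. a \<in> A ==> \<psi> a = \<phi> a" "\<And>p. p \<in> P \<inter> ?B ==> \<psi> p = 0" by blast
      have "\<psi> b \<noteq> 0"
      proof
        assume z: "\<psi> b = 0"
        have vb: "poly v x * b \<in> ?B" using inB[OF v(1)] b(1) subring_setD(6)[OF B] by blast
        have "\<psi> (poly v x * b) = 0" using \<psi>(1) z inB[OF v(1)] b(1) by (simp add: hom_on_def)
        moreover have "\<psi> (c - poly v x * b) = 0" using \<psi>(4) hvx PB by blast
        moreover have "\<psi> ((c - poly v x * b) + poly v x * b) = \<psi> (c - poly v x * b) + \<psi> (poly v x * b)"
          using \<psi>(1) vb hvx PB unfolding hom_on_def by blast
        ultimately show False using nz(2) \<psi>(3)[OF cA] by simp
      qed
      then show "\<exists>\<psi>. hom_on ?B \<psi> \<and> (\<forall>p\<in>P. \<psi> p = 0) \<and> \<psi> b \<noteq> 0 \<and> (\<forall>c\<in>A. \<psi> c = \<phi> c)"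
        using \<psi> PB by (intro exI[of _ \<psi>]) auto
    next
      have "lead_coeff p * c \<notin> P" using Pp pl cP lpB cA AB by blast
      then show "lead_coeff p * c \<in> A - P" using pA cA subring_setD(6)[OF A] by auto
    qed
  qed
qed

definition ideal_in :: "'r::comm_ring_1 set => 'r set => bool" where
  "ideal_in A J \<longleftrightarrow> 0 \<in> J \<and> J \<subseteq> A \<and> (\<forall>x\<in>J. \<forall>y\<in>J. x - y \<in> J) \<and> (\<forall>a\<in>A. \<forall>x\<in>J. a * x \<in> J)"

text \<open>An ideal which is maximal among the proper ones is prime.\<close>

lemma ex_prime_in:
  assumes A: "subring_set A" and J: "ideal_in A J" "1 \<notin> J"
  shows "\<exists>P. prime_in A P \<and> J \<subseteq> P"
proof -
  define \<I> where "\<I> = {K. ideal_in A K \<and> 1 \<notin> K \<and> J \<subseteq> K}"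
  have "\<exists>M\<in>\<I>. \<forall>X\<in>\<I>. M \<subseteq> X \<longrightarrow> X = M"
  proof (rule subset_Zorn_nonempty)
    show "\<I> \<noteq> {}" using J by (auto simp: \<I>_def)
    fix \<C> assume c: "\<C> \<noteq> {}" "subset.chain \<I> \<C>"
    then have s: "K \<in> \<C> ==> K \<in> \<I>" and t: "K \<in> \<C> ==> L \<in> \<C> ==> K \<subseteq> L \<or> L \<subseteq> K" for K L
      by (auto simp: subset.chain_def)
    have "x - y \<in> \<Union>\<C>" if "x \<in> \<Union>\<C>" "y \<in> \<Union>\<C>" for x y
    proof -
      obtain K L where "K \<in> \<C>" "x \<in> K" "L \<in> \<C>" "y \<in> L" using \<open>x \<in> \<Union>\<C>\<close> \<open>y \<in> \<Union>\<C>\<close> by blast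
      then obtain M where "M \<in> \<C>" "x \<in> M" "y \<in> M" using t[of K L] by blast
      then show ?thesis using s[of M] by (auto simp: \<I>_def ideal_in_def)
    qed
    moreover have ideals: "K \<in> \<C> ==> ideal_in A K" for K using s by (simp add: \<I>_def)
    moreover have "a * x \<in> \<Union>\<C>" if "a \<in> A" "x \<in> \<Union>\<C>" for a x
      using that ideals unfolding ideal_in_def by blast
    moreover have "0 \<in> \<Union>\<C>" "\<Union>\<C> \<subseteq> A"
      using c(1) ideals unfolding ideal_in_def by blast+
    ultimately have "ideal_in A (\<Union>\<C>)" by (simp add: ideal_in_def)
    then show "\<Union>\<C> \<in> \<I>" using c(1) s by (auto simp: \<I>_def)
  qed
  then obtain P where P: "ideal_in A P" "1 \<notin> P" "J \<subseteq> P"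
    and m: "\<And>K. ideal_in A K ==> 1 \<notin> K ==> P \<subseteq> K ==> K = P"
    by (auto simp: \<I>_def)
  have Pm: "a * x \<in> P" if "a \<in> A" "x \<in> P" for a x using P that by (auto simp: ideal_in_def)
  have PA: "P \<subseteq> A" and P0: "0 \<in> P" using P by (auto simp: ideal_in_def)
  have Pd: "x - y \<in> P" if "x \<in> P" "y \<in> P" for x y using P that by (auto simp: ideal_in_def)
  have Pa: "x + y \<in> P" if "x \<in> P" "y \<in> P" for x y using Pd[OF that(1) Pd[OF P0 that(2)]] by simp
  have unit: "\<exists>p\<in>P. \<exists>c\<in>A. 1 = p + a * c" if a: "a \<in> A" "a \<notin> P" for a
  proof -
    define K where "K = {p + a * c | p c. p \<in> P \<and> c \<in> A}"
    have "ideal_in A K" unfolding ideal_in_def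
    proof (intro conjI ballI)
      show "0 \<in> K" unfolding K_def using P0 subring_setD(2)[OF A] by force
      show "K \<subseteq> A" unfolding K_def using PA a by (auto intro!: subring_setD(5,6)[OF A])
      fix x assume "x \<in> K"
      then obtain p c where x: "x = p + a * c" "p \<in> P" "c \<in> A" unfolding K_def by blast
      show "b * x \<in> K" if "b \<in> A" for b
        unfolding K_def mem_Collect_eq
        by (rule exI[of _ "b * p"], rule exI[of _ "b * c"])
           (use x that Pm subring_setD(6)[OF A] in \<open>auto simp: algebra_simps\<close>)
      fix y assume "y \<in> K"
      then obtain q d where y: "y = q + a * d" "q \<in> P" "d \<in> A" unfolding K_def by blast
      show "x - y \<in> K" unfolding K_def mem_Collect_eq
        by (rule exI[of _ "p - q"], rule exI[of _ "c - d"])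
           (use x y Pd subring_setD(3)[OF A] in \<open>auto simp: algebra_simps\<close>)
    qed
    moreover have "P \<subseteq> K"
    proof
      fix p assume "p \<in> P"
      then show "p \<in> K" unfolding K_def mem_Collect_eq
        by (intro exI[of _ p] exI[of _ 0]) (use subring_setD(2)[OF A] in auto)
    qed
    moreover have "a \<in> K" unfolding K_def mem_Collect_eq
      by (intro exI[of _ 0] exI[of _ 1]) (use subring_setD(1)[OF A] P0 in auto)
    ultimately have "1 \<in> K" using m[of K] a(2) by blast
    then show ?thesis unfolding K_def by auto
  qed
  have "a \<in> P \<or> b \<in> P" if ab: "a \<in> A" "b \<in> A" "a * b \<in> P" for a b
  proof (rule ccontr)
    assume "\<not> (a \<in> P \<or> b \<in> P)"
    then have n: "a \<notin> P" "b \<notin> P" by auto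
    obtain p c where p: "p \<in> P" "c \<in> A" "1 = p + a * c" using unit[OF ab(1) n(1)] by blast
    obtain q d where q: "q \<in> P" "d \<in> A" "1 = q + b * d" using unit[OF ab(2) n(2)] by blast
    have "(1::'a) = (p + a * c) * (q + b * d)" using p(3) q(3) by simp
    also have "\<dots> = (q + b * d) * p + (a * c) * q + (c * d) * (a * b)" by (simp add: algebra_simps)
    also have "\<dots> \<in> P"
      using Pm[OF _ p(1), of "q + b * d"] Pm[OF _ q(1), of "a * c"] Pm[OF _ ab(3), of "c * d"] p q ab PA
      by (intro Pa) (auto intro!: subring_setD(5,6)[OF A])
    finally show False using P(2) by simp
  qed
  then have "prime_in A P" using P unfolding prime_in_def ideal_in_def by blast
  then show ?thesis using P(3) by blast
qed

text \<open>The condition that \<open>b\<close> does not become zero is moved down a tower of simple extensions.\<close>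

lemma hom_extension_list:
  fixes A P :: "'r::comm_ring_1 set" and cs :: "'r list"
  assumes "subring_set A" "prime_in (foldl adjoin A cs) P" "b \<in> foldl adjoin A cs" "b \<notin> P"
  shows "\<exists>a\<in>A - P. \<forall>\<phi> :: 'r => 'k::alg_closed_field. hom_on A \<phi> \<and> (\<forall>p\<in>A \<inter> P. \<phi> p = 0) \<and> \<phi> a \<noteq> 0 \<longrightarrow>
    (\<exists>\<psi>. hom_on (foldl adjoin A cs) \<psi> \<and> (\<forall>p\<in>P. \<psi> p = 0) \<and> \<psi> b \<noteq> 0 \<and> (\<forall>c\<in>A. \<psi> c = \<phi> c))"
  using assms
proof (induction cs arbitrary: A)
  case Nil
  then have "P \<subseteq> A" by (simp add: prime_in_def)
  then show ?case using Nil by (intro bexI[of _ b]) auto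
next
  case (Cons c cs)
  let ?A' = "adjoin A c" and ?B = "foldl adjoin A (c # cs)"
  note A' = subring_adjoin[OF Cons.prems(1), of c]
  have sub: "S \<subseteq> foldl adjoin S ds \<and> subring_set (foldl adjoin S ds)" if "subring_set S" for S :: "'r set" and ds
    using that
  proof (induction ds arbitrary: S)
    case (Cons d ds)
    show ?case using Cons.IH[OF subring_adjoin[OF Cons.prems]] adjoin_superset[OF Cons.prems] by fastforce
  qed simp
  have "foldl adjoin A (c # cs) = foldl adjoin ?A' cs" by simp
  then obtain a' where a': "a' \<in> ?A'" "a' \<notin> P" and ext: "\<And>\<phi> :: 'r => 'k. hom_on ?A' \<phi> ==> (\<forall>p\<in>?A' \<inter> P. \<phi> p = 0) ==> \<phi> a' \<noteq> 0 ==>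
     \<exists>\<psi>. hom_on ?B \<psi> \<and> (\<forall>p\<in>P. \<psi> p = 0) \<and> \<psi> b \<noteq> 0 \<and> (\<forall>c\<in>?A'. \<psi> c = \<phi> c)"
    using Cons.IH[OF A'] Cons.prems(2-4) by (simp only: foldl_Cons) blast
  have le: "?A' \<subseteq> ?B" using sub[OF A'] by simp
  have "prime_in ?A' (P \<inter> ?A')"
    unfolding prime_in_def
  proof (intro conjI ballI impI)
    fix a b assume "a \<in> ?A'" "b \<in> ?A'" "a * b \<in> P \<inter> ?A'"
    then show "a \<in> P \<inter> ?A' \<or> b \<in> P \<inter> ?A'"
      using Cons.prems(2) le unfolding prime_in_def by blast
  next
    fix a x assume "a \<in> ?A'" "x \<in> P \<inter> ?A'"
    then show "a * x \<in> P \<inter> ?A'"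
      using Cons.prems(2) le subring_setD(6)[OF A'] unfolding prime_in_def by blast
  next
    fix x y assume "x \<in> P \<inter> ?A'" "y \<in> P \<inter> ?A'"
    then show "x - y \<in> P \<inter> ?A'"
      using Cons.prems(2) subring_setD(3)[OF A'] unfolding prime_in_def by blast
  qed (use Cons.prems(2) subring_setD(2)[OF A'] in \<open>simp_all add: prime_in_def\<close>)
  from hom_extension[OF Cons.prems(1) this a'(1)] a'(2)
  obtain a where a: "a \<in> A" "a \<notin> P" and ext2: "\<And>\<phi> :: 'r => 'k. hom_on A \<phi> ==> (\<forall>p\<in>A \<inter> (P \<inter> ?A'). \<phi> p = 0) ==> \<phi> a \<noteq> 0 ==>
     \<exists>\<psi>. hom_on ?A' \<psi> \<and> (\<forall>p\<in>P \<inter> ?A'. \<psi> p = 0) \<and> \<psi> a' \<noteq> 0 \<and> (\<forall>c\<in>A. \<psi> c = \<phi> c)"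
    using adjoin_superset[OF Cons.prems(1), of c] by fast
  show ?case
  proof (intro bexI[of _ a] allI impI)
    fix \<phi> :: "'r => 'k" assume \<phi>: "hom_on A \<phi> \<and> (\<forall>p\<in>A \<inter> P. \<phi> p = 0) \<and> \<phi> a \<noteq> 0"
    then obtain \<psi> where \<psi>: "hom_on ?A' \<psi>" "\<forall>p\<in>P \<inter> ?A'. \<psi> p = 0" "\<psi> a' \<noteq> 0" "\<forall>c\<in>A. \<psi> c = \<phi> c"
      using ext2[of \<phi>] by blast
    then obtain \<theta> where \<theta>: "hom_on ?B \<theta>" "\<forall>p\<in>P. \<theta> p = 0" "\<theta> b \<noteq> 0" "\<forall>c\<in>?A'. \<theta> c = \<psi> c"
      using ext[of \<psi>] by blast
    then show "\<exists>\<psi>. hom_on ?B \<psi> \<and> (\<forall>p\<in>P. \<psi> p = 0) \<and> \<psi> b \<noteq> 0 \<and> (\<forall>c\<in>A. \<psi> c = \<phi> c)"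
      using \<psi>(4) adjoin_superset[OF Cons.prems(1), of c] by (intro exI[of _ \<theta>]) auto
  qed (use a in auto)
qed

lemma subring_foldl_adjoin:
  assumes "subring_set A"
  shows "subring_set (foldl adjoin A cs)" "A \<subseteq> foldl adjoin A cs" "set cs \<subseteq> foldl adjoin A cs"
  using assms
proof (induction cs arbitrary: A)
  case (Cons c cs)
  { case 1 then show ?case using Cons.IH(1)[OF subring_adjoin] by simp }
  { case 2 then show ?case using Cons.IH(2)[OF subring_adjoin[OF 2]] adjoin_superset[OF 2] by fastforce }
  { case 3 then show ?case using Cons.IH(2,3)[OF subring_adjoin[OF 3]] adjoin_gen[OF 3] by fastforce }
qed auto

lemma foldl_adjoin_least:
  assumes "subring_set S" "A \<subseteq> S" "set cs \<subseteq> S"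
  shows "foldl adjoin A cs \<subseteq> S"
  using assms(2,3)
proof (induction cs arbitrary: A)
  case (Cons c cs)
  have "adjoin A c \<subseteq> S"
  proof
    fix y assume "y \<in> adjoin A c"
    then obtain f where f: "\<forall>i. coeff f i \<in> A" "y = poly f c" unfolding adjoin_def by blast
    then have "coeff f i * c ^ i \<in> S" for i
      using Cons.prems by (auto intro!: subring_setD(6,7)[OF assms(1)])
    then show "y \<in> S" unfolding f(2) poly_altdef by (intro subring_set_sum[OF assms(1)]) simp
  qed
  then show ?case using Cons by simp
qed simp

section \<open>The Nullstellensatz\<close>

lemma gen_alg_extensional: "f \<in> gen_alg X C ==> f \<in> extensional X"
  by (induction rule: gen_alg.induct) (rule restrict_extensional)+

definition ideal_of :: "'p set => ('p => 'k::comm_ring_1) set => ('p => 'k) set => bool" where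
  "ideal_of X A I \<longleftrightarrow> I \<subseteq> A \<and> (\<lambda>x\<in>X. 0) \<in> I \<and> (\<forall>f\<in>I. \<forall>g\<in>I. (\<lambda>x\<in>X. f x + g x) \<in> I) \<and>
    (\<forall>a\<in>A. \<forall>f\<in>I. (\<lambda>x\<in>X. a x * f x) \<in> I)"

text \<open>An ideal without common zeros contains \<open>1\<close>: otherwise it lies in a prime ideal, and the inclusion of the constants
  extends to a homomorphism on the quotient by that prime, which is evaluation at a point of \<open>X\<close>. The extension
  results are about subrings of a type with ring operations, so \<open>A\<close> is replaced by the ring \<open>B\<close> which
  its generators generate among the functions on the whole type.\<close>

theorem nullstellensatz:
  fixes X :: "'p set" and A :: "('p => 'k::alg_closed_field) set"
  assumes aff: "affine_variety X A" and I: "ideal_of X A I" and nz: "\<And>x. x \<in> X ==> \<exists>f\<in>I. f x \<noteq> 0"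
  shows "(\<lambda>x\<in>X. 1) \<in> I"
proof (rule ccontr)
  assume n1: "(\<lambda>x\<in>X. 1) \<notin> I"
  obtain C where C: "finite C" "A = gen_alg X C" using aff unfolding affine_variety_def by blast
  obtain cs where cs: "set cs = C" using finite_list[OF C(1)] by blast
  define K :: "('p => 'k) set" where "K = range (\<lambda>c. (\<lambda>_. c))"
  define B where "B = foldl adjoin K cs"
  have K: "subring_set K" unfolding subring_set_def K_def
    by (auto simp: fun_eq_iff one_fun_def image_iff)
  note B = subring_foldl_adjoin[OF K, of cs, folded B_def]
  have Bc: "(\<lambda>_. c) \<in> B" for c using B(2) by (auto simp: K_def)
  have A_closed: "(\<lambda>x\<in>X. f x - g x) \<in> A" if "f \<in> A" "g \<in> A" for f g
  proof -
    have "(\<lambda>x\<in>X. f x + (\<lambda>x\<in>X. (\<lambda>x\<in>X. -1) x * g x) x) \<in> A"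
      using that unfolding C(2) by (intro gen_alg.add gen_alg.mult gen_alg.const)
    also have "(\<lambda>x\<in>X. f x + (\<lambda>x\<in>X. (\<lambda>x\<in>X. -1) x * g x) x) = (\<lambda>x\<in>X. f x - g x)"
      by (rule ext) auto
    finally show ?thesis .
  qed
  have res: "restrict f X \<in> A" if "f \<in> B" for f
  proof -
    have "subring_set {f. restrict f X \<in> A}" unfolding subring_set_def
    proof (intro conjI ballI; simp only: mem_Collect_eq)
      show "restrict 1 X \<in> A" using gen_alg.const[of 1 X C] unfolding C(2) one_fun_def .
      fix f g :: "'p => 'k" assume f: "restrict f X \<in> A" and g: "restrict g X \<in> A"
      have "(\<lambda>x\<in>X. restrict f X x - restrict g X x) \<in> A" "(\<lambda>x\<in>X. restrict f X x * restrict g X x) \<in> A"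
        using A_closed[OF f g] f g gen_alg.mult unfolding C(2) by blast+
      moreover have "(\<lambda>x\<in>X. restrict f X x - restrict g X x) = restrict (f - g) X"
        "(\<lambda>x\<in>X. restrict f X x * restrict g X x) = restrict (f * g) X" by (auto simp: fun_eq_iff)
      ultimately show "restrict (f - g) X \<in> A" "restrict (f * g) X \<in> A" by simp_all
    qed
    moreover have "K \<subseteq> {f. restrict f X \<in> A}"
      unfolding C(2) K_def by (auto intro: gen_alg.const[of _ X C])
    moreover have "set cs \<subseteq> {f. restrict f X \<in> A}" using cs gen_alg.gen[of _ C X] C(2) by auto
    ultimately show ?thesis using foldl_adjoin_least[of "{f. restrict f X \<in> A}" K cs] that
      by (auto simp: B_def)
  qed
  have surj: "\<exists>g\<in>B. restrict g X = f" if "f \<in> A" for f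
    using that unfolding C(2)
  proof (induction rule: gen_alg.induct)
    case (const c) show ?case by (rule bexI[of _ "\<lambda>_. c"]) (use Bc in auto)
  next
    case (gen f) then show ?case using B(3) cs by blast
  next
    case (add f g)
    then obtain f' g' where "f' \<in> B" "g' \<in> B" "restrict f' X = f" "restrict g' X = g" by blast
    then show ?case using subring_setD(5)[OF B(1)] by (intro bexI[of _ "f' + g'"]) auto
  next
    case (mult f g)
    then obtain f' g' where "f' \<in> B" "g' \<in> B" "restrict f' X = f" "restrict g' X = g" by blast
    then show ?case using subring_setD(6)[OF B(1)] by (intro bexI[of _ "f' * g'"]) auto
  qed
  have I0: "(\<lambda>x\<in>X. 0) \<in> I" and IA: "I \<subseteq> A"
    using I by (auto simp: ideal_of_def)
  have Ia: "(\<lambda>x\<in>X. f x + g x) \<in> I" if "f \<in> I" "g \<in> I" for f g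
    using I that by (auto simp: ideal_of_def)
  have Im: "(\<lambda>x\<in>X. a x * f x) \<in> I" if "a \<in> A" "f \<in> I" for f a
    using I that by (auto simp: ideal_of_def)
  define J where "J = {f \<in> B. restrict f X \<in> I}"
  have "ideal_in B J" unfolding ideal_in_def
  proof (intro conjI ballI)
    show "0 \<in> J" using I0 subring_setD(2)[OF B(1)] unfolding J_def zero_fun_def by blast
    show "J \<subseteq> B" by (auto simp: J_def)
    fix f assume f: "f \<in> J"
    show m: "a * f \<in> J" if a: "a \<in> B" for a
    proof -
      have "(\<lambda>x\<in>X. restrict a X x * restrict f X x) \<in> I" using Im[OF res[OF a]] f unfolding J_def by blast
      also have "(\<lambda>x\<in>X. restrict a X x * restrict f X x) = restrict (a * f) X" by (auto simp: fun_eq_iff)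
      finally show ?thesis using subring_setD(6)[OF B(1) a] f unfolding J_def by blast
    qed
    fix g assume g: "g \<in> J"
    have "(\<lambda>x\<in>X. restrict f X x + (\<lambda>x\<in>X. (\<lambda>x\<in>X. -1) x * restrict g X x) x) \<in> I"
      using f g unfolding J_def by (intro Ia Im) (simp_all only: C(2) gen_alg.const mem_Collect_eq)
    also have "(\<lambda>x\<in>X. restrict f X x + (\<lambda>x\<in>X. (\<lambda>x\<in>X. -1) x * restrict g X x) x) = restrict (f - g) X"
      by (auto simp: fun_eq_iff)
    finally show "f - g \<in> J" using subring_setD(3)[OF B(1)] f g unfolding J_def by blast
  qed
  moreover have "1 \<notin> J" using n1 by (simp add: J_def one_fun_def)
  ultimately obtain P where P: "prime_in B P" "J \<subseteq> P" using ex_prime_in[OF B(1)] by blast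
  have P1: "1 \<notin> P" using P(1) by (simp add: prime_in_def)
  have KP: "p = 0" if p: "p \<in> K \<inter> P" for p
  proof (rule ccontr)
    assume n: "p \<noteq> 0"
    obtain c where c: "p = (\<lambda>_. c)" using p by (auto simp: K_def)
    then have "c \<noteq> 0" using n by (auto simp: zero_fun_def)
    then have "(\<lambda>_. inverse c) * p = 1" by (simp add: c times_fun_def one_fun_def)
    moreover have "(\<lambda>_. inverse c) * p \<in> P" using P(1) Bc p by (auto simp: prime_in_def)
    ultimately show False using P1 by simp
  qed
  obtain a where a: "a \<in> K" "a \<notin> P" and ext: "\<And>\<phi> :: ('p => 'k) => 'k. hom_on K \<phi> ==> (\<forall>p\<in>K \<inter> P. \<phi> p = 0) ==> \<phi> a \<noteq> 0 ==>
     \<exists>\<psi>. hom_on B \<psi> \<and> (\<forall>p\<in>P. \<psi> p = 0) \<and> \<psi> 1 \<noteq> 0 \<and> (\<forall>c\<in>K. \<psi> c = \<phi> c)"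
    using hom_extension_list[OF K, of cs P 1, where 'k = 'k] P(1) P1 subring_setD(1)[OF B(1)]
    unfolding B_def[symmetric] by blast
  define ev :: "('p => 'k) => 'k" where "ev f = f undefined" for f
  have "a \<noteq> 0" using a(2) P(1) by (auto simp: prime_in_def)
  then have "ev a \<noteq> 0" using a(1) by (auto simp: K_def ev_def zero_fun_def)
  moreover have "hom_on K ev" by (simp add: hom_on_def ev_def)
  moreover have "\<forall>p\<in>K \<inter> P. ev p = 0" using KP unfolding ev_def by (metis zero_fun_apply)
  ultimately obtain \<psi> where \<psi>: "hom_on B \<psi>" "\<forall>p\<in>P. \<psi> p = 0" "\<forall>c\<in>K. \<psi> c = ev c"
    using ext by blast
  define lift where "lift f = (SOME g. g \<in> B \<and> restrict g X = f)" for f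
  define \<chi> where "\<chi> f = \<psi> (lift f)" for f
  have lift: "lift f \<in> B" "restrict (lift f) X = f" if "f \<in> A" for f
    using someI_ex[of "\<lambda>g. g \<in> B \<and> restrict g X = f"] surj[OF that] unfolding lift_def by blast+
  have val: "\<chi> (restrict g X) = \<psi> g" if g: "g \<in> B" for g
  proof -
    let ?h = "lift (restrict g X)"
    have h: "?h \<in> B" "restrict ?h X = restrict g X" using lift[OF res[OF g]] by auto
    have "restrict (?h - g) X = (\<lambda>x\<in>X. 0)"
    proof
      fix x show "restrict (?h - g) X x = (\<lambda>x\<in>X. 0) x" using fun_cong[OF h(2), of x] by (auto simp: restrict_def)
    qed
    then have "restrict (?h - g) X \<in> I" using I0 by (simp only:)
    then have "?h - g \<in> J" using subring_setD(3)[OF B(1) h(1) g] unfolding J_def by blast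
    then have d: "?h - g \<in> P" using P(2) by blast
    have "\<psi> ((?h - g) + g) = \<psi> (?h - g) + \<psi> g"
      using \<psi>(1) g subring_setD(3)[OF B(1) h(1) g] unfolding hom_on_def by blast
    then show ?thesis using d \<psi>(2) by (simp add: \<chi>_def)
  qed
  have c1: "\<forall>c. \<chi> (\<lambda>x\<in>X. c) = c"
  proof
    fix c have "\<psi> (\<lambda>_. c) = ev (\<lambda>_. c)" using \<psi>(3) unfolding K_def by blast
    then show "\<chi> (\<lambda>x\<in>X. c) = c" using val[OF Bc[of c]] by (simp add: ev_def)
  qed
  have c2: "\<chi> (\<lambda>x\<in>X. f x + g x) = \<chi> f + \<chi> g \<and> \<chi> (\<lambda>x\<in>X. f x * g x) = \<chi> f * \<chi> g" if "f \<in> A" "g \<in> A" for f g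
  proof -
    note f = lift[OF that(1)] and g = lift[OF that(2)]
    have e: "restrict (lift f + lift g) X = (\<lambda>x\<in>X. f x + g x)" "restrict (lift f * lift g) X = (\<lambda>x\<in>X. f x * g x)"
      by (subst f(2)[symmetric], subst g(2)[symmetric], auto simp: fun_eq_iff)+
    show ?thesis
      using val[OF subring_setD(5)[OF B(1) f(1) g(1)]] val[OF subring_setD(6)[OF B(1) f(1) g(1)]] f(1) g(1) \<psi>(1)
      unfolding e by (auto simp: \<chi>_def hom_on_def)
  qed
  obtain x where x: "x \<in> X" "\<forall>f\<in>A. \<chi> f = f x"
    using aff c1 c2 unfolding affine_variety_def by blast
  obtain f where f: "f \<in> I" "f x \<noteq> 0" using nz[OF x(1)] by blast
  have fA: "f \<in> A" using f(1) IA by blast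
  have "lift f \<in> P" using lift[OF fA] f(1) P(2) by (auto simp: J_def)
  then have "\<chi> f = 0" using \<psi>(2) by (simp add: \<chi>_def)
  then show False using x(2) fA f(2) by simp
qed

section \<open>Functions belonging to an algebra of functions\<close>

text \<open>Values outside \<open>X\<close> are ignored, so that regular functions can be written as plain \<open>\<lambda>\<close>-terms.\<close>

definition regf :: "'p set => ('p => 'k::comm_ring_1) set => ('p => 'k) => bool" where
  "regf X A f \<longleftrightarrow> restrict f X \<in> A"

locale fun_alg =
  fixes X :: "'p set" and A :: "('p => 'k::field) set"
  assumes gen: "\<exists>C. A = gen_alg X C"
begin

lemma regf_const: "regf X A (\<lambda>x. c)"
  using gen by (auto simp: regf_def intro: gen_alg.const)

lemma regf_add: "regf X A f ==> regf X A g ==> regf X A (\<lambda>x. f x + g x)"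
proof -
  obtain C where C: "A = gen_alg X C" using gen by blast
  assume "regf X A f" "regf X A g"
  then have "(\<lambda>x\<in>X. restrict f X x + restrict g X x) \<in> A"
    unfolding regf_def C by (rule gen_alg.add)
  moreover have "(\<lambda>x\<in>X. restrict f X x + restrict g X x) = (\<lambda>x\<in>X. f x + g x)" by (auto simp: fun_eq_iff)
  ultimately show ?thesis by (simp only: regf_def)
qed

lemma regf_mult: "regf X A f ==> regf X A g ==> regf X A (\<lambda>x. f x * g x)"
proof -
  obtain C where C: "A = gen_alg X C" using gen by blast
  assume "regf X A f" "regf X A g"
  then have "(\<lambda>x\<in>X. restrict f X x * restrict g X x) \<in> A"
    unfolding regf_def C by (rule gen_alg.mult)
  moreover have "(\<lambda>x\<in>X. restrict f X x * restrict g X x) = (\<lambda>x\<in>X. f x * g x)" by (auto simp: fun_eq_iff)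
  ultimately show ?thesis by (simp only: regf_def)
qed

lemma regf_uminus: "regf X A f ==> regf X A (\<lambda>x. - f x)"
  using regf_mult[OF regf_const[of "-1"]] by simp

lemma regf_diff: "regf X A f ==> regf X A g ==> regf X A (\<lambda>x. f x - g x)"
  using regf_add[OF _ regf_uminus] by simp

lemma regf_sum: "(\<And>i. i \<in> I ==> regf X A (f i)) ==> regf X A (\<lambda>x. \<Sum>i\<in>I. f i x)"
  by (induction I rule: infinite_finite_induct) (simp_all add: regf_const regf_add)

lemma regf_prod: "(\<And>i. i \<in> I ==> regf X A (f i)) ==> regf X A (\<lambda>x. \<Prod>i\<in>I. f i x)"
  by (induction I rule: infinite_finite_induct) (simp_all add: regf_const regf_mult)

lemma regf_power: "regf X A f ==> regf X A (\<lambda>x. f x ^ n)"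
  by (induction n) (simp_all add: regf_const regf_mult)

lemma ext: "f \<in> A ==> f \<in> extensional X"
  using gen gen_alg_extensional by blast

lemma regf_mem: "f \<in> A ==> regf X A f"
  using extensional_restrict[OF ext[of f]] by (simp add: regf_def)

lemma mem_regf: "f \<in> extensional X ==> regf X A f ==> f \<in> A"
  using extensional_restrict[of f X] by (simp add: regf_def)

end

lemma regf_cong: "regf X A f ==> (\<And>x. x \<in> X ==> f x = g x) ==> regf X A g"
  unfolding regf_def by (metis restrict_ext)

lemma fun_alg_gen_alg [intro]: "fun_alg X (gen_alg X C)"
  by standard blast

lemma regf_gen: "f \<in> C ==> regf X (gen_alg X C) f"
  by (simp add: regf_def gen_alg.gen)

text \<open>To show that a class of functions closed under the ring operations contains an algebra of
  functions, look at its generators.\<close>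

lemma regf_gen_alg_induct [consumes 1, case_names cong const gen add mult]:
  assumes "regf X (gen_alg X C) f"
    and "\<And>f g. P f ==> (\<And>x. x \<in> X ==> f x = g x) ==> P g"
    and "\<And>c. P (\<lambda>x. c)" and "\<And>f. f \<in> C ==> P f"
    and "\<And>f g. P f ==> P g ==> P (\<lambda>x. f x + g x)"
    and "\<And>f g. P f ==> P g ==> P (\<lambda>x. f x * g x)"
  shows "P f"
proof -
  have "P f'" if "f' \<in> gen_alg X C" for f'
    using that
  proof (induction rule: gen_alg.induct)
    case (const c) show ?case by (rule assms(2)[OF assms(3)[of c]]) simp
  next
    case (gen f) show ?case by (rule assms(2)[OF assms(4)[OF gen]]) simp
  next
    case (add f g) show ?case by (rule assms(2)[OF assms(5)[OF add.IH]]) simp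
  next
    case (mult f g) show ?case by (rule assms(2)[OF assms(6)[OF mult.IH]]) simp
  qed
  from this[OF assms(1)[unfolded regf_def]] show ?thesis by (rule assms(2)) simp
qed

lemma regf_pullback:
  assumes "regf Y (gen_alg Y C) f" "fun_alg X A" "p ` X \<subseteq> Y" "\<And>f. f \<in> C ==> regf X A (\<lambda>x. f (p x))"
  shows "regf X A (\<lambda>x. f (p x))"
  using assms(1)
proof (induction rule: regf_gen_alg_induct)
  case (cong f g) then show ?case using assms(3) by (intro regf_cong[OF cong(1)]) auto
qed (use assms in \<open>auto intro: fun_alg.regf_const fun_alg.regf_add fun_alg.regf_mult\<close>)

section \<open>Polynomials\<close>

abbreviation keys :: "('a \<Rightarrow>\<^sub>0 'b::zero) => 'a set" where "keys \<equiv> Poly_Mapping.keys"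
abbreviation lookup :: "('a \<Rightarrow>\<^sub>0 'b::zero) => 'a => 'b" where "lookup \<equiv> Poly_Mapping.lookup"
abbreviation single :: "'a => 'b => 'a \<Rightarrow>\<^sub>0 'b::zero" where "single \<equiv> Poly_Mapping.single"

definition monom_eval :: "(nat \<Rightarrow>\<^sub>0 nat) => (nat => 'k::comm_ring_1) => 'k" where
  "monom_eval \<alpha> x = (\<Prod>i\<in>keys \<alpha>. x i ^ lookup \<alpha> i)"

lemma monom_eval_superset:
  assumes "finite S" "keys \<alpha> \<subseteq> S"
  shows "monom_eval \<alpha> x = (\<Prod>i\<in>S. x i ^ lookup \<alpha> i)"
  unfolding monom_eval_def by (rule prod.mono_neutral_left) (use assms in \<open>auto simp: in_keys_iff\<close>)

lemma monom_eval_add: "monom_eval (\<alpha> + \<beta>) x = monom_eval \<alpha> x * monom_eval \<beta> x"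
proof -
  let ?S = "keys \<alpha> \<union> keys \<beta>"
  have "monom_eval (\<alpha> + \<beta>) x = (\<Prod>i\<in>?S. x i ^ lookup (\<alpha> + \<beta>) i)"
    by (rule monom_eval_superset) (use keys_add[of \<alpha> \<beta>] in auto)
  also have "\<dots> = (\<Prod>i\<in>?S. x i ^ lookup \<alpha> i) * (\<Prod>i\<in>?S. x i ^ lookup \<beta> i)"
    by (simp add: lookup_add power_add prod.distrib)
  also have "\<dots> = monom_eval \<alpha> x * monom_eval \<beta> x"
    by (subst (1 2) monom_eval_superset[symmetric]) auto
  finally show ?thesis .
qed

lemma monom_eval_mult: "monom_eval \<alpha> (\<lambda>i. x i * y i) = monom_eval \<alpha> x * monom_eval \<alpha> y"
  by (simp add: monom_eval_def power_mult_distrib prod.distrib)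

lemma monom_eval_single: "monom_eval (single i k) x = x i ^ k"
  by (cases "k = 0") (simp_all add: monom_eval_def)

lemma monom_eval_zero [simp]: "monom_eval 0 x = 1"
  by (simp add: monom_eval_def)

lemma mpoly_eval_superset:
  assumes "finite S" "keys P \<subseteq> S"
  shows "mpoly_eval P x = (\<Sum>\<alpha>\<in>S. lookup P \<alpha> * monom_eval \<alpha> x)"
  unfolding mpoly_eval_def monom_eval_def[symmetric]
  by (rule sum.mono_neutral_left) (use assms in \<open>auto simp: in_keys_iff\<close>)

lemma mpoly_eval_add: "mpoly_eval (P + Q) x = mpoly_eval P x + mpoly_eval Q x"
proof -
  let ?S = "keys P \<union> keys Q"
  have "mpoly_eval (P + Q) x = (\<Sum>\<alpha>\<in>?S. lookup (P + Q) \<alpha> * monom_eval \<alpha> x)"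
    by (rule mpoly_eval_superset) (use keys_add[of P Q] in auto)
  also have "\<dots> = (\<Sum>\<alpha>\<in>?S. lookup P \<alpha> * monom_eval \<alpha> x) + (\<Sum>\<alpha>\<in>?S. lookup Q \<alpha> * monom_eval \<alpha> x)"
    by (simp add: lookup_add algebra_simps sum.distrib)
  also have "\<dots> = mpoly_eval P x + mpoly_eval Q x"
    by (subst (1 2) mpoly_eval_superset[symmetric]) auto
  finally show ?thesis .
qed

lemma mpoly_eval_single: "mpoly_eval (single \<alpha> c) x = c * monom_eval \<alpha> x"
  by (cases "c = 0") (simp_all add: mpoly_eval_def monom_eval_def)

lemma mpoly_eval_zero [simp]: "mpoly_eval 0 x = 0"
  by (simp add: mpoly_eval_def)

lemma mpoly_eval_sum: "mpoly_eval (\<Sum>i\<in>I. P i) x = (\<Sum>i\<in>I. mpoly_eval (P i) x)"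
  by (induction I rule: infinite_finite_induct) (simp_all add: mpoly_eval_add)

lemma sum_singles:
  assumes "finite S" "keys P \<subseteq> S"
  shows "P = (\<Sum>\<alpha>\<in>S. single \<alpha> (lookup P \<alpha>))"
proof (rule poly_mapping_eqI)
  fix \<beta>
  have "(\<Sum>\<alpha>\<in>S. lookup (single \<alpha> (lookup P \<alpha>)) \<beta>) =
      (\<Sum>\<alpha>\<in>S. if \<alpha> = \<beta> then lookup P \<beta> else 0)"
    by (rule sum.cong) (auto simp: lookup_single)
  also have "\<dots> = lookup P \<beta>"
    using assms by (auto simp: in_keys_iff)
  finally show "lookup P \<beta> = lookup (\<Sum>\<alpha>\<in>S. single \<alpha> (lookup P \<alpha>)) \<beta>"
    by (simp add: lookup_sum)
qed

lemma mult_sum_singles: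
  assumes "finite S" "keys P \<subseteq> S" "finite T" "keys Q \<subseteq> T"
  shows "P * Q = (\<Sum>\<alpha>\<in>S. \<Sum>\<beta>\<in>T. single (\<alpha> + \<beta>) (lookup P \<alpha> * lookup Q \<beta>))"
  by (subst sum_singles[OF assms(1,2)], subst sum_singles[OF assms(3,4)])
     (simp add: sum_product mult_single)

lemma mpoly_eval_mult: "mpoly_eval (P * Q) x = mpoly_eval P x * mpoly_eval Q x"
proof -
  let ?S = "keys P" and ?T = "keys Q"
  have "mpoly_eval (P * Q) x = (\<Sum>\<alpha>\<in>?S. \<Sum>\<beta>\<in>?T. lookup P \<alpha> * lookup Q \<beta> * monom_eval (\<alpha> + \<beta>) x)"
    by (subst mult_sum_singles[of ?S P ?T Q]) (simp_all add: mpoly_eval_sum mpoly_eval_single)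
  also have "\<dots> = mpoly_eval P x * mpoly_eval Q x"
    by (simp add: mpoly_eval_superset[of ?S] mpoly_eval_superset[of ?T] sum_product monom_eval_add algebra_simps)
  finally show ?thesis .
qed

lemma mpoly_eval_one [simp]: "mpoly_eval 1 x = 1"
  using mpoly_eval_single[of 0 1 x] by simp

lemma mpoly_eval_uminus: "mpoly_eval (- P) x = - mpoly_eval P x"
  using mpoly_eval_add[of P "- P" x] by (simp add: add_eq_0_iff)

lemma mpoly_eval_diff: "mpoly_eval (P - Q) x = mpoly_eval P x - mpoly_eval Q x"
  using mpoly_eval_add[of P "- Q" x] by (simp add: mpoly_eval_uminus)

lemma mpoly_eval_power: "mpoly_eval (P ^ n) x = mpoly_eval P x ^ n"
  by (induction n) (simp_all add: mpoly_eval_mult)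

lemma mpoly_eval_cong:
  assumes "\<And>\<alpha> i. \<alpha> \<in> keys P ==> i \<in> keys \<alpha> ==> x i = y i"
  shows "mpoly_eval P x = mpoly_eval P y"
  unfolding mpoly_eval_def by (intro sum.cong refl arg_cong2[where f = "(*)"] prod.cong) (use assms in auto)

text \<open>Monomials are distinct characters of a multiplicative monoid, so Dedekind's argument shows that
  a polynomial is determined by its values.\<close>

lemma monomials_independent:
  fixes c :: "(nat \<Rightarrow>\<^sub>0 nat) => 'k::field"
  assumes "infinite (UNIV :: 'k set)" "finite S" "\<And>x :: nat => 'k. (\<Sum>\<alpha>\<in>S. c \<alpha> * monom_eval \<alpha> x) = 0" "\<alpha> \<in> S"
  shows "c \<alpha> = 0"
  using assms(2-)
proof (induction S arbitrary: c \<alpha> rule: finite_induct)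
  case (insert \<beta> S)
  have *: "c \<alpha> = 0" if \<alpha>: "\<alpha> \<in> S" for \<alpha>
  proof -
    have "\<alpha> \<noteq> \<beta>" using \<alpha> insert.hyps by blast
    then obtain i where i: "lookup \<alpha> i \<noteq> lookup \<beta> i"
      using poly_mapping_eqI[of \<alpha> \<beta>] by auto
    define f where "f = monom (1::'k) (lookup \<alpha> i) - monom 1 (lookup \<beta> i)"
    have "coeff f (lookup \<alpha> i) = 1" using i by (simp add: f_def)
    then have "f \<noteq> 0" by auto
    then obtain t where t: "poly f t \<noteq> 0"
      using poly_roots_finite[of f] assms(1) by (metis (mono_tags, lifting) UNIV_I finite_subset mem_Collect_eq subsetI)
    define y where "y = (\<lambda>j. if j = i then t else (1::'k))"
    have ev: "monom_eval \<gamma> y = t ^ lookup \<gamma> i" for \<gamma>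
    proof -
      have "monom_eval \<gamma> y = (\<Prod>j\<in>insert i (keys \<gamma>). y j ^ lookup \<gamma> j)"
        by (rule monom_eval_superset) auto
      also have "\<dots> = (\<Prod>j\<in>insert i (keys \<gamma>). if j = i then t ^ lookup \<gamma> i else 1)"
        by (rule prod.cong) (auto simp: y_def)
      finally show ?thesis by simp
    qed
    have "(\<Sum>\<gamma>\<in>S. (c \<gamma> * (monom_eval \<gamma> y - monom_eval \<beta> y)) * monom_eval \<gamma> x) = 0" for x
    proof -
      have "(\<Sum>\<gamma>\<in>S. (c \<gamma> * (monom_eval \<gamma> y - monom_eval \<beta> y)) * monom_eval \<gamma> x) =
          (\<Sum>\<gamma>\<in>insert \<beta> S. (c \<gamma> * (monom_eval \<gamma> y - monom_eval \<beta> y)) * monom_eval \<gamma> x)"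
        using insert.hyps by simp
      also have "\<dots> = (\<Sum>\<gamma>\<in>insert \<beta> S. c \<gamma> * monom_eval \<gamma> (\<lambda>i. y i * x i) - monom_eval \<beta> y * (c \<gamma> * monom_eval \<gamma> x))"
        by (rule sum.cong, rule refl) (simp only: monom_eval_mult, simp add: algebra_simps)
      also have "\<dots> = (\<Sum>\<gamma>\<in>insert \<beta> S. c \<gamma> * monom_eval \<gamma> (\<lambda>i. y i * x i)) -
          monom_eval \<beta> y * (\<Sum>\<gamma>\<in>insert \<beta> S. c \<gamma> * monom_eval \<gamma> x)"
        by (simp only: sum_distrib_left sum_subtractf)
      also have "\<dots> = 0" using insert.prems(1)[of "\<lambda>i. y i * x i"] insert.prems(1)[of x] by (simp only:) simp
      finally show ?thesis .
    qed
    from insert.IH[OF this \<alpha>] have "c \<alpha> * (monom_eval \<alpha> y - monom_eval \<beta> y) = 0" .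
    then show ?thesis using t by (simp add: ev f_def poly_monom)
  qed
  have "c \<beta> = 0" using insert.prems(1)[of "\<lambda>_. 1"] insert.hyps *
    by (simp add: monom_eval_def)
  then show ?case using * insert.prems(2) by blast
qed simp

lemma mpoly_eq_0:
  fixes P :: "'k::field mpoly"
  assumes "infinite (UNIV :: 'k set)" "\<And>x. mpoly_eval P x = 0"
  shows "P = 0"
proof (rule poly_mapping_eqI)
  fix \<alpha>
  show "lookup P \<alpha> = lookup 0 \<alpha>"
  proof (cases "\<alpha> \<in> keys P")
    case True
    have "(\<Sum>\<alpha>\<in>keys P. lookup P \<alpha> * monom_eval \<alpha> x) = 0" for x
      using assms(2)[of x] by (simp add: mpoly_eval_superset[of "keys P"])
    from monomials_independent[OF assms(1) _ this True] show ?thesis by simp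
  qed (simp add: in_keys_iff)
qed

lemma mpoly_deriv_superset:
  assumes "finite S" "keys P \<subseteq> S"
  shows "mpoly_deriv j P = (\<Sum>\<alpha>\<in>S. single (\<alpha> - single j 1) (of_nat (lookup \<alpha> j) * lookup P \<alpha>))"
  unfolding mpoly_deriv_def
  by (rule sum.mono_neutral_left) (use assms in \<open>auto simp: in_keys_iff\<close>)

lemma mpoly_deriv_add: "mpoly_deriv j (P + Q) = mpoly_deriv j P + mpoly_deriv j Q"
proof -
  let ?S = "keys P \<union> keys Q"
  have "mpoly_deriv j (P + Q) = (\<Sum>\<alpha>\<in>?S. single (\<alpha> - single j 1) (of_nat (lookup \<alpha> j) * lookup (P + Q) \<alpha>))"
    by (rule mpoly_deriv_superset) (use keys_add[of P Q] in auto)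
  also have "\<dots> = (\<Sum>\<alpha>\<in>?S. single (\<alpha> - single j 1) (of_nat (lookup \<alpha> j) * lookup P \<alpha>)) +
     (\<Sum>\<alpha>\<in>?S. single (\<alpha> - single j 1) (of_nat (lookup \<alpha> j) * lookup Q \<alpha>))"
    by (simp add: lookup_add distrib_left single_add sum.distrib)
  also have "\<dots> = mpoly_deriv j P + mpoly_deriv j Q"
    by (subst (1 2) mpoly_deriv_superset[symmetric]) auto
  finally show ?thesis .
qed

lemma mpoly_deriv_single: "mpoly_deriv j (single \<alpha> c) =
    single (\<alpha> - single j 1) (of_nat (lookup \<alpha> j) * c)"
  by (cases "c = 0") (simp_all add: mpoly_deriv_def)

lemma mpoly_deriv_sum: "mpoly_deriv j (\<Sum>i\<in>I. P i) = (\<Sum>i\<in>I. mpoly_deriv j (P i))"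
  by (induction I rule: infinite_finite_induct) (simp_all add: mpoly_deriv_add mpoly_deriv_def[of _ 0])

lemma mpoly_deriv_var_mult:
  assumes "\<And>\<alpha>. \<alpha> \<in> keys D ==> j \<notin> keys \<alpha>"
  shows "mpoly_deriv j (single (single j 1) 1 * D - 1) = (D :: 'k::comm_ring_1 mpoly)"
proof -
  let ?e = "single j (1::nat)" and ?K = "keys D"
  have "single ?e 1 * D = (\<Sum>\<alpha>\<in>?K. single ?e 1 * single \<alpha> (lookup D \<alpha>))"
    by (subst sum_singles[of ?K D]) (auto simp: sum_distrib_left)
  also have "\<dots> = (\<Sum>\<alpha>\<in>?K. single (?e + \<alpha>) (lookup D \<alpha>))"
    by (simp add: mult_single)
  finally have "mpoly_deriv j (single ?e 1 * D + single 0 (- 1)) =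
      (\<Sum>\<alpha>\<in>?K. single (?e + \<alpha> - ?e) (of_nat (lookup (?e + \<alpha>) j) * lookup D \<alpha>))"
    by (simp add: mpoly_deriv_add mpoly_deriv_sum mpoly_deriv_single)
  also have "\<dots> = (\<Sum>\<alpha>\<in>?K. single \<alpha> (lookup D \<alpha>))"
    using assms by (intro sum.cong refl) (auto simp: lookup_add in_keys_iff)
  also have "\<dots> = D" by (rule sum_singles[symmetric]) auto
  finally show ?thesis by (simp add: single_uminus)
qed

section \<open>Polynomials over an algebra of functions\<close>

lemma rel_polyI:
  assumes "finite S" "\<And>\<alpha>. \<alpha> \<in> S ==> keys \<alpha> \<subseteq> {..<n}" "\<And>v. v \<in> V ==> keys (P v) \<subseteq> S"
    "\<And>\<alpha>. regf V A (\<lambda>v. lookup (P v) \<alpha>)"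
  shows "P \<in> rel_poly V A n"
  unfolding rel_poly_def mem_Collect_eq by (rule exI[of _ S]) (use assms in \<open>simp add: regf_def\<close>)

lemma rel_polyE:
  assumes "P \<in> rel_poly V A n"
  obtains S where "finite S" "\<And>\<alpha>. \<alpha> \<in> S ==> keys \<alpha> \<subseteq> {..<n}" "\<And>v. v \<in> V ==> keys (P v) \<subseteq> S"
    "\<And>\<alpha>. regf V A (\<lambda>v. lookup (P v) \<alpha>)"
proof -
  from assms obtain S where S: "finite S \<and> (\<forall>\<alpha>\<in>S. keys \<alpha> \<subseteq> {..<n}) \<and>
      (\<forall>v\<in>V. keys (P v) \<subseteq> S) \<and> (\<forall>\<alpha>. (\<lambda>v\<in>V. lookup (P v) \<alpha>) \<in> A)"
    unfolding rel_poly_def mem_Collect_eq by (elim exE)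
  show ?thesis by (rule that[of S]) (use S in \<open>simp_all add: regf_def\<close>)
qed

context fun_alg
begin

lemma rel_poly_single:
  assumes "regf X A c" "keys \<alpha> \<subseteq> {..<n}"
  shows "(\<lambda>v. single \<alpha> (c v)) \<in> rel_poly X A n"
proof (rule rel_polyI[of "{\<alpha>}"])
  fix \<beta> show "regf X A (\<lambda>v. lookup (single \<alpha> (c v)) \<beta>)"
    by (cases "\<alpha> = \<beta>") (simp_all add: lookup_single assms(1) regf_const)
next
  fix v show "keys (single \<alpha> (c v)) \<subseteq> {\<alpha>}"
    by (simp only: keys_single split: if_split) blast
qed (use assms(2) in simp_all)

lemma rel_poly_add:
  assumes "P \<in> rel_poly X A n" "Q \<in> rel_poly X A n"
  shows "(\<lambda>v. P v + Q v) \<in> rel_poly X A n"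
proof -
  from assms(1) obtain S where S: "finite S" "\<And>\<alpha>. \<alpha> \<in> S ==> keys \<alpha> \<subseteq> {..<n}" "\<And>v. v \<in> X ==> keys (P v) \<subseteq> S"
    "\<And>\<alpha>. regf X A (\<lambda>v. lookup (P v) \<alpha>)" by (rule rel_polyE) (rule that)
  from assms(2) obtain T where T: "finite T" "\<And>\<alpha>. \<alpha> \<in> T ==> keys \<alpha> \<subseteq> {..<n}" "\<And>v. v \<in> X ==> keys (Q v) \<subseteq> T"
    "\<And>\<alpha>. regf X A (\<lambda>v. lookup (Q v) \<alpha>)" by (rule rel_polyE) (rule that)
  show ?thesis
  proof (rule rel_polyI[of "S \<union> T"])
    fix v assume "v \<in> X"
    then show "keys (P v + Q v) \<subseteq> S \<union> T"
      using keys_add[of "P v" "Q v"] S(3) T(3) by blast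
  next
    fix \<alpha> show "regf X A (\<lambda>v. lookup (P v + Q v) \<alpha>)"
      unfolding lookup_add by (rule regf_add[OF S(4) T(4)])
  next
    fix \<alpha> assume "\<alpha> \<in> S \<union> T"
    then show "keys \<alpha> \<subseteq> {..<n}" using S(2) T(2) by blast
  qed (use S(1) T(1) in simp)
qed

lemma rel_poly_mult:
  assumes "P \<in> rel_poly X A n" "Q \<in> rel_poly X A n"
  shows "(\<lambda>v. P v * Q v) \<in> rel_poly X A n"
proof -
  from assms(1) obtain S where S: "finite S" "\<And>\<alpha>. \<alpha> \<in> S ==> keys \<alpha> \<subseteq> {..<n}" "\<And>v. v \<in> X ==> keys (P v) \<subseteq> S"
    "\<And>\<alpha>. regf X A (\<lambda>v. lookup (P v) \<alpha>)" by (rule rel_polyE) (rule that)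
  from assms(2) obtain T where T: "finite T" "\<And>\<alpha>. \<alpha> \<in> T ==> keys \<alpha> \<subseteq> {..<n}" "\<And>v. v \<in> X ==> keys (Q v) \<subseteq> T"
    "\<And>\<alpha>. regf X A (\<lambda>v. lookup (Q v) \<alpha>)" by (rule rel_polyE) (rule that)
  let ?U = "(\<lambda>(\<alpha>, \<beta>). \<alpha> + \<beta>) ` (S \<times> T)"
  show ?thesis
  proof (rule rel_polyI[of ?U])
    show "finite ?U" using S(1) T(1) by blast
    show "keys \<gamma> \<subseteq> {..<n}" if "\<gamma> \<in> ?U" for \<gamma>
    proof -
      obtain \<alpha> \<beta> where "\<alpha> \<in> S" "\<beta> \<in> T" "\<gamma> = \<alpha> + \<beta>" using \<open>\<gamma> \<in> ?U\<close> by auto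
      then show ?thesis using S(2)[of \<alpha>] T(2)[of \<beta>] keys_add[of \<alpha> \<beta>] by blast
    qed
    show "keys (P v * Q v) \<subseteq> ?U" if "v \<in> X" for v
      using S(3)[OF that] T(3)[OF that] keys_mult[of "P v" "Q v"] by blast
    fix \<gamma>
    have "regf X A (\<lambda>v. \<Sum>\<alpha>\<in>S. \<Sum>\<beta>\<in>T. lookup (P v) \<alpha> * lookup (Q v) \<beta> * (if \<alpha> + \<beta> = \<gamma> then 1 else 0))"
      by (intro regf_sum regf_mult S(4) T(4) regf_const)
    then show "regf X A (\<lambda>v. lookup (P v * Q v) \<gamma>)"
    proof (rule regf_cong)
      fix v assume v: "v \<in> X"
      show "(\<Sum>\<alpha>\<in>S. \<Sum>\<beta>\<in>T. lookup (P v) \<alpha> * lookup (Q v) \<beta> * (if \<alpha> + \<beta> = \<gamma> then 1 else 0)) =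
          lookup (P v * Q v) \<gamma>"
        unfolding mult_sum_singles[OF S(1) S(3)[OF v] T(1) T(3)[OF v]] lookup_sum
        by (intro sum.cong refl) (auto simp: lookup_single)
    qed
  qed
qed

lemma rel_poly_sum:
  assumes "\<And>i. i \<in> I ==> P i \<in> rel_poly X A n"
  shows "(\<lambda>v. \<Sum>i\<in>I. P i v) \<in> rel_poly X A n"
  using assms
proof (induction I rule: infinite_finite_induct)
  case (insert i I) then show ?case using rel_poly_add[of "P i" n] by simp
qed (use rel_poly_single[of "\<lambda>v. 0" 0 n] regf_const in simp_all)

lemma rel_poly_one: "(\<lambda>v. 1) \<in> rel_poly X A n"
  using rel_poly_single[of "\<lambda>v. 1" 0 n] regf_const by simp

lemma rel_poly_power: "P \<in> rel_poly X A n ==> (\<lambda>v. P v ^ k) \<in> rel_poly X A n"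
  by (induction k) (simp_all add: rel_poly_one rel_poly_mult)

lemma rel_poly_uminus: "P \<in> rel_poly X A n ==> (\<lambda>v. - P v) \<in> rel_poly X A n"
  using rel_poly_mult[OF rel_poly_single[of "\<lambda>v. -1" 0 n]] regf_const by (simp add: single_uminus)

lemma rel_poly_diff: "P \<in> rel_poly X A n ==> Q \<in> rel_poly X A n ==> (\<lambda>v. P v - Q v) \<in> rel_poly X A n"
  using rel_poly_add[OF _ rel_poly_uminus] by simp

end

section \<open>Standard smooth maps obtained by inverting one function\<close>

lemma det_1x1: "det (mat (Suc 0) (Suc 0) f) = f (0, 0)"
  by (subst det_single) auto

text \<open>The factor of a monomial which does not involve \<open>x\<^sub>0\<close>.\<close>

definition drop0 :: "(nat \<Rightarrow>\<^sub>0 nat) => (nat \<Rightarrow>\<^sub>0 nat)" where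
  "drop0 \<alpha> = \<alpha> - single 0 (lookup \<alpha> 0)"

lemma drop0_add: "drop0 \<alpha> + single 0 (lookup \<alpha> 0) = \<alpha>"
  by (rule poly_mapping_eqI) (simp add: drop0_def lookup_add lookup_minus lookup_single when_def)

lemma drop0_keys: "keys (drop0 \<alpha>) \<subseteq> keys \<alpha> - {0}"
  by (auto simp: drop0_def in_keys_iff lookup_minus lookup_single when_def split: if_splits)

text \<open>Rabinowitsch's trick, over the algebra \<open>A\<close>: a polynomial vanishing on the graph \<open>x\<^sub>0 D = 1\<close> is a
  multiple of \<open>x\<^sub>0 D - 1\<close>, because clearing the denominators turns it into a polynomial without
  \<open>x\<^sub>0\<close> which vanishes wherever \<open>D\<close> does not.\<close>

lemma rabinowitsch_relative:
  fixes D P :: "'p => 'k::field mpoly"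
  assumes inf: "infinite (UNIV :: 'k set)" and "fun_alg V A"
    and D: "D \<in> rel_poly V A (Suc n)" "\<And>v \<alpha>. v \<in> V ==> \<alpha> \<in> keys (D v) ==> 0 \<notin> keys \<alpha>"
    and P: "P \<in> rel_poly V A (Suc n)"
    and van: "\<And>v x. v \<in> V ==> x 0 * mpoly_eval (D v) x = 1 ==> mpoly_eval (P v) x = 0"
  shows "\<exists>H\<in>rel_poly V A (Suc n). \<forall>v\<in>V. P v = H v * (single (single 0 1) 1 * D v - 1)"
proof -
  interpret fun_alg V A by fact
  define X0 where "X0 = single (single (0::nat) (1::nat)) (1::'k)"
  from P obtain S where S: "finite S" "\<And>\<alpha>. \<alpha> \<in> S ==> keys \<alpha> \<subseteq> {..<Suc n}" "\<And>v. v \<in> V ==> keys (P v) \<subseteq> S"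
    "\<And>\<alpha>. regf V A (\<lambda>v. lookup (P v) \<alpha>)" by (rule rel_polyE) (rule that)
  define a where "a \<alpha> v = lookup (P v) \<alpha>" for \<alpha> v
  define k where "k \<alpha> = lookup \<alpha> (0::nat)" for \<alpha> :: "nat \<Rightarrow>\<^sub>0 nat"
  define e where "e = Max (insert 0 (k ` S))"
  have ke: "k \<alpha> \<le> e" if "\<alpha> \<in> S" for \<alpha> using that S(1) by (auto simp: e_def)
  define F where "F v = X0 * D v - 1" for v
  define G where "G j v = (\<Sum>i<j. (X0 * D v) ^ i)" for j v
  have FG: "(X0 * D v) ^ j - 1 = F v * G j v" for j v
    unfolding F_def G_def by (rule power_diff_1_eq)
  define Q where "Q v = (\<Sum>\<alpha>\<in>S. single (drop0 \<alpha>) (a \<alpha> v) * D v ^ (e - k \<alpha>))" for v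
  define R where "R v = (\<Sum>\<alpha>\<in>S. single (drop0 \<alpha>) (a \<alpha> v) * D v ^ (e - k \<alpha>) * G (k \<alpha>) v)" for v
  have X0: "(\<lambda>v. X0) \<in> rel_poly V A (Suc n)"
    unfolding X0_def by (rule rel_poly_single[OF regf_const]) simp
  have G: "(\<lambda>v. G j v) \<in> rel_poly V A (Suc n)" for j
    unfolding G_def by (intro rel_poly_sum rel_poly_power rel_poly_mult X0 D(1))
  have R: "R \<in> rel_poly V A (Suc n)"
  proof -
    have "(\<lambda>v. single (drop0 \<alpha>) (a \<alpha> v)) \<in> rel_poly V A (Suc n)" if "\<alpha> \<in> S" for \<alpha>
    proof (rule rel_poly_single)
      show "regf V A (\<lambda>v. a \<alpha> v)" unfolding a_def by (rule S(4))
      show "keys (drop0 \<alpha>) \<subseteq> {..<Suc n}" using S(2)[OF that] drop0_keys[of \<alpha>] by blast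
    qed
    then show ?thesis unfolding R_def by (intro rel_poly_sum rel_poly_mult rel_poly_power G D(1))
  qed
  have X0_single: "X0 ^ j * single \<beta> c = single (\<beta> + single 0 j) c" for j \<beta> c
  proof (induction j)
    case (Suc j)
    have "X0 ^ Suc j * single \<beta> c = X0 * (X0 ^ j * single \<beta> c)" by (simp add: mult.assoc)
    also have "\<dots> = X0 * single (\<beta> + single 0 j) c" by (simp only: Suc)
    also have "\<dots> = single (\<beta> + (single 0 j + single 0 1)) c"
      by (simp add: X0_def mult_single add_ac)
    finally show ?case by (simp add: single_add[symmetric])
  qed simp
  have DP: "D v ^ e * P v = Q v + F v * R v" if v: "v \<in> V" for v
  proof -
    have "P v = (\<Sum>\<alpha>\<in>S. single \<alpha> (a \<alpha> v))"
      unfolding a_def by (rule sum_singles[OF S(1) S(3)[OF v]])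
    also have "\<dots> = (\<Sum>\<alpha>\<in>S. X0 ^ k \<alpha> * single (drop0 \<alpha>) (a \<alpha> v))"
      by (simp add: X0_single k_def drop0_add)
    finally have "D v ^ e * P v = (\<Sum>\<alpha>\<in>S. D v ^ e * (X0 ^ k \<alpha> * single (drop0 \<alpha>) (a \<alpha> v)))"
      by (simp add: sum_distrib_left)
    also have "\<dots> = (\<Sum>\<alpha>\<in>S. single (drop0 \<alpha>) (a \<alpha> v) * D v ^ (e - k \<alpha>) * (1 + F v * G (k \<alpha>) v))"
    proof (rule sum.cong[OF refl])
      fix \<alpha> assume "\<alpha> \<in> S"
      then have "D v ^ e = D v ^ (e - k \<alpha>) * D v ^ k \<alpha>" using ke by (simp add: power_add[symmetric])
      moreover have "1 + F v * G (k \<alpha>) v = X0 ^ k \<alpha> * D v ^ k \<alpha>"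
        unfolding FG[symmetric] by (simp add: power_mult_distrib)
      ultimately show "D v ^ e * (X0 ^ k \<alpha> * single (drop0 \<alpha>) (a \<alpha> v)) =
          single (drop0 \<alpha>) (a \<alpha> v) * D v ^ (e - k \<alpha>) * (1 + F v * G (k \<alpha>) v)"
        by (simp add: mult_ac)
    qed
    also have "\<dots> = Q v + F v * R v"
      unfolding Q_def R_def sum_distrib_left sum.distrib[symmetric] by (rule sum.cong) (simp_all add: algebra_simps)
    finally show ?thesis .
  qed
  have DQ: "D v * Q v = 0" if v: "v \<in> V" for v
  proof (rule mpoly_eq_0[OF inf])
    fix x
    let ?D = "mpoly_eval (D v) x"
    show "mpoly_eval (D v * Q v) x = 0"
    proof (cases "?D = 0")
      case False
      define y where "y = x(0 := 1 / ?D)"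
      have Dy: "mpoly_eval (D v) y = ?D"
        by (rule mpoly_eval_cong) (use D(2)[OF v] in \<open>auto simp: y_def\<close>)
      have m: "monom_eval (drop0 \<alpha>) y = monom_eval (drop0 \<alpha>) x" for \<alpha>
        unfolding monom_eval_def using drop0_keys[of \<alpha>] by (intro prod.cong) (auto simp: y_def)
      have "mpoly_eval (F v) y = 0"
        using False by (simp add: F_def X0_def mpoly_eval_diff mpoly_eval_mult mpoly_eval_single monom_eval_single Dy) (simp add: y_def)
      moreover have "mpoly_eval (P v) y = 0"
        by (rule van[OF v]) (use False in \<open>simp add: Dy\<close>, simp add: y_def)
      ultimately have "mpoly_eval (Q v) y = 0"
        using arg_cong[OF DP[OF v], of "\<lambda>f. mpoly_eval f y"] by (simp add: mpoly_eval_add mpoly_eval_mult)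
      then have "mpoly_eval (Q v) x = 0"
        by (simp add: Q_def mpoly_eval_sum mpoly_eval_mult mpoly_eval_single mpoly_eval_power m Dy)
      then show ?thesis by (simp add: mpoly_eval_mult)
    qed (simp add: mpoly_eval_mult)
  qed
  define H where "H v = X0 ^ Suc e * D v * R v - P v * G (Suc e) v" for v
  have "H \<in> rel_poly V A (Suc n)"
    unfolding H_def by (intro rel_poly_diff rel_poly_mult rel_poly_power X0 D(1) R P G)
  moreover have "P v = H v * F v" if v: "v \<in> V" for v
  proof -
    have "P v = P v * (X0 * D v) ^ Suc e - P v * ((X0 * D v) ^ Suc e - 1)" by (simp add: algebra_simps)
    also have "P v * (X0 * D v) ^ Suc e = X0 ^ Suc e * D v * (D v ^ e * P v)"
      by (simp add: power_mult_distrib mult_ac)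
    also have "\<dots> = X0 ^ Suc e * (D v * Q v) + X0 ^ Suc e * D v * (F v * R v)"
      unfolding DP[OF v] by (simp only: distrib_left mult.assoc)
    finally show ?thesis unfolding DQ[OF v] FG H_def by (simp add: algebra_simps)
  qed
  ultimately show ?thesis unfolding F_def X0_def by blast
qed

text \<open>By the hypotheses \<open>U\<close> is the subset \<open>x\<^sub>0 D = 1\<close> of the product of \<open>V\<close> with an affine space, and its ring is
  \<open>A[x\<^sub>0, \<dots>, x\<^sub>n] / (x\<^sub>0 D - 1)\<close>. The derivative of this relation by \<open>x\<^sub>0\<close> is \<open>D\<close>, a unit with inverse \<open>x\<^sub>0\<close>.\<close>

lemma standard_smooth_localized:
  fixes V :: "'q set" and A :: "('q => 'k::field) set" and U :: "'p set" and B :: "('p => 'k) set"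
  assumes inf: "infinite (UNIV :: 'k set)" and "fun_alg V A" and B: "fun_alg U B" and p: "p ` U \<subseteq> V"
    and pull: "\<And>a. a \<in> A ==> regf U B (\<lambda>u. a (p u))" and \<xi>: "\<And>i. i \<le> n ==> \<xi> i \<in> B"
    and gen: "B \<subseteq> gen_alg U ({\<lambda>u. a (p u) | a. a \<in> A} \<union> \<xi> ` {..n})"
    and D: "D \<in> rel_poly V A (Suc n)" "\<And>v \<alpha>. v \<in> V ==> \<alpha> \<in> keys (D v) ==> 0 \<notin> keys \<alpha>"
    and inv: "\<And>u. u \<in> U ==> \<xi> 0 u * mpoly_eval (D (p u)) (\<lambda>i. \<xi> i u) = 1"
    and onto: "\<And>v x. v \<in> V ==> x 0 * mpoly_eval (D v) x = 1 ==> \<exists>u\<in>U. p u = v \<and> (\<forall>i\<le>n. \<xi> i u = x i)"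
  shows "standard_smooth V A U B p"
proof -
  interpret A: fun_alg V A by fact
  interpret B: fun_alg U B by fact
  define F where "F i v = single (single 0 1) 1 * D v - 1" for i :: nat and v
  have X0: "(\<lambda>v. single (single 0 1) (1::'k)) \<in> rel_poly V A (Suc n)"
    by (rule A.rel_poly_single[OF A.regf_const]) simp
  have F: "F i \<in> rel_poly V A (Suc n)" for i
    unfolding F_def by (intro A.rel_poly_diff A.rel_poly_mult X0 D(1) A.rel_poly_one)
  have evF: "mpoly_eval (F i (p u)) (\<lambda>i. \<xi> i u) = 0" if "u \<in> U" for u i
    using inv[OF that] by (simp add: F_def mpoly_eval_diff mpoly_eval_mult mpoly_eval_single monom_eval_single)
  have lift: "\<exists>P\<in>rel_poly V A (Suc n). \<forall>u\<in>U. b u = mpoly_eval (P (p u)) (\<lambda>i. \<xi> i u)" if "b \<in> B" for b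
    using subsetD[OF gen that]
  proof (induction rule: gen_alg.induct)
    case (const c)
    show ?case
      by (rule bexI[OF _ A.rel_poly_single[OF A.regf_const[of c], of 0]]) (simp_all add: mpoly_eval_single)
  next
    case (gen f)
    then consider a where "a \<in> A" "f = (\<lambda>u. a (p u))" | i where "i \<le> n" "f = \<xi> i" by auto
    then show ?case
    proof cases
      case 1
      show ?thesis
        by (rule bexI[OF _ A.rel_poly_single[OF A.regf_mem[OF 1(1)], of 0]]) (simp_all add: mpoly_eval_single 1(2))
    next
      case 2
      show ?thesis
        by (rule bexI[OF _ A.rel_poly_single[OF A.regf_const[of 1], of "single i 1"]])
           (use 2 in \<open>simp_all add: mpoly_eval_single monom_eval_single\<close>)
    qed
  next
    case (add f g)
    then obtain P Q where P: "P \<in> rel_poly V A (Suc n)" "\<forall>u\<in>U. f u = mpoly_eval (P (p u)) (\<lambda>i. \<xi> i u)"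
      and Q: "Q \<in> rel_poly V A (Suc n)" "\<forall>u\<in>U. g u = mpoly_eval (Q (p u)) (\<lambda>i. \<xi> i u)" by (elim bexE) (rule that)
    show ?case by (rule bexI[OF _ A.rel_poly_add[OF P(1) Q(1)]]) (simp add: mpoly_eval_add P(2) Q(2))
  next
    case (mult f g)
    then obtain P Q where P: "P \<in> rel_poly V A (Suc n)" "\<forall>u\<in>U. f u = mpoly_eval (P (p u)) (\<lambda>i. \<xi> i u)"
      and Q: "Q \<in> rel_poly V A (Suc n)" "\<forall>u\<in>U. g u = mpoly_eval (Q (p u)) (\<lambda>i. \<xi> i u)" by (elim bexE) (rule that)
    show ?case by (rule bexI[OF _ A.rel_poly_mult[OF P(1) Q(1)]]) (simp add: mpoly_eval_mult P(2) Q(2))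
  qed
  have rel: "(\<forall>u\<in>U. mpoly_eval (P (p u)) (\<lambda>i. \<xi> i u) = 0) \<longleftrightarrow>
      (\<exists>H. (\<forall>i<1. H i \<in> rel_poly V A (Suc n)) \<and> (\<forall>v\<in>V. P v = (\<Sum>i<(1::nat). H i v * F i v)))"
    if P: "P \<in> rel_poly V A (Suc n)" for P
  proof
    assume z: "\<forall>u\<in>U. mpoly_eval (P (p u)) (\<lambda>i. \<xi> i u) = 0"
    from P obtain S where S: "finite S" "\<And>\<alpha>. \<alpha> \<in> S ==> keys \<alpha> \<subseteq> {..<Suc n}" "\<And>v. v \<in> V ==> keys (P v) \<subseteq> S"
      "\<And>\<alpha>. regf V A (\<lambda>v. lookup (P v) \<alpha>)" by (rule rel_polyE) (rule that)
    have "mpoly_eval (P v) x = 0" if v: "v \<in> V" "x 0 * mpoly_eval (D v) x = 1" for v x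
    proof -
      obtain u where u: "u \<in> U" "p u = v" "\<forall>i\<le>n. \<xi> i u = x i" using onto[OF v] by blast
      have "mpoly_eval (P v) x = mpoly_eval (P v) (\<lambda>i. \<xi> i u)"
      proof (rule mpoly_eval_cong)
        fix \<alpha> i assume "\<alpha> \<in> keys (P v)" "i \<in> keys \<alpha>"
        then have "i < Suc n" using S(2,3) v(1) by blast
        then show "x i = \<xi> i u" using u(3) by simp
      qed
      then show ?thesis using z u by auto
    qed
    then have "\<exists>H\<in>rel_poly V A (Suc n). \<forall>v\<in>V. P v = H v * F 0 v"
      unfolding F_def by (intro rabinowitsch_relative[OF inf \<open>fun_alg V A\<close> D(1) D(2) P])
    then obtain H where "H \<in> rel_poly V A (Suc n)" "\<forall>v\<in>V. P v = H v * F 0 v" by (elim bexE) (rule that)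
    then show "\<exists>H. (\<forall>i<1. H i \<in> rel_poly V A (Suc n)) \<and> (\<forall>v\<in>V. P v = (\<Sum>i<(1::nat). H i v * F i v))"
      by (intro exI[of _ "\<lambda>_. H"]) simp
  next
    assume "\<exists>H. (\<forall>i<1. H i \<in> rel_poly V A (Suc n)) \<and> (\<forall>v\<in>V. P v = (\<Sum>i<(1::nat). H i v * F i v))"
    then obtain H where "\<forall>v\<in>V. P v = H (0::nat) v * F 0 v" by auto
    then show "\<forall>u\<in>U. mpoly_eval (P (p u)) (\<lambda>i. \<xi> i u) = 0"
      using p evF by (auto simp: mpoly_eval_mult image_subset_iff)
  qed
  have "det (mat 1 1 (\<lambda>(i, j). mpoly_eval (mpoly_deriv j (F i (p u))) (\<lambda>l. \<xi> l u))) = mpoly_eval (D (p u)) (\<lambda>i. \<xi> i u)"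
    if "u \<in> U" for u
  proof -
    have "p u \<in> V" using that p by blast
    then show ?thesis using mpoly_deriv_var_mult[of "D (p u)" 0] D(2) by (simp add: det_1x1 F_def)
  qed
  then have "\<exists>b\<in>B. \<forall>u\<in>U. b u * det (mat 1 1 (\<lambda>(i, j). mpoly_eval (mpoly_deriv j (F i (p u))) (\<lambda>l. \<xi> l u))) = 1"
    using inv \<xi>[of 0] by (intro bexI[of _ "\<xi> 0"]) simp_all
  moreover have "\<forall>i<Suc n. \<xi> i \<in> B" using \<xi> by simp
  ultimately show ?thesis unfolding standard_smooth_def using F lift rel
    by (intro exI[of _ "Suc n"] exI[of _ "1::nat"] exI[of _ \<xi>] exI[of _ F]) simp
qed

section \<open>Affine varieties\<close>

lemma gen_alg_subsetI:
  assumes "\<And>c. (\<lambda>x\<in>X. c) \<in> S" "\<And>f. f \<in> C ==> restrict f X \<in> S"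
    "\<And>f g. f \<in> gen_alg X C ==> f \<in> S ==> g \<in> gen_alg X C ==> g \<in> S ==> (\<lambda>x\<in>X. f x + g x) \<in> S"
    "\<And>f g. f \<in> gen_alg X C ==> f \<in> S ==> g \<in> gen_alg X C ==> g \<in> S ==> (\<lambda>x\<in>X. f x * g x) \<in> S"
  shows "gen_alg X C \<subseteq> S"
proof
  fix f assume "f \<in> gen_alg X C"
  then show "f \<in> S" by (induction rule: gen_alg.induct) (fact assms)+
qed

context fun_alg
begin

lemma openin_zariski_iff: "openin (zariski X A) U \<longleftrightarrow> (\<exists>S\<subseteq>A. U = {x\<in>X. \<exists>f\<in>S. f x \<noteq> 0})"
  using gen openin_zariski by blast

lemma openin_principal: "regf X A s ==> openin (zariski X A) {x\<in>X. s x \<noteq> 0}"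
  unfolding openin_zariski_iff by (rule exI[of _ "{restrict s X}"]) (auto simp: regf_def)

lemma openin_X: "openin (zariski X A) X"
  using openin_principal[OF regf_const[of 1]] by simp

lemma topspace_zariski: "topspace (zariski X A) = X"
proof
  show "topspace (zariski X A) \<subseteq> X"
    using openin_topspace[of "zariski X A"] unfolding openin_zariski_iff by blast
qed (use openin_X openin_subset in blast)

lemma openin_basis:
  assumes "openin (zariski X A) V" "x \<in> V"
  obtains s where "s \<in> A" "s x \<noteq> 0" "\<And>y. y \<in> X ==> s y \<noteq> 0 ==> y \<in> V"
proof -
  from assms(1) obtain S where S: "S \<subseteq> A" "V = {x\<in>X. \<exists>f\<in>S. f x \<noteq> 0}" unfolding openin_zariski_iff by blast
  with assms(2) obtain s where "s \<in> S" "s x \<noteq> 0" by blast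
  with S show ?thesis by (intro that[of s]) auto
qed

lemma in_closure_of_iff:
  assumes "S \<subseteq> X"
  shows "x \<in> zariski X A closure_of S \<longleftrightarrow> x \<in> X \<and> (\<forall>f\<in>A. (\<forall>y\<in>S. f y = 0) \<longrightarrow> f x = 0)"
proof
  assume x: "x \<in> zariski X A closure_of S"
  have xX: "x \<in> X" using subsetD[OF closure_of_subset_topspace x] topspace_zariski by simp
  have "f x = 0" if "f \<in> A" "\<forall>y\<in>S. f y = 0" for f
  proof (rule ccontr)
    assume "f x \<noteq> 0"
    moreover have "openin (zariski X A) {x\<in>X. f x \<noteq> 0}" by (rule openin_principal[OF regf_mem[OF that(1)]])
    moreover from x have "\<forall>T. x \<in> T \<and> openin (zariski X A) T \<longrightarrow> (\<exists>y. y \<in> S \<and> y \<in> T)"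
      unfolding in_closure_of by (rule conjunct2)
    ultimately obtain y where "y \<in> S" "y \<in> {x\<in>X. f x \<noteq> 0}" using xX by (elim allE[of _ "{x\<in>X. f x \<noteq> 0}"]) auto
    then show False using that(2) by simp
  qed
  with xX show "x \<in> X \<and> (\<forall>f\<in>A. (\<forall>y\<in>S. f y = 0) \<longrightarrow> f x = 0)" by blast
next
  assume x: "x \<in> X \<and> (\<forall>f\<in>A. (\<forall>y\<in>S. f y = 0) \<longrightarrow> f x = 0)"
  show "x \<in> zariski X A closure_of S" unfolding in_closure_of topspace_zariski
  proof (intro conjI allI impI)
    fix T assume T: "x \<in> T \<and> openin (zariski X A) T"
    then have "openin (zariski X A) T" "x \<in> T" by simp_all
    then obtain s where s: "s \<in> A" "s x \<noteq> 0" "\<And>y. y \<in> X ==> s y \<noteq> 0 ==> y \<in> T"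
      by (rule openin_basis) (rule that)
    then obtain y where "y \<in> S" "s y \<noteq> 0" using x by blast
    then show "\<exists>y. y \<in> S \<and> y \<in> T" using s(3) assms by blast
  qed (use x in blast)
qed

lemma regular_on_extensional: "f \<in> regular_on X A U ==> f \<in> extensional U"
  by (simp add: regular_on_def)

lemma regular_on_restrict:
  assumes "f \<in> regular_on X A U" "openin (zariski X A) V" "V \<subseteq> U"
  shows "restrict f V \<in> regular_on X A V"
  unfolding regular_on_def mem_Collect_eq
proof (intro conjI ballI)
  fix x assume x: "x \<in> V"
  then obtain a b W where W: "a \<in> A" "b \<in> A" "openin (zariski X A) W" "x \<in> W" "W \<subseteq> U" "\<forall>y\<in>W. b y \<noteq> 0 \<and> f y = a y / b y"
    using assms(1,3) unfolding regular_on_def by blast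
  show "\<exists>a\<in>A. \<exists>b\<in>A. \<exists>W. openin (zariski X A) W \<and> x \<in> W \<and> W \<subseteq> V \<and> (\<forall>y\<in>W. b y \<noteq> 0 \<and> restrict f V y = a y / b y)"
    by (rule bexI[of _ a], rule bexI[of _ b], rule exI[of _ "W \<inter> V"])
       (use W x assms(2) in auto)
qed simp

lemma regular_on_glue:
  assumes "f \<in> extensional U"
    "\<And>x. x \<in> U ==> \<exists>V. openin (zariski X A) V \<and> x \<in> V \<and> V \<subseteq> U \<and> restrict f V \<in> regular_on X A V"
  shows "f \<in> regular_on X A U"
  unfolding regular_on_def mem_Collect_eq
proof (intro conjI ballI)
  fix x assume x: "x \<in> U"
  from assms(2)[OF x] obtain V where V: "openin (zariski X A) V" "x \<in> V" "V \<subseteq> U" "restrict f V \<in> regular_on X A V" by blast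
  then obtain a b W where W: "a \<in> A" "b \<in> A" "openin (zariski X A) W" "x \<in> W" "W \<subseteq> V" "\<forall>y\<in>W. b y \<noteq> 0 \<and> restrict f V y = a y / b y"
    unfolding regular_on_def by blast
  show "\<exists>a\<in>A. \<exists>b\<in>A. \<exists>W. openin (zariski X A) W \<and> x \<in> W \<and> W \<subseteq> U \<and> (\<forall>y\<in>W. b y \<noteq> 0 \<and> f y = a y / b y)"
    by (rule bexI[of _ a], rule bexI[of _ b], rule exI[of _ W]) (use W V(3) in \<open>auto simp: subset_iff\<close>)
qed (rule assms(1))

lemma mem_regular_on: "A \<subseteq> regular_on X A X"
proof
  fix f assume f: "f \<in> A"
  have "restrict (\<lambda>x. 1) X \<in> A" using regf_const[of 1] by (simp add: regf_def)
  then show "f \<in> regular_on X A X" unfolding regular_on_def mem_Collect_eq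
    using f ext[OF f] openin_X by (intro conjI ballI bexI[of _ f] bexI[of _ "restrict (\<lambda>x. 1) X"] exI[of _ X]) auto
qed

end

lemma affine_variety_fun_alg: "affine_variety X A ==> fun_alg X A"
  unfolding affine_variety_def fun_alg_def by blast

text \<open>A function which is locally a fraction is global: its denominators form an ideal without common
  zeros.\<close>

lemma regular_on_affine:
  fixes X :: "'p set" and A :: "('p => 'k::alg_closed_field) set"
  assumes aff: "affine_variety X A"
  shows "regular_on X A X = A"
proof
  interpret fun_alg X A by (rule affine_variety_fun_alg[OF aff])
  show "A \<subseteq> regular_on X A X" by (rule mem_regular_on)
  show "regular_on X A X \<subseteq> A"
  proof
    fix f assume f: "f \<in> regular_on X A X"
    then have fe: "f \<in> extensional X" by (rule regular_on_extensional)
    define I where "I = {c \<in> A. regf X A (\<lambda>x. c x * f x)}"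
    have "ideal_of X A I" unfolding ideal_of_def
    proof (intro conjI ballI)
      show "I \<subseteq> A" by (auto simp: I_def)
      have "regf X A (\<lambda>x. (\<lambda>x\<in>X. 0) x * f x)" by (rule regf_cong[OF regf_const[of 0]]) simp
      then show "(\<lambda>x\<in>X. 0) \<in> I" using regf_const[of 0] by (simp add: I_def regf_def)
      fix c assume c: "c \<in> I"
      then have c': "c \<in> A" "regf X A (\<lambda>x. c x * f x)" by (auto simp: I_def)
      show "(\<lambda>x\<in>X. c x + d x) \<in> I" if "d \<in> I" for d
      proof -
        have d: "d \<in> A" "regf X A (\<lambda>x. d x * f x)" using that by (auto simp: I_def)
        have "regf X A (\<lambda>x. (\<lambda>x\<in>X. c x + d x) x * f x)"
          by (rule regf_cong[OF regf_add[OF c'(2) d(2)]]) (simp add: algebra_simps)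
        then show ?thesis using regf_add[OF regf_mem[OF c'(1)] regf_mem[OF d(1)]] by (simp add: I_def regf_def)
      qed
      show "(\<lambda>x\<in>X. a x * c x) \<in> I" if "a \<in> A" for a
      proof -
        have "regf X A (\<lambda>x. (\<lambda>x\<in>X. a x * c x) x * f x)"
          by (rule regf_cong[OF regf_mult[OF regf_mem[OF that] c'(2)]]) (simp add: algebra_simps)
        then show ?thesis using regf_mult[OF regf_mem[OF that] regf_mem[OF c'(1)]] by (simp add: I_def regf_def)
      qed
    qed
    moreover have "\<exists>c\<in>I. c x \<noteq> 0" if x: "x \<in> X" for x
    proof -
      obtain a b V where V: "a \<in> A" "b \<in> A" "openin (zariski X A) V" "x \<in> V" "\<forall>y\<in>V. b y \<noteq> 0 \<and> f y = a y / b y"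
        using f x unfolding regular_on_def by blast
      obtain s where s: "s \<in> A" "s x \<noteq> 0" "\<And>y. y \<in> X ==> s y \<noteq> 0 ==> y \<in> V"
        by (rule openin_basis[OF V(3,4)]) (rule that)
      have "regf X A (\<lambda>y. (\<lambda>y\<in>X. s y * b y) y * f y)"
        by (rule regf_cong[OF regf_mult[OF regf_mem[OF s(1)] regf_mem[OF V(1)]]]) (use s(3) V(5) in fastforce)
      then have "(\<lambda>y\<in>X. s y * b y) \<in> I"
        using regf_mult[OF regf_mem[OF s(1)] regf_mem[OF V(2)]] by (simp add: I_def regf_def)
      moreover have "(\<lambda>y\<in>X. s y * b y) x \<noteq> 0" using x s(2) V(4,5) by simp
      ultimately show ?thesis by blast
    qed
    ultimately have "(\<lambda>x\<in>X. 1) \<in> I" using nullstellensatz[OF aff] by blast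
    then have "regf X A (\<lambda>x. (\<lambda>x\<in>X. 1) x * f x)" by (simp add: I_def)
    then have "regf X A f" by (rule regf_cong) simp
    then show "f \<in> A" by (rule mem_regf[OF fe])
  qed
qed

lemma affine_open_whole:
  fixes X :: "'p set" and A :: "('p => 'k::alg_closed_field) set"
  assumes aff: "affine_variety X A"
  shows "affine_open (affine_kspace X A) X"
proof -
  interpret fun_alg X A by (rule affine_variety_fun_alg[OF aff])
  show ?thesis using aff openin_X by (simp add: affine_open_def affine_kspace_def regular_on_affine[OF aff])
qed

text \<open>Separatedness holds because some function \<open>f\<close> takes distinct values at two given points, while
  \<open>f \<otimes> 1 - 1 \<otimes> f\<close> vanishes on the diagonal.\<close>

lemma variety_affine:
  fixes X :: "'p set" and A :: "('p => 'k::alg_closed_field) set"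
  assumes aff: "affine_variety X A"
  shows "variety (affine_kspace X A)"
proof -
  interpret fun_alg X A by (rule affine_variety_fun_alg[OF aff])
  have sel: "ktop (affine_kspace X A) = zariski X A" "kreg (affine_kspace X A) = regular_on X A"
    by (simp_all add: affine_kspace_def)
  have sep: "\<exists>f\<in>A. f x \<noteq> f y" if xy: "x \<in> X" "y \<in> X" "x \<noteq> y" for x y
  proof (rule ccontr)
    assume n: "\<not> (\<exists>f\<in>A. f x \<noteq> f y)"
    have "\<exists>!z. z \<in> X \<and> (\<forall>f\<in>A. f x = f z)"
      using aff[unfolded affine_variety_def, THEN conjunct2, rule_format, of "\<lambda>f. f x"] xy(1) by simp
    then show False using xy n by blast
  qed
  show ?thesis unfolding variety_def sel topspace_zariski
  proof (intro conjI allI impI ballI)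
    fix W V f assume "openin (zariski X A) W \<and> openin (zariski X A) V \<and> V \<subseteq> W \<and> f \<in> regular_on X A W"
    then show "restrict f V \<in> regular_on X A V" using regular_on_restrict by blast
  next
    fix W f assume a: "openin (zariski X A) W \<and> f \<in> extensional W \<and>
       (\<forall>x\<in>W. \<exists>V. openin (zariski X A) V \<and> x \<in> V \<and> V \<subseteq> W \<and> restrict f V \<in> regular_on X A V)"
    show "f \<in> regular_on X A W" by (rule regular_on_glue) (use a in blast)+
  next
    show "\<exists>\<U>. finite \<U> \<and> (\<forall>U\<in>\<U>. affine_open (affine_kspace X A) U) \<and> \<Union>\<U> = X"
      by (rule exI[of _ "{X}"]) (use affine_open_whole[OF aff] in simp)
  next
    fix x y assume xy: "x \<in> X" "y \<in> X" "x \<noteq> y"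
    then obtain c where c: "c \<in> A" "c x \<noteq> c y" using sep by blast
    define o1 :: "'p => 'k" where "o1 = (\<lambda>x\<in>X. 1)"
    define cm where "cm = (\<lambda>x\<in>X. - c x)"
    have o1: "o1 \<in> A" using regf_const[of 1] by (simp add: regf_def o1_def)
    have cm: "cm \<in> A" using regf_uminus[OF regf_mem[OF c(1)]] by (simp add: regf_def cm_def)
    define f where "f i = (if i = 0 then c else o1)" for i :: nat
    define g where "g i = (if i = 0 then o1 else cm)" for i :: nat
    have val: "(\<Sum>i<2. f i v * g i w) = c v - c w" if "v \<in> X" "w \<in> X" for v w
      using that by (simp add: f_def g_def o1_def cm_def numeral_2_eq_2)
    have "\<forall>i<2. f i \<in> regular_on X A X \<and> g i \<in> regular_on X A X"
      using c(1) o1 cm by (simp add: f_def g_def regular_on_affine[OF aff])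
    then show "\<exists>U V. openin (zariski X A) U \<and> openin (zariski X A) V \<and> x \<in> U \<and> y \<in> V \<and>
         (\<exists>(n::nat) f g. (\<forall>i<n. f i \<in> regular_on X A U \<and> g i \<in> regular_on X A V) \<and>
            (\<Sum>i<n. f i x * g i y) \<noteq> 0 \<and> (\<forall>w\<in>U \<inter> V. (\<Sum>i<n. f i w * g i w) = 0))"
      using openin_X xy c(2) val
      by (intro exI[of _ X] exI[of _ "2::nat"] exI[of _ f] exI[of _ g] conjI) auto
  qed (use regular_on_extensional in blast)
qed

lemma morphism_affine:
  fixes X :: "'p set" and A :: "('p => 'k::field) set" and Y :: "'q set" and B :: "('q => 'k) set"
  assumes A: "fun_alg X A" and B: "fun_alg Y B" and p: "p ` X \<subseteq> Y" and pull: "\<And>b. b \<in> B ==> regf X A (\<lambda>x. b (p x))"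
  shows "morphism (affine_kspace X A) (affine_kspace Y B) p"
proof -
  interpret A: fun_alg X A by fact
  interpret B: fun_alg Y B by fact
  have pre: "openin (zariski X A) {x \<in> X. p x \<in> V}" if V: "openin (zariski Y B) V" for V
  proof -
    obtain S where S: "S \<subseteq> B" "V = {y\<in>Y. \<exists>f\<in>S. f y \<noteq> 0}" using V B.openin_zariski_iff by blast
    have "{x \<in> X. p x \<in> V} = {x\<in>X. \<exists>f\<in>(\<lambda>f. \<lambda>x\<in>X. f (p x)) ` S. f x \<noteq> 0}" using S(2) p by auto
    moreover have "(\<lambda>f. \<lambda>x\<in>X. f (p x)) ` S \<subseteq> A" using pull S(1) by (auto simp: regf_def)
    ultimately show ?thesis unfolding A.openin_zariski_iff by blast
  qed
  show ?thesis unfolding morphism_def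
  proof (intro conjI allI impI)
    show "continuous_map (ktop (affine_kspace X A)) (ktop (affine_kspace Y B)) p"
      using p pre by (auto simp: continuous_map_def affine_kspace_def A.topspace_zariski B.topspace_zariski)
    fix V g assume "openin (ktop (affine_kspace Y B)) V \<and> g \<in> kreg (affine_kspace Y B) V"
    then have V: "openin (zariski Y B) V" and g: "g \<in> regular_on Y B V" by (auto simp: affine_kspace_def)
    let ?W = "{x \<in> X. p x \<in> V}"
    have "(\<lambda>x\<in>?W. g (p x)) \<in> regular_on X A ?W" unfolding regular_on_def mem_Collect_eq
    proof (intro conjI ballI)
      fix x assume x: "x \<in> ?W"
      then obtain a b T where T: "a \<in> B" "b \<in> B" "openin (zariski Y B) T" "p x \<in> T" "T \<subseteq> V" "\<forall>y\<in>T. b y \<noteq> 0 \<and> g y = a y / b y"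
        using g unfolding regular_on_def by blast
      show "\<exists>a\<in>A. \<exists>b\<in>A. \<exists>V. openin (zariski X A) V \<and> x \<in> V \<and> V \<subseteq> ?W \<and> (\<forall>y\<in>V. b y \<noteq> 0 \<and> (\<lambda>x\<in>?W. g (p x)) y = a y / b y)"
        by (rule bexI[of _ "\<lambda>x\<in>X. a (p x)"], rule bexI[of _ "\<lambda>x\<in>X. b (p x)"], rule exI[of _ "{x \<in> X. p x \<in> T}"])
           (use T pre[OF T(3)] x pull in \<open>auto simp: regf_def\<close>)
    qed simp
    then show "(\<lambda>x\<in>{x \<in> topspace (ktop (affine_kspace X A)). p x \<in> V}. g (p x)) \<in> kreg (affine_kspace X A) {x \<in> topspace (ktop (affine_kspace X A)). p x \<in> V}"
      by (simp add: affine_kspace_def A.topspace_zariski)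
  qed
qed

lemma smooth_morphism_affine:
  fixes X :: "'p set" and A :: "('p => 'k::alg_closed_field) set" and Y :: "'q set" and B :: "('q => 'k) set"
  assumes X: "affine_variety X A" and Y: "affine_variety Y B"
    and p: "p ` X \<subseteq> Y" and pull: "\<And>b. b \<in> B ==> regf X A (\<lambda>x. b (p x))" and "standard_smooth Y B X A p"
  shows "smooth_morphism (affine_kspace X A) (affine_kspace Y B) p"
proof -
  note A = affine_variety_fun_alg[OF X] and B = affine_variety_fun_alg[OF Y]
  have "kreg (affine_kspace X A) X = A" "kreg (affine_kspace Y B) Y = B" "topspace (ktop (affine_kspace X A)) = X"
    using regular_on_affine[OF X] regular_on_affine[OF Y] fun_alg.topspace_zariski[OF A] by (simp_all add: affine_kspace_def)
  then show ?thesis unfolding smooth_morphism_def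
    using morphism_affine[OF A B p pull] affine_open_whole[OF X] affine_open_whole[OF Y] p assms(5)
    by (intro conjI ballI exI[of _ X] exI[of _ Y]) simp_all
qed

section \<open>Constructions of affine varieties\<close>

definition character :: "'p set => ('p => 'k::field) set => (('p => 'k) => 'k) => bool" where
  "character X A \<chi> \<longleftrightarrow> (\<forall>c. \<chi> (\<lambda>x\<in>X. c) = c) \<and>
      (\<forall>f\<in>A. \<forall>g\<in>A. \<chi> (\<lambda>x\<in>X. f x + g x) = \<chi> f + \<chi> g \<and> \<chi> (\<lambda>x\<in>X. f x * g x) = \<chi> f * \<chi> g)"

lemma affine_variety_iff: "affine_variety X A \<longleftrightarrow> (\<exists>C. finite C \<and> A = gen_alg X C) \<and>
    (\<forall>\<chi>. character X A \<chi> \<longrightarrow> (\<exists>!x. x \<in> X \<and> (\<forall>f\<in>A. \<chi> f = f x)))"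
  unfolding affine_variety_def character_def by simp

lemma affine_variety_pointD:
  assumes "affine_variety X A" "character X A \<chi>"
  obtains x where "x \<in> X" "\<And>f. f \<in> A ==> \<chi> f = f x"
  using assms unfolding affine_variety_iff by metis

lemma affine_variety_eqI:
  assumes "affine_variety X A" "x \<in> X" "y \<in> X" "\<And>f. f \<in> A ==> f x = f y"
  shows "x = y"
proof -
  have "character X A (\<lambda>f. f x)" using assms(2) by (simp add: character_def)
  then show ?thesis using assms unfolding affine_variety_iff by blast
qed

lemma character_regf:
  assumes "character X A \<chi>" "fun_alg X A"
  shows "\<chi> (\<lambda>x\<in>X. c) = c"
    "regf X A f ==> regf X A g ==> \<chi> (\<lambda>x\<in>X. f x + g x) = \<chi> (restrict f X) + \<chi> (restrict g X)"
    "regf X A f ==> regf X A g ==> \<chi> (\<lambda>x\<in>X. f x * g x) = \<chi> (restrict f X) * \<chi> (restrict g X)"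
proof -
  show "\<chi> (\<lambda>x\<in>X. c) = c" using assms by (simp add: character_def)
  assume fg: "regf X A f" "regf X A g"
  have "(\<lambda>x\<in>X. f x + g x) = (\<lambda>x\<in>X. restrict f X x + restrict g X x)" "(\<lambda>x\<in>X. f x * g x) = (\<lambda>x\<in>X. restrict f X x * restrict g X x)"
    by (auto simp: fun_eq_iff)
  then show "\<chi> (\<lambda>x\<in>X. f x + g x) = \<chi> (restrict f X) + \<chi> (restrict g X)" "\<chi> (\<lambda>x\<in>X. f x * g x) = \<chi> (restrict f X) * \<chi> (restrict g X)"
    using assms(1) fg by (simp_all only: character_def regf_def)
qed

text \<open>A character is determined by its values on generators.\<close>

lemma affine_variety_gen_algI:
  assumes "finite C" "\<And>x y. x \<in> X ==> y \<in> X ==> (\<And>c. c \<in> C ==> c x = c y) ==> x = y"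
    "\<And>\<chi>. character X (gen_alg X C) \<chi> ==> \<exists>x\<in>X. \<forall>c\<in>C. \<chi> (restrict c X) = c x"
  shows "affine_variety X (gen_alg X C)"
  unfolding affine_variety_iff
proof (intro conjI allI impI)
  show "\<exists>D. finite D \<and> gen_alg X C = gen_alg X D" using assms(1) by blast
  fix \<chi> assume \<chi>: "character X (gen_alg X C) \<chi>"
  then obtain x where x: "x \<in> X" "\<forall>c\<in>C. \<chi> (restrict c X) = c x" using assms(3) by blast
  have "gen_alg X C \<subseteq> {f. \<chi> f = f x}"
    by (rule gen_alg_subsetI) (use \<chi> x in \<open>auto simp: character_def\<close>)
  then have v: "\<chi> f = f x" if "f \<in> gen_alg X C" for f using that by blast
  show "\<exists>!x. x \<in> X \<and> (\<forall>f\<in>gen_alg X C. \<chi> f = f x)"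
  proof (rule ex1I[of _ x])
    fix y assume y: "y \<in> X \<and> (\<forall>f\<in>gen_alg X C. \<chi> f = f y)"
    have "c y = c x" if "c \<in> C" for c
      using y v[OF gen_alg.gen[OF that]] gen_alg.gen[OF that, of X] x(1) by auto
    then show "y = x" using assms(2) y x(1) by blast
  qed (use x v in blast)
qed

lemma restrict_gen_alg:
  assumes "Y \<subseteq> X"
  shows "(\<lambda>f. restrict f Y) ` gen_alg X C = gen_alg Y C"
proof
  note r = restrict_restrict Int_absorb1[OF assms]
  have "gen_alg X C \<subseteq> {f. restrict f Y \<in> gen_alg Y C}"
  proof (rule gen_alg_subsetI; unfold mem_Collect_eq)
    fix f assume "f \<in> C"
    then show "restrict (restrict f X) Y \<in> gen_alg Y C"
      unfolding r by (rule gen_alg.gen)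
  next
    fix c :: 'b show "restrict (\<lambda>x\<in>X. c) Y \<in> gen_alg Y C" unfolding r by (rule gen_alg.const)
  next
    fix f g assume *: "restrict f Y \<in> gen_alg Y C" "restrict g Y \<in> gen_alg Y C"
    have "restrict (\<lambda>x\<in>X. f x + g x) Y = (\<lambda>x\<in>Y. restrict f Y x + restrict g Y x)"
      "restrict (\<lambda>x\<in>X. f x * g x) Y = (\<lambda>x\<in>Y. restrict f Y x * restrict g Y x)"
      unfolding r by (auto simp: fun_eq_iff)
    then show "restrict (\<lambda>x\<in>X. f x + g x) Y \<in> gen_alg Y C" "restrict (\<lambda>x\<in>X. f x * g x) Y \<in> gen_alg Y C"
      using gen_alg.add[OF *] gen_alg.mult[OF *] by (simp_all only:)
  qed
  then show "(\<lambda>f. restrict f Y) ` gen_alg X C \<subseteq> gen_alg Y C" by blast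
  show "gen_alg Y C \<subseteq> (\<lambda>f. restrict f Y) ` gen_alg X C"
  proof (rule gen_alg_subsetI)
    fix c show "(\<lambda>x\<in>Y. c) \<in> (\<lambda>f. restrict f Y) ` gen_alg X C"
      by (rule image_eqI[OF _ gen_alg.const[of c]]) (simp only: r)
  next
    fix f assume "f \<in> C"
    then show "restrict f Y \<in> (\<lambda>f. restrict f Y) ` gen_alg X C"
      by (intro image_eqI[OF _ gen_alg.gen[of f]]) (simp_all only: r)
  next
    fix f g assume "f \<in> (\<lambda>f. restrict f Y) ` gen_alg X C" "g \<in> (\<lambda>f. restrict f Y) ` gen_alg X C"
    then obtain f' g' where 1: "f' \<in> gen_alg X C" "f = restrict f' Y" "g' \<in> gen_alg X C" "g = restrict g' Y" by blast
    have 2: "(\<lambda>x\<in>Y. f x + g x) = restrict (\<lambda>x\<in>X. f' x + g' x) Y" "(\<lambda>x\<in>Y. f x * g x) = restrict (\<lambda>x\<in>X. f' x * g' x) Y"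
      unfolding r 1(2,4) by (auto simp: fun_eq_iff)
    show "(\<lambda>x\<in>Y. f x + g x) \<in> (\<lambda>f. restrict f Y) ` gen_alg X C"
      unfolding 2(1) by (rule imageI[OF gen_alg.add[OF 1(1,3)]])
    show "(\<lambda>x\<in>Y. f x * g x) \<in> (\<lambda>f. restrict f Y) ` gen_alg X C"
      unfolding 2(2) by (rule imageI[OF gen_alg.mult[OF 1(1,3)]])
  qed
qed

lemma fun_alg_restrict:
  assumes "fun_alg X A" "Y \<subseteq> X"
  shows "fun_alg Y ((\<lambda>f. restrict f Y) ` A)"
proof -
  obtain C where "A = gen_alg X C" using fun_alg.gen[OF assms(1)] by blast
  then show ?thesis using restrict_gen_alg[OF assms(2), of C] by (simp add: fun_alg_gen_alg)
qed

lemma regf_restrict: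
  assumes "regf X A f" "Y \<subseteq> X"
  shows "regf Y ((\<lambda>f. restrict f Y) ` A) f"
proof -
  have "restrict f Y = restrict (restrict f X) Y" by (simp only: restrict_restrict Int_absorb1[OF assms(2)])
  then show ?thesis using assms(1) unfolding regf_def by blast
qed

text \<open>A character of the restricted algebra comes from one of \<open>A\<close>, hence from a point of \<open>X\<close>; the functions in \<open>S\<close> vanish
  at this point since their restrictions to \<open>Y\<close> are zero.\<close>

lemma affine_variety_closed:
  fixes A :: "('p => 'k::field) set"
  assumes X: "affine_variety X A" and Y: "Y = {x\<in>X. \<forall>f\<in>S. f x = 0}" and S: "S \<subseteq> A"
  shows "affine_variety Y ((\<lambda>f. restrict f Y) ` A)"
proof -
  have YX: "Y \<subseteq> X" using Y by blast
  obtain C where C: "finite C" "A = gen_alg X C" using X unfolding affine_variety_iff by blast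
  have A: "fun_alg X A" unfolding C by blast
  have e: "(\<lambda>f. restrict f Y) ` A = gen_alg Y C" unfolding C by (rule restrict_gen_alg[OF YX])
  show ?thesis unfolding e
  proof (rule affine_variety_gen_algI[OF C(1)])
    fix x y assume xy: "x \<in> Y" "y \<in> Y" "\<And>c. c \<in> C ==> c x = c y"
    have "A \<subseteq> {f. f x = f y}" unfolding C(2)
      by (rule gen_alg_subsetI) (use xy YX in \<open>auto simp: subset_iff\<close>)
    then have "f x = f y" if "f \<in> A" for f using that by blast
    then show "x = y" using affine_variety_eqI[OF X] xy YX by blast
  next
    fix \<chi> assume \<chi>: "character Y (gen_alg Y C) \<chi>"
    define \<chi>' where "\<chi>' f = \<chi> (restrict f Y)" for f
    have "character X A \<chi>'" unfolding character_def
    proof (intro conjI allI ballI)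
      fix c :: 'k
      have "restrict (\<lambda>x\<in>X. c) Y = (\<lambda>x\<in>Y. c)" by (simp only: restrict_restrict Int_absorb1[OF YX])
      then show "\<chi>' (\<lambda>x\<in>X. c) = c" using \<chi> by (simp add: \<chi>'_def character_def)
    next
      fix f g assume fg: "f \<in> A" "g \<in> A"
      have "restrict f Y \<in> gen_alg Y C" "restrict g Y \<in> gen_alg Y C" using e fg by blast+
      moreover have "restrict (\<lambda>x\<in>X. f x + g x) Y = (\<lambda>x\<in>Y. restrict f Y x + restrict g Y x)"
        "restrict (\<lambda>x\<in>X. f x * g x) Y = (\<lambda>x\<in>Y. restrict f Y x * restrict g Y x)" using YX by (auto simp: fun_eq_iff)
      ultimately show "\<chi>' (\<lambda>x\<in>X. f x + g x) = \<chi>' f + \<chi>' g" "\<chi>' (\<lambda>x\<in>X. f x * g x) = \<chi>' f * \<chi>' g"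
        using \<chi> unfolding \<chi>'_def character_def by (simp_all only:)
    qed
    then obtain x where x: "x \<in> X" "\<And>f. f \<in> A ==> \<chi>' f = f x" using affine_variety_pointD[OF X] by blast
    have "f x = 0" if f: "f \<in> S" for f
    proof -
      have "restrict f Y = (\<lambda>x\<in>Y. 0)" using f Y by auto
      then have "\<chi>' f = 0" using \<chi> by (simp add: \<chi>'_def character_def)
      then show ?thesis using x(2) f S by auto
    qed
    then have xY: "x \<in> Y" using x(1) Y by blast
    have "\<chi> (restrict c Y) = c x" if "c \<in> C" for c
    proof -
      have "restrict (restrict c X) Y = restrict c Y" by (simp only: restrict_restrict Int_absorb1[OF YX])
      then show ?thesis using x(2)[of "restrict c X"] gen_alg.gen[OF that, of X] x(1) by (simp add: \<chi>'_def C)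
    qed
    then show "\<exists>x\<in>Y. \<forall>c\<in>C. \<chi> (restrict c Y) = c x" using xY by blast
  qed
qed

text \<open>The principal open subset \<open>D \<noteq> 0\<close> of an affine variety, embedded in a space of sequences by
  \<open>1 / D\<close> and a finite list of generators of the coordinate ring.\<close>

lemma affine_variety_localization:
  fixes X :: "'p set" and A :: "('p => 'k::field) set"
  assumes X: "affine_variety X A" and D: "D \<in> A"
  obtains Z :: "(nat => 'k) set" and B q y where "affine_variety Z B" "q ` Z = {x\<in>X. D x \<noteq> 0}" "inj_on q Z"
    "\<And>f. f \<in> A ==> regf Z B (\<lambda>z. f (q z))" "y \<in> B" "\<And>z. z \<in> Z ==> y z * D (q z) = 1"
    "B \<subseteq> gen_alg Z (insert y {\<lambda>z. f (q z) | f. f \<in> A})"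
proof -
  obtain C where C: "finite C" "A = gen_alg X C" using X unfolding affine_variety_iff by blast
  have A: "fun_alg X A" unfolding C by blast
  obtain cs where cs: "set cs = C" using finite_list[OF C(1)] by blast
  define N where "N = length cs"
  define E where "E u = (\<lambda>i. if i = 0 then inverse (D u) else if i \<le> N then (cs ! (i - 1)) u else 0)" for u
  define Z where "Z = E ` {x\<in>X. D x \<noteq> 0}"
  have C_eq: "c x = c x'" if "c \<in> C" "\<And>i. 0 < i ==> i \<le> N ==> E x i = E x' i" for c x x'
  proof -
    obtain j where j: "j < N" "c = cs ! j" using \<open>c \<in> C\<close> unfolding cs[symmetric] in_set_conv_nth N_def by auto
    then show ?thesis using that(2)[of "Suc j"] by (simp add: E_def)
  qed
  have eq: "f x = f x'" if "f \<in> A" "x \<in> X" "x' \<in> X" "\<And>i. 0 < i ==> i \<le> N ==> E x i = E x' i" for f x x'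
  proof -
    have "A \<subseteq> {f. f x = f x'}" unfolding C(2)
    proof (rule gen_alg_subsetI; unfold mem_Collect_eq)
      fix c assume "c \<in> C"
      from C_eq[OF this that(4)] show "restrict c X x = restrict c X x'" using that(2,3) by simp
    qed (use that(2,3) in simp_all)
    then show ?thesis using that(1) by blast
  qed
  have inj: "x = x'" if "x \<in> X" "x' \<in> X" "\<And>i. 0 < i ==> i \<le> N ==> E x i = E x' i" for x x'
    by (rule affine_variety_eqI[OF X that(1,2)]) (rule eq[OF _ that])
  have injE: "inj_on E {x\<in>X. D x \<noteq> 0}"
    by (rule inj_onI, rule inj) simp_all
  define q where "q = inv_into {x\<in>X. D x \<noteq> 0} E"
  have qE: "q (E x) = x" if "x \<in> X" "D x \<noteq> 0" for x
    unfolding q_def by (rule inv_into_f_f[OF injE]) (use that in simp)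
  have Eq: "E (q z) = z" "q z \<in> X" "D (q z) \<noteq> 0" if "z \<in> Z" for z
    using that qE by (auto simp: Z_def)
  define co where "co i = (\<lambda>z :: nat => 'k. z i)" for i :: nat
  define CZ where "CZ = co ` {..N}"
  define B where "B = gen_alg Z CZ"
  interpret B: fun_alg Z B unfolding B_def by blast
  have coB: "regf Z B (co i)" if "i \<le> N" for i
    unfolding B_def by (rule regf_gen) (use that in \<open>auto simp: CZ_def\<close>)
  have pull: "regf Z B (\<lambda>z. f (q z))" if "f \<in> A" for f
  proof (rule regf_pullback[where p = q and f = f and Y = X and C = C, OF _ B.fun_alg_axioms])
    show "regf X (gen_alg X C) f" using fun_alg.regf_mem[OF A that] unfolding C .
    show "q ` Z \<subseteq> X" using Eq(2) by blast
    fix c assume "c \<in> C"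
    then obtain j where j: "j < N" "c = cs ! j" unfolding cs[symmetric] in_set_conv_nth N_def by auto
    show "regf Z B (\<lambda>z. c (q z))"
    proof (rule regf_cong[OF coB[of "Suc j"]])
      fix z assume "z \<in> Z"
      then have "E (q z) (Suc j) = z (Suc j)" by (simp add: Eq)
      then show "co (Suc j) z = c (q z)" using j by (simp add: E_def co_def)
    qed (use j in simp)
  qed
  have co0: "co 0 z * D (q z) = 1" if "z \<in> Z" for z
  proof -
    have "z 0 = E (q z) 0" using Eq(1)[OF that] by simp
    then show ?thesis using Eq(3)[OF that] by (simp add: E_def co_def)
  qed
  have aff: "affine_variety Z B" unfolding B_def
  proof (rule affine_variety_gen_algI)
    show "finite CZ" by (simp add: CZ_def)
    fix z z' assume z: "z \<in> Z" "z' \<in> Z" "\<And>c. c \<in> CZ ==> c z = c z'"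
    have "z i = z' i" for i
    proof (cases "i \<le> N")
      case True
      then show ?thesis using z(3)[of "co i"] by (auto simp: CZ_def co_def)
    next
      case False
      then have "E (q z) i = 0" "E (q z') i = 0" by (auto simp: E_def)
      then show ?thesis using Eq(1) z(1,2) by simp
    qed
    then show "z = z'" by blast
  next
    fix \<chi> assume "character Z (gen_alg Z CZ) \<chi>"
    then have \<chi>: "character Z B \<chi>" by (simp add: B_def)
    note ch = character_regf[OF \<chi> B.fun_alg_axioms]
    define \<chi>' where "\<chi>' f = \<chi> (\<lambda>z\<in>Z. f (q z))" for f
    have res: "(\<lambda>z\<in>Z. (\<lambda>x\<in>X. f x) (q z)) = (\<lambda>z\<in>Z. f (q z))" for f
      using Eq(2) by (auto simp: fun_eq_iff)
    have "character X A \<chi>'" unfolding character_def \<chi>'_def res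
      using ch(2,3)[OF pull pull] ch(1) by simp
    then obtain x where x: "x \<in> X" "\<And>f. f \<in> A ==> \<chi>' f = f x" using affine_variety_pointD[OF X] by blast
    have "\<chi> (\<lambda>z\<in>Z. co 0 z * D (q z)) = \<chi> (restrict (co 0) Z) * \<chi> (\<lambda>z\<in>Z. D (q z))"
      by (rule ch(3)[OF coB pull[OF D]]) simp
    moreover have "(\<lambda>z\<in>Z. co 0 z * D (q z)) = (\<lambda>z\<in>Z. 1)" using co0 by (auto simp: fun_eq_iff)
    ultimately have 1: "\<chi> (restrict (co 0) Z) * D x = 1"
      using ch(1)[of 1] x(2)[OF D] by (simp add: \<chi>'_def)
    then have Dx: "D x \<noteq> 0" by auto
    have "\<chi> (restrict c Z) = c (E x)" if "c \<in> CZ" for c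
    proof -
      obtain i where i: "i \<le> N" "c = co i" using \<open>c \<in> CZ\<close> by (auto simp: CZ_def)
      show ?thesis
      proof (cases "i = 0")
        case True
        then show ?thesis using 1 Dx i by (simp add: E_def co_def field_simps)
      next
        case False
        let ?c = "cs ! (i - 1)"
        have c: "?c \<in> C" using cs i False by (auto simp: N_def)
        have "(\<lambda>z\<in>Z. restrict ?c X (q z)) = restrict c Z"
        proof
          fix z show "(\<lambda>z\<in>Z. restrict ?c X (q z)) z = restrict c Z z"
          proof (cases "z \<in> Z")
            case True
            then have "E (q z) i = z i" by (simp add: Eq)
            then show ?thesis using True False i Eq(2) by (simp add: E_def co_def)
          qed simp
        qed
        then have "\<chi> (restrict c Z) = \<chi>' (restrict ?c X)" by (simp only: \<chi>'_def)
        also have "\<dots> = ?c x" using x(2)[of "restrict ?c X"] gen_alg.gen[OF c, of X] x(1) unfolding C(2) by simp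
        finally show ?thesis using False i by (simp add: E_def co_def)
      qed
    qed
    moreover have "E x \<in> Z" using x(1) Dx by (simp add: Z_def)
    ultimately show "\<exists>z\<in>Z. \<forall>c\<in>CZ. \<chi> (restrict c Z) = c z" by blast
  qed
  have img: "q ` Z = {x\<in>X. D x \<noteq> 0}"
  proof
    show "q ` Z \<subseteq> {x\<in>X. D x \<noteq> 0}" using Eq(2,3) by blast
    show "{x\<in>X. D x \<noteq> 0} \<subseteq> q ` Z"
    proof
      fix x assume x: "x \<in> {x\<in>X. D x \<noteq> 0}"
      then have "q (E x) = x" "E x \<in> Z" using qE by (auto simp: Z_def)
      then show "x \<in> q ` Z" by (metis imageI)
    qed
  qed
  have inj_q: "inj_on q Z" by (rule inj_on_inverseI) (rule Eq(1))
  have mem: "restrict (co 0) Z \<in> B" using coB[of 0] by (simp add: regf_def)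
  have inv: "restrict (co 0) Z z * D (q z) = 1" if "z \<in> Z" for z using co0[OF that] that by simp
  have sub: "B \<subseteq> gen_alg Z (insert (restrict (co 0) Z) {\<lambda>z. f (q z) | f. f \<in> A})" (is "_ \<subseteq> gen_alg Z ?G")
  proof
    fix b assume "b \<in> B"
    then have "regf Z (gen_alg Z CZ) b" using B.regf_mem by (simp add: B_def)
    then have "regf Z (gen_alg Z ?G) (\<lambda>z. b (id z))"
    proof (rule regf_pullback[where p = id and f = b and Y = Z and C = CZ, OF _ fun_alg_gen_alg])
      fix c assume "c \<in> CZ"
      then obtain i where i: "i \<le> N" "c = co i" by (auto simp: CZ_def)
      show "regf Z (gen_alg Z ?G) (\<lambda>z. c (id z))"
      proof (cases "i = 0")
        case True
        show ?thesis by (rule regf_cong[OF regf_gen[of "restrict (co 0) Z"]]) (use True i in auto)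
      next
        case False
        let ?c = "cs ! (i - 1)"
        have c: "?c \<in> C" using cs i False by (auto simp: N_def)
        have "(\<lambda>z. restrict ?c X (q z)) \<in> ?G" using gen_alg.gen[OF c, of X] unfolding C(2) by blast
        then show ?thesis
        proof (rule regf_cong[OF regf_gen])
          fix z assume z: "z \<in> Z"
          then have "E (q z) i = z i" by (simp add: Eq)
          then show "restrict ?c X (q z) = c (id z)" using z False i Eq(2) by (simp add: E_def co_def)
        qed
      qed
    qed auto
    then show "b \<in> gen_alg Z ?G"
      using fun_alg.mem_regf[OF fun_alg_gen_alg B.ext[OF \<open>b \<in> B\<close>]] by simp
  qed
  show ?thesis by (rule that[OF aff img inj_q pull mem inv sub])
qed

section \<open>Algebraic group actions\<close>

text \<open>The last assumption says that the action is a morphism of varieties: the translates of a regular function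
  are combinations of finitely many functions, with coefficients that are regular on the group.\<close>

locale algebraic_action =
  fixes X :: "('h, 'p, 'k::field) gvar"
  assumes group: "group (grp X)"
    and grp_alg: "fun_alg (carrier (grp X)) (grp_fun X)"
    and affine: "affine_variety (pts X) (pts_fun X)"
    and act_closed: "g \<in> carrier (grp X) ==> x \<in> pts X ==> gact X g x \<in> pts X"
    and act_one: "x \<in> pts X ==> gact X \<one>\<^bsub>grp X\<^esub> x = x"
    and act_mult: "g \<in> carrier (grp X) ==> h \<in> carrier (grp X) ==> x \<in> pts X ==>
      gact X (g \<otimes>\<^bsub>grp X\<^esub> h) x = gact X g (gact X h x)"
    and rational: "f \<in> pts_fun X ==> \<exists>(n::nat) c w. (\<forall>i<n. c i \<in> grp_fun X \<and> w i \<in> pts_fun X) \<and>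
      (\<forall>g\<in>carrier (grp X). \<forall>x\<in>pts X. f (gact X (inv\<^bsub>grp X\<^esub> g) x) = (\<Sum>i<n. c i g * w i x))"
begin

sublocale pts: fun_alg "pts X" "pts_fun X"
  by (rule affine_variety_fun_alg[OF affine])

sublocale grp: fun_alg "carrier (grp X)" "grp_fun X"
  by (rule grp_alg)

sublocale G: group "grp X"
  by (rule group)

lemma act_inv: "g \<in> carrier (grp X) ==> x \<in> pts X ==> gact X (inv\<^bsub>grp X\<^esub> g) (gact X g x) = x"
  "g \<in> carrier (grp X) ==> x \<in> pts X ==> gact X g (gact X (inv\<^bsub>grp X\<^esub> g) x) = x"
  by (simp_all add: act_mult[symmetric] act_one)

lemma regf_translate:
  assumes "f \<in> pts_fun X" "g \<in> carrier (grp X)"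
  shows "regf (pts X) (pts_fun X) (\<lambda>x. f (gact X g x))"
proof -
  obtain n :: nat and c w where cw: "\<forall>i<n. c i \<in> grp_fun X \<and> w i \<in> pts_fun X"
    "\<forall>g\<in>carrier (grp X). \<forall>x\<in>pts X. f (gact X (inv\<^bsub>grp X\<^esub> g) x) = (\<Sum>i<n. c i g * w i x)"
    using rational[OF assms(1)] by (elim exE conjE) (rule that)
  have "regf (pts X) (pts_fun X) (\<lambda>x. \<Sum>i<n. c i (inv\<^bsub>grp X\<^esub> g) * w i x)"
    by (intro pts.regf_sum pts.regf_mult pts.regf_const pts.regf_mem) (use cw(1) in simp)
  then show ?thesis
  proof (rule regf_cong)
    fix x assume "x \<in> pts X"
    then show "(\<Sum>i<n. c i (inv\<^bsub>grp X\<^esub> g) * w i x) = f (gact X g x)"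
      using cw(2)[rule_format, of "inv\<^bsub>grp X\<^esub> g" x] assms(2) by simp
  qed
qed

definition stable :: "'p set => bool" where
  "stable S \<longleftrightarrow> S \<subseteq> pts X \<and> (\<forall>g\<in>carrier (grp X). \<forall>x\<in>S. gact X g x \<in> S)"

definition orb :: "'p => 'p set" where
  "orb x = (\<lambda>g. gact X g x) ` carrier (grp X)"

lemma orbit_eq_orb: "Group_Action.orbit (grp X) (gact X) x = orb x"
  by (auto simp: orbit_def orb_def)

lemma orb_refl: "x \<in> pts X ==> x \<in> orb x"
  unfolding orb_def by (rule image_eqI[of _ _ "\<one>\<^bsub>grp X\<^esub>"]) (simp_all add: act_one)

lemma orb_sub: "x \<in> pts X ==> orb x \<subseteq> pts X"
  by (auto simp: orb_def act_closed)

lemma stable_orb: "x \<in> pts X ==> stable (orb x)"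
  unfolding stable_def
proof (intro conjI ballI)
  fix g y assume x: "x \<in> pts X" and g: "g \<in> carrier (grp X)" and "y \<in> orb x"
  then obtain h where h: "h \<in> carrier (grp X)" "y = gact X h x" by (auto simp: orb_def)
  then have "gact X g y = gact X (g \<otimes>\<^bsub>grp X\<^esub> h) x" using g x by (simp add: act_mult)
  then show "gact X g y \<in> orb x" unfolding orb_def using g h
    by (intro image_eqI[of _ _ "g \<otimes>\<^bsub>grp X\<^esub> h"]) auto
qed (rule orb_sub)

abbreviation closure :: "'p set => 'p set" where
  "closure S \<equiv> gvar_top X closure_of S"

lemma in_closure_iff:
  "S \<subseteq> pts X ==> x \<in> closure S \<longleftrightarrow> x \<in> pts X \<and> (\<forall>f\<in>pts_fun X. (\<forall>y\<in>S. f y = 0) \<longrightarrow> f x = 0)"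
  unfolding gvar_top_def by (rule pts.in_closure_of_iff)

lemma closure_sub: "closure S \<subseteq> pts X"
  using closure_of_subset_topspace[of "gvar_top X" S] by (simp add: gvar_top_def pts.topspace_zariski)

lemma sub_closure: "S \<subseteq> pts X ==> S \<subseteq> closure S"
  by (intro closure_of_subset) (simp add: gvar_top_def pts.topspace_zariski)

lemma closure_zero_set:
  "S \<subseteq> pts X ==> closure S = {x\<in>pts X. \<forall>f\<in>{f\<in>pts_fun X. \<forall>y\<in>S. f y = 0}. f x = 0}"
  by (auto simp: in_closure_iff)

lemma stable_closure:
  assumes "stable S"
  shows "stable (closure S)"
  unfolding stable_def
proof (intro conjI ballI)
  have S: "S \<subseteq> pts X" using assms by (simp add: stable_def)
  fix g x assume g: "g \<in> carrier (grp X)" and x: "x \<in> closure S"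
  have xX: "x \<in> pts X" using x closure_sub by blast
  show "gact X g x \<in> closure S" unfolding in_closure_iff[OF S]
  proof (intro conjI ballI impI)
    show "gact X g x \<in> pts X" by (rule act_closed[OF g xX])
    fix f assume f: "f \<in> pts_fun X" "\<forall>y\<in>S. f y = 0"
    let ?f = "\<lambda>x\<in>pts X. f (gact X g x)"
    have "?f \<in> pts_fun X" using regf_translate[OF f(1) g] by (simp add: regf_def)
    moreover have "\<forall>y\<in>S. ?f y = 0" using f(2) assms g S by (auto simp: stable_def)
    ultimately have "?f x = 0" using x unfolding in_closure_iff[OF S] by blast
    then show "f (gact X g x) = 0" using xX by simp
  qed
qed (rule closure_sub)

lemma closure_least:
  assumes "S \<subseteq> closure T" "T \<subseteq> pts X"
  shows "closure S \<subseteq> closure T"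
  using closure_of_mono[OF assms(1), of "gvar_top X"] by simp

lemma orbit_closuresE:
  assumes "C \<in> orbit_closures X"
  obtains x where "x \<in> pts X" "C = closure (orb x)"
  using assms by (auto simp: orbit_closures_def orbit_eq_orb)

lemma orbit_closuresI: "x \<in> pts X ==> closure (orb x) \<in> orbit_closures X"
  by (auto simp: orbit_closures_def orbit_eq_orb)

lemma orbit_closure_stable: "C \<in> orbit_closures X ==> stable C"
  by (elim orbit_closuresE) (simp add: stable_closure stable_orb)

lemma orbit_closure_closed: "C \<in> orbit_closures X ==> closure C = C"
  by (elim orbit_closuresE) simp

lemma affine_closed:
  assumes "C \<subseteq> pts X" "closure C = C"
  shows "affine_variety C (sub_fun X C)"
proof -
  have "C = {x\<in>pts X. \<forall>f\<in>{f\<in>pts_fun X. \<forall>y\<in>C. f y = 0}. f x = 0}"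
    using closure_zero_set[OF assms(1)] assms(2) by simp
  from affine_variety_closed[OF affine this] show ?thesis by (simp add: sub_fun_def)
qed

lemma cring_coord: "cring (coord_ring X)"
proof (rule cringI)
  have sub: "(\<lambda>x\<in>pts X. f x + g x) \<in> pts_fun X" "(\<lambda>x\<in>pts X. f x * g x) \<in> pts_fun X" "(\<lambda>x\<in>pts X. - f x) \<in> pts_fun X"
    if "f \<in> pts_fun X" "g \<in> pts_fun X" for f g
    using pts.regf_add[OF pts.regf_mem[OF that(1)] pts.regf_mem[OF that(2)]] pts.regf_uminus[OF pts.regf_mem[OF that(1)]]
      pts.regf_mult[OF pts.regf_mem[OF that(1)] pts.regf_mem[OF that(2)]] by (simp_all add: regf_def)
  have c: "(\<lambda>x\<in>pts X. c) \<in> pts_fun X" for c using pts.regf_const[of c] by (simp add: regf_def)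
  have e: "f x = undefined" if "f \<in> pts_fun X" "x \<notin> pts X" for f x using pts.ext[OF that(1)] that(2) by (simp add: extensional_def)
  show "abelian_group (coord_ring X)"
  proof (rule abelian_groupI)
    fix f assume f: "f \<in> carrier (coord_ring X)"
    then show "\<zero>\<^bsub>coord_ring X\<^esub> \<oplus>\<^bsub>coord_ring X\<^esub> f = f"
      using e[of f] by (auto simp: fun_ring_def fun_eq_iff)
    have "(\<lambda>x\<in>pts X. - f x) \<oplus>\<^bsub>coord_ring X\<^esub> f = \<zero>\<^bsub>coord_ring X\<^esub>" by (auto simp: fun_ring_def fun_eq_iff)
    moreover have "(\<lambda>x\<in>pts X. - f x) \<in> carrier (coord_ring X)" using f sub by (simp add: fun_ring_def)
    ultimately show "\<exists>g\<in>carrier (coord_ring X). g \<oplus>\<^bsub>coord_ring X\<^esub> f = \<zero>\<^bsub>coord_ring X\<^esub>" by blast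
  qed (auto simp: fun_ring_def sub c fun_eq_iff)
  show "comm_monoid (coord_ring X)"
  proof (rule comm_monoidI)
    fix f assume f: "f \<in> carrier (coord_ring X)"
    then show "\<one>\<^bsub>coord_ring X\<^esub> \<otimes>\<^bsub>coord_ring X\<^esub> f = f"
      using e[of f] by (auto simp: fun_ring_def fun_eq_iff)
  qed (auto simp: fun_ring_def sub c fun_eq_iff)
qed (auto simp: fun_ring_def fun_eq_iff algebra_simps)

lemma sub_funE:
  assumes "f \<in> sub_fun X Z"
  obtains f' where "f' \<in> pts_fun X" "f = restrict f' Z"
  using assms by (auto simp: sub_fun_def)

lemma structure_sheaf_sel [simp]:
  "carrier (structure_sheaf X Z) = sub_fun X Z"
  "zero (structure_sheaf X Z) = (\<lambda>x\<in>Z. 0)"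
  "add (structure_sheaf X Z) = (\<lambda>f g. \<lambda>x\<in>Z. f x + g x)"
  "module.smult (structure_sheaf X Z) = (\<lambda>a f. \<lambda>x\<in>Z. a x * f x)"
  "mact (structure_sheaf X Z) = (\<lambda>h f. \<lambda>x\<in>Z. f (gact X (inv\<^bsub>grp X\<^esub> h) x))"
  by (simp_all add: structure_sheaf_def)

lemma coord_ring_sel [simp]:
  "carrier (coord_ring X) = pts_fun X"
  "monoid.mult (coord_ring X) = (\<lambda>f g. \<lambda>x\<in>pts X. f x * g x)"
  "one (coord_ring X) = (\<lambda>x\<in>pts X. 1)"
  "zero (coord_ring X) = (\<lambda>x\<in>pts X. 0)"
  "add (coord_ring X) = (\<lambda>f g. \<lambda>x\<in>pts X. f x + g x)"
  by (simp_all add: fun_ring_def)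

context
  fixes Z :: "'p set"
  assumes Z: "stable Z"
begin

private lemma ZX: "Z \<subseteq> pts X"
  using Z by (simp add: stable_def)

lemma fun_alg_sub: "fun_alg Z (sub_fun X Z)"
  unfolding sub_fun_def by (rule fun_alg_restrict[OF pts.fun_alg_axioms ZX])

private lemma sub: "(\<lambda>x\<in>Z. f x + g x) \<in> sub_fun X Z" "(\<lambda>x\<in>Z. f x * g x) \<in> sub_fun X Z" "(\<lambda>x\<in>Z. - f x) \<in> sub_fun X Z"
  if "f \<in> sub_fun X Z" "g \<in> sub_fun X Z"
proof -
  interpret Z: fun_alg Z "sub_fun X Z" by (rule fun_alg_sub)
  show "(\<lambda>x\<in>Z. f x + g x) \<in> sub_fun X Z" "(\<lambda>x\<in>Z. f x * g x) \<in> sub_fun X Z" "(\<lambda>x\<in>Z. - f x) \<in> sub_fun X Z"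
    using Z.regf_add[OF Z.regf_mem[OF that(1)] Z.regf_mem[OF that(2)]] Z.regf_uminus[OF Z.regf_mem[OF that(1)]]
      Z.regf_mult[OF Z.regf_mem[OF that(1)] Z.regf_mem[OF that(2)]] by (simp_all add: regf_def)
qed

private lemma sub_const: "(\<lambda>x\<in>Z. c) \<in> sub_fun X Z"
  using fun_alg.regf_const[OF fun_alg_sub, of c] by (simp add: regf_def)

private lemma sub_smult: "a \<in> pts_fun X ==> f \<in> sub_fun X Z ==> (\<lambda>x\<in>Z. a x * f x) \<in> sub_fun X Z"
proof -
  assume a: "a \<in> pts_fun X" and f: "f \<in> sub_fun X Z"
  have "restrict a Z \<in> sub_fun X Z" using a by (auto simp: sub_fun_def)
  from sub(2)[OF this f] show "(\<lambda>x\<in>Z. a x * f x) \<in> sub_fun X Z" by (simp cong: restrict_cong)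
qed

private lemma sub_ext: "f \<in> sub_fun X Z ==> x \<notin> Z ==> f x = undefined"
  by (auto simp: sub_fun_def)

private lemma act_Z: "h \<in> carrier (grp X) ==> x \<in> Z ==> gact X h x \<in> Z"
  using Z by (simp add: stable_def)

lemma abelian_group_structure_sheaf: "abelian_group (structure_sheaf X Z)"
proof (rule abelian_groupI)
  fix f assume f: "f \<in> carrier (structure_sheaf X Z)"
  then show "\<zero>\<^bsub>structure_sheaf X Z\<^esub> \<oplus>\<^bsub>structure_sheaf X Z\<^esub> f = f"
    using sub_ext[of f] by (auto simp: fun_eq_iff)
  show "\<exists>g\<in>carrier (structure_sheaf X Z). g \<oplus>\<^bsub>structure_sheaf X Z\<^esub> f = \<zero>\<^bsub>structure_sheaf X Z\<^esub>"
    by (rule bexI[of _ "\<lambda>x\<in>Z. - f x"]) (use f sub in \<open>auto simp: fun_eq_iff\<close>)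
qed (auto simp: sub sub_const fun_eq_iff)

lemma finsum_structure_sheaf:
  assumes "\<And>i. i < n ==> F i \<in> sub_fun X Z"
  shows "finsum (structure_sheaf X Z) F {..<n::nat} = (\<lambda>x\<in>Z. \<Sum>i<n. F i x)"
  using assms
proof (induction n)
  case 0
  interpret M: abelian_group "structure_sheaf X Z" by (rule abelian_group_structure_sheaf)
  show ?case by simp
next
  case (Suc n)
  interpret M: abelian_group "structure_sheaf X Z" by (rule abelian_group_structure_sheaf)
  have "finsum (structure_sheaf X Z) F (insert n {..<n}) = F n \<oplus>\<^bsub>structure_sheaf X Z\<^esub> finsum (structure_sheaf X Z) F {..<n}"
    by (rule M.finsum_insert) (use Suc.prems in auto)
  also have "\<dots> = (\<lambda>x\<in>Z. \<Sum>i<Suc n. F i x)" using Suc by (auto simp: fun_eq_iff)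
  finally show ?case by (simp only: lessThan_Suc)
qed

text \<open>The module is generated by the constant function \<open>1\<close>, and the coefficients needed for rationality are those of
  the functions on \<open>X\<close>.\<close>

lemma coherent_structure_sheaf: "coherent_eqmod X (structure_sheaf X Z)"
proof -
  interpret M: abelian_group "structure_sheaf X Z" by (rule abelian_group_structure_sheaf)
  have mod: "module (coord_ring X) (structure_sheaf X Z)"
  proof (rule moduleI[OF cring_coord abelian_group_structure_sheaf])
    fix f assume f: "f \<in> carrier (structure_sheaf X Z)"
    then show "\<one>\<^bsub>coord_ring X\<^esub> \<odot>\<^bsub>structure_sheaf X Z\<^esub> f = f"
      using sub_ext[of f] ZX by (auto simp: fun_eq_iff)
  qed (use ZX sub_smult in \<open>auto simp: fun_eq_iff algebra_simps subset_iff\<close>)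
  have gen: "\<exists>r. r \<in> {\<lambda>x\<in>Z. 1} \<rightarrow> pts_fun X \<and>
      m = finsum (structure_sheaf X Z) (\<lambda>s. r s \<odot>\<^bsub>structure_sheaf X Z\<^esub> s) {\<lambda>x\<in>Z. 1}" if m: "m \<in> sub_fun X Z" for m
  proof -
    obtain f where f: "f \<in> pts_fun X" "m = restrict f Z" by (rule sub_funE[OF m])
    have "finsum (structure_sheaf X Z) (\<lambda>s. f \<odot>\<^bsub>structure_sheaf X Z\<^esub> s) {\<lambda>x\<in>Z. 1} = f \<odot>\<^bsub>structure_sheaf X Z\<^esub> (\<lambda>x\<in>Z. 1) \<oplus>\<^bsub>structure_sheaf X Z\<^esub> finsum (structure_sheaf X Z) (\<lambda>s. f \<odot>\<^bsub>structure_sheaf X Z\<^esub> s) {}"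
      by (rule M.finsum_insert) (use sub_smult[OF f(1) sub_const[of 1]] in simp_all)
    also have "\<dots> = m" using f by (auto simp: fun_eq_iff)
    finally show ?thesis using f(1) by (intro exI[of _ "\<lambda>_. f"]) auto
  qed
  have rat: "\<exists>(n::nat) c w. (\<forall>i<n. c i \<in> grp_fun X \<and> w i \<in> sub_fun X Z) \<and>
       (\<forall>h\<in>carrier (grp X). (\<lambda>x\<in>Z. m (gact X (inv\<^bsub>grp X\<^esub> h) x)) =
          finsum (structure_sheaf X Z) (\<lambda>i. (\<lambda>x\<in>pts X. c i h) \<odot>\<^bsub>structure_sheaf X Z\<^esub> w i) {..<n})" if m: "m \<in> sub_fun X Z" for m
  proof -
    obtain f where f: "f \<in> pts_fun X" "m = restrict f Z" by (rule sub_funE[OF m])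
    obtain n :: nat and c w where cw: "\<forall>i<n. c i \<in> grp_fun X \<and> w i \<in> pts_fun X"
      "\<forall>g\<in>carrier (grp X). \<forall>x\<in>pts X. f (gact X (inv\<^bsub>grp X\<^esub> g) x) = (\<Sum>i<n. c i g * w i x)"
      using rational[OF f(1)] by (elim exE conjE) (rule that)
    have w: "restrict (w i) Z \<in> sub_fun X Z" if "i < n" for i using cw(1) that by (auto simp: sub_fun_def)
    have c: "(\<lambda>x\<in>pts X. c) \<in> pts_fun X" for c using pts.regf_const[of c] by (simp add: regf_def)
    have "(\<lambda>x\<in>Z. m (gact X (inv\<^bsub>grp X\<^esub> h) x)) =
          finsum (structure_sheaf X Z) (\<lambda>i. (\<lambda>x\<in>pts X. c i h) \<odot>\<^bsub>structure_sheaf X Z\<^esub> restrict (w i) Z) {..<n}"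
      if h: "h \<in> carrier (grp X)" for h
    proof -
      have "finsum (structure_sheaf X Z) (\<lambda>i. (\<lambda>x\<in>pts X. c i h) \<odot>\<^bsub>structure_sheaf X Z\<^esub> restrict (w i) Z) {..<n} =
          (\<lambda>x\<in>Z. \<Sum>i<n. ((\<lambda>x\<in>pts X. c i h) \<odot>\<^bsub>structure_sheaf X Z\<^esub> restrict (w i) Z) x)"
        by (rule finsum_structure_sheaf) (use sub_smult[OF c w] in simp)
      also have "\<dots> = (\<lambda>x\<in>Z. m (gact X (inv\<^bsub>grp X\<^esub> h) x))"
        using cw(2) h ZX act_Z[of "inv\<^bsub>grp X\<^esub> h"] by (auto simp: fun_eq_iff f(2) subset_iff)
      finally show ?thesis by simp
    qed
    then show ?thesis using cw(1) w by (intro exI[of _ n] exI[of _ c] exI[of _ "\<lambda>i. restrict (w i) Z"]) auto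
  qed
  have closed: "(\<lambda>x\<in>Z. m (gact X h x)) \<in> sub_fun X Z" if m: "m \<in> sub_fun X Z" and h: "h \<in> carrier (grp X)" for m h
  proof -
    obtain f where f: "f \<in> pts_fun X" "m = restrict f Z" by (rule sub_funE[OF m])
    have "restrict (\<lambda>x\<in>pts X. f (gact X h x)) Z \<in> sub_fun X Z"
      using regf_translate[OF f(1) h] unfolding sub_fun_def regf_def by (rule imageI)
    also have "restrict (\<lambda>x\<in>pts X. f (gact X h x)) Z = (\<lambda>x\<in>Z. m (gact X h x))"
      using ZX act_Z[OF h] f(2) by (auto simp: fun_eq_iff)
    finally show ?thesis .
  qed
  show ?thesis unfolding coherent_eqmod_def structure_sheaf_sel
  proof (intro conjI ballI)
    show "\<exists>S. finite S \<and> S \<subseteq> sub_fun X Z \<and> (\<forall>m\<in>sub_fun X Z. \<exists>r. r \<in> S \<rightarrow> pts_fun X \<and>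
        m = finsum (structure_sheaf X Z) (\<lambda>s. \<lambda>x\<in>Z. r s x * s x) S)"
      using gen sub_const by (intro exI[of _ "{\<lambda>x\<in>Z. 1}"]) simp
    show "\<exists>(n::nat) c w. (\<forall>i<n. c i \<in> grp_fun X \<and> w i \<in> sub_fun X Z) \<and>
       (\<forall>h\<in>carrier (grp X). (\<lambda>x\<in>Z. m (gact X (inv\<^bsub>grp X\<^esub> h) x)) =
          finsum (structure_sheaf X Z) (\<lambda>i. \<lambda>x\<in>Z. (\<lambda>x\<in>pts X. c i h) x * w i x) {..<n})" if "m \<in> sub_fun X Z" for m
      using rat[OF that] by simp
    fix m assume m: "m \<in> sub_fun X Z"
    show "(\<lambda>x\<in>Z. m (gact X (inv\<^bsub>grp X\<^esub> \<one>\<^bsub>grp X\<^esub>) x)) = m"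
      using sub_ext[OF m] ZX by (auto simp: fun_eq_iff act_one subset_iff)
    fix h assume h: "h \<in> carrier (grp X)"
    show "(\<lambda>x\<in>Z. m (gact X (inv\<^bsub>grp X\<^esub> h) x)) \<in> sub_fun X Z" by (rule closed[OF m]) (use h in simp)
    show "(\<lambda>x\<in>Z. m (gact X (inv\<^bsub>grp X\<^esub> (g \<otimes>\<^bsub>grp X\<^esub> h)) x)) = (\<lambda>x\<in>Z. (\<lambda>x\<in>Z. m (gact X (inv\<^bsub>grp X\<^esub> h) x)) (gact X (inv\<^bsub>grp X\<^esub> g) x))"
      if g: "g \<in> carrier (grp X)" for g
      using g h ZX act_Z[of "inv\<^bsub>grp X\<^esub> g"] by (auto simp: fun_eq_iff G.inv_mult_group act_mult subset_iff)
    show "(\<lambda>x\<in>Z. (\<lambda>x\<in>Z. m x + m' x) (gact X (inv\<^bsub>grp X\<^esub> h) x)) =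
        (\<lambda>x\<in>Z. (\<lambda>x\<in>Z. m (gact X (inv\<^bsub>grp X\<^esub> h) x)) x + (\<lambda>x\<in>Z. m' (gact X (inv\<^bsub>grp X\<^esub> h) x)) x)" for m'
      using act_Z[of "inv\<^bsub>grp X\<^esub> h"] h by (auto simp: fun_eq_iff)
    show "(\<lambda>x\<in>Z. (\<lambda>x\<in>Z. a x * m x) (gact X (inv\<^bsub>grp X\<^esub> h) x)) =
        (\<lambda>x\<in>Z. (\<lambda>x\<in>pts X. a (gact X (inv\<^bsub>grp X\<^esub> h) x)) x * (\<lambda>x\<in>Z. m (gact X (inv\<^bsub>grp X\<^esub> h) x)) x)" for a
      using act_Z[of "inv\<^bsub>grp X\<^esub> h"] h ZX by (auto simp: fun_eq_iff)
  qed (rule mod)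
qed

end

end

section \<open>Linear combinations in equivariant modules\<close>

text \<open>Sums over lists, which unlike \<^const>\<open>finsum\<close> may have repeated terms.\<close>

definition msum :: "('a, 'b) ring_scheme => 'a list => 'a" where
  "msum M xs = foldr (add M) xs (zero M)"

context abelian_group
begin

lemma msum_Nil [simp]: "msum G [] = \<zero>"
  by (simp add: msum_def)

lemma msum_Cons [simp]: "msum G (x # xs) = x \<oplus> msum G xs"
  by (simp add: msum_def)

lemma msum_closed: "set xs \<subseteq> carrier G ==> msum G xs \<in> carrier G"
  by (induction xs) auto

lemma finsum_eq_msum: "distinct xs ==> F \<in> set xs \<rightarrow> carrier G ==> finsum G F (set xs) = msum G (map F xs)"
  by (induction xs) (auto simp: finsum_insert Pi_iff)

lemma finsum_lessThan_msum:
  assumes "\<And>i. i < n ==> F i \<in> carrier G"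
  shows "finsum G F {..<n::nat} = msum G (map F [0..<n])"
  using finsum_eq_msum[of "[0..<n]" F] assms by (auto simp: Pi_iff atLeast0LessThan)

end

locale eqmodule = algebraic_action X for X :: "('h, 'p, 'k::field) gvar" +
  fixes M :: "('p => 'k, 'm, 'h) eqmod" (structure)
  assumes coh: "coherent_eqmod X M"
begin

sublocale M: module "coord_ring X" M
  using coh by (simp add: coherent_eqmod_def)

abbreviation reg :: "('p => 'k) => bool" where
  "reg \<equiv> regf (pts X) (pts_fun X)"

text \<open>The coordinate ring consists of extensional functions; restricting the scalar here makes it possible to
  write scalars as plain \<open>\<lambda>\<close>-terms.\<close>

definition sm :: "('p => 'k) => 'm => 'm" where
  "sm a m = restrict a (pts X) \<odot>\<^bsub>M\<^esub> m"

lemma sm_closed [simp]: "reg a ==> m \<in> carrier M ==> sm a m \<in> carrier M"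
  unfolding sm_def by (rule M.smult_closed) (simp_all add: regf_def)

lemma sm_cong: "(\<And>x. x \<in> pts X ==> a x = b x) ==> sm a m = sm b m"
  unfolding sm_def by (metis restrict_ext)

lemma sm_add_l:
  assumes "reg a" "reg b" "m \<in> carrier M"
  shows "sm (\<lambda>x. a x + b x) m = sm a m \<oplus> sm b m"
proof -
  have "(restrict a (pts X) \<oplus>\<^bsub>coord_ring X\<^esub> restrict b (pts X)) = (\<lambda>x\<in>pts X. a x + b x)"
    by (auto simp: fun_eq_iff)
  then show ?thesis using M.smult_l_distr[of "restrict a (pts X)" "restrict b (pts X)" m] assms
    by (simp only: sm_def regf_def coord_ring_sel(1))
qed

lemma sm_mult:
  assumes "reg a" "reg b" "m \<in> carrier M"
  shows "sm (\<lambda>x. a x * b x) m = sm a (sm b m)"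
proof -
  have "(restrict a (pts X) \<otimes>\<^bsub>coord_ring X\<^esub> restrict b (pts X)) = (\<lambda>x\<in>pts X. a x * b x)"
    by (auto simp: fun_eq_iff)
  then show ?thesis using M.smult_assoc1[of "restrict a (pts X)" "restrict b (pts X)" m] assms
    by (simp only: sm_def regf_def coord_ring_sel(1))
qed

lemma sm_add_r: "reg a ==> m \<in> carrier M ==> n \<in> carrier M ==> sm a (m \<oplus> n) = sm a m \<oplus> sm a n"
  unfolding sm_def by (rule M.smult_r_distr) (simp_all add: regf_def)

lemma sm_one: "m \<in> carrier M ==> sm (\<lambda>x. 1) m = m"
  using M.smult_one[of m] by (simp only: sm_def coord_ring_sel)

lemma sm_zero: "m \<in> carrier M ==> sm (\<lambda>x. 0) m = \<zero>"
  using M.smult_l_null[of m] by (simp only: sm_def coord_ring_sel)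

lemma sm_zero_r: "reg a ==> sm a \<zero> = \<zero>"
  unfolding sm_def by (rule M.smult_r_null) (simp add: regf_def)

lemma sm_neg:
  assumes "m \<in> carrier M"
  shows "sm (\<lambda>x. - 1) m = \<ominus> m"
proof -
  have "sm (\<lambda>x. - 1) m \<oplus> m = sm (\<lambda>x. -1 + 1) m"
    using sm_add_l[OF pts.regf_const pts.regf_const assms, of "-1" 1] by (simp only: sm_one[OF assms])
  also have "\<dots> = \<zero>" using sm_zero[OF assms] by simp
  finally show ?thesis using M.minus_equality[of "sm (\<lambda>x. - 1) m" m] assms pts.regf_const by simp
qed

lemma smult_eq_sm: "a \<in> pts_fun X ==> a \<odot>\<^bsub>M\<^esub> m = sm a m"
  using extensional_restrict[OF pts.ext[of a]] by (simp add: sm_def)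

lemma act_carrier: "h \<in> carrier (grp X) ==> m \<in> carrier M ==> mact M h m \<in> carrier M"
  and act_1: "m \<in> carrier M ==> mact M \<one>\<^bsub>grp X\<^esub> m = m"
  and act_comp: "g \<in> carrier (grp X) ==> h \<in> carrier (grp X) ==> m \<in> carrier M ==>
      mact M (g \<otimes>\<^bsub>grp X\<^esub> h) m = mact M g (mact M h m)"
  and act_add: "h \<in> carrier (grp X) ==> m \<in> carrier M ==> m' \<in> carrier M ==>
      mact M h (m \<oplus> m') = mact M h m \<oplus> mact M h m'"
  using coh unfolding coherent_eqmod_def by blast+

lemma act_zero:
  assumes "h \<in> carrier (grp X)"
  shows "mact M h \<zero> = \<zero>"
proof -
  have "mact M h \<zero> \<oplus> mact M h \<zero> = mact M h \<zero>"
    using act_add[OF assms M.zero_closed M.zero_closed] by simp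
  then show ?thesis using act_carrier[OF assms M.zero_closed] by (metis M.add.r_cancel_one)
qed

lemma act_sm:
  assumes "h \<in> carrier (grp X)" "m \<in> carrier M" "reg a"
  shows "mact M h (sm a m) = sm (\<lambda>x. a (gact X (inv\<^bsub>grp X\<^esub> h) x)) (mact M h m)"
proof -
  have "mact M h (restrict a (pts X) \<odot>\<^bsub>M\<^esub> m) =
          (\<lambda>x\<in>pts X. restrict a (pts X) (gact X (inv\<^bsub>grp X\<^esub> h) x)) \<odot>\<^bsub>M\<^esub> mact M h m"
    using coh assms unfolding coherent_eqmod_def regf_def by blast
  also have "(\<lambda>x\<in>pts X. restrict a (pts X) (gact X (inv\<^bsub>grp X\<^esub> h) x)) = (\<lambda>x\<in>pts X. a (gact X (inv\<^bsub>grp X\<^esub> h) x))"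
    using act_closed[of "inv\<^bsub>grp X\<^esub> h"] assms(1) by (auto simp: fun_eq_iff)
  finally show ?thesis by (simp only: sm_def)
qed

text \<open>\<open>lc f [(c\<^sub>1, w\<^sub>1), \<dots>]\<close> is \<open>f c\<^sub>1 \<cdot> w\<^sub>1 + \<dots>\<close>; the pairs will be matrix coefficients and vectors, and \<open>f\<close>
  turns functions on the group into functions on the space. The combination is meaningful if \<open>ok f L\<close> holds.\<close>

definition lc :: "('c => 'p => 'k) => ('c \<times> 'm) list => 'm" where
  "lc f L = msum M (map (\<lambda>(c, w). sm (f c) w) L)"

definition ok :: "('c => 'p => 'k) => ('c \<times> 'm) list => bool" where
  "ok f L \<longleftrightarrow> (\<forall>(c, w)\<in>set L. reg (f c) \<and> w \<in> carrier M)"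

lemma ok_simps [simp]: "ok f []" "ok f ((c, w) # L) \<longleftrightarrow> reg (f c) \<and> w \<in> carrier M \<and> ok f L"
    "ok f (L @ L') \<longleftrightarrow> ok f L \<and> ok f L'"
  by (auto simp: ok_def)

lemma lc_simps [simp]: "lc f [] = \<zero>" "lc f ((c, w) # L) = sm (f c) w \<oplus> lc f L"
  by (simp_all add: lc_def)

lemma lc_closed [simp]: "ok f L ==> lc f L \<in> carrier M"
  by (induction L) auto

lemma lc_append: "ok f L ==> ok f L' ==> lc f (L @ L') = lc f L \<oplus> lc f L'"
  by (induction L) (auto simp: M.a_assoc)

lemma ok_add: "ok f L ==> ok g L ==> ok (\<lambda>c x. f c x + g c x) L"
  by (auto simp: ok_def intro: pts.regf_add)

lemma ok_mult: "ok f L ==> reg a ==> ok (\<lambda>c x. a x * f c x) L"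
  by (auto simp: ok_def intro: pts.regf_mult)

lemma lc_add: "ok f L ==> ok g L ==> lc (\<lambda>c x. f c x + g c x) L = lc f L \<oplus> lc g L"
proof (induction L)
  case (Cons p L)
  then show ?case by (cases p) (simp add: sm_add_l M.a_ac)
qed simp

lemma lc_mult: "ok f L ==> reg a ==> lc (\<lambda>c x. a x * f c x) L = sm a (lc f L)"
proof (induction L)
  case (Cons p L)
  then show ?case by (cases p) (simp add: sm_mult sm_add_r)
qed (simp add: sm_zero_r)

lemma lc_cong: "(\<And>c w x. (c, w) \<in> set L ==> x \<in> pts X ==> f c x = g c x) ==> lc f L = lc g L"
proof (induction L)
  case (Cons p L)
  have "lc f L = lc g L" using Cons by (metis list.set_intros(2))
  moreover have "sm (f (fst p)) (snd p) = sm (g (fst p)) (snd p)"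
    using Cons.prems[of "fst p" "snd p"] by (intro sm_cong) simp
  ultimately show ?case by (cases p) simp
qed simp

lemma ok_const: "(\<And>c w. (c, w) \<in> set L ==> w \<in> carrier M) ==> ok (\<lambda>c x. e c) L"
  by (auto simp: ok_def intro: pts.regf_const)

text \<open>A linear relation between vectors whose coefficients are functions on the group may be
  specialized along any partially defined map \<open>s\<close> from the space to the group, once the denominators
  are cleared by \<open>u\<close>: over a field the relation is a combination of relations with constant coefficients.\<close>

lemma substitute_in_relation:
  fixes u :: "'p => 'k" and s :: "'p => 'h" and L :: "(('h => 'k) \<times> 'm) list"
  assumes s: "\<And>x. x \<in> pts X ==> u x \<noteq> 0 ==> s x \<in> carrier (grp X)"
    and L: "ok (\<lambda>c x. u x * c (s x)) L"
    and rel: "\<And>h. h \<in> carrier (grp X) ==> lc (\<lambda>c x. c h) L = \<zero>"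
  shows "lc (\<lambda>c x. u x * c (s x)) L = \<zero>"
  using L rel
proof (induction "length L" arbitrary: L)
  case (Suc n)
  obtain c w L' where L: "L = (c, w) # L'" using Suc.hyps(2) by (metis Suc_length_conv prod.exhaust)
  have wM: "w \<in> carrier M" and L'M: "\<And>d v. (d, v) \<in> set L' ==> v \<in> carrier M"
    and c: "reg (\<lambda>x. u x * c (s x))" and ok': "ok (\<lambda>c x. u x * c (s x)) L'"
    using Suc.prems(1) L by (auto simp: ok_def)
  have k: "ok (\<lambda>c x. e c) L'" for e using L'M by (rule ok_const)
  show ?case
  proof (cases "\<forall>h\<in>carrier (grp X). c h = 0")
    case True
    have "lc (\<lambda>c x. c h) L' = \<zero>" if "h \<in> carrier (grp X)" for h
      using Suc.prems(2)[OF that] True that wM k[of "\<lambda>c. c h"] by (simp add: L sm_zero)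
    then have "lc (\<lambda>c x. u x * c (s x)) L' = \<zero>" using Suc.hyps(1)[of L'] Suc.hyps(2) ok' L by simp
    moreover have "sm (\<lambda>x. u x * c (s x)) w = sm (\<lambda>x. 0) w"
      by (rule sm_cong) (use True s in fastforce)
    ultimately show ?thesis using wM by (simp add: L sm_zero)
  next
    case False
    then obtain h0 where h0: "h0 \<in> carrier (grp X)" "c h0 \<noteq> 0" by blast
    \<comment> \<open>The relation at \<open>h0\<close> expresses \<open>w\<close> by the other vectors; eliminating \<open>w\<close> leaves a shorter relation.\<close>
    define l where "l d = d h0 / c h0" for d :: "'h => 'k"
    define L'' where "L'' = map (\<lambda>(d, v). (\<lambda>h. d h + (- c h) * l d, v)) L'"
    have comp: "lc f L'' = lc (\<lambda>d. f (\<lambda>h. d h + (- c h) * l d)) L'" for f :: "('h => 'k) => 'p => 'k"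
      unfolding lc_def L''_def map_map by (rule arg_cong[of _ _ "msum M"]) (rule map_cong, auto)
    have okc: "ok f L'' \<longleftrightarrow> ok (\<lambda>d. f (\<lambda>h. d h + (- c h) * l d)) L'" for f :: "('h => 'k) => 'p => 'k"
      unfolding ok_def L''_def by auto
    have lw: "lc (\<lambda>d x. l d) L' = \<ominus> w"
    proof -
      have "sm (\<lambda>x. c h0) w \<oplus> lc (\<lambda>d x. d h0) L' = \<zero>"
        using Suc.prems(2)[OF h0(1)] by (simp add: L)
      then have "sm (\<lambda>x. inverse (c h0)) (sm (\<lambda>x. c h0) w \<oplus> lc (\<lambda>d x. d h0) L') = \<zero>"
        by (simp add: sm_zero_r pts.regf_const)
      then have "sm (\<lambda>x. inverse (c h0) * c h0) w \<oplus> lc (\<lambda>d x. inverse (c h0) * d h0) L' = \<zero>"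
        using wM k[of "\<lambda>d. d h0"] by (simp add: sm_add_r sm_mult lc_mult pts.regf_const)
      moreover have "sm (\<lambda>x. inverse (c h0) * c h0) w = w" using h0(2) wM by (simp add: sm_one)
      moreover have "(\<lambda>d (x::'p). inverse (c h0) * d h0) = (\<lambda>d x. l d)" by (simp add: l_def fun_eq_iff field_simps)
      ultimately have "w \<oplus> lc (\<lambda>d x. l d) L' = \<zero>" by (simp only:)
      then show ?thesis using wM k[of l] M.minus_equality[of "lc (\<lambda>d x. l d) L'" w] by (simp add: M.a_comm)
    qed
    have main: "lc f L'' = \<zero> \<longleftrightarrow> lc f L = \<zero>"
      if f: "f = (\<lambda>d x. v x * d (t x))" and v: "reg (\<lambda>x. v x * c (t x))" "ok f L'" for f v and t :: "'p => 'h"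
    proof -
      have vn: "reg (\<lambda>x. - (v x * c (t x)))" by (rule pts.regf_uminus[OF v(1)])
      have "lc f L'' = lc (\<lambda>d x. f d x + (- (v x * c (t x))) * l d) L'"
        unfolding comp f by (rule lc_cong) (simp add: algebra_simps)
      also have "\<dots> = lc f L' \<oplus> sm (\<lambda>x. - (v x * c (t x))) (lc (\<lambda>d x. l d) L')"
        using lc_add[OF v(2) ok_mult[OF k[of l] vn]] lc_mult[OF k[of l] vn] by simp
      also have "sm (\<lambda>x. - (v x * c (t x))) (lc (\<lambda>d x. l d) L') = sm (\<lambda>x. - (v x * c (t x)) * - 1) w"
        unfolding lw sm_neg[OF wM, symmetric] by (rule sm_mult[OF vn pts.regf_const wM, symmetric])
      also have "\<dots> = sm (f c) w" unfolding f by (rule sm_cong) simp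
      finally show ?thesis using v wM by (simp add: L M.a_comm f)
    qed
    have "lc (\<lambda>c x. u x * c (s x)) L'' = \<zero>"
    proof (rule Suc.hyps(1))
      show "n = length L''" using Suc.hyps(2) by (simp add: L''_def L)
      have "ok (\<lambda>d x. u x * d (s x) + - (u x * c (s x)) * l d) L'"
        using ok_add[OF ok' ok_mult[OF k[of l] pts.regf_uminus[OF c]]] by simp
      then show "ok (\<lambda>c x. u x * c (s x)) L''" unfolding okc by (simp add: algebra_simps)
      show "lc (\<lambda>c x. c h) L'' = \<zero>" if "h \<in> carrier (grp X)" for h
        using main[of "\<lambda>c x. c h" "\<lambda>_. 1" "\<lambda>_. h"] Suc.prems(2)[OF that] k[of "\<lambda>d. d h"] pts.regf_const by simp
    qed
    then show ?thesis using main[OF refl c ok'] by simp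
  qed
qed simp

text \<open>The list \<open>L\<close> is the coaction of \<open>m\<close>, an element of \<open>k[G] \<otimes> M\<close>.\<close>

definition represents :: "(('h => 'k) \<times> 'm) list => 'm => bool" where
  "represents L m \<longleftrightarrow> set L \<subseteq> grp_fun X \<times> carrier M \<and> (\<forall>h\<in>carrier (grp X). mact M h m = lc (\<lambda>c x. c h) L)"

lemma ex_represents:
  assumes "m \<in> carrier M"
  shows "\<exists>L. represents L m"
proof -
  from coh assms obtain n :: nat and c w where cw: "\<forall>i<n. c i \<in> grp_fun X \<and> w i \<in> carrier M"
    "\<forall>h\<in>carrier (grp X). mact M h m = finsum M (\<lambda>i. (\<lambda>x\<in>pts X. c i h) \<odot>\<^bsub>M\<^esub> w i) {..<n}"
    unfolding coherent_eqmod_def by (elim conjE ballE[of _ _ m] exE) (rule that, auto)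
  define L where "L = map (\<lambda>i. (c i, w i)) [0..<n]"
  have "mact M h m = lc (\<lambda>c x. c h) L" if h: "h \<in> carrier (grp X)" for h
  proof -
    have "finsum M (\<lambda>i. sm (\<lambda>x. c i h) (w i)) {..<n} = msum M (map (\<lambda>i. sm (\<lambda>x. c i h) (w i)) [0..<n])"
      by (rule M.finsum_lessThan_msum) (use cw(1) pts.regf_const in simp)
    also have "\<dots> = lc (\<lambda>c x. c h) L" by (simp add: lc_def L_def comp_def)
    finally show ?thesis using cw(2) h by (simp add: sm_def)
  qed
  moreover have "set L \<subseteq> grp_fun X \<times> carrier M" using cw(1) by (auto simp: L_def)
  ultimately show ?thesis unfolding represents_def by blast
qed

end

section \<open>Restriction of equivariant modules to a slice\<close>

context eqmodule
begin

text \<open>The submodule \<open>I M\<close>.\<close>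

inductive_set ispan :: "('p => 'k) set => 'm set" for I :: "('p => 'k) set" where
  zero: "\<zero> \<in> ispan I"
| add: "a \<in> I ==> m \<in> carrier M ==> n \<in> ispan I ==> sm a m \<oplus> n \<in> ispan I"

lemma ispan_carrier:
  assumes "I \<subseteq> Collect reg" "x \<in> ispan I"
  shows "x \<in> carrier M"
  using assms(2) by (induction rule: ispan.induct) (use assms(1) in auto)

lemma ispan_gen: "I \<subseteq> Collect reg ==> a \<in> I ==> m \<in> carrier M ==> sm a m \<in> ispan I"
  using ispan.add[OF _ _ ispan.zero, of a I m] by auto

lemma ispan_add:
  assumes "I \<subseteq> Collect reg" "x \<in> ispan I" "y \<in> ispan I"
  shows "x \<oplus> y \<in> ispan I"
  using assms(2)
proof (induction rule: ispan.induct)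
  case zero
  then show ?case using assms(3) ispan_carrier[OF assms(1,3)] by simp
next
  case (add a m n)
  have "sm a m \<oplus> n \<oplus> y = sm a m \<oplus> (n \<oplus> y)"
    using add assms ispan_carrier[OF assms(1)] by (intro M.a_assoc) auto
  then show ?case using ispan.add[OF add(1,2,4)] by simp
qed

lemma ispan_sm:
  assumes "I \<subseteq> Collect reg" "reg b" "\<And>a. a \<in> I ==> (\<lambda>x. b x * a x) \<in> I" "x \<in> ispan I"
  shows "sm b x \<in> ispan I"
  using assms(4)
proof (induction rule: ispan.induct)
  case zero
  then show ?case using assms(2) by (simp add: sm_zero_r ispan.zero)
next
  case (add a m n)
  have "reg a" "n \<in> carrier M" using add assms(1) ispan_carrier by auto
  then have "sm b (sm a m \<oplus> n) = sm (\<lambda>x. b x * a x) m \<oplus> sm b n"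
    using assms(2) add(2) by (simp add: sm_add_r sm_mult)
  then show ?case using ispan.add[OF assms(3)[OF add(1)] add(2,4)] by simp
qed

lemma ispan_act:
  assumes "I \<subseteq> Collect reg" "h \<in> carrier (grp X)" "\<And>a. a \<in> I ==> (\<lambda>x. a (gact X (inv\<^bsub>grp X\<^esub> h) x)) \<in> I" "x \<in> ispan I"
  shows "mact M h x \<in> ispan I"
  using assms(4)
proof (induction rule: ispan.induct)
  case zero
  then show ?case using assms(2) by (simp add: act_zero ispan.zero)
next
  case (add a m n)
  have "reg a" "n \<in> carrier M" using add assms(1) ispan_carrier by auto
  then have "mact M h (sm a m \<oplus> n) = sm (\<lambda>x. a (gact X (inv\<^bsub>grp X\<^esub> h) x)) (mact M h m) \<oplus> mact M h n"
    using assms(2) add(2) by (simp add: act_add act_sm)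
  then show ?case using ispan.add[OF assms(3)[OF add(1)] act_carrier[OF assms(2) add(2)] add(4)] by simp
qed

lemma lc_ispan:
  assumes "I \<subseteq> Collect reg" "\<And>c w. (c, w) \<in> set L ==> f c \<in> I \<and> w \<in> carrier M"
  shows "lc f L \<in> ispan I"
  using assms(2)
proof (induction L)
  case (Cons p L)
  then show ?case by (cases p) (auto intro!: ispan.add)
qed (simp add: ispan.zero)

text \<open>The coaction of \<open>a m\<close> is the product of the coactions \<open>\<Sum> e\<^sub>j \<otimes> a\<^sub>j\<close> of the function \<open>a\<close> and \<open>L\<close> of the section \<open>m\<close>; here \<open>E j d\<close> is
  the product of the coefficients \<open>e\<^sub>j\<close> and \<open>d\<close>.\<close>

lemma lc_product:
  assumes "\<And>j. j < k ==> reg (e j) \<and> reg (a j)" "ok f' L"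
    and f: "\<And>j d v x. j < k ==> (d, v) \<in> set L ==> x \<in> pts X ==> f (E j d) x = e j x * f' d x"
  shows "ok f (concat (map (\<lambda>j. map (\<lambda>(d, v). (E j d, sm (a j) v)) L) [0..<k])) \<and>
    lc f (concat (map (\<lambda>j. map (\<lambda>(d, v). (E j d, sm (a j) v)) L) [0..<k])) = sm (\<lambda>x. \<Sum>j<k. e j x * a j x) (lc f' L)"
  using assms(1) f
proof (induction k)
  case 0
  show ?case using lc_closed[OF assms(2)] by (simp add: sm_zero)
next
  case (Suc k)
  let ?Q = "\<lambda>j. map (\<lambda>(d, v). (E j d, sm (a j) v)) L"
  have ek: "reg (e k)" "reg (a k)" using Suc.prems(1) by auto
  have 1: "ok f (?Q k) \<and> lc f (?Q k) = sm (\<lambda>x. e k x * a k x) (lc f' L)"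
    using assms(2) Suc.prems(2)[of k]
  proof (induction L)
    case Nil
    then show ?case using ek by (simp add: sm_zero_r pts.regf_mult)
  next
    case (Cons p L)
    obtain d v where p: "p = (d, v)" by (cases p)
    have IH: "ok f (map (\<lambda>(d, v). (E k d, sm (a k) v)) L) \<and> lc f (map (\<lambda>(d, v). (E k d, sm (a k) v)) L) = sm (\<lambda>x. e k x * a k x) (lc f' L)"
      by (rule Cons.IH) (use Cons.prems p in auto)
    have v: "reg (f' d)" "v \<in> carrier M" "ok f' L" using Cons.prems(1) p by auto
    have fE: "f (E k d) x = e k x * f' d x" if "x \<in> pts X" for x
      by (rule Cons.prems(2)[OF _ _ that, of _ v]) (simp_all add: p)
    have r: "reg (f (E k d))"
      by (rule regf_cong[OF pts.regf_mult[OF ek(1) v(1)]]) (simp add: fE)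
    have "sm (f (E k d)) (sm (a k) v) = sm (\<lambda>x. f (E k d) x * a k x) v"
      using r ek v by (simp add: sm_mult)
    also have "\<dots> = sm (\<lambda>x. (e k x * a k x) * f' d x) v"
      by (rule sm_cong) (simp add: fE)
    also have "\<dots> = sm (\<lambda>x. e k x * a k x) (sm (f' d) v)"
      using ek v by (simp add: sm_mult pts.regf_mult)
    finally show ?case using IH r v ek by (simp add: p sm_add_r pts.regf_mult)
  qed
  have 2: "ok f (concat (map ?Q [0..<k])) \<and> lc f (concat (map ?Q [0..<k])) = sm (\<lambda>x. \<Sum>j<k. e j x * a j x) (lc f' L)"
    by (rule Suc.IH) (use Suc.prems in auto)
  have "reg (\<lambda>x. \<Sum>j<k. e j x * a j x)" by (intro pts.regf_sum pts.regf_mult) (use Suc.prems(1) in auto)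
  then have "sm (\<lambda>x. \<Sum>j<Suc k. e j x * a j x) (lc f' L) = sm (\<lambda>x. \<Sum>j<k. e j x * a j x) (lc f' L) \<oplus> sm (\<lambda>x. e k x * a k x) (lc f' L)"
    using sm_add_l[of "\<lambda>x. \<Sum>j<k. e j x * a j x" "\<lambda>x. e k x * a k x" "lc f' L"] assms(2) ek by (simp add: pts.regf_mult)
  then show ?case using 1 2 by (simp add: lc_append)
qed

end

text \<open>A slice \<open>\<iota>\<close> for an action of \<open>G\<close> on \<open>X\<close>: on the principal open set \<open>\<Delta> \<noteq> 0\<close> every point \<open>x\<close> is moved by
  \<open>\<sigma> x\<close> from the point \<open>r x\<close> of the slice, all of these being algebraic.\<close>

locale slice = G: algebraic_action XG + T: algebraic_action XT
  for XG :: "('h, 'x, 'k::field) gvar" and XT :: "('t, 'y, 'k) gvar" +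
  fixes \<iota> :: "'y => 'x" and r :: "'x => 'y" and \<Delta> :: "'x => 'k" and \<sigma> :: "'x => 'h" and \<phi> :: "'t => 'h"
  assumes iota_closed: "y \<in> pts XT ==> \<iota> y \<in> pts XG"
    and iota_regf: "f \<in> pts_fun XG ==> regf (pts XT) (pts_fun XT) (\<lambda>y. f (\<iota> y))"
    and r_closed: "x \<in> pts XG ==> r x \<in> pts XT"
    and r_regf: "b \<in> pts_fun XT ==> regf (pts XG) (pts_fun XG) (\<lambda>x. b (r x))"
    and r_iota: "y \<in> pts XT ==> r (\<iota> y) = y"
    and Delta_regf: "regf (pts XG) (pts_fun XG) \<Delta>"
    and Delta_iota: "y \<in> pts XT ==> \<Delta> (\<iota> y) = 1"
    and sigma_closed: "x \<in> pts XG ==> \<Delta> x \<noteq> 0 ==> \<sigma> x \<in> carrier (grp XG)"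
    and sigma_act: "x \<in> pts XG ==> \<Delta> x \<noteq> 0 ==> gact XG (\<sigma> x) (\<iota> (r x)) = x"
    and sigma_iota: "y \<in> pts XT ==> \<sigma> (\<iota> y) = \<one>\<^bsub>grp XG\<^esub>"
    and sigma_regf: "c \<in> grp_fun XG ==> \<exists>N0. \<forall>N\<ge>N0. regf (pts XG) (pts_fun XG) (\<lambda>x. \<Delta> x ^ N * c (\<sigma> x))"
    and phi_closed: "t \<in> carrier (grp XT) ==> \<phi> t \<in> carrier (grp XG)"
    and phi_mult: "s \<in> carrier (grp XT) ==> t \<in> carrier (grp XT) ==> \<phi> (s \<otimes>\<^bsub>grp XT\<^esub> t) = \<phi> s \<otimes>\<^bsub>grp XG\<^esub> \<phi> t"
    and phi_regf: "c \<in> grp_fun XG ==> regf (carrier (grp XT)) (grp_fun XT) (\<lambda>t. c (\<phi> t))"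
    and iota_act: "t \<in> carrier (grp XT) ==> y \<in> pts XT ==> \<iota> (gact XT t y) = gact XG (\<phi> t) (\<iota> y)"
begin

lemma phi_one: "\<phi> \<one>\<^bsub>grp XT\<^esub> = \<one>\<^bsub>grp XG\<^esub>"
proof -
  have "\<phi> \<one>\<^bsub>grp XT\<^esub> \<otimes>\<^bsub>grp XG\<^esub> \<phi> \<one>\<^bsub>grp XT\<^esub> = \<phi> \<one>\<^bsub>grp XT\<^esub>"
    using phi_mult[of "\<one>\<^bsub>grp XT\<^esub>" "\<one>\<^bsub>grp XT\<^esub>"] by simp
  then show ?thesis using phi_closed[OF T.G.one_closed] by (metis G.G.r_cancel_one)
qed

lemma phi_inv:
  assumes "t \<in> carrier (grp XT)"
  shows "\<phi> (inv\<^bsub>grp XT\<^esub> t) = inv\<^bsub>grp XG\<^esub> (\<phi> t)"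
proof -
  have "\<phi> (inv\<^bsub>grp XT\<^esub> t) \<otimes>\<^bsub>grp XG\<^esub> \<phi> t = \<one>\<^bsub>grp XG\<^esub>"
    using phi_mult[of "inv\<^bsub>grp XT\<^esub> t" t] assms by (simp add: phi_one)
  then show ?thesis using G.G.inv_equality assms phi_closed by (metis T.G.inv_closed)
qed

abbreviation "regG \<equiv> regf (pts XG) (pts_fun XG)"

definition slice_ideal :: "('x => 'k) set" where
  "slice_ideal = {a. regG a \<and> (\<forall>y\<in>pts XT. a (\<iota> y) = 0)}"

lemma slice_ideal_sub: "slice_ideal \<subseteq> Collect regG"
  by (auto simp: slice_ideal_def)

lemma slice_ideal_mult: "regG b ==> a \<in> slice_ideal ==> (\<lambda>x. b x * a x) \<in> slice_ideal"
  by (auto simp: slice_ideal_def intro: G.pts.regf_mult)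

lemma slice_ideal_act:
  assumes "t \<in> carrier (grp XT)" "a \<in> slice_ideal"
  shows "(\<lambda>x. a (gact XG (inv\<^bsub>grp XG\<^esub> (\<phi> t)) x)) \<in> slice_ideal"
proof -
  let ?g = "inv\<^bsub>grp XG\<^esub> (\<phi> t)"
  have g: "?g \<in> carrier (grp XG)" using assms(1) phi_closed by simp
  have a: "restrict a (pts XG) \<in> pts_fun XG" using assms(2) by (simp add: slice_ideal_def regf_def)
  have "regG (\<lambda>x. restrict a (pts XG) (gact XG ?g x))" by (rule G.regf_translate[OF a g])
  then have "regG (\<lambda>x. a (gact XG ?g x))" by (rule regf_cong) (use G.act_closed[OF g] in simp)
  moreover have "a (gact XG ?g (\<iota> y)) = 0" if "y \<in> pts XT" for y
    using assms that iota_act[of "inv\<^bsub>grp XT\<^esub> t" y] phi_inv[OF assms(1)] T.act_closed[of "inv\<^bsub>grp XT\<^esub> t" y]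
    by (auto simp: slice_ideal_def)
  ultimately show ?thesis by (simp add: slice_ideal_def)
qed

text \<open>A function \<open>c\<close> on the group becomes a function on the space by evaluation at \<open>\<sigma>\<close>, with its denominators cleared.\<close>

definition tw :: "nat => ('h => 'k) => 'x => 'k" where
  "tw N c x = \<Delta> x ^ N * c (\<sigma> x)"

definition module_ideal :: "('x => 'k, 'm, 'h) eqmod => 'm set" where
  "module_ideal M = eqmodule.ispan XG M slice_ideal"

lemma eqmoduleG: "coherent_eqmod XG M ==> eqmodule XG M"
  by unfold_locales

lemma eqmoduleT: "coherent_eqmod XT M ==> eqmodule XT M"
  by unfold_locales

lemma tw_ok:
  assumes "coherent_eqmod XG M" "set L \<subseteq> grp_fun XG \<times> carrier M"
  shows "\<exists>N0. \<forall>N\<ge>N0. eqmodule.ok XG M (tw N) L"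
proof -
  interpret M: eqmodule XG M by (rule eqmoduleG[OF assms(1)])
  show ?thesis using assms(2)
  proof (induction L)
    case (Cons p L)
    obtain c w where p: "p = (c, w)" by (cases p)
    obtain N0 where N0: "\<forall>N\<ge>N0. M.ok (tw N) L" using Cons by auto
    obtain N1 where N1: "\<forall>N\<ge>N1. regG (\<lambda>x. \<Delta> x ^ N * c (\<sigma> x))" using sigma_regf[of c] Cons.prems p by auto
    have "tw N c = (\<lambda>x. \<Delta> x ^ N * c (\<sigma> x))" for N by (simp add: tw_def fun_eq_iff)
    then show ?case using N0 N1 Cons.prems p by (intro exI[of _ "max N0 N1"]) auto
  qed simp
qed

definition vanishing :: "('x => 'k, 'm, 'h) eqmod => 'm => bool" where
  "vanishing M m \<longleftrightarrow> (\<exists>L N0. eqmodule.represents XG M L m \<and>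
    (\<forall>N\<ge>N0. eqmodule.ok XG M (tw N) L \<and> eqmodule.lc XG M (tw N) L = \<zero>\<^bsub>M\<^esub>))"

text \<open>The value at \<open>x\<close> of the translate of \<open>m\<close> by \<open>\<sigma> x\<close> comes from the value of \<open>m\<close> at the point \<open>\<iota> (r x)\<close> of the slice, so
  it is zero if \<open>m\<close> vanishes on the slice.\<close>

lemma vanishing_module_ideal:
  fixes M (structure)
  assumes M: "coherent_eqmod XG M" and m: "m \<in> module_ideal M"
  shows "vanishing M m"
proof -
  interpret M: eqmodule XG M by (rule eqmoduleG[OF M])
  from m have "m \<in> M.ispan slice_ideal" by (simp add: module_ideal_def)
  then show ?thesis
  proof (induction rule: M.ispan.induct)
    case zero
    have "M.represents [] \<zero>" by (simp add: M.represents_def M.act_zero)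
    then show ?case unfolding vanishing_def by (intro exI[of _ "[]"] exI[of _ 0]) simp
  next
    case (add a n p)
    have a: "regG a" "\<And>y. y \<in> pts XT ==> a (\<iota> y) = 0" using add by (auto simp: slice_ideal_def)
    have pM: "p \<in> carrier M" using add M.ispan_carrier[OF slice_ideal_sub] by blast
    obtain Lp Np where Lp: "M.represents Lp p" "\<forall>N\<ge>Np. M.ok (tw N) Lp \<and> M.lc (tw N) Lp = \<zero>"
      using add(4) unfolding vanishing_def by blast
    obtain Ln where Ln: "M.represents Ln n" using M.ex_represents add(2) by blast
    obtain Nn where Nn: "\<forall>N\<ge>Nn. M.ok (tw N) Ln" using tw_ok[OF M] Ln unfolding M.represents_def by blast
    have "restrict a (pts XG) \<in> pts_fun XG" using a(1) by (simp add: regf_def)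
    then obtain k :: nat and e b where eb: "\<forall>i<k. e i \<in> grp_fun XG \<and> b i \<in> pts_fun XG"
      "\<forall>g\<in>carrier (grp XG). \<forall>x\<in>pts XG. restrict a (pts XG) (gact XG (inv\<^bsub>grp XG\<^esub> g) x) = (\<Sum>i<k. e i g * b i x)"
      using G.rational by blast
    have a_eq: "a (gact XG (inv\<^bsub>grp XG\<^esub> g) x) = (\<Sum>i<k. e i g * b i x)" if "g \<in> carrier (grp XG)" "x \<in> pts XG" for g x
      using eb(2) that G.act_closed[of "inv\<^bsub>grp XG\<^esub> g" x] by fastforce
    have b: "regG (b j)" if "j < k" for j using eb(1) that G.pts.regf_mem by blast
    have "\<exists>Ne\<ge>1. \<forall>j<k. \<forall>N\<ge>Ne. regG (\<lambda>x. \<Delta> x ^ N * e j (\<sigma> x))"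
      using eb(1)
    proof (induction k)
      case (Suc k)
      then obtain Ne where Ne: "Ne \<ge> 1" "\<forall>j<k. \<forall>N\<ge>Ne. regG (\<lambda>x. \<Delta> x ^ N * e j (\<sigma> x))" by auto
      obtain N1 where N1: "\<forall>N\<ge>N1. regG (\<lambda>x. \<Delta> x ^ N * e k (\<sigma> x))" using sigma_regf[of "e k"] Suc.prems by auto
      show ?case by (rule exI[of _ "max Ne N1"]) (use Ne N1 in \<open>auto simp: less_Suc_eq\<close>)
    qed auto
    then obtain Ne where Ne: "Ne \<ge> 1" "\<forall>j<k. regG (\<lambda>x. \<Delta> x ^ Ne * e j (\<sigma> x))" by blast
    define E where "E j d = (\<lambda>g\<in>carrier (grp XG). e j g * d g)" for j and d :: "'h => 'k"
    define Q where "Q = concat (map (\<lambda>j. map (\<lambda>(d, v). (E j d, M.sm (b j) v)) Ln) [0..<k])"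
    have LnM: "set Ln \<subseteq> grp_fun XG \<times> carrier M" using Ln by (simp add: M.represents_def)
    have Qset: "set Q \<subseteq> grp_fun XG \<times> carrier M"
    proof -
      have "E j d \<in> grp_fun XG" if "j < k" "d \<in> grp_fun XG" for j d
        using G.grp.regf_mult[OF G.grp.regf_mem G.grp.regf_mem, of "e j" d] eb(1) that by (simp add: E_def regf_def)
      then show ?thesis using LnM b by (auto simp: Q_def)
    qed
    have Qh: "M.ok (\<lambda>c x. c h) Q \<and> M.lc (\<lambda>c x. c h) Q = M.sm (\<lambda>x. a (gact XG (inv\<^bsub>grp XG\<^esub> h) x)) (mact M h n)"
      if h: "h \<in> carrier (grp XG)" for h
    proof -
      have "M.ok (\<lambda>c x. c h) Ln" by (rule M.ok_const) (use LnM in auto)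
      then have "M.ok (\<lambda>c x. c h) Q \<and> M.lc (\<lambda>c x. c h) Q = M.sm (\<lambda>x. \<Sum>j<k. e j h * b j x) (M.lc (\<lambda>c x. c h) Ln)"
        unfolding Q_def by (intro M.lc_product) (use h b G.pts.regf_const in \<open>auto simp: E_def\<close>)
      moreover have "M.lc (\<lambda>c x. c h) Ln = mact M h n" using Ln h by (simp add: M.represents_def)
      moreover have "M.sm (\<lambda>x. \<Sum>j<k. e j h * b j x) (mact M h n) = M.sm (\<lambda>x. a (gact XG (inv\<^bsub>grp XG\<^esub> h) x)) (mact M h n)"
        by (rule M.sm_cong) (use a_eq h in simp)
      ultimately show ?thesis by simp
    qed
    have QT: "M.ok (tw N) Q \<and> M.lc (tw N) Q = \<zero>" if N: "N \<ge> Ne + Nn" for N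
    proof -
      have okN: "M.ok (tw (N - Ne)) Ln" using Nn N by simp
      have "M.ok (tw N) Q \<and> M.lc (tw N) Q = M.sm (\<lambda>x. \<Sum>j<k. (\<Delta> x ^ Ne * e j (\<sigma> x)) * b j x) (M.lc (tw (N - Ne)) Ln)"
        unfolding Q_def
      proof (rule M.lc_product[OF _ okN])
        show "regG (\<lambda>x. \<Delta> x ^ Ne * e j (\<sigma> x)) \<and> regG (b j)" if "j < k" for j using Ne(2) b that by blast
        fix j d x assume x: "x \<in> pts XG"
        show "tw N (E j d) x = \<Delta> x ^ Ne * e j (\<sigma> x) * tw (N - Ne) d x"
        proof (cases "\<Delta> x = 0")
          case True
          then show ?thesis using Ne(1) N by (simp add: tw_def power_0_left)
        next
          case False
          have "\<Delta> x ^ N = \<Delta> x ^ Ne * \<Delta> x ^ (N - Ne)" using N by (simp add: power_add[symmetric])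
          then show ?thesis using sigma_closed[OF x False] by (simp add: tw_def E_def)
        qed
      qed
      moreover have "M.sm (\<lambda>x. \<Sum>j<k. (\<Delta> x ^ Ne * e j (\<sigma> x)) * b j x) (M.lc (tw (N - Ne)) Ln) = M.sm (\<lambda>x. 0) (M.lc (tw (N - Ne)) Ln)"
      proof (rule M.sm_cong)
        fix x assume x: "x \<in> pts XG"
        show "(\<Sum>j<k. (\<Delta> x ^ Ne * e j (\<sigma> x)) * b j x) = 0"
        proof (cases "\<Delta> x = 0")
          case True
          then show ?thesis using Ne(1) by (simp add: power_0_left)
        next
          case False
          note s = sigma_closed[OF x False]
          have "gact XG (inv\<^bsub>grp XG\<^esub> (\<sigma> x)) x = \<iota> (r x)"
            using G.act_inv(1)[OF s iota_closed[OF r_closed[OF x]]] sigma_act[OF x False] by simp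
          then have "(\<Sum>j<k. e j (\<sigma> x) * b j x) = 0" using a_eq[OF s x] a(2)[OF r_closed[OF x]] by simp
          then show ?thesis by (simp add: mult.assoc sum_distrib_left[symmetric])
        qed
      qed
      ultimately show ?thesis using M.lc_closed[OF okN] by (simp add: M.sm_zero)
    qed
    have LpM: "set Lp \<subseteq> grp_fun XG \<times> carrier M" using Lp(1) by (simp add: M.represents_def)
    have "M.represents (Q @ Lp) (M.sm a n \<oplus> p)" unfolding M.represents_def
    proof (intro conjI ballI)
      show "set (Q @ Lp) \<subseteq> grp_fun XG \<times> carrier M" using Qset LpM by auto
      fix h assume h: "h \<in> carrier (grp XG)"
      have "M.ok (\<lambda>c x. c h) Lp" by (rule M.ok_const) (use LpM in auto)
      then have "M.lc (\<lambda>c x. c h) (Q @ Lp) = M.lc (\<lambda>c x. c h) Q \<oplus> M.lc (\<lambda>c x. c h) Lp"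
        using Qh[OF h] by (intro M.lc_append) auto
      also have "\<dots> = mact M h (M.sm a n \<oplus> p)"
        using Qh[OF h] Lp(1) h a(1) add(2) pM by (simp add: M.represents_def M.act_add M.act_sm)
      finally show "mact M h (M.sm a n \<oplus> p) = M.lc (\<lambda>c x. c h) (Q @ Lp)" by simp
    qed
    moreover have "M.ok (tw N) (Q @ Lp) \<and> M.lc (tw N) (Q @ Lp) = \<zero>" if "N \<ge> max (Ne + Nn) Np" for N
      using QT[of N] Lp(2) that by (simp add: M.lc_append)
    ultimately show ?case unfolding vanishing_def by blast
  qed
qed

lemma eqmod_homD:
  assumes "eqmod_hom X M N \<alpha>" "m \<in> carrier M"
  shows "\<alpha> m \<in> carrier N"
    "m' \<in> carrier M ==> \<alpha> (m \<oplus>\<^bsub>M\<^esub> m') = \<alpha> m \<oplus>\<^bsub>N\<^esub> \<alpha> m'"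
    "a \<in> pts_fun X ==> \<alpha> (a \<odot>\<^bsub>M\<^esub> m) = a \<odot>\<^bsub>N\<^esub> \<alpha> m"
    "h \<in> carrier (grp X) ==> \<alpha> (mact M h m) = mact N h (\<alpha> m)"
  using bspec[OF assms(1)[unfolded eqmod_hom_def] assms(2)] by simp_all

lemma hom_zero:
  assumes "coherent_eqmod X M" "coherent_eqmod X N" "eqmod_hom X M N \<alpha>"
  shows "\<alpha> \<zero>\<^bsub>M\<^esub> = \<zero>\<^bsub>N\<^esub>"
proof -
  interpret M: abelian_group M using assms(1) by (simp add: coherent_eqmod_def module_def)
  interpret N: abelian_group N using assms(2) by (simp add: coherent_eqmod_def module_def)
  have "\<alpha> \<zero>\<^bsub>M\<^esub> = \<alpha> \<zero>\<^bsub>M\<^esub> \<oplus>\<^bsub>N\<^esub> \<alpha> \<zero>\<^bsub>M\<^esub>" "\<alpha> \<zero>\<^bsub>M\<^esub> \<in> carrier N"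
    using eqmod_homD(1,2)[OF assms(3), of "\<zero>\<^bsub>M\<^esub>"] by simp_all
  then show ?thesis using N.add.r_cancel_one'[of "\<alpha> \<zero>\<^bsub>M\<^esub>" "\<alpha> \<zero>\<^bsub>M\<^esub>"] by simp
qed

lemma hom_facts:
  assumes "coherent_eqmod XG M" "coherent_eqmod XG N" "eqmod_hom XG M N \<alpha>"
  shows "m \<in> carrier M ==> \<alpha> m \<in> carrier N"
    "m \<in> carrier M ==> m' \<in> carrier M ==> \<alpha> (m \<oplus>\<^bsub>M\<^esub> m') = \<alpha> m \<oplus>\<^bsub>N\<^esub> \<alpha> m'"
    "regG a ==> m \<in> carrier M ==> \<alpha> (eqmodule.sm XG M a m) = eqmodule.sm XG N a (\<alpha> m)"
    "h \<in> carrier (grp XG) ==> m \<in> carrier M ==> \<alpha> (mact M h m) = mact N h (\<alpha> m)"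
proof -
  interpret M: eqmodule XG M by (rule eqmoduleG[OF assms(1)])
  interpret N: eqmodule XG N by (rule eqmoduleG[OF assms(2)])
  show "m \<in> carrier M ==> \<alpha> m \<in> carrier N"
    "m \<in> carrier M ==> m' \<in> carrier M ==> \<alpha> (m \<oplus>\<^bsub>M\<^esub> m') = \<alpha> m \<oplus>\<^bsub>N\<^esub> \<alpha> m'"
    "h \<in> carrier (grp XG) ==> m \<in> carrier M ==> \<alpha> (mact M h m) = mact N h (\<alpha> m)"
    using eqmod_homD[OF assms(3)] by blast+
  show "regG a ==> m \<in> carrier M ==> \<alpha> (M.sm a m) = N.sm a (\<alpha> m)"
    unfolding M.sm_def N.sm_def regf_def by (rule eqmod_homD(3)[OF assms(3)])
qed

lemma hom_lc:
  assumes "coherent_eqmod XG M" "coherent_eqmod XG N" "eqmod_hom XG M N \<alpha>" "eqmodule.ok XG M f L"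
  shows "\<alpha> (eqmodule.lc XG M f L) = eqmodule.lc XG N f (map (\<lambda>(c, w). (c, \<alpha> w)) L) \<and>
    eqmodule.ok XG N f (map (\<lambda>(c, w). (c, \<alpha> w)) L)"
proof -
  interpret M: eqmodule XG M by (rule eqmoduleG[OF assms(1)])
  interpret N: eqmodule XG N by (rule eqmoduleG[OF assms(2)])
  show ?thesis using assms(4)
  proof (induction L)
    case (Cons p L)
    then show ?case using hom_facts[OF assms(1-3)] by (cases p) simp
  qed (simp add: hom_zero[OF assms(1-3)])
qed

lemma hom_module_ideal:
  assumes "coherent_eqmod XG M" "coherent_eqmod XG N" "eqmod_hom XG M N \<alpha>" "m \<in> module_ideal M"
  shows "\<alpha> m \<in> module_ideal N"
proof -
  interpret M: eqmodule XG M by (rule eqmoduleG[OF assms(1)])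
  interpret N: eqmodule XG N by (rule eqmoduleG[OF assms(2)])
  have "m \<in> M.ispan slice_ideal" using assms(4) by (simp add: module_ideal_def)
  then have "\<alpha> m \<in> N.ispan slice_ideal"
  proof (induction rule: M.ispan.induct)
    case zero
    then show ?case by (simp add: hom_zero[OF assms(1-3)] N.ispan.zero)
  next
    case (add a m n)
    have "regG a" "n \<in> carrier M" using add slice_ideal_sub M.ispan_carrier[OF slice_ideal_sub] by auto
    then show ?case using hom_facts[OF assms(1-3)] add by (simp add: N.ispan.add)
  qed
  then show ?thesis by (simp add: module_ideal_def)
qed

text \<open>Restriction to the slice keeps monomorphisms of equivariant modules injective. If \<open>\<alpha> m\<close> vanishes on the slice, the
  coaction of \<open>\<alpha> m\<close> becomes zero when it is evaluated at \<open>\<sigma>\<close>, and so does that of \<open>m\<close>, as \<open>\<alpha>\<close> is injective. Subtracting this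
  evaluation from the one at the identity writes \<open>m\<close> as a combination of sections with coefficients
  \<open>c 1 - \<Delta>\<^sup>n c(\<sigma>)\<close>, which are zero on the slice because \<open>\<sigma> = 1\<close> and \<open>\<Delta> = 1\<close> there.\<close>

lemma module_ideal_reflected:
  assumes M: "coherent_eqmod XG M" and N: "coherent_eqmod XG N" and \<alpha>: "eqmod_hom XG M N \<alpha>"
    and inj: "inj_on \<alpha> (carrier M)" and m: "m \<in> carrier M" "\<alpha> m \<in> module_ideal N"
  shows "m \<in> module_ideal M"
proof -
  interpret M: eqmodule XG M by (rule eqmoduleG[OF M])
  interpret N: eqmodule XG N by (rule eqmoduleG[OF N])
  note hom = hom_facts[OF M N \<alpha>]
  obtain L' where L': "M.represents L' m" using M.ex_represents m(1) by blast
  obtain L N0 where L: "N.represents L (\<alpha> m)" "\<forall>n\<ge>N0. N.ok (tw n) L \<and> N.lc (tw n) L = \<zero>\<^bsub>N\<^esub>"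
    using vanishing_module_ideal[OF N m(2)] unfolding vanishing_def by blast
  have L'M: "set L' \<subseteq> grp_fun XG \<times> carrier M" and LN: "set L \<subseteq> grp_fun XG \<times> carrier N"
    using L' L(1) by (auto simp: M.represents_def N.represents_def)
  obtain N1 where N1: "\<forall>n\<ge>N1. M.ok (tw n) L'" using tw_ok[OF M L'M] by blast
  define n where "n = max 1 (max N0 N1)"
  have n: "n \<ge> 1" "N.ok (tw n) L" "N.lc (tw n) L = \<zero>\<^bsub>N\<^esub>" "M.ok (tw n) L'"
    using L(2) N1 by (simp_all add: n_def)
  define D1 where "D1 = map (\<lambda>(c, w). (c, \<alpha> w)) L'"
  define D2 where "D2 = map (\<lambda>(c, w). (c, N.sm (\<lambda>x. - 1) w)) L"
  have D2: "N.ok f D2 \<and> N.lc f D2 = N.sm (\<lambda>x. - 1) (N.lc f L)" if "N.ok f L" for f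
    unfolding D2_def using that
  proof (induction L)
    case (Cons p L)
    obtain c w where p: "p = (c, w)" by (cases p)
    have w: "regG (f c)" "w \<in> carrier N" "N.ok f L" using Cons.prems p by auto
    note rm = G.pts.regf_const[of "- 1"]
    have "N.sm (f c) (N.sm (\<lambda>x. - 1) w) = N.sm (\<lambda>x. - 1) (N.sm (f c) w)"
      using N.sm_mult[OF w(1) rm w(2)] N.sm_mult[OF rm w(1) w(2)] by simp
    then show ?case using Cons w rm by (simp add: p N.sm_add_r)
  qed (simp add: N.sm_zero_r G.pts.regf_const)
  have tw_eq: "tw n = (\<lambda>c x. \<Delta> x ^ n * c (\<sigma> x))" by (simp add: tw_def fun_eq_iff)
  have D1: "N.ok f D1 \<and> N.lc f D1 = \<alpha> (M.lc f L')" if "M.ok f L'" for f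
    using hom_lc[OF M N \<alpha> that] by (simp add: D1_def)
  have "N.lc (\<lambda>c x. \<Delta> x ^ n * c (\<sigma> x)) (D1 @ D2) = \<zero>\<^bsub>N\<^esub>"
  proof (rule N.substitute_in_relation)
    show "\<sigma> x \<in> carrier (grp XG)" if "x \<in> pts XG" "\<Delta> x ^ n \<noteq> 0" for x
      using sigma_closed[OF that(1)] that(2) n(1) by (auto simp: power_0_left)
    show "N.ok (\<lambda>c x. \<Delta> x ^ n * c (\<sigma> x)) (D1 @ D2)"
      using D1[OF n(4)] D2[OF n(2)] by (simp add: tw_eq)
    fix h assume h: "h \<in> carrier (grp XG)"
    have o: "M.ok (\<lambda>c x. c h) L'" "N.ok (\<lambda>c x. c h) L"
      by (rule M.ok_const, use L'M in auto) (rule N.ok_const, use LN in auto)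
    have "N.lc (\<lambda>c x. c h) (D1 @ D2) = \<alpha> (mact M h m) \<oplus>\<^bsub>N\<^esub> N.sm (\<lambda>x. - 1) (mact N h (\<alpha> m))"
      using D1[OF o(1)] D2[OF o(2)] L' L(1) h by (simp add: N.lc_append M.represents_def N.represents_def)
    also have "\<dots> = \<zero>\<^bsub>N\<^esub>"
      using hom(1)[OF m(1)] hom(4)[OF h m(1)] N.act_carrier[OF h] by (simp add: N.sm_neg N.M.r_neg)
    finally show "N.lc (\<lambda>c x. c h) (D1 @ D2) = \<zero>\<^bsub>N\<^esub>" .
  qed
  then have "\<alpha> (M.lc (tw n) L') \<oplus>\<^bsub>N\<^esub> N.sm (\<lambda>x. - 1) \<zero>\<^bsub>N\<^esub> = \<zero>\<^bsub>N\<^esub>"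
    using D1[OF n(4)] D2[OF n(2)] n(3) by (simp add: N.lc_append tw_eq[symmetric])
  then have "\<alpha> (M.lc (tw n) L') = \<alpha> \<zero>\<^bsub>M\<^esub>"
    using hom(1)[OF M.lc_closed[OF n(4)]] by (simp add: N.sm_zero_r G.pts.regf_const hom_zero[OF M N \<alpha>])
  then have z: "M.lc (tw n) L' = \<zero>\<^bsub>M\<^esub>" using inj M.lc_closed[OF n(4)] by (auto dest: inj_onD)
  define f where "f c x = c \<one>\<^bsub>grp XG\<^esub> - tw n c x" for c x
  have fI: "f c \<in> slice_ideal" if "(c, w) \<in> set L'" for c w
  proof -
    have "regG (tw n c)" using n(4) that by (auto simp: M.ok_def)
    then have "regG (\<lambda>x. c \<one>\<^bsub>grp XG\<^esub> - tw n c x)" by (intro G.pts.regf_diff G.pts.regf_const) simp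
    then show ?thesis unfolding slice_ideal_def f_def mem_Collect_eq
      by (simp add: tw_def Delta_iota sigma_iota)
  qed
  have okf: "M.ok f L'" using fI L'M slice_ideal_sub unfolding M.ok_def by fastforce
  have "m = M.lc (\<lambda>c x. c \<one>\<^bsub>grp XG\<^esub>) L'" using L' M.act_1[OF m(1)] by (metis M.represents_def G.G.one_closed)
  also have "\<dots> = M.lc (\<lambda>c x. f c x + tw n c x) L'" by (simp add: f_def)
  also have "\<dots> = M.lc f L'" using M.lc_add[OF okf n(4)] z okf by simp
  also have "\<dots> \<in> M.ispan slice_ideal"
    by (rule M.lc_ispan[OF slice_ideal_sub]) (use fI L'M in auto)
  finally show ?thesis by (simp add: module_ideal_def)
qed

end

section \<open>Restriction to a slice in equivariant K-theory\<close>

lemma (in abelian_group) minus_eq_zero_iff: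
  assumes "a \<in> carrier G" "b \<in> carrier G"
  shows "a \<ominus> b = \<zero> \<longleftrightarrow> a = b"
proof
  assume z: "a \<ominus> b = \<zero>"
  have "a = (a \<ominus> b) \<oplus> b" using assms by (simp add: minus_eq a_assoc l_neg)
  then show "a = b" using z assms by simp
qed (use assms in \<open>simp add: minus_eq r_neg\<close>)

context algebraic_action
begin

text \<open>Generation of a module by a list of elements which may be repeated.\<close>

lemma coherent_generators:
  assumes "coherent_eqmod X M"
  obtains ss where "set ss \<subseteq> carrier M"
    "\<And>m. m \<in> carrier M ==> \<exists>a. (\<forall>i<length ss. a i \<in> pts_fun X) \<and> m = msum M (map (\<lambda>i. a i \<odot>\<^bsub>M\<^esub> ss ! i) [0..<length ss])"
proof -
  interpret M: module "coord_ring X" M using assms by (simp add: coherent_eqmod_def)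
  obtain S where S: "finite S" "S \<subseteq> carrier M"
    "\<forall>m\<in>carrier M. \<exists>r. r \<in> S \<rightarrow> pts_fun X \<and> m = finsum M (\<lambda>s. r s \<odot>\<^bsub>M\<^esub> s) S"
    using assms unfolding coherent_eqmod_def by (elim conjE exE) (rule that)
  obtain ss where ss: "set ss = S" "distinct ss" using finite_distinct_list[OF S(1)] by blast
  show ?thesis
  proof (rule that[of ss])
    show "set ss \<subseteq> carrier M" using ss S by simp
    fix m assume "m \<in> carrier M"
    then obtain r where r: "r \<in> S \<rightarrow> pts_fun X" "m = finsum M (\<lambda>s. r s \<odot>\<^bsub>M\<^esub> s) S" using S(3) by blast
    have "(\<lambda>s. r s \<odot>\<^bsub>M\<^esub> s) \<in> set ss \<rightarrow> carrier M"
    proof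
      fix s assume "s \<in> set ss"
      then have "r s \<in> carrier (coord_ring X)" "s \<in> carrier M" using r(1) S(2) ss(1) by auto
      then show "r s \<odot>\<^bsub>M\<^esub> s \<in> carrier M" by (rule M.smult_closed)
    qed
    then have "m = msum M (map (\<lambda>s. r s \<odot>\<^bsub>M\<^esub> s) ss)"
      using M.M.finsum_eq_msum[OF ss(2)] r(2) ss(1) by simp
    also have "map (\<lambda>s. r s \<odot>\<^bsub>M\<^esub> s) ss = map (\<lambda>i. r (ss ! i) \<odot>\<^bsub>M\<^esub> ss ! i) [0..<length ss]"
      by (rule nth_equalityI) auto
    finally show "\<exists>a. (\<forall>i<length ss. a i \<in> pts_fun X) \<and> m = msum M (map (\<lambda>i. a i \<odot>\<^bsub>M\<^esub> ss ! i) [0..<length ss])"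
      using r(1) ss(1) by (intro exI[of _ "\<lambda>i. r (ss ! i)"]) (auto simp: Pi_iff)
  qed
qed

lemma finite_generationI:
  assumes "module (coord_ring X) M" "finite S" "S \<subseteq> carrier M" "set L \<subseteq> pts_fun X \<times> S"
  shows "\<exists>r. r \<in> S \<rightarrow> pts_fun X \<and> msum M (map (\<lambda>(a, s). a \<odot>\<^bsub>M\<^esub> s) L) = finsum M (\<lambda>s. r s \<odot>\<^bsub>M\<^esub> s) S"
  using assms(4)
proof (induction L)
  case Nil
  interpret M: module "coord_ring X" M by fact
  define z :: "'p => 'k" where "z = \<zero>\<^bsub>coord_ring X\<^esub>"
  have z: "z \<in> pts_fun X" using pts.regf_const[of 0] by (simp add: regf_def z_def)
  have "z \<odot>\<^bsub>M\<^esub> s = \<zero>\<^bsub>M\<^esub>" if "s \<in> S" for s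
    unfolding z_def by (rule M.smult_l_null) (use that assms(3) in blast)
  then have "finsum M (\<lambda>s. z \<odot>\<^bsub>M\<^esub> s) S = finsum M (\<lambda>s. \<zero>\<^bsub>M\<^esub>) S"
    by (intro M.M.finsum_cong') auto
  then show ?case using z by (intro exI[of _ "\<lambda>s. z"]) simp
next
  case (Cons p L)
  interpret M: module "coord_ring X" M by fact
  obtain a s where p: "p = (a, s)" by (cases p)
  have as: "a \<in> pts_fun X" "s \<in> S" using Cons.prems p by auto
  obtain r where r: "r \<in> S \<rightarrow> pts_fun X" "msum M (map (\<lambda>(a, s). a \<odot>\<^bsub>M\<^esub> s) L) = finsum M (\<lambda>s. r s \<odot>\<^bsub>M\<^esub> s) S"
    using Cons by auto
  define r' where "r' = r(s := (\<lambda>x\<in>pts X. a x + r s x))"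
  have rs: "r s \<in> pts_fun X" using r(1) as by auto
  have r'1: "r' \<in> S \<rightarrow> pts_fun X"
    using r(1) pts.regf_add[OF pts.regf_mem[OF as(1)] pts.regf_mem[OF rs]] by (auto simp: r'_def regf_def)
  have c: "q t \<odot>\<^bsub>M\<^esub> t \<in> carrier M" if "q \<in> S \<rightarrow> pts_fun X" "t \<in> S" for q t
  proof (rule M.smult_closed)
    show "q t \<in> carrier (coord_ring X)" using that by auto
  qed (use that assms(3) in auto)
  have S': "S = insert s (S - {s})" using as by blast
  have *: "finsum M (\<lambda>t. q t \<odot>\<^bsub>M\<^esub> t) S = q s \<odot>\<^bsub>M\<^esub> s \<oplus>\<^bsub>M\<^esub> finsum M (\<lambda>t. q t \<odot>\<^bsub>M\<^esub> t) (S - {s})"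
    if q: "q \<in> S \<rightarrow> pts_fun X" for q
    by (subst S', rule M.M.finsum_insert) (use assms(2) c[OF q] as in auto)
  have "finsum M (\<lambda>t. r' t \<odot>\<^bsub>M\<^esub> t) (S - {s}) = finsum M (\<lambda>t. r t \<odot>\<^bsub>M\<^esub> t) (S - {s})"
    by (rule M.M.finsum_cong') (use c[OF r(1)] in \<open>auto simp: r'_def\<close>)
  moreover have "r' s \<odot>\<^bsub>M\<^esub> s = a \<odot>\<^bsub>M\<^esub> s \<oplus>\<^bsub>M\<^esub> r s \<odot>\<^bsub>M\<^esub> s"
    using M.smult_l_distr[of a "r s" s] as rs assms(3) by (auto simp: r'_def)
  moreover have "a \<odot>\<^bsub>M\<^esub> s \<in> carrier M" using M.smult_closed[of a s] as assms(3) by auto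
  moreover have "finsum M (\<lambda>t. r t \<odot>\<^bsub>M\<^esub> t) (S - {s}) \<in> carrier M"
    by (rule M.M.finsum_closed) (use c[OF r(1)] in auto)
  ultimately have "finsum M (\<lambda>t. r' t \<odot>\<^bsub>M\<^esub> t) S = a \<odot>\<^bsub>M\<^esub> s \<oplus>\<^bsub>M\<^esub> finsum M (\<lambda>t. r t \<odot>\<^bsub>M\<^esub> t) S"
    using *[OF r'1] *[OF r(1)] c[OF r(1) as(2)] by (simp add: M.M.a_assoc)
  then show ?case using r'1 r(2) p by (intro exI[of _ r']) simp
qed

lemma zero_module: "coherent_eqmod X (structure_sheaf X {})" "carrier (structure_sheaf X {}) = {\<lambda>x. undefined}"
proof -
  show "coherent_eqmod X (structure_sheaf X {})" by (rule coherent_structure_sheaf) (simp add: stable_def)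
  have "pts_fun X \<noteq> {}" using pts.regf_const[of 0] by (auto simp: regf_def)
  moreover have "restrict f {} = (\<lambda>x. undefined)" for f :: "'p => 'k" by (simp add: fun_eq_iff)
  ultimately show "carrier (structure_sheaf X {}) = {\<lambda>x. undefined}" unfolding structure_sheaf_sel sub_fun_def by auto
qed

end

context slice
begin

definition pull :: "('x => 'k) => 'y => 'k" where
  "pull a = (\<lambda>y\<in>pts XT. a (\<iota> y))"

lemma pull_mem: "a \<in> pts_fun XG ==> pull a \<in> pts_fun XT"
  using iota_regf by (simp add: pull_def regf_def)

text \<open>\<open>N\<close> is the restriction \<open>M / I M\<close> of \<open>M\<close> to the slice with ideal \<open>I\<close>, on which \<open>T\<close> acts through \<open>\<phi>\<close>.\<close>

definition restriction :: "('x => 'k, 'm, 'h) eqmod => ('m => 'n) => ('y => 'k, 'n, 't) eqmod => bool" where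
  "restriction M \<kappa> N \<longleftrightarrow> coherent_eqmod XG M \<and> coherent_eqmod XT N \<and> \<kappa> ` carrier M = carrier N \<and>
    (\<forall>m\<in>carrier M. (\<forall>m'\<in>carrier M. \<kappa> (m \<oplus>\<^bsub>M\<^esub> m') = \<kappa> m \<oplus>\<^bsub>N\<^esub> \<kappa> m') \<and>
      (\<forall>a\<in>pts_fun XG. \<kappa> (a \<odot>\<^bsub>M\<^esub> m) = pull a \<odot>\<^bsub>N\<^esub> \<kappa> m) \<and>
      (\<forall>t\<in>carrier (grp XT). \<kappa> (mact M (\<phi> t) m) = mact N t (\<kappa> m)) \<and>
      (\<kappa> m = \<zero>\<^bsub>N\<^esub> \<longleftrightarrow> m \<in> module_ideal M))"

lemma restrictionD:
  assumes "restriction M \<kappa> N"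
  shows "coherent_eqmod XG M" "coherent_eqmod XT N" "\<kappa> ` carrier M = carrier N"
    and "m \<in> carrier M ==> \<kappa> m \<in> carrier N"
    and "m \<in> carrier M ==> m' \<in> carrier M ==> \<kappa> (m \<oplus>\<^bsub>M\<^esub> m') = \<kappa> m \<oplus>\<^bsub>N\<^esub> \<kappa> m'"
    and "m \<in> carrier M ==> a \<in> pts_fun XG ==> \<kappa> (a \<odot>\<^bsub>M\<^esub> m) = pull a \<odot>\<^bsub>N\<^esub> \<kappa> m"
    and "m \<in> carrier M ==> t \<in> carrier (grp XT) ==> \<kappa> (mact M (\<phi> t) m) = mact N t (\<kappa> m)"
    and "m \<in> carrier M ==> \<kappa> m = \<zero>\<^bsub>N\<^esub> \<longleftrightarrow> m \<in> module_ideal M"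
proof -
  note d = assms[unfolded restriction_def]
  show "coherent_eqmod XG M" "coherent_eqmod XT N" and im: "\<kappa> ` carrier M = carrier N" using d by simp_all
  assume m: "m \<in> carrier M"
  have "\<forall>m\<in>carrier M. (\<forall>m'\<in>carrier M. \<kappa> (m \<oplus>\<^bsub>M\<^esub> m') = \<kappa> m \<oplus>\<^bsub>N\<^esub> \<kappa> m') \<and>
      (\<forall>a\<in>pts_fun XG. \<kappa> (a \<odot>\<^bsub>M\<^esub> m) = pull a \<odot>\<^bsub>N\<^esub> \<kappa> m) \<and>
      (\<forall>t\<in>carrier (grp XT). \<kappa> (mact M (\<phi> t) m) = mact N t (\<kappa> m)) \<and>
      (\<kappa> m = \<zero>\<^bsub>N\<^esub> \<longleftrightarrow> m \<in> module_ideal M)" using d by (elim conjE)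
  note mm = bspec[OF this m]
  show "\<kappa> m \<in> carrier N" using im m by blast
  show "m' \<in> carrier M ==> \<kappa> (m \<oplus>\<^bsub>M\<^esub> m') = \<kappa> m \<oplus>\<^bsub>N\<^esub> \<kappa> m'"
    "a \<in> pts_fun XG ==> \<kappa> (a \<odot>\<^bsub>M\<^esub> m) = pull a \<odot>\<^bsub>N\<^esub> \<kappa> m"
    "t \<in> carrier (grp XT) ==> \<kappa> (mact M (\<phi> t) m) = mact N t (\<kappa> m)"
    "\<kappa> m = \<zero>\<^bsub>N\<^esub> \<longleftrightarrow> m \<in> module_ideal M" using mm by simp_all
qed

lemma restriction_zero:
  assumes "restriction M \<kappa> N"
  shows "\<kappa> \<zero>\<^bsub>M\<^esub> = \<zero>\<^bsub>N\<^esub>"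
proof -
  interpret M: eqmodule XG M by (rule eqmoduleG[OF restrictionD(1)[OF assms]])
  show ?thesis using restrictionD(8)[OF assms M.M.zero_closed] M.ispan.zero by (simp add: module_ideal_def)
qed

lemma restriction_minus:
  assumes R: "restriction M \<kappa> N" and m: "m \<in> carrier M" and m': "m' \<in> carrier M"
  shows "\<kappa> (m \<ominus>\<^bsub>M\<^esub> m') = \<kappa> m \<ominus>\<^bsub>N\<^esub> \<kappa> m'"
proof -
  interpret M: eqmodule XG M by (rule eqmoduleG[OF restrictionD(1)[OF R]])
  interpret N: eqmodule XT N by (rule eqmoduleT[OF restrictionD(2)[OF R]])
  note \<kappa> = restrictionD[OF R]
  have "\<kappa> (\<ominus>\<^bsub>M\<^esub> m') \<oplus>\<^bsub>N\<^esub> \<kappa> m' = \<zero>\<^bsub>N\<^esub>"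
    using \<kappa>(5)[of "\<ominus>\<^bsub>M\<^esub> m'" m'] m' by (simp add: M.M.l_neg restriction_zero[OF R])
  then have "\<kappa> (\<ominus>\<^bsub>M\<^esub> m') = \<ominus>\<^bsub>N\<^esub> \<kappa> m'"
    using N.M.minus_equality[of "\<kappa> (\<ominus>\<^bsub>M\<^esub> m')" "\<kappa> m'"] \<kappa>(4) m' by simp
  then show ?thesis using \<kappa>(5)[of m "\<ominus>\<^bsub>M\<^esub> m'"] m m' by (simp add: M.M.minus_eq N.M.minus_eq)
qed

lemma restriction_eq_iff:
  assumes R: "restriction M \<kappa> N" and m: "m \<in> carrier M" and m': "m' \<in> carrier M"
  shows "\<kappa> m = \<kappa> m' \<longleftrightarrow> m \<ominus>\<^bsub>M\<^esub> m' \<in> module_ideal M"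
proof -
  interpret M: eqmodule XG M by (rule eqmoduleG[OF restrictionD(1)[OF R]])
  interpret N: eqmodule XT N by (rule eqmoduleT[OF restrictionD(2)[OF R]])
  note \<kappa> = restrictionD[OF R]
  have "\<kappa> m = \<kappa> m' \<longleftrightarrow> \<kappa> m \<ominus>\<^bsub>N\<^esub> \<kappa> m' = \<zero>\<^bsub>N\<^esub>"
    using \<kappa>(4) m m' by (simp add: N.M.minus_eq_zero_iff)
  then show ?thesis using restriction_minus[OF assms] \<kappa>(8)[of "m \<ominus>\<^bsub>M\<^esub> m'"] m m' by simp
qed

lemma hom_minus:
  assumes A: "coherent_eqmod XG A" and B: "coherent_eqmod XG B" and \<gamma>: "eqmod_hom XG A B \<gamma>"
    and m: "m \<in> carrier A" "m' \<in> carrier A"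
  shows "\<gamma> (m \<ominus>\<^bsub>A\<^esub> m') = \<gamma> m \<ominus>\<^bsub>B\<^esub> \<gamma> m'"
proof -
  interpret A: eqmodule XG A by (rule eqmoduleG[OF A])
  interpret B: eqmodule XG B by (rule eqmoduleG[OF B])
  note hom = hom_facts[OF A B \<gamma>]
  have "\<gamma> (\<ominus>\<^bsub>A\<^esub> m') \<oplus>\<^bsub>B\<^esub> \<gamma> m' = \<zero>\<^bsub>B\<^esub>"
    using hom(2)[of "\<ominus>\<^bsub>A\<^esub> m'" m'] m(2) by (simp add: A.M.l_neg hom_zero[OF A B \<gamma>])
  then have "\<gamma> (\<ominus>\<^bsub>A\<^esub> m') = \<ominus>\<^bsub>B\<^esub> \<gamma> m'"
    using B.M.minus_equality[of "\<gamma> (\<ominus>\<^bsub>A\<^esub> m')" "\<gamma> m'"] hom(1) m(2) by simp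
  then show ?thesis using hom(2)[of m "\<ominus>\<^bsub>A\<^esub> m'"] m by (simp add: A.M.minus_eq B.M.minus_eq)
qed

abbreviation lift :: "('y => 'k) => 'x => 'k" where
  "lift b \<equiv> \<lambda>x\<in>pts XG. b (r x)"

lemma lift_mem: "b \<in> pts_fun XT ==> lift b \<in> pts_fun XG"
  using r_regf by (simp add: regf_def)

lemma pull_lift: "b \<in> pts_fun XT ==> pull (lift b) = b"
  using T.pts.ext[of b] iota_closed r_iota by (auto simp: pull_def fun_eq_iff extensional_def)

lemma induced_hom:
  assumes RA: "restriction A \<kappa>A A'" and RB: "restriction B \<kappa>B B'" and \<gamma>: "eqmod_hom XG A B \<gamma>"
  obtains \<gamma>' where "eqmod_hom XT A' B' \<gamma>'" "\<And>m. m \<in> carrier A ==> \<gamma>' (\<kappa>A m) = \<kappa>B (\<gamma> m)"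
proof -
  note ra = restrictionD[OF RA] and rb = restrictionD[OF RB]
  interpret A: eqmodule XG A by (rule eqmoduleG[OF ra(1)])
  interpret B: eqmodule XG B by (rule eqmoduleG[OF rb(1)])
  note hom = hom_facts[OF ra(1) rb(1) \<gamma>]
  define \<rho> where "\<rho> z = (SOME m. m \<in> carrier A \<and> \<kappa>A m = z)" for z
  define \<gamma>' where "\<gamma>' z = \<kappa>B (\<gamma> (\<rho> z))" for z
  have val: "\<gamma>' (\<kappa>A m) = \<kappa>B (\<gamma> m)" if m: "m \<in> carrier A" for m
  proof -
    have \<rho>: "\<rho> (\<kappa>A m) \<in> carrier A \<and> \<kappa>A (\<rho> (\<kappa>A m)) = \<kappa>A m"
      unfolding \<rho>_def by (rule someI[of _ m]) (use m in simp)
    then have "\<rho> (\<kappa>A m) \<ominus>\<^bsub>A\<^esub> m \<in> module_ideal A" using restriction_eq_iff[OF RA] m by blast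
    then have "\<gamma> (\<rho> (\<kappa>A m) \<ominus>\<^bsub>A\<^esub> m) \<in> module_ideal B" by (rule hom_module_ideal[OF ra(1) rb(1) \<gamma>])
    then have "\<gamma> (\<rho> (\<kappa>A m)) \<ominus>\<^bsub>B\<^esub> \<gamma> m \<in> module_ideal B" using hom_minus[OF ra(1) rb(1) \<gamma>] \<rho> m by simp
    then show ?thesis using restriction_eq_iff[OF RB] hom(1) \<rho> m by (simp add: \<gamma>'_def)
  qed
  have "eqmod_hom XT A' B' \<gamma>'" unfolding eqmod_hom_def
  proof (intro ballI conjI)
    fix z assume "z \<in> carrier A'"
    then obtain m where m: "m \<in> carrier A" "z = \<kappa>A m" using ra(3) by blast
    show "\<gamma>' z \<in> carrier B'" using val m hom(1) rb(4) by simp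
    show "\<gamma>' (z \<oplus>\<^bsub>A'\<^esub> z') = \<gamma>' z \<oplus>\<^bsub>B'\<^esub> \<gamma>' z'" if "z' \<in> carrier A'" for z'
    proof -
      obtain m' where m': "m' \<in> carrier A" "z' = \<kappa>A m'" using ra(3) \<open>z' \<in> carrier A'\<close> by blast
      show ?thesis using val[of "m \<oplus>\<^bsub>A\<^esub> m'"] val[of m] val[of m'] m m' ra(5)[of m m'] rb(5)[of "\<gamma> m" "\<gamma> m'"] hom by simp
    qed
    show "\<gamma>' (b \<odot>\<^bsub>A'\<^esub> z) = b \<odot>\<^bsub>B'\<^esub> \<gamma>' z" if b: "b \<in> pts_fun XT" for b
    proof -
      let ?a = "\<lambda>x\<in>pts XG. b (r x)"
      note a = lift_mem[OF b] pull_lift[OF b]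
      have c: "?a \<odot>\<^bsub>A\<^esub> m \<in> carrier A" using A.M.smult_closed[of ?a m] a m by simp
      have "\<gamma>' (b \<odot>\<^bsub>A'\<^esub> z) = \<gamma>' (\<kappa>A (?a \<odot>\<^bsub>A\<^esub> m))" using ra(6)[OF m(1) a(1)] a(2) m by simp
      also have "\<dots> = \<kappa>B (?a \<odot>\<^bsub>B\<^esub> \<gamma> m)" using val[OF c] eqmod_homD(3)[OF \<gamma> m(1) a(1)] by simp
      also have "\<dots> = b \<odot>\<^bsub>B'\<^esub> \<gamma>' z" using rb(6)[OF hom(1)[OF m(1)] a(1)] a(2) val[OF m(1)] m by simp
      finally show ?thesis .
    qed
    show "\<gamma>' (mact A' t z) = mact B' t (\<gamma>' z)" if t: "t \<in> carrier (grp XT)" for t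
    proof -
      note p = phi_closed[OF t]
      have "\<gamma>' (mact A' t z) = \<kappa>B (\<gamma> (mact A (\<phi> t) m))"
        using ra(7)[OF m(1) t] val[OF A.act_carrier[OF p m(1)]] m by simp
      then show ?thesis using hom(4)[OF p m(1)] rb(7)[OF hom(1)[OF m(1)] t] val[OF m(1)] m by simp
    qed
  qed
  then show ?thesis using that val by blast
qed

lemma module_ideal_surj:
  assumes A: "coherent_eqmod XG A" and B: "coherent_eqmod XG B" and \<gamma>: "eqmod_hom XG A B \<gamma>"
    and surj: "\<gamma> ` carrier A = carrier B" and z: "z \<in> module_ideal B"
  shows "\<exists>n\<in>module_ideal A. \<gamma> n = z"
proof -
  interpret A: eqmodule XG A by (rule eqmoduleG[OF A])
  interpret B: eqmodule XG B by (rule eqmoduleG[OF B])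
  note hom = hom_facts[OF A B \<gamma>]
  have "z \<in> B.ispan slice_ideal" using z by (simp add: module_ideal_def)
  then have "\<exists>n\<in>A.ispan slice_ideal. \<gamma> n = z"
  proof (induction rule: B.ispan.induct)
    case zero
    then show ?case using A.ispan.zero hom_zero[OF A B \<gamma>] by blast
  next
    case (add a m p)
    obtain n where n: "n \<in> A.ispan slice_ideal" "\<gamma> n = p" using add(4) by blast
    have "m \<in> \<gamma> ` carrier A" using add(2) by (simp only: surj)
    then obtain m0 where m0: "m0 \<in> carrier A" "\<gamma> m0 = m" by blast
    have a: "regG a" using add(1) by (simp add: slice_ideal_def)
    have "n \<in> carrier A" using A.ispan_carrier[OF slice_ideal_sub n(1)] .
    then have "\<gamma> (A.sm a m0 \<oplus>\<^bsub>A\<^esub> n) = B.sm a m \<oplus>\<^bsub>B\<^esub> p" using hom a m0 n by simp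
    then show ?case by (rule bexI[OF _ A.ispan.add[OF add(1) m0(1) n(1)]])
  qed
  then show ?thesis by (simp add: module_ideal_def)
qed

text \<open>Restriction to the slice is exact on equivariant modules.\<close>

lemma restriction_short_exact:
  assumes R': "restriction M' \<kappa>' N'" and R: "restriction M \<kappa> N" and R'': "restriction M'' \<kappa>'' N''"
    and ex: "short_exact XG M' M M''"
  shows "short_exact XT N' N N''"
proof -
  from ex obtain \<alpha> \<beta> where ab: "eqmod_hom XG M' M \<alpha>" "eqmod_hom XG M M'' \<beta>" "inj_on \<alpha> (carrier M')"
    "\<beta> ` carrier M = carrier M''" "\<alpha> ` carrier M' = {m\<in>carrier M. \<beta> m = \<zero>\<^bsub>M''\<^esub>}"
    unfolding short_exact_def by (elim exE conjE) (rule that)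
  note coh = restrictionD(1)[OF R'] restrictionD(1)[OF R] restrictionD(1)[OF R'']
  interpret M': eqmodule XG M' by (rule eqmoduleG[OF coh(1)])
  interpret M: eqmodule XG M by (rule eqmoduleG[OF coh(2)])
  interpret M'': eqmodule XG M'' by (rule eqmoduleG[OF coh(3)])
  interpret N: eqmodule XT N by (rule eqmoduleT[OF restrictionD(2)[OF R]])
  note homa = hom_facts[OF coh(1,2) ab(1)] and homb = hom_facts[OF coh(2,3) ab(2)]
  obtain \<alpha>' where \<alpha>': "eqmod_hom XT N' N \<alpha>'" "\<And>m. m \<in> carrier M' ==> \<alpha>' (\<kappa>' m) = \<kappa> (\<alpha> m)"
    by (rule induced_hom[OF R' R ab(1)]) (rule that)
  obtain \<beta>' where \<beta>': "eqmod_hom XT N N'' \<beta>'" "\<And>m. m \<in> carrier M ==> \<beta>' (\<kappa> m) = \<kappa>'' (\<beta> m)"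
    by (rule induced_hom[OF R R'' ab(2)]) (rule that)
  show ?thesis unfolding short_exact_def
  proof (intro exI[of _ \<alpha>'] exI[of _ \<beta>'] conjI)
    show "inj_on \<alpha>' (carrier N')"
    proof (rule inj_onI)
      fix z w assume "z \<in> carrier N'" "w \<in> carrier N'" and e: "\<alpha>' z = \<alpha>' w"
      then obtain m n where m: "m \<in> carrier M'" "z = \<kappa>' m" and n: "n \<in> carrier M'" "w = \<kappa>' n"
        using restrictionD(3)[OF R'] by blast
      have "\<kappa> (\<alpha> m) = \<kappa> (\<alpha> n)" using e \<alpha>'(2) m n by simp
      then have "\<alpha> m \<ominus>\<^bsub>M\<^esub> \<alpha> n \<in> module_ideal M" using restriction_eq_iff[OF R] homa(1) m n by blast
      then have "\<alpha> (m \<ominus>\<^bsub>M'\<^esub> n) \<in> module_ideal M" using hom_minus[OF coh(1,2) ab(1)] m n by simp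
      then have "m \<ominus>\<^bsub>M'\<^esub> n \<in> module_ideal M'"
        by (rule module_ideal_reflected[OF coh(1,2) ab(1,3), rotated]) (use m n in simp)
      then show "z = w" using restriction_eq_iff[OF R'] m n by blast
    qed
    show "\<beta>' ` carrier N = carrier N''"
    proof -
      have "\<beta>' ` carrier N = (\<lambda>m. \<kappa>'' (\<beta> m)) ` carrier M"
        unfolding restrictionD(3)[OF R, symmetric] image_image using \<beta>'(2) by (intro image_cong) auto
      also have "\<dots> = \<kappa>'' ` carrier M''" unfolding ab(4)[symmetric] image_image ..
      finally show ?thesis using restrictionD(3)[OF R''] by simp
    qed
    show "\<alpha>' ` carrier N' = {z \<in> carrier N. \<beta>' z = \<zero>\<^bsub>N''\<^esub>}"
    proof (intro equalityI subsetI)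
      fix z assume "z \<in> \<alpha>' ` carrier N'"
      then obtain m where m: "m \<in> carrier M'" "z = \<kappa> (\<alpha> m)"
        using restrictionD(3)[OF R'] \<alpha>'(2) by (metis imageE)
      have "\<alpha> m \<in> carrier M" "\<beta> (\<alpha> m) = \<zero>\<^bsub>M''\<^esub>" using ab(5) m(1) by blast+
      then show "z \<in> {z \<in> carrier N. \<beta>' z = \<zero>\<^bsub>N''\<^esub>}"
        using m \<beta>'(2) restriction_zero[OF R''] restrictionD(4)[OF R] by simp
    next
      fix z assume z: "z \<in> {z \<in> carrier N. \<beta>' z = \<zero>\<^bsub>N''\<^esub>}"
      then obtain m where m: "m \<in> carrier M" "z = \<kappa> m" using restrictionD(3)[OF R] by blast
      have "\<kappa>'' (\<beta> m) = \<zero>\<^bsub>N''\<^esub>" using z m \<beta>'(2) by simp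
      then have "\<beta> m \<in> module_ideal M''" using restrictionD(8)[OF R'' homb(1)[OF m(1)]] by simp
      then obtain n where n: "n \<in> module_ideal M" "\<beta> n = \<beta> m"
        using module_ideal_surj[OF coh(2,3) ab(2,4)] by blast
      have nM: "n \<in> carrier M" using M.ispan_carrier[OF slice_ideal_sub] n(1) by (simp add: module_ideal_def)
      have "\<beta> (m \<ominus>\<^bsub>M\<^esub> n) = \<zero>\<^bsub>M''\<^esub>"
        using hom_minus[OF coh(2,3) ab(2) m(1) nM] n(2) homb(1)[OF m(1)] by (simp add: M''.M.r_neg M''.M.minus_eq)
      then have "m \<ominus>\<^bsub>M\<^esub> n \<in> \<alpha> ` carrier M'" using ab(5) m(1) nM by simp
      then obtain p where p: "p \<in> carrier M'" "\<alpha> p = m \<ominus>\<^bsub>M\<^esub> n" by (metis imageE)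
      have "\<kappa> n = \<zero>\<^bsub>N\<^esub>" using restrictionD(8)[OF R nM] n(1) by simp
      then have "\<kappa> (\<alpha> p) = z"
        using p(2) restriction_minus[OF R m(1) nM] m(2) restrictionD(4)[OF R m(1)] by (simp add: N.M.minus_eq)
      then have "\<alpha>' (\<kappa>' p) = z" using \<alpha>'(2)[OF p(1)] by simp
      then show "z \<in> \<alpha>' ` carrier N'" using restrictionD(4)[OF R' p(1)] by blast
    qed
  qed (rule \<alpha>'(1), rule \<beta>'(1))
qed

lemma module_ideal_iff:
  assumes M: "coherent_eqmod XG M" and m: "m \<in> carrier M" "n \<in> carrier M"
  shows "m \<ominus>\<^bsub>M\<^esub> n \<in> module_ideal M \<longleftrightarrow> (\<exists>p\<in>module_ideal M. m = p \<oplus>\<^bsub>M\<^esub> n)"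
proof -
  interpret M: eqmodule XG M by (rule eqmoduleG[OF M])
  have c: "p \<in> carrier M" if "p \<in> module_ideal M" for p
    using that M.ispan_carrier[OF slice_ideal_sub] by (simp add: module_ideal_def)
  have 1: "m = (m \<ominus>\<^bsub>M\<^esub> n) \<oplus>\<^bsub>M\<^esub> n" using m by (simp add: M.M.minus_eq M.M.a_assoc M.M.l_neg)
  have 2: "(p \<oplus>\<^bsub>M\<^esub> n) \<ominus>\<^bsub>M\<^esub> n = p" if "p \<in> carrier M" for p
    using that m by (simp add: M.M.minus_eq M.M.a_assoc M.M.r_neg)
  show ?thesis using 1 2 c by metis
qed

end

context slice
begin

text \<open>The quotient by \<open>I M\<close>, transported along any map \<open>\<kappa>\<close> with the right fibres, so that its elements can
  be of any sufficiently large type.\<close>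

definition quotient :: "('x => 'k, 'm, 'h) eqmod => ('m => 'n) => ('y => 'k, 'n, 't) eqmod" where
  "quotient M \<kappa> = (let \<rho> = (\<lambda>z. SOME m. m \<in> carrier M \<and> \<kappa> m = z) in
    \<lparr>carrier = \<kappa> ` carrier M, monoid.mult = undefined, one = undefined, zero = \<kappa> \<zero>\<^bsub>M\<^esub>,
     add = (\<lambda>z w. \<kappa> (\<rho> z \<oplus>\<^bsub>M\<^esub> \<rho> w)), module.smult = (\<lambda>b z. \<kappa> ((\<lambda>x\<in>pts XG. b (r x)) \<odot>\<^bsub>M\<^esub> \<rho> z)),
     mact = (\<lambda>t z. \<kappa> (mact M (\<phi> t) (\<rho> z)))\<rparr>)"

lemma restriction_quotient:
  fixes M (structure)
  assumes M: "coherent_eqmod XG M"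
    and \<kappa>: "\<And>m n. m \<in> carrier M ==> n \<in> carrier M ==> \<kappa> m = \<kappa> n \<longleftrightarrow> m \<ominus> n \<in> module_ideal M"
  shows "restriction M \<kappa> (quotient M \<kappa>)"
proof -
  interpret M: eqmodule XG M by (rule eqmoduleG[OF M])
  let ?N = "quotient M \<kappa>" and ?I = "module_ideal M"
  define \<rho> where "\<rho> z = (SOME m. m \<in> carrier M \<and> \<kappa> m = z)" for z
  have N_sel: "carrier ?N = \<kappa> ` carrier M" "\<zero>\<^bsub>?N\<^esub> = \<kappa> \<zero>" "\<And>z w. z \<oplus>\<^bsub>?N\<^esub> w = \<kappa> (\<rho> z \<oplus> \<rho> w)"
    "\<And>b z. b \<odot>\<^bsub>?N\<^esub> z = \<kappa> (lift b \<odot> \<rho> z)" "\<And>t z. mact ?N t z = \<kappa> (mact M (\<phi> t) (\<rho> z))"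
    by (simp_all add: quotient_def \<rho>_def Let_def)
  have Ic: "p \<in> carrier M" if "p \<in> ?I" for p
    using that M.ispan_carrier[OF slice_ideal_sub] by (simp add: module_ideal_def)
  have \<kappa>': "\<kappa> m = \<kappa> n \<longleftrightarrow> (\<exists>p\<in>?I. m = p \<oplus> n)" if "m \<in> carrier M" "n \<in> carrier M" for m n
    using \<kappa>[OF that] module_ideal_iff[OF M that] by simp
  have \<rho>: "\<rho> (\<kappa> m) \<in> carrier M" "\<exists>p\<in>?I. \<rho> (\<kappa> m) = p \<oplus> m" if m: "m \<in> carrier M" for m
  proof -
    have *: "\<rho> (\<kappa> m) \<in> carrier M \<and> \<kappa> (\<rho> (\<kappa> m)) = \<kappa> m"
      unfolding \<rho>_def by (rule someI[of _ m]) (use m in simp)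
    then show "\<rho> (\<kappa> m) \<in> carrier M" by (rule conjunct1)
    from * show "\<exists>p\<in>?I. \<rho> (\<kappa> m) = p \<oplus> m" by (elim conjE) (rule iffD1[OF \<kappa>'[OF _ m]])
  qed
  have \<kappa>I: "\<kappa> m = \<kappa> n" if "m \<in> carrier M" "n \<in> carrier M" "p \<in> ?I" "m = p \<oplus> n" for m n p
    using \<kappa>'[OF that(1,2)] that(3,4) by blast
  have Iadd: "p \<oplus> q \<in> ?I" if "p \<in> ?I" "q \<in> ?I" for p q
    using that M.ispan_add[OF slice_ideal_sub] by (simp add: module_ideal_def)
  have Ism: "M.sm a p \<in> ?I" if "regG a" "p \<in> ?I" for a p
    using that M.ispan_sm[OF slice_ideal_sub that(1) slice_ideal_mult[OF that(1)]] by (simp add: module_ideal_def)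
  have Iact: "mact M (\<phi> t) p \<in> ?I" if "t \<in> carrier (grp XT)" "p \<in> ?I" for t p
    using that M.ispan_act[OF slice_ideal_sub phi_closed[OF that(1)] slice_ideal_act[OF that(1)]] by (simp add: module_ideal_def)
  have add: "\<kappa> m \<oplus>\<^bsub>?N\<^esub> \<kappa> n = \<kappa> (m \<oplus> n)" if m: "m \<in> carrier M" "n \<in> carrier M" for m n
  proof -
    obtain p where p: "p \<in> ?I" "\<rho> (\<kappa> m) = p \<oplus> m" using \<rho>(2)[OF m(1)] by (elim bexE) (rule that)
    obtain q where q: "q \<in> ?I" "\<rho> (\<kappa> n) = q \<oplus> n" using \<rho>(2)[OF m(2)] by (elim bexE) (rule that)
    have e: "\<rho> (\<kappa> m) \<oplus> \<rho> (\<kappa> n) = (p \<oplus> q) \<oplus> (m \<oplus> n)"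
      unfolding p(2) q(2) using m Ic[OF p(1)] Ic[OF q(1)] by (simp add: M.M.a_ac)
    have "\<kappa> (\<rho> (\<kappa> m) \<oplus> \<rho> (\<kappa> n)) = \<kappa> (m \<oplus> n)"
      by (rule \<kappa>I[OF M.M.a_closed[OF \<rho>(1)[OF m(1)] \<rho>(1)[OF m(2)]] M.M.a_closed[OF m] Iadd[OF p(1) q(1)] e])
    then show ?thesis by (simp only: N_sel)
  qed
  have smult: "b \<odot>\<^bsub>?N\<^esub> \<kappa> m = \<kappa> (lift b \<odot> m)" if b: "b \<in> pts_fun XT" and m: "m \<in> carrier M" for b m
  proof -
    let ?a = "lift b"
    have a: "?a \<in> pts_fun XG" "regG ?a" using lift_mem[OF b] G.pts.regf_mem by blast+
    obtain p where p: "p \<in> ?I" "\<rho> (\<kappa> m) = p \<oplus> m" using \<rho>(2)[OF m] by (elim bexE) (rule that)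
    have e: "M.sm ?a (\<rho> (\<kappa> m)) = M.sm ?a p \<oplus> M.sm ?a m"
      unfolding p(2) by (rule M.sm_add_r[OF a(2) Ic[OF p(1)] m])
    have "\<kappa> (M.sm ?a (\<rho> (\<kappa> m))) = \<kappa> (M.sm ?a m)"
      by (rule \<kappa>I[OF M.sm_closed[OF a(2) \<rho>(1)[OF m]] M.sm_closed[OF a(2) m] Ism[OF a(2) p(1)] e])
    then show ?thesis by (simp only: N_sel M.smult_eq_sm[OF a(1)])
  qed
  have act: "mact ?N t (\<kappa> m) = \<kappa> (mact M (\<phi> t) m)" if t: "t \<in> carrier (grp XT)" and m: "m \<in> carrier M" for t m
  proof -
    note pt = phi_closed[OF t]
    obtain p where p: "p \<in> ?I" "\<rho> (\<kappa> m) = p \<oplus> m" using \<rho>(2)[OF m] by (elim bexE) (rule that)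
    have e: "mact M (\<phi> t) (\<rho> (\<kappa> m)) = mact M (\<phi> t) p \<oplus> mact M (\<phi> t) m"
      unfolding p(2) by (rule M.act_add[OF pt Ic[OF p(1)] m])
    have "\<kappa> (mact M (\<phi> t) (\<rho> (\<kappa> m))) = \<kappa> (mact M (\<phi> t) m)"
      by (rule \<kappa>I[OF M.act_carrier[OF pt \<rho>(1)[OF m]] M.act_carrier[OF pt m] Iact[OF t p(1)] e])
    then show ?thesis by (simp only: N_sel)
  qed
  have smult': "\<kappa> (a \<odot> m) = pull a \<odot>\<^bsub>?N\<^esub> \<kappa> m" if a: "a \<in> pts_fun XG" and m: "m \<in> carrier M" for a m
  proof -
    let ?b = "\<lambda>x\<in>pts XG. pull a (r x)"
    note b = lift_mem[OF pull_mem[OF a]]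
    have ra: "regG a" "regG ?b" using a b G.pts.regf_mem by blast+
    define c where "c = (\<lambda>x. a x - ?b x)"
    have c: "regG c" "c \<in> slice_ideal"
      using G.pts.regf_diff[OF ra] iota_closed r_iota by (auto simp: c_def slice_ideal_def pull_def)
    have "M.sm a m = M.sm (\<lambda>x. c x + ?b x) m" by (rule M.sm_cong) (simp add: c_def)
    also have "\<dots> = M.sm c m \<oplus> M.sm ?b m" by (rule M.sm_add_l[OF c(1) ra(2) m])
    finally have e: "M.sm a m = M.sm c m \<oplus> M.sm ?b m" .
    have cI: "M.sm c m \<in> ?I" using M.ispan_gen[OF slice_ideal_sub c(2) m] by (simp add: module_ideal_def)
    have "\<kappa> (M.sm a m) = \<kappa> (M.sm ?b m)"
      by (rule \<kappa>I[OF M.sm_closed[OF ra(1) m] M.sm_closed[OF ra(2) m] cI e])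
    then show ?thesis using smult[OF pull_mem[OF a] m] by (simp only: M.smult_eq_sm[OF a] M.smult_eq_sm[OF b])
  qed
  have sc: "a \<odot> m \<in> carrier M" if "a \<in> pts_fun XG" "m \<in> carrier M" for a m
    using M.M.smult_closed[of a m] that by simp
  have ab: "abelian_group ?N"
  proof (rule abelian_groupI)
    fix z w assume "z \<in> carrier ?N" "w \<in> carrier ?N"
    then obtain m n where m: "m \<in> carrier M" "z = \<kappa> m" and n: "n \<in> carrier M" "w = \<kappa> n" unfolding N_sel by blast
    show "z \<oplus>\<^bsub>?N\<^esub> w \<in> carrier ?N" "z \<oplus>\<^bsub>?N\<^esub> w = w \<oplus>\<^bsub>?N\<^esub> z"
      using m n by (simp_all add: add M.M.a_comm N_sel(1))
    fix v assume "v \<in> carrier ?N"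
    then obtain l where "l \<in> carrier M" "v = \<kappa> l" unfolding N_sel by blast
    then show "z \<oplus>\<^bsub>?N\<^esub> w \<oplus>\<^bsub>?N\<^esub> v = z \<oplus>\<^bsub>?N\<^esub> (w \<oplus>\<^bsub>?N\<^esub> v)" using m n by (simp add: add M.M.a_assoc)
  next
    fix z assume "z \<in> carrier ?N"
    then obtain m where m: "m \<in> carrier M" "z = \<kappa> m" unfolding N_sel by blast
    show "\<zero>\<^bsub>?N\<^esub> \<oplus>\<^bsub>?N\<^esub> z = z" using m by (simp add: N_sel(2) add)
    have "\<kappa> (\<ominus> m) \<oplus>\<^bsub>?N\<^esub> z = \<zero>\<^bsub>?N\<^esub>" using m by (simp add: N_sel(2) add M.M.l_neg)
    then show "\<exists>w\<in>carrier ?N. w \<oplus>\<^bsub>?N\<^esub> z = \<zero>\<^bsub>?N\<^esub>" using m by (auto simp: N_sel(1))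
  qed (simp add: N_sel)
  interpret N: abelian_group ?N by (rule ab)
  have mod: "module (coord_ring XT) ?N"
  proof (rule moduleI[OF T.cring_coord ab])
    fix b z assume "b \<in> carrier (coord_ring XT)" "z \<in> carrier ?N"
    then obtain m where b: "b \<in> pts_fun XT" and m: "m \<in> carrier M" "z = \<kappa> m" unfolding N_sel by auto
    note lb = lift_mem[OF b]
    show "b \<odot>\<^bsub>?N\<^esub> z \<in> carrier ?N" using smult[OF b m(1)] sc[OF lb m(1)] m(2) by (simp add: N_sel(1))
    { fix w assume "w \<in> carrier ?N"
      then obtain n where n: "n \<in> carrier M" "w = \<kappa> n" unfolding N_sel by blast
      have "lift b \<odot> (m \<oplus> n) = lift b \<odot> m \<oplus> lift b \<odot> n"
        by (rule M.M.smult_r_distr) (use lb m n in simp_all)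
      then show "b \<odot>\<^bsub>?N\<^esub> (z \<oplus>\<^bsub>?N\<^esub> w) = b \<odot>\<^bsub>?N\<^esub> z \<oplus>\<^bsub>?N\<^esub> b \<odot>\<^bsub>?N\<^esub> w"
        using m n sc[OF lb] by (simp add: add smult[OF b]) }
    fix b' assume "b' \<in> carrier (coord_ring XT)"
    then have b': "b' \<in> pts_fun XT" by simp
    note lb' = lift_mem[OF b']
    have s: "b \<oplus>\<^bsub>coord_ring XT\<^esub> b' \<in> pts_fun XT" "b \<otimes>\<^bsub>coord_ring XT\<^esub> b' \<in> pts_fun XT"
      using T.pts.regf_add[OF T.pts.regf_mem[OF b] T.pts.regf_mem[OF b']] T.pts.regf_mult[OF T.pts.regf_mem[OF b] T.pts.regf_mem[OF b']]
      by (simp_all add: regf_def)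
    have l: "(\<lambda>x\<in>pts XG. (b \<oplus>\<^bsub>coord_ring XT\<^esub> b') (r x)) = lift b \<oplus>\<^bsub>coord_ring XG\<^esub> lift b'"
      "(\<lambda>x\<in>pts XG. (b \<otimes>\<^bsub>coord_ring XT\<^esub> b') (r x)) = lift b \<otimes>\<^bsub>coord_ring XG\<^esub> lift b'"
      using r_closed by (auto simp: fun_eq_iff)
    have "(lift b \<oplus>\<^bsub>coord_ring XG\<^esub> lift b') \<odot> m =
        lift b \<odot> m \<oplus> lift b' \<odot> m"
      "(lift b \<otimes>\<^bsub>coord_ring XG\<^esub> lift b') \<odot> m =
        lift b \<odot> (lift b' \<odot> m)"
      by (rule M.M.smult_l_distr M.M.smult_assoc1; use lb lb' m in \<open>simp only: G.coord_ring_sel\<close>; fail)+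
    then show "(b \<oplus>\<^bsub>coord_ring XT\<^esub> b') \<odot>\<^bsub>?N\<^esub> z = b \<odot>\<^bsub>?N\<^esub> z \<oplus>\<^bsub>?N\<^esub> b' \<odot>\<^bsub>?N\<^esub> z"
      "(b \<otimes>\<^bsub>coord_ring XT\<^esub> b') \<odot>\<^bsub>?N\<^esub> z = b \<odot>\<^bsub>?N\<^esub> (b' \<odot>\<^bsub>?N\<^esub> z)"
      unfolding m(2) smult[OF s(1) m(1)] smult[OF s(2) m(1)] smult[OF b m(1)] smult[OF b' m(1)] l
      by (simp_all only: add[OF sc[OF lb m(1)] sc[OF lb' m(1)]] smult[OF b sc[OF lb' m(1)]])
  next
    fix z assume "z \<in> carrier ?N"
    then obtain m where m: "m \<in> carrier M" "z = \<kappa> m" unfolding N_sel by blast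
    have o: "\<one>\<^bsub>coord_ring XT\<^esub> \<in> pts_fun XT" using T.pts.regf_const[of 1] by (simp add: regf_def)
    have "(\<lambda>x\<in>pts XG. \<one>\<^bsub>coord_ring XT\<^esub> (r x)) = \<one>\<^bsub>coord_ring XG\<^esub>" using r_closed by (auto simp: fun_eq_iff)
    then show "\<one>\<^bsub>coord_ring XT\<^esub> \<odot>\<^bsub>?N\<^esub> z = z" using smult[OF o m(1)] M.M.smult_one[OF m(1)] m(2) by (simp only:)
  qed
  have \<kappa>_msum: "\<kappa> (msum M xs) = msum ?N (map \<kappa> xs)" if "set xs \<subseteq> carrier M" for xs
    using that
  proof (induction xs)
    case Nil then show ?case by (simp add: N_sel(2))
  next
    case (Cons x xs)
    then show ?case using M.M.msum_closed[of xs] by (simp add: add[symmetric])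
  qed
  obtain ss where ss: "set ss \<subseteq> carrier M"
    "\<And>m. m \<in> carrier M ==> \<exists>a. (\<forall>i<length ss. a i \<in> pts_fun XG) \<and> m = msum M (map (\<lambda>i. a i \<odot> ss ! i) [0..<length ss])"
    by (rule G.coherent_generators[OF M]) (rule that)
  have gen: "\<exists>q. q \<in> \<kappa> ` set ss \<rightarrow> pts_fun XT \<and> z = finsum ?N (\<lambda>s. q s \<odot>\<^bsub>?N\<^esub> s) (\<kappa> ` set ss)" if "z \<in> carrier ?N" for z
  proof -
    obtain m where m: "m \<in> carrier M" "z = \<kappa> m" using \<open>z \<in> carrier ?N\<close> unfolding N_sel by blast
    obtain a where a: "\<forall>i<length ss. a i \<in> pts_fun XG" "m = msum M (map (\<lambda>i. a i \<odot> ss ! i) [0..<length ss])"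
      using ss(2)[OF m(1)] by blast
    have si: "ss ! i \<in> carrier M" if "i < length ss" for i using ss(1) that by auto
    let ?L = "map (\<lambda>i. (pull (a i), \<kappa> (ss ! i))) [0..<length ss]"
    have "z = msum ?N (map \<kappa> (map (\<lambda>i. a i \<odot> ss ! i) [0..<length ss]))"
      unfolding m(2) a(2) by (rule \<kappa>_msum) (use a(1) si sc in auto)
    also have "map \<kappa> (map (\<lambda>i. a i \<odot> ss ! i) [0..<length ss]) = map (\<lambda>(b, s). b \<odot>\<^bsub>?N\<^esub> s) ?L"
      using a(1) si smult' by auto
    finally have z: "z = msum ?N (map (\<lambda>(b, s). b \<odot>\<^bsub>?N\<^esub> s) ?L)" .
    show ?thesis unfolding z
      by (rule T.finite_generationI[OF mod]) (use ss(1) a(1) pull_mem in \<open>auto simp: N_sel(1)\<close>)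
  qed
  have rat: "\<exists>(n::nat) c w. (\<forall>i<n. c i \<in> grp_fun XT \<and> w i \<in> carrier ?N) \<and>
       (\<forall>h\<in>carrier (grp XT). mact ?N h z = finsum ?N (\<lambda>i. (\<lambda>x\<in>pts XT. c i h) \<odot>\<^bsub>?N\<^esub> w i) {..<n})" if "z \<in> carrier ?N" for z
  proof -
    obtain m where m: "m \<in> carrier M" "z = \<kappa> m" using \<open>z \<in> carrier ?N\<close> unfolding N_sel by blast
    from M m(1) obtain n :: nat and c w where cw: "\<forall>i<n. c i \<in> grp_fun XG \<and> w i \<in> carrier M"
      "\<forall>h\<in>carrier (grp XG). mact M h m = finsum M (\<lambda>i. (\<lambda>x\<in>pts XG. c i h) \<odot> w i) {..<n}"
      unfolding coherent_eqmod_def by (elim conjE ballE[of _ _ m] exE) (rule that, auto)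
    have kc: "(\<lambda>x\<in>pts XG. e) \<in> pts_fun XG" "(\<lambda>x\<in>pts XT. e) \<in> pts_fun XT" for e
      using G.pts.regf_const[of e] T.pts.regf_const[of e] by (simp_all add: regf_def)
    have pk: "pull (\<lambda>x\<in>pts XG. e) = (\<lambda>x\<in>pts XT. e)" for e using iota_closed by (auto simp: pull_def fun_eq_iff)
    define c' where "c' i = (\<lambda>t\<in>carrier (grp XT). c i (\<phi> t))" for i
    have "mact ?N t z = finsum ?N (\<lambda>i. (\<lambda>x\<in>pts XT. c' i t) \<odot>\<^bsub>?N\<^esub> \<kappa> (w i)) {..<n}" if t: "t \<in> carrier (grp XT)" for t
    proof -
      have k: "(\<lambda>x\<in>pts XT. c' i t) \<odot>\<^bsub>?N\<^esub> \<kappa> (w i) = \<kappa> ((\<lambda>x\<in>pts XG. c i (\<phi> t)) \<odot> w i)" if "i < n" for i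
        using smult'[OF kc(1), of "w i" "c i (\<phi> t)"] cw(1) that t by (simp add: c'_def pk)
      have s: "(\<lambda>x\<in>pts XG. c i (\<phi> t)) \<odot> w i \<in> carrier M" if "i < n" for i
        using sc[OF kc(1)] cw(1) that by blast
      have "finsum ?N (\<lambda>i. (\<lambda>x\<in>pts XT. c' i t) \<odot>\<^bsub>?N\<^esub> \<kappa> (w i)) {..<n} =
          msum ?N (map (\<lambda>i. (\<lambda>x\<in>pts XT. c' i t) \<odot>\<^bsub>?N\<^esub> \<kappa> (w i)) [0..<n])"
        by (rule N.finsum_lessThan_msum) (simp add: k s N_sel(1))
      also have "map (\<lambda>i. (\<lambda>x\<in>pts XT. c' i t) \<odot>\<^bsub>?N\<^esub> \<kappa> (w i)) [0..<n] = map \<kappa> (map (\<lambda>i. (\<lambda>x\<in>pts XG. c i (\<phi> t)) \<odot> w i) [0..<n])"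
        using k by simp
      also have "msum ?N \<dots> = \<kappa> (msum M (map (\<lambda>i. (\<lambda>x\<in>pts XG. c i (\<phi> t)) \<odot> w i) [0..<n]))"
        by (rule \<kappa>_msum[symmetric]) (use s in auto)
      also have "msum M (map (\<lambda>i. (\<lambda>x\<in>pts XG. c i (\<phi> t)) \<odot> w i) [0..<n]) = mact M (\<phi> t) m"
        using cw(2) phi_closed[OF t] M.M.finsum_lessThan_msum[of n, OF s] by simp
      finally show ?thesis unfolding m(2) act[OF t m(1)] by (rule sym)
    qed
    moreover have "c' i \<in> grp_fun XT" if "i < n" for i using phi_regf cw(1) that by (simp add: c'_def regf_def)
    ultimately show ?thesis using cw(1) by (intro exI[of _ n] exI[of _ c'] exI[of _ "\<lambda>i. \<kappa> (w i)"]) (auto simp: N_sel(1))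
  qed
  have coh: "coherent_eqmod XT ?N" unfolding coherent_eqmod_def
  proof (intro conjI ballI)
    show "\<exists>S. finite S \<and> S \<subseteq> carrier ?N \<and> (\<forall>m\<in>carrier ?N. \<exists>r. r \<in> S \<rightarrow> pts_fun XT \<and> m = finsum ?N (\<lambda>s. r s \<odot>\<^bsub>?N\<^esub> s) S)"
      by (rule exI[of _ "\<kappa> ` set ss"]) (use gen ss(1) in \<open>auto simp: N_sel(1)\<close>)
  next
    fix z assume "z \<in> carrier ?N"
    then obtain m where m: "m \<in> carrier M" "z = \<kappa> m" unfolding N_sel by blast
    show "mact ?N \<one>\<^bsub>grp XT\<^esub> z = z" using act[OF T.G.one_closed m(1)] m M.act_1 by (simp add: phi_one)
    fix t assume t: "t \<in> carrier (grp XT)"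
    note pt = phi_closed[OF t]
    note mt = M.act_carrier[OF pt m(1)]
    show "mact ?N t z \<in> carrier ?N" using act[OF t m(1)] m(2) mt by (simp add: N_sel(1))
    show "mact ?N (s \<otimes>\<^bsub>grp XT\<^esub> t) z = mact ?N s (mact ?N t z)" if s: "s \<in> carrier (grp XT)" for s
      using act[OF T.G.m_closed[OF s t] m(1)] act[OF t m(1)] act[OF s mt] M.act_comp[OF phi_closed[OF s] pt m(1)] m(2)
      by (simp add: phi_mult[OF s t])
    show "mact ?N t (z \<oplus>\<^bsub>?N\<^esub> w) = mact ?N t z \<oplus>\<^bsub>?N\<^esub> mact ?N t w" if "w \<in> carrier ?N" for w
    proof -
      obtain n where n: "n \<in> carrier M" "w = \<kappa> n" using \<open>w \<in> carrier ?N\<close> unfolding N_sel by blast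
      show ?thesis using act[OF t M.M.a_closed[OF m(1) n(1)]] act[OF t m(1)] act[OF t n(1)] M.act_add[OF pt m(1) n(1)]
          mt M.act_carrier[OF pt n(1)] m n by (simp add: add)
    qed
    show "mact ?N t (b \<odot>\<^bsub>?N\<^esub> z) = (\<lambda>x\<in>pts XT. b (gact XT (inv\<^bsub>grp XT\<^esub> t) x)) \<odot>\<^bsub>?N\<^esub> mact ?N t z" if b: "b \<in> pts_fun XT" for b
    proof -
      let ?a = "lift b"
      let ?g = "inv\<^bsub>grp XG\<^esub> (\<phi> t)"
      let ?a' = "\<lambda>x\<in>pts XG. ?a (gact XG ?g x)"
      note a = lift_mem[OF b]
      have g: "?g \<in> carrier (grp XG)" using pt by simp
      have a': "?a' \<in> pts_fun XG" using G.regf_translate[OF a g] by (simp add: regf_def)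
      have ra: "regG ?a" using G.pts.regf_mem[OF a] .
      have "mact ?N t (b \<odot>\<^bsub>?N\<^esub> z) = \<kappa> (mact M (\<phi> t) (?a \<odot> m))"
        using smult[OF b m(1)] act[OF t sc[OF a m(1)]] m(2) by simp
      also have "mact M (\<phi> t) (?a \<odot> m) = ?a' \<odot> mact M (\<phi> t) m"
        using M.act_sm[OF pt m(1) ra] unfolding M.smult_eq_sm[OF a] by (simp only: M.sm_def)
      also have "\<kappa> \<dots> = pull ?a' \<odot>\<^bsub>?N\<^esub> \<kappa> (mact M (\<phi> t) m)" by (rule smult'[OF a' mt])
      also have "pull ?a' = (\<lambda>x\<in>pts XT. b (gact XT (inv\<^bsub>grp XT\<^esub> t) x))"
      proof -
        have "?a' (\<iota> y) = b (gact XT (inv\<^bsub>grp XT\<^esub> t) y)" if y: "y \<in> pts XT" for y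
        proof -
          have ti: "inv\<^bsub>grp XT\<^esub> t \<in> carrier (grp XT)" using t by simp
          have "gact XG ?g (\<iota> y) = \<iota> (gact XT (inv\<^bsub>grp XT\<^esub> t) y)"
            using iota_act[OF ti y] phi_inv[OF t] by simp
          then show ?thesis using y iota_closed T.act_closed[OF ti y] r_iota by simp
        qed
        then show ?thesis by (auto simp: pull_def fun_eq_iff)
      qed
      finally show ?thesis unfolding act[OF t m(1), folded m(2)] .
    qed
  qed (rule mod, rule rat)
  have ker: "\<kappa> m = \<zero>\<^bsub>?N\<^esub> \<longleftrightarrow> m \<in> ?I" if m: "m \<in> carrier M" for m
    using \<kappa>[OF m M.M.zero_closed] m M.M.minus_equality[of "\<zero>" "\<zero>"]
    by (simp add: N_sel(2) M.M.minus_eq)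
  show ?thesis unfolding restriction_def
    using M coh add smult' act ker N_sel(1) by simp
qed

text \<open>A class modulo \<open>I M\<close> is encoded by the values on the slice of the coefficients of a chosen representative with
  respect to finitely many generators. The injection \<open>e\<close> packs these finitely many functions into one.\<close>

lemma ex_restriction:
  fixes M :: "('x => 'k, 'm, 'h) eqmod" (structure) and e :: "nat \<times> 'y => 'y"
  assumes M: "coherent_eqmod XG M" and e: "inj_on e (UNIV \<times> pts XT)"
  shows "\<exists>(\<kappa> :: 'm => 'y => 'k) N. restriction M \<kappa> N"
proof -
  interpret M: eqmodule XG M by (rule eqmoduleG[OF M])
  obtain ss where ss: "set ss \<subseteq> carrier M"
    "\<And>m. m \<in> carrier M ==> \<exists>a. (\<forall>i<length ss. a i \<in> pts_fun XG) \<and> m = msum M (map (\<lambda>i. a i \<odot> ss ! i) [0..<length ss])"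
    by (rule G.coherent_generators[OF M]) (rule that)
  let ?n = "length ss" and ?I = "module_ideal M"
  define cl where "cl m = {n \<in> carrier M. n \<ominus> m \<in> ?I}" for m
  define co where "co m = (SOME a. (\<forall>i<?n. a i \<in> pts_fun XG) \<and> m = msum M (map (\<lambda>i. a i \<odot> ss ! i) [0..<?n]))" for m
  have co: "\<forall>i<?n. co m i \<in> pts_fun XG" "m = msum M (map (\<lambda>i. co m i \<odot> ss ! i) [0..<?n])" if "m \<in> carrier M" for m
    using someI_ex[OF ss(2)[OF that]] unfolding co_def by blast+
  define \<rho> where "\<rho> m = (SOME n. n \<in> cl m)" for m
  define \<kappa> :: "'m => 'y => 'k" where
    "\<kappa> m v = (let p = inv_into ({..<?n} \<times> pts XT) e v in pull (co (\<rho> m) (fst p)) (snd p))" for m v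
  have Ic: "p \<in> carrier M" if "p \<in> ?I" for p
    using that M.ispan_carrier[OF slice_ideal_sub] by (simp add: module_ideal_def)
  have I0: "\<zero> \<in> ?I" using M.ispan.zero by (simp add: module_ideal_def)
  have Iadd: "p \<oplus> q \<in> ?I" if "p \<in> ?I" "q \<in> ?I" for p q
    using that M.ispan_add[OF slice_ideal_sub] by (simp add: module_ideal_def)
  have Ineg: "\<ominus> p \<in> ?I" if "p \<in> ?I" for p
    using that M.ispan_sm[OF slice_ideal_sub G.pts.regf_const slice_ideal_mult[OF G.pts.regf_const], of p "- 1"] M.sm_neg[OF Ic[OF that]]
    by (simp add: module_ideal_def)
  have tr: "l \<ominus> n = (l \<ominus> m) \<oplus> (m \<ominus> n)" if "l \<in> carrier M" "m \<in> carrier M" "n \<in> carrier M" for l m n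
  proof -
    have "(l \<oplus> \<ominus> m) \<oplus> (m \<oplus> \<ominus> n) = l \<oplus> ((\<ominus> m \<oplus> m) \<oplus> \<ominus> n)"
      using that by (simp only: M.M.a_assoc M.M.a_closed M.M.a_inv_closed)
    then show ?thesis using that by (simp add: M.M.minus_eq M.M.l_neg)
  qed
  have sy: "n \<ominus> m = \<ominus> (m \<ominus> n)" if "m \<in> carrier M" "n \<in> carrier M" for m n
    using that by (simp add: M.M.minus_eq M.M.minus_add M.M.a_comm)
  have \<rho>: "\<rho> m \<in> carrier M" "\<rho> m \<ominus> m \<in> ?I" if "m \<in> carrier M" for m
  proof -
    have "m \<in> cl m" using that I0 by (simp add: cl_def M.M.minus_eq M.M.r_neg)
    then have "\<rho> m \<in> cl m" unfolding \<rho>_def by (rule someI)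
    then show "\<rho> m \<in> carrier M" "\<rho> m \<ominus> m \<in> ?I" by (simp_all add: cl_def)
  qed
  have \<kappa>_e: "\<kappa> m (e (i, y)) = pull (co (\<rho> m) i) y" if "i < ?n" "y \<in> pts XT" for m i y
  proof -
    have "inj_on e ({..<?n} \<times> pts XT)" by (rule inj_on_subset[OF e]) auto
    then have "inv_into ({..<?n} \<times> pts XT) e (e (i, y)) = (i, y)" using that by (intro inv_into_f_f) auto
    then show ?thesis by (simp add: \<kappa>_def)
  qed
  have "\<kappa> m = \<kappa> m' \<longleftrightarrow> m \<ominus> m' \<in> ?I" if m: "m \<in> carrier M" "m' \<in> carrier M" for m m'
  proof
    assume mm: "m \<ominus> m' \<in> ?I"
    have "n \<in> cl m \<longleftrightarrow> n \<in> cl m'" for n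
    proof -
      have "n \<ominus> m \<in> ?I \<longleftrightarrow> n \<ominus> m' \<in> ?I" if n: "n \<in> carrier M"
        using tr[OF n m(1) m(2)] tr[OF n m(2) m(1)] sy[OF m] mm Iadd Ineg by metis
      then show ?thesis by (auto simp: cl_def)
    qed
    then have "cl m = cl m'" by blast
    then have "\<rho> m = \<rho> m'" by (simp add: \<rho>_def)
    then show "\<kappa> m = \<kappa> m'" by (simp add: \<kappa>_def fun_eq_iff)
  next
    assume k: "\<kappa> m = \<kappa> m'"
    let ?a = "co (\<rho> m)" and ?a' = "co (\<rho> m')"
    let ?L = "map (\<lambda>i. (i, ss ! i)) [0..<?n]"
    note c = co[OF \<rho>(1)[OF m(1)]] and c' = co[OF \<rho>(1)[OF m(2)]]
    have si: "ss ! i \<in> carrier M" if "i < ?n" for i using ss(1) that by auto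
    have lc: "lc0 = M.lc (co p) ?L" if "lc0 = p" "p = \<rho> m \<or> p = \<rho> m'" for p lc0
    proof -
      have cp: "\<forall>i<?n. co p i \<in> pts_fun XG" "p = msum M (map (\<lambda>i. co p i \<odot> ss ! i) [0..<?n])"
        using c c' \<open>p = \<rho> m \<or> p = \<rho> m'\<close> by auto
      have "map (\<lambda>i. co p i \<odot> ss ! i) [0..<?n] = map (\<lambda>(i, w). M.sm (co p i) w) ?L"
        using cp(1) M.smult_eq_sm by auto
      then show ?thesis using cp(2) \<open>lc0 = p\<close> by (simp only: M.lc_def)
    qed
    have dI: "(\<lambda>x. ?a i x - ?a' i x) \<in> slice_ideal" if i: "i < ?n" for i
    proof -
      have "pull (?a i) y = pull (?a' i) y" if "y \<in> pts XT" for y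
        using \<kappa>_e[OF i that, of m] \<kappa>_e[OF i that, of m'] k by simp
      then have "?a i (\<iota> y) = ?a' i (\<iota> y)" if "y \<in> pts XT" for y using that by (simp add: pull_def)
      moreover have "regG (\<lambda>x. ?a i x - ?a' i x)"
        using c(1) c'(1) i by (intro G.pts.regf_diff G.pts.regf_mem) auto
      ultimately show ?thesis by (simp add: slice_ideal_def)
    qed
    have ok: "M.ok ?a' ?L" "M.ok (\<lambda>i x. ?a i x - ?a' i x) ?L"
      using c'(1) si dI G.pts.regf_mem by (auto simp: M.ok_def slice_ideal_def)
    have "\<rho> m = M.lc (\<lambda>i x. (?a i x - ?a' i x) + ?a' i x) ?L" using lc[OF refl, of "\<rho> m"] by simp
    also have "\<dots> = M.lc (\<lambda>i x. ?a i x - ?a' i x) ?L \<oplus> M.lc ?a' ?L" by (rule M.lc_add[OF ok(2,1)])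
    finally have "\<rho> m = M.lc (\<lambda>i x. ?a i x - ?a' i x) ?L \<oplus> \<rho> m'" using lc[OF refl, of "\<rho> m'"] by simp
    moreover have "M.lc (\<lambda>i x. ?a i x - ?a' i x) ?L \<in> ?I"
      unfolding module_ideal_def by (rule M.lc_ispan[OF slice_ideal_sub]) (use dI si in auto)
    ultimately have "\<rho> m \<ominus> \<rho> m' \<in> ?I" using module_ideal_iff[OF M \<rho>(1)[OF m(1)] \<rho>(1)[OF m(2)]] by blast
    moreover have "m \<ominus> \<rho> m \<in> ?I" using Ineg[OF \<rho>(2)[OF m(1)]] sy[OF \<rho>(1)[OF m(1)] m(1)] by simp
    ultimately show "m \<ominus> m' \<in> ?I"
      using tr[OF m(1) \<rho>(1)[OF m(1)] m(2)] tr[OF \<rho>(1)[OF m(1)] \<rho>(1)[OF m(2)] m(2)] \<rho>(2)[OF m(2)] Iadd by metis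
  qed
  then have "restriction M \<kappa> (quotient M \<kappa>)" by (rule restriction_quotient[OF M])
  then show ?thesis by blast
qed

end

context slice
begin

text \<open>The structure sheaf of a stable set \<open>C'\<close> restricts to that of \<open>C\<close>, provided that \<open>\<Delta> \<cdot> (f \<circ> r)\<close>
  vanishes on \<open>C'\<close> for every equation \<open>f\<close> of \<open>C\<close>: then every function on \<open>C'\<close> which is zero on \<open>C\<close> can be
  corrected to one that is zero on the whole slice.\<close>

lemma restriction_structure_sheaf:
  assumes C: "T.stable C" and C': "G.stable C'" and sub: "\<And>y. y \<in> C ==> \<iota> y \<in> C'"
    and van: "\<And>f x. f \<in> pts_fun XT ==> (\<And>y. y \<in> C ==> f y = 0) ==> x \<in> C' ==> \<Delta> x * f (r x) = 0"
  shows "restriction (structure_sheaf XG C') (\<lambda>f. \<lambda>y\<in>C. f (\<iota> y)) (structure_sheaf XT C)"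
proof -
  let ?M = "structure_sheaf XG C'" and ?N = "structure_sheaf XT C" and ?\<kappa> = "\<lambda>f. \<lambda>y\<in>C. f (\<iota> y)"
  have M: "coherent_eqmod XG ?M" by (rule G.coherent_structure_sheaf[OF C'])
  have N: "coherent_eqmod XT ?N" by (rule T.coherent_structure_sheaf[OF C])
  interpret M: eqmodule XG ?M by (rule eqmoduleG[OF M])
  have CX: "C \<subseteq> pts XT" and CX': "C' \<subseteq> pts XG" using C C' by (simp_all add: T.stable_def G.stable_def)
  have \<kappa>1: "?\<kappa> (restrict a C') = restrict (pull a) C" for a
    using sub CX by (auto simp: pull_def fun_eq_iff)
  have img: "?\<kappa> ` sub_fun XG C' = sub_fun XT C"
  proof
    show "?\<kappa> ` sub_fun XG C' \<subseteq> sub_fun XT C"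
      using \<kappa>1 pull_mem by (auto simp: sub_fun_def)
    show "sub_fun XT C \<subseteq> ?\<kappa> ` sub_fun XG C'"
    proof
      fix f assume "f \<in> sub_fun XT C"
      then obtain b where b: "b \<in> pts_fun XT" "f = restrict b C" by (rule T.sub_funE)
      have "f = ?\<kappa> (restrict (\<lambda>x\<in>pts XG. b (r x)) C')" unfolding \<kappa>1 pull_lift[OF b(1)] by (rule b(2))
      moreover have "restrict (\<lambda>x\<in>pts XG. b (r x)) C' \<in> sub_fun XG C'" using lift_mem[OF b(1)] unfolding sub_fun_def by (rule imageI)
      ultimately show "f \<in> ?\<kappa> ` sub_fun XG C'" by (rule image_eqI)
    qed
  qed
  have act: "?\<kappa> (mact ?M (\<phi> t) f) = mact ?N t (?\<kappa> f)" if t: "t \<in> carrier (grp XT)" for t f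
  proof -
    have ti: "inv\<^bsub>grp XT\<^esub> t \<in> carrier (grp XT)" using t by simp
    have "gact XG (inv\<^bsub>grp XG\<^esub> (\<phi> t)) (\<iota> y) = \<iota> (gact XT (inv\<^bsub>grp XT\<^esub> t) y)" "gact XT (inv\<^bsub>grp XT\<^esub> t) y \<in> C" if "y \<in> C" for y
      using iota_act[OF ti, of y] phi_inv[OF t] that CX C ti by (auto simp: T.stable_def)
    then show ?thesis using sub by (auto simp: fun_eq_iff)
  qed
  have ker: "?\<kappa> m = \<zero>\<^bsub>?N\<^esub> \<longleftrightarrow> m \<in> module_ideal ?M" if m: "m \<in> sub_fun XG C'" for m
  proof
    assume z: "?\<kappa> m = \<zero>\<^bsub>?N\<^esub>"
    obtain a where a: "a \<in> pts_fun XG" "m = restrict a C'" by (rule G.sub_funE[OF m])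
    let ?b = "pull a" and ?l = "\<lambda>x\<in>pts XG. pull a (r x)"
    note b = pull_mem[OF a(1)] and l = lift_mem[OF pull_mem[OF a(1)]]
    have "?b y = 0" if "y \<in> C" for y
      using fun_cong[OF z, of y] that CX sub by (auto simp: a(2) pull_def)
    then have v: "\<Delta> x * ?b (r x) = 0" if "x \<in> C'" for x using van[OF b _ that] by blast
    define c where "c x = a x - \<Delta> x * ?l x" for x
    have "regG c" unfolding c_def by (intro G.pts.regf_diff G.pts.regf_mult G.pts.regf_mem a(1) Delta_regf l)
    then have cI: "c \<in> slice_ideal" using iota_closed by (simp add: slice_ideal_def c_def Delta_iota r_iota pull_def)
    have one: "(\<lambda>x\<in>C'. 1) \<in> carrier ?M" using fun_alg.regf_const[OF G.fun_alg_sub[OF C'], of 1] by (simp add: regf_def)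
    have "m = M.sm c (\<lambda>x\<in>C'. 1)" using v CX' by (auto simp: M.sm_def a(2) fun_eq_iff c_def subset_iff)
    then show "m \<in> module_ideal ?M" using M.ispan_gen[OF slice_ideal_sub cI one] by (simp add: module_ideal_def)
  next
    assume "m \<in> module_ideal ?M"
    then have "m \<in> M.ispan slice_ideal" by (simp add: module_ideal_def)
    then show "?\<kappa> m = \<zero>\<^bsub>?N\<^esub>"
    proof (induction rule: M.ispan.induct)
      case zero
      then show ?case using sub by (auto simp: fun_eq_iff)
    next
      case (add c f n)
      have "n (\<iota> y) = 0" "c (\<iota> y) = 0" if "y \<in> C" for y
        using fun_cong[OF add(4), of y] add(1) that CX by (auto simp: slice_ideal_def)
      then show ?case using sub CX' by (auto simp: fun_eq_iff M.sm_def)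
    qed
  qed
  show ?thesis unfolding restriction_def
  proof (intro conjI ballI)
    fix m assume m: "m \<in> carrier ?M"
    show "?\<kappa> (m \<oplus>\<^bsub>?M\<^esub> m') = ?\<kappa> m \<oplus>\<^bsub>?N\<^esub> ?\<kappa> m'" for m' using sub by (auto simp: fun_eq_iff)
    show "?\<kappa> (a \<odot>\<^bsub>?M\<^esub> m) = pull a \<odot>\<^bsub>?N\<^esub> ?\<kappa> m" for a using sub CX by (auto simp: fun_eq_iff pull_def)
    show "?\<kappa> (mact ?M (\<phi> t) m) = mact ?N t (?\<kappa> m)" if "t \<in> carrier (grp XT)" for t by (rule act[OF that])
    show "?\<kappa> m = \<zero>\<^bsub>?N\<^esub> \<longleftrightarrow> m \<in> module_ideal ?M" by (rule ker) (use m in simp)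
  qed (use M N img in simp_all)
qed

end

lemma comm_group_K_free: "comm_group (K_free X)"
  unfolding K_free_def by (rule abelian_free_Abelian_group)

lemma carrier_K_free: "frag_of M \<in> carrier (K_free X) \<longleftrightarrow> coherent_eqmod X M"
  by (simp add: K_free_def)

lemma K_free_sub: "a \<in> carrier (K_free X) ==> b \<in> carrier (K_free X) ==> a - b = a \<otimes>\<^bsub>K_free X\<^esub> inv\<^bsub>K_free X\<^esub> b"
  by (simp add: K_free_def)

definition K_gens :: "('h, 'p, 'k::field) gvar => (('h, 'p, 'k) fun_eqmod \<Rightarrow>\<^sub>0 int) set" where
  "K_gens X = {frag_of M - frag_of M' - frag_of M'' | M M' M''.
       coherent_eqmod X M \<and> coherent_eqmod X M' \<and> coherent_eqmod X M'' \<and> short_exact X M' M M''}"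

lemma K_rel_eq: "K_rel X = generate (K_free X) (K_gens X)"
  by (simp add: K_rel_def K_gens_def)

lemma K_gensE:
  assumes "a \<in> K_gens X"
  obtains M M' M'' where "a = frag_of M - frag_of M' - frag_of M''"
    "coherent_eqmod X M" "coherent_eqmod X M'" "coherent_eqmod X M''" "short_exact X M' M M''"
  using assms unfolding K_gens_def by blast

lemma K_gens_sub: "K_gens X \<subseteq> carrier (K_free X)"
proof
  interpret F: comm_group "K_free X" by (rule comm_group_K_free)
  have d: "a - b \<in> carrier (K_free X)" if "a \<in> carrier (K_free X)" "b \<in> carrier (K_free X)" for a b
    using that by (simp add: K_free_sub)
  fix a assume "a \<in> K_gens X"
  then show "a \<in> carrier (K_free X)" by (rule K_gensE) (simp add: d carrier_K_free)
qed

lemma subgroup_K_rel: "subgroup (K_rel X) (K_free X)"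
  unfolding K_rel_eq
  by (rule group.generate_is_subgroup[OF comm_group.axioms(2)[OF comm_group_K_free] K_gens_sub])

lemma comm_group_K_group: "comm_group (K_group X)"
  unfolding K_group_def by (rule comm_group.abelian_FactGroup[OF comm_group_K_free subgroup_K_rel])

lemma normal_K_rel: "K_rel X \<lhd> K_free X"
  by (rule comm_group.subgroup_imp_normal[OF comm_group_K_free subgroup_K_rel])

lemma K_class_hom: "(\<lambda>a. K_rel X #>\<^bsub>K_free X\<^esub> a) \<in> hom (K_free X) (K_group X)"
  unfolding K_group_def by (rule normal.r_coset_hom_Mod[OF normal_K_rel])

lemma K_class_closed: "coherent_eqmod X M ==> K_class X M \<in> carrier (K_group X)"
  using hom_in_carrier[OF K_class_hom] carrier_K_free unfolding K_class_def by blast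

lemma group_hom_K_class: "group_hom (K_free X) (K_group X) (\<lambda>a. K_rel X #>\<^bsub>K_free X\<^esub> a)"
  by (intro group_hom.intro group_hom_axioms.intro comm_group.axioms(2) comm_group_K_free comm_group_K_group K_class_hom)

lemma K_class_exact:
  assumes M: "coherent_eqmod X M" "coherent_eqmod X M'" "coherent_eqmod X M''" and ex: "short_exact X M' M M''"
  shows "K_class X M = K_class X M' \<otimes>\<^bsub>K_group X\<^esub> K_class X M''"
proof -
  interpret F: comm_group "K_free X" by (rule comm_group_K_free)
  interpret K: comm_group "K_group X" by (rule comm_group_K_group)
  interpret h: group_hom "K_free X" "K_group X" "\<lambda>a. K_rel X #>\<^bsub>K_free X\<^esub> a" by (rule group_hom_K_class)
  note c = M[folded carrier_K_free]
  have r: "frag_of M - frag_of M' - frag_of M'' \<in> K_rel X"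
    unfolding K_rel_eq K_gens_def by (rule generate.incl) (use M ex in blast)
  have "K_rel X #>\<^bsub>K_free X\<^esub> (frag_of M - frag_of M' - frag_of M'') = \<one>\<^bsub>K_group X\<^esub>"
    using F.coset_join2[OF subgroup.mem_carrier[OF subgroup_K_rel r] subgroup_K_rel r] by (simp add: K_group_def FactGroup_def)
  moreover have "frag_of M - frag_of M' - frag_of M'' = frag_of M \<otimes>\<^bsub>K_free X\<^esub> inv\<^bsub>K_free X\<^esub> frag_of M' \<otimes>\<^bsub>K_free X\<^esub> inv\<^bsub>K_free X\<^esub> frag_of M''"
    using c by (simp add: K_free_sub)
  ultimately have e: "K_class X M \<otimes>\<^bsub>K_group X\<^esub> inv\<^bsub>K_group X\<^esub> K_class X M' \<otimes>\<^bsub>K_group X\<^esub> inv\<^bsub>K_group X\<^esub> K_class X M'' = \<one>\<^bsub>K_group X\<^esub>"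
    using c by (simp add: K_class_def)
  note k = K_class_closed[OF M(1)] K_class_closed[OF M(2)] K_class_closed[OF M(3)]
  have "K_class X M \<otimes>\<^bsub>K_group X\<^esub> inv\<^bsub>K_group X\<^esub> K_class X M' = K_class X M''"
    using e k by (metis K.inv_equality K.inv_closed K.m_closed K.inv_inv)
  then show ?thesis using k by (metis K.inv_solve_right K.m_comm K.m_closed)
qed

context slice
begin

lemma restriction_zero_module:
  "restriction (structure_sheaf XG {}) (\<lambda>f. \<lambda>y\<in>{}. f (\<iota> y)) (structure_sheaf XT {})"
  by (rule restriction_structure_sheaf) (simp_all add: T.stable_def G.stable_def)

lemma K_class_zero: "K_class XT (structure_sheaf XT {}) = \<one>\<^bsub>K_group XT\<^esub>"
proof -
  interpret K: comm_group "K_group XT" by (rule comm_group_K_group)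
  let ?Z = "structure_sheaf XT {}"
  note Z = T.zero_module
  have hom: "eqmod_hom XT ?Z ?Z id" by (simp add: eqmod_hom_def)
  have "zero ?Z = (\<lambda>x. undefined)" by (simp add: fun_eq_iff)
  then have "short_exact XT ?Z ?Z ?Z" unfolding short_exact_def
    using hom Z(2) by (intro exI[of _ id]) auto
  from K_class_exact[OF Z(1) Z(1) Z(1) this] K_class_closed[OF Z(1)] show ?thesis
    by (metis K.l_cancel_one')
qed

text \<open>Both \<open>N\<close> and \<open>N'\<close> may serve as a restriction of \<open>M\<close> in the exact sequence \<open>0 \<rightarrow> M \<rightarrow> M \<rightarrow> 0 \<rightarrow> 0\<close>.\<close>

lemma restriction_class_unique:
  fixes N N' :: "('t, 'y, 'k) fun_eqmod" and M :: "('x => 'k, 'x => 'k, 'h) eqmod"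
  assumes R: "restriction M \<kappa> N" and R': "restriction M \<kappa>' N'"
  shows "K_class XT N = K_class XT N'"
proof -
  interpret K: comm_group "K_group XT" by (rule comm_group_K_group)
  note M = restrictionD(1)[OF R]
  interpret M: eqmodule XG M by (rule eqmoduleG[OF M])
  let ?Z = "structure_sheaf XG {}"
  have z: "zero ?Z = (\<lambda>x. undefined)" by (simp add: fun_eq_iff)
  have "short_exact XG M M ?Z" unfolding short_exact_def
  proof (rule exI[of _ id], rule exI[of _ "\<lambda>m x. undefined"], intro conjI)
    show "eqmod_hom XG M M id" by (simp add: eqmod_hom_def)
    show "eqmod_hom XG M ?Z (\<lambda>m x. undefined)" unfolding eqmod_hom_def
      using G.zero_module(2) by (auto simp: fun_eq_iff simp del: G.structure_sheaf_sel(1))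
    show "(\<lambda>m x. undefined) ` carrier M = carrier ?Z" using G.zero_module(2) M.M.zero_closed by auto
  qed (use z in auto)
  from restriction_short_exact[OF R R' restriction_zero_module this]
  have "K_class XT N' = K_class XT N \<otimes>\<^bsub>K_group XT\<^esub> \<one>\<^bsub>K_group XT\<^esub>"
    using K_class_exact[OF restrictionD(2)[OF R'] restrictionD(2)[OF R] T.zero_module(1)] K_class_zero by simp
  then show ?thesis using K_class_closed[OF restrictionD(2)[OF R]] by simp
qed

text \<open>By exactness the class of a chosen restriction is additive, and it does not depend on the choice. The injection
  \<open>e\<close> ensures that restrictions exist among the modules whose elements are functions on the slice.\<close>

theorem K_restriction:
  fixes e :: "nat \<times> 'y => 'y"
  assumes e: "inj_on e (UNIV \<times> pts XT)"
  obtains f where "f \<in> hom (K_group XG) (K_group XT)"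
    "\<And>M \<kappa> N. restriction M \<kappa> N ==> f (K_class XG M) = K_class XT N"
proof -
  interpret KT: comm_group "K_group XT" by (rule comm_group_K_group)
  interpret KG: comm_group "K_group XG" by (rule comm_group_K_group)
  interpret F: comm_group "K_free XG" by (rule comm_group_K_free)
  define R where "R M = (SOME N. \<exists>\<kappa> :: ('x => 'k) => 'y => 'k. restriction M \<kappa> N)" for M :: "('h, 'x, 'k) fun_eqmod"
  have R: "\<exists>\<kappa> :: ('x => 'k) => 'y => 'k. restriction M \<kappa> (R M)" if M: "coherent_eqmod XG M" for M
  proof -
    have "\<exists>N. \<exists>\<kappa> :: ('x => 'k) => 'y => 'k. restriction M \<kappa> N" using ex_restriction[OF M e] by blast
    then show ?thesis unfolding R_def by (rule someI_ex)
  qed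
  have cohR: "coherent_eqmod XT (R M)" if M: "coherent_eqmod XG M" for M
    using R[OF M] restrictionD(2) by (elim exE)
  have "(\<lambda>M. K_class XT (R M)) ` {M. coherent_eqmod XG M} \<subseteq> carrier (K_group XT)"
    using cohR K_class_closed by blast
  then obtain h where h: "h \<in> hom (K_free XG) (K_group XT)" "\<And>M. coherent_eqmod XG M ==> h (frag_of M) = K_class XT (R M)"
    unfolding K_free_def by (rule KT.free_Abelian_group_universal) (rule that; simp add: K_free_def)
  interpret h: group_hom "K_free XG" "K_group XT" h
    using h(1) by unfold_locales
  have "K_rel XG \<subseteq> kernel (K_free XG) (K_group XT) h"
    unfolding K_rel_eq
  proof (rule F.generate_subgroup_incl[OF _ h.subgroup_kernel], rule subsetI)
    fix a assume a: "a \<in> K_gens XG"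
    then obtain M M' M'' where a_eq: "a = frag_of M - frag_of M' - frag_of M''"
      and M: "coherent_eqmod XG M" "coherent_eqmod XG M'" "coherent_eqmod XG M''" and ex: "short_exact XG M' M M''" by (rule K_gensE)
    note c = M[folded carrier_K_free]
    obtain k k' k'' :: "('x => 'k) => 'y => 'k" where "restriction M k (R M)" "restriction M' k' (R M')" "restriction M'' k'' (R M'')"
      using R[OF M(1)] R[OF M(2)] R[OF M(3)] by (elim exE) (rule that)
    then have "short_exact XT (R M') (R M) (R M'')" using restriction_short_exact ex by blast
    then have "K_class XT (R M) = K_class XT (R M') \<otimes>\<^bsub>K_group XT\<^esub> K_class XT (R M'')"
      by (rule K_class_exact[OF cohR[OF M(1)] cohR[OF M(2)] cohR[OF M(3)]])
    moreover have "a = frag_of M \<otimes>\<^bsub>K_free XG\<^esub> inv\<^bsub>K_free XG\<^esub> frag_of M' \<otimes>\<^bsub>K_free XG\<^esub> inv\<^bsub>K_free XG\<^esub> frag_of M''"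
      using c by (simp add: a_eq K_free_sub)
    ultimately have "h a = (K_class XT (R M') \<otimes>\<^bsub>K_group XT\<^esub> K_class XT (R M'')) \<otimes>\<^bsub>K_group XT\<^esub> inv\<^bsub>K_group XT\<^esub> K_class XT (R M') \<otimes>\<^bsub>K_group XT\<^esub> inv\<^bsub>K_group XT\<^esub> K_class XT (R M'')"
      using c by (simp add: h(2) M)
    also have "\<dots> = \<one>\<^bsub>K_group XT\<^esub>"
      using K_class_closed[OF cohR[OF M(2)]] K_class_closed[OF cohR[OF M(3)]]
      by (simp add: KT.m_comm[of "K_class XT (R M')" "K_class XT (R M'')"] KT.m_assoc)
    finally have "h a = \<one>\<^bsub>K_group XT\<^esub>" .
    moreover have "a \<in> carrier (K_free XG)" using a K_gens_sub by blast
    ultimately show "a \<in> kernel (K_free XG) (K_group XT) h" by (simp add: kernel_def)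
  qed
  then obtain f where f0: "f \<in> hom (K_free XG Mod K_rel XG) (K_group XT)"
    and f1: "\<And>x. x \<in> carrier (K_free XG) ==> f (K_rel XG #>\<^bsub>K_free XG\<^esub> x) = h x"
    by (rule h.FactGroup_universal_kernel[OF normal_K_rel]) (rule that)
  have f: "f \<in> hom (K_group XG) (K_group XT)" using f0 by (simp only: K_group_def[of XG])
  show ?thesis
  proof (rule that[OF f])
    fix M :: "('x => 'k, 'x => 'k, 'h) eqmod" and \<kappa> and N :: "('y => 'k, 'y => 'k, 't) eqmod"
    assume r: "restriction M \<kappa> N"
    note M = restrictionD(1)[OF r]
    obtain k :: "('x => 'k) => 'y => 'k" where k: "restriction M k (R M)" using R[OF M] by (elim exE) (rule that)
    have "f (K_class XG M) = K_class XT (R M)"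
      using f1[OF iffD2[OF carrier_K_free M]] h(2)[OF M] by (simp add: K_class_def)
    then show "f (K_class XG M) = K_class XT N" using restriction_class_unique[OF k r] by simp
  qed
qed

end

section \<open>Orbit closures and singularities along a slice\<close>

text \<open>Transversality: the points with \<open>\<Delta> \<noteq> 0\<close> in one orbit are all retracted into one orbit of the slice.\<close>

locale transversal_slice = slice XG XT \<iota> r \<Delta> \<sigma> \<phi>
  for XG :: "('h, 'x, 'k::field) gvar" and XT :: "('t, 'y, 'k) gvar" and \<iota> r \<Delta> \<sigma> \<phi> +
  assumes transversal: "g \<in> carrier (grp XG) ==> y \<in> pts XT ==> \<Delta> (gact XG g (\<iota> y)) \<noteq> 0 ==>
      \<exists>b\<in>carrier (grp XT). r (gact XG g (\<iota> y)) = gact XT b y"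
begin

definition sat :: "'y set => 'x set" where
  "sat C = G.closure (\<Union>y\<in>C. G.orb (\<iota> y))"

lemma sat_base: "C \<subseteq> pts XT ==> (\<Union>y\<in>C. G.orb (\<iota> y)) \<subseteq> pts XG"
  using G.orb_sub iota_closed by blast

lemma stable_sat:
  assumes "C \<subseteq> pts XT"
  shows "G.stable (sat C)"
  unfolding sat_def
proof (rule G.stable_closure)
  show "G.stable (\<Union>y\<in>C. G.orb (\<iota> y))"
    using G.stable_orb[OF iota_closed] assms sat_base[OF assms] unfolding G.stable_def by blast
qed

lemma iota_sat: "C \<subseteq> pts XT ==> y \<in> C ==> \<iota> y \<in> sat C"
  unfolding sat_def using G.sub_closure[OF sat_base] G.orb_refl[OF iota_closed] by blast

lemma closed_sat: "G.closure (sat C) = sat C"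
  by (simp add: sat_def)

text \<open>The function \<open>\<Delta> \<cdot> (f \<circ> r)\<close> is regular and by transversality vanishes on the orbits through \<open>C\<close>, so it vanishes on their
  closure.\<close>

lemma sat_vanishing:
  assumes C: "T.stable C" and f: "f \<in> pts_fun XT" "\<And>y. y \<in> C ==> f y = 0" and x: "x \<in> sat C"
  shows "\<Delta> x * f (r x) = 0"
proof -
  have CX: "C \<subseteq> pts XT" using C by (simp add: T.stable_def)
  let ?F = "\<lambda>x\<in>pts XG. \<Delta> x * f (r x)"
  have "?F \<in> pts_fun XG"
    using G.pts.regf_mult[OF Delta_regf r_regf[OF f(1)]] by (simp add: regf_def)
  moreover have "?F z = 0" if z: "z \<in> (\<Union>y\<in>C. G.orb (\<iota> y))" for z
  proof -
    obtain g y where gy: "g \<in> carrier (grp XG)" "y \<in> C" "z = gact XG g (\<iota> y)"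
      using z by (auto simp: G.orb_def)
    have "z \<in> pts XG" using z sat_base[OF CX] by blast
    moreover have "f (r z) = 0" if n: "\<Delta> z \<noteq> 0"
    proof -
      have "y \<in> pts XT" using gy(2) CX by blast
      then obtain b where "b \<in> carrier (grp XT)" "r z = gact XT b y"
        using transversal[OF gy(1), of y] n gy(3) by blast
      then show ?thesis using C gy(2) f(2) by (simp add: T.stable_def)
    qed
    ultimately show ?thesis by auto
  qed
  ultimately have "?F x = 0" using x unfolding sat_def G.in_closure_iff[OF sat_base[OF CX]] by blast
  moreover have "x \<in> pts XG" using x G.closure_sub unfolding sat_def by blast
  ultimately show ?thesis by simp
qed

lemma sat_retract:
  assumes C: "T.stable C" "T.closure C = C" and x: "x \<in> sat C" "\<Delta> x \<noteq> 0"
  shows "r x \<in> C"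
proof -
  have CX: "C \<subseteq> pts XT" using C by (simp add: T.stable_def)
  have xX: "x \<in> pts XG" using x G.closure_sub unfolding sat_def by blast
  have "r x \<in> T.closure C" unfolding T.in_closure_iff[OF CX]
    using r_closed[OF xX] sat_vanishing[OF C(1) _ _ x(1)] x(2) by auto
  then show ?thesis using C(2) by simp
qed

lemma iota_sat_iff:
  assumes "T.stable C" "T.closure C = C" "y \<in> pts XT"
  shows "\<iota> y \<in> sat C \<longleftrightarrow> y \<in> C"
  using sat_retract[OF assms(1,2), of "\<iota> y"] iota_sat[of C y] assms by (auto simp: Delta_iota r_iota T.stable_def)

lemma sat_mono: "C \<subseteq> C' ==> sat C \<subseteq> sat C'"
  unfolding sat_def by (rule closure_of_mono) blast

text \<open>The map \<open>\<iota>\<close> is continuous, so it sends the closure of an orbit into the closure of the larger orbit.\<close>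

lemma sat_closure_orb:
  assumes y: "y \<in> pts XT"
  shows "sat (T.closure (T.orb y)) = G.closure (G.orb (\<iota> y))"
proof
  let ?C = "T.closure (T.orb y)"
  note oy = T.orb_sub[OF y] and oi = G.orb_sub[OF iota_closed[OF y]]
  have "y \<in> ?C" using T.sub_closure[OF oy] T.orb_refl[OF y] by blast
  then show "G.closure (G.orb (\<iota> y)) \<subseteq> sat ?C" unfolding sat_def by (intro closure_of_mono) blast
  have io: "\<iota> z \<in> G.closure (G.orb (\<iota> y))" if z: "z \<in> ?C" for z
    unfolding G.in_closure_iff[OF oi]
  proof (intro conjI ballI impI)
    have zX: "z \<in> pts XT" using z T.closure_sub by blast
    then show "\<iota> z \<in> pts XG" by (rule iota_closed)
    fix f assume f: "f \<in> pts_fun XG" "\<forall>x\<in>G.orb (\<iota> y). f x = 0"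
    have "pull f w = 0" if w: "w \<in> T.orb y" for w
    proof -
      obtain b where b: "b \<in> carrier (grp XT)" "w = gact XT b y" using w by (auto simp: T.orb_def)
      then have "\<iota> w \<in> G.orb (\<iota> y)" using iota_act[OF b(1) y] phi_closed[OF b(1)] by (auto simp: G.orb_def)
      then show ?thesis using f(2) w oy by (auto simp: pull_def)
    qed
    then have "pull f z = 0" using z pull_mem[OF f(1)] unfolding T.in_closure_iff[OF oy] by blast
    then show "f (\<iota> z) = 0" using zX by (simp add: pull_def)
  qed
  have st: "G.stable (G.closure (G.orb (\<iota> y)))" by (rule G.stable_closure[OF G.stable_orb[OF iota_closed[OF y]]])
  have "(\<Union>z\<in>?C. G.orb (\<iota> z)) \<subseteq> G.closure (G.orb (\<iota> y))"
    using io st by (auto simp: G.orb_def G.stable_def)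
  then show "sat ?C \<subseteq> G.closure (G.orb (\<iota> y))" unfolding sat_def by (rule G.closure_least[OF _ oi])
qed

lemma sat_orbit_closure:
  assumes "C \<in> orbit_closures XT"
  shows "sat C \<in> orbit_closures XG"
proof -
  obtain y where y: "y \<in> pts XT" "C = T.closure (T.orb y)" by (rule T.orbit_closuresE[OF assms])
  show ?thesis unfolding y(2) sat_closure_orb[OF y(1)] by (rule G.orbit_closuresI[OF iota_closed[OF y(1)]])
qed

lemma inj_sat: "inj_on sat (orbit_closures XT)"
proof (rule inj_onI)
  fix C C' assume C: "C \<in> orbit_closures XT" and C': "C' \<in> orbit_closures XT" and e: "sat C = sat C'"
  have CX: "C \<subseteq> pts XT" "C' \<subseteq> pts XT"
    using T.orbit_closure_stable[OF C] T.orbit_closure_stable[OF C'] by (simp_all add: T.stable_def)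
  have "y \<in> C \<longleftrightarrow> y \<in> C'" if "y \<in> pts XT" for y
    using iota_sat_iff[OF T.orbit_closure_stable[OF C] T.orbit_closure_closed[OF C] that]
      iota_sat_iff[OF T.orbit_closure_stable[OF C'] T.orbit_closure_closed[OF C'] that] e by simp
  then show "C = C'" using CX by blast
qed

text \<open>The union of the orbits which meet the slice.\<close>

definition sat_open :: "'x set" where
  "sat_open = {x\<in>pts XG. \<exists>g\<in>carrier (grp XG). \<Delta> (gact XG g x) \<noteq> 0}"

lemma openin_sat_open: "openin (gvar_top XG) sat_open"
proof -
  have "restrict \<Delta> (pts XG) \<in> pts_fun XG" using Delta_regf by (simp add: regf_def)
  then have o: "openin (gvar_top XG) {x\<in>pts XG. restrict \<Delta> (pts XG) (gact XG g x) \<noteq> 0}" if "g \<in> carrier (grp XG)" for g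
    unfolding gvar_top_def by (rule G.pts.openin_principal[OF G.regf_translate[OF _ that]])
  have "sat_open = (\<Union>g\<in>carrier (grp XG). {x\<in>pts XG. restrict \<Delta> (pts XG) (gact XG g x) \<noteq> 0})"
    using G.act_closed by (auto simp: sat_open_def)
  also have "openin (gvar_top XG) \<dots>" by (rule openin_Union) (use o in blast)
  finally show ?thesis .
qed

lemma sat_open_stable:
  assumes g: "g \<in> carrier (grp XG)" and x: "x \<in> sat_open"
  shows "gact XG g x \<in> sat_open"
proof -
  obtain h where h: "h \<in> carrier (grp XG)" "\<Delta> (gact XG h x) \<noteq> 0" and xX: "x \<in> pts XG"
    using x by (auto simp: sat_open_def)
  have "gact XG (h \<otimes>\<^bsub>grp XG\<^esub> inv\<^bsub>grp XG\<^esub> g) (gact XG g x) = gact XG h x"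
    using g h(1) xX by (simp add: G.act_mult G.act_inv G.act_closed)
  then show ?thesis using g h G.act_closed[OF g xX]
    unfolding sat_open_def by (intro CollectI conjI bexI[of _ "h \<otimes>\<^bsub>grp XG\<^esub> inv\<^bsub>grp XG\<^esub> g"]) simp_all
qed

text \<open>If the closure of an orbit meets the open set, some translate of \<open>\<Delta>\<close> does not vanish on the orbit, so the orbit
  contains a point with \<open>\<Delta> \<noteq> 0\<close>, and \<open>\<sigma>\<close> moves this point into the slice.\<close>

lemma image_sat: "sat ` orbit_closures XT = {C \<in> orbit_closures XG. C \<inter> sat_open \<noteq> {}}"
proof (intro equalityI subsetI)
  fix D assume "D \<in> sat ` orbit_closures XT"
  then obtain C where C: "C \<in> orbit_closures XT" "D = sat C" by blast
  obtain y where y: "y \<in> pts XT" "C = T.closure (T.orb y)" by (rule T.orbit_closuresE[OF C(1)])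
  have CX: "C \<subseteq> pts XT" using T.orbit_closure_stable[OF C(1)] by (simp add: T.stable_def)
  have "y \<in> C" unfolding y(2) using T.sub_closure[OF T.orb_sub[OF y(1)]] T.orb_refl[OF y(1)] by blast
  then have "\<iota> y \<in> D" using iota_sat[OF CX] C(2) by simp
  moreover have "\<iota> y \<in> sat_open" using iota_closed[OF y(1)] Delta_iota[OF y(1)] G.act_one
    unfolding sat_open_def by (intro CollectI conjI bexI[of _ "\<one>\<^bsub>grp XG\<^esub>"]) simp_all
  ultimately show "D \<in> {C \<in> orbit_closures XG. C \<inter> sat_open \<noteq> {}}" using sat_orbit_closure[OF C(1)] C(2) by blast
next
  fix D assume "D \<in> {C \<in> orbit_closures XG. C \<inter> sat_open \<noteq> {}}"
  then obtain u where D: "D \<in> orbit_closures XG" and u: "u \<in> D" "u \<in> sat_open" by blast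
  obtain x where x: "x \<in> pts XG" "D = G.closure (G.orb x)" by (rule G.orbit_closuresE[OF D])
  obtain g where g: "g \<in> carrier (grp XG)" "\<Delta> (gact XG g u) \<noteq> 0" using u(2) by (auto simp: sat_open_def)
  have gu: "gact XG g u \<in> G.closure (G.orb x)"
    using G.orbit_closure_stable[OF D] u(1) g(1) x(2) by (simp add: G.stable_def)
  have "\<exists>w\<in>G.orb x. \<Delta> w \<noteq> 0"
  proof (rule ccontr)
    assume n: "\<not> (\<exists>w\<in>G.orb x. \<Delta> w \<noteq> 0)"
    have "restrict \<Delta> (pts XG) \<in> pts_fun XG" using Delta_regf by (simp add: regf_def)
    moreover have "\<forall>w\<in>G.orb x. restrict \<Delta> (pts XG) w = 0" using n subsetD[OF G.orb_sub[OF x(1)]] by simp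
    ultimately have "restrict \<Delta> (pts XG) (gact XG g u) = 0"
      using gu unfolding G.in_closure_iff[OF G.orb_sub[OF x(1)]] by blast
    moreover have "gact XG g u \<in> pts XG" using gu G.closure_sub by blast
    ultimately show False using g(2) by simp
  qed
  then obtain h where h: "h \<in> carrier (grp XG)" "\<Delta> (gact XG h x) \<noteq> 0" by (auto simp: G.orb_def)
  define w where "w = gact XG h x"
  have wX: "w \<in> pts XG" using G.act_closed[OF h(1) x(1)] by (simp add: w_def)
  have dw: "\<Delta> w \<noteq> 0" using h(2) by (simp add: w_def)
  note s = sigma_closed[OF wX dw]
  let ?y = "r w"
  have y: "?y \<in> pts XT" by (rule r_closed[OF wX])
  note iy = iota_closed[OF y]
  have orb_eq: "G.orb (gact XG k v) = G.orb v" if "k \<in> carrier (grp XG)" "v \<in> pts XG" for k v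
  proof -
    have "G.orb (gact XG k v) \<subseteq> G.orb v" if "k \<in> carrier (grp XG)" "v \<in> pts XG" for k v
      using that G.stable_orb[OF that(2)] G.orb_refl[OF that(2)] unfolding G.stable_def
      by (auto simp: G.orb_def[of "gact XG k v"])
    from this[OF that] this[of "inv\<^bsub>grp XG\<^esub> k" "gact XG k v"] that G.act_closed[OF that] show ?thesis
      by (simp add: G.act_inv)
  qed
  have "G.orb x = G.orb w" unfolding w_def using orb_eq[OF h(1) x(1)] by simp
  also have "\<dots> = G.orb (\<iota> ?y)" using orb_eq[OF s iy] sigma_act[OF wX dw] by simp
  finally have "D = sat (T.closure (T.orb ?y))" using x(2) sat_closure_orb[OF y] by simp
  then show "D \<in> sat ` orbit_closures XT" using T.orbit_closuresI[OF y] by blast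
qed

end

text \<open>Coordinates identifying the open set \<open>\<Delta> \<noteq> 0\<close> with the product of the slice and a principal open
  subset of an affine space.\<close>

locale coordinate_slice = transversal_slice XG XT \<iota> r \<Delta> \<sigma> \<phi>
  for XG :: "('h, 'x, 'k::alg_closed_field) gvar" and XT :: "('t, 'y, 'k) gvar" and \<iota> r \<Delta> \<sigma> \<phi> +
  fixes n :: nat and \<xi> :: "nat => 'x => 'k" and P :: "'k mpoly"
  assumes xi_regf: "i \<in> {1..n} ==> regf (pts XG) (pts_fun XG) (\<xi> i)"
    and P_keys: "\<alpha> \<in> keys P ==> keys \<alpha> \<subseteq> {1..n}"
    and Delta_P: "x \<in> pts XG ==> \<Delta> x = mpoly_eval P (\<lambda>i. \<xi> i x)"
    and coordinates_onto: "y \<in> pts XT ==> mpoly_eval P v \<noteq> 0 ==> \<exists>x\<in>pts XG. r x = y \<and> (\<forall>i\<in>{1..n}. \<xi> i x = v i)"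
    and coordinates_gen: "f \<in> pts_fun XG ==> regf {x\<in>pts XG. \<Delta> x \<noteq> 0}
      (gen_alg {x\<in>pts XG. \<Delta> x \<noteq> 0} ({\<lambda>x. b (r x) | b. b \<in> pts_fun XT} \<union> \<xi> ` {1..n} \<union> {\<lambda>x. inverse (\<Delta> x)})) f"
begin

text \<open>The variety \<open>Z\<close> is the open subset \<open>\<Delta> \<noteq> 0\<close> of \<open>sat C\<close> with its inclusion \<open>q\<close>, and \<open>p = r \<circ> q\<close> maps it to \<open>C\<close>. The ring of \<open>Z\<close> arises
  over \<open>sat C\<close> by adjoining \<open>1 / \<Delta>\<close>, and over \<open>C\<close> by adjoining the variables \<open>\<xi>\<close> and \<open>1 / P\<close>, as \<open>\<Delta> = P(\<xi>)\<close>.\<close>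

theorem smoothly_equivalent_sat:
  assumes C: "T.stable C" "T.closure C = C" and y: "y \<in> C"
  shows "smoothly_equivalent (closed_sub XT C) y (closed_sub XG (sat C)) (\<iota> y)"
proof -
  let ?C' = "sat C"
  have CX: "C \<subseteq> pts XT" using C by (simp add: T.stable_def)
  have st': "G.stable ?C'" by (rule stable_sat[OF CX])
  have CX': "?C' \<subseteq> pts XG" using st' by (simp add: G.stable_def)
  note affC = T.affine_closed[OF CX C(2)] and affC' = G.affine_closed[OF CX' closed_sat]
  note algC = affine_variety_fun_alg[OF affC] and algC' = affine_variety_fun_alg[OF affC']
  have D: "restrict \<Delta> ?C' \<in> sub_fun XG ?C'"
    using regf_restrict[OF Delta_regf CX'] by (simp add: regf_def sub_fun_def)
  obtain Z :: "(nat => 'k) set" and B q w where Z: "affine_variety Z B" and qZ: "q ` Z = {x\<in>?C'. restrict \<Delta> ?C' x \<noteq> 0}"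
    and inj: "inj_on q Z" and qpull: "\<And>f. f \<in> sub_fun XG ?C' ==> regf Z B (\<lambda>z. f (q z))"
    and w: "w \<in> B" and wD: "\<And>z. z \<in> Z ==> w z * restrict \<Delta> ?C' (q z) = 1"
    and Bgen: "B \<subseteq> gen_alg Z (insert w {\<lambda>z. f (q z) | f. f \<in> sub_fun XG ?C'})"
    by (rule affine_variety_localization[OF affC' D]) (rule that)
  have q: "q z \<in> ?C'" "\<Delta> (q z) \<noteq> 0" "q z \<in> pts XG" if "z \<in> Z" for z
    using imageI[OF that, of q] CX' unfolding qZ by auto
  have wD': "w z * \<Delta> (q z) = 1" if "z \<in> Z" for z using wD[OF that] q(1)[OF that] by simp
  note algZ = affine_variety_fun_alg[OF Z]
  have qsurj: "\<exists>z\<in>Z. q z = x" if "x \<in> ?C'" "\<Delta> x \<noteq> 0" for x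
  proof -
    have "x \<in> q ` Z" unfolding qZ using that by simp
    then show ?thesis by blast
  qed
  interpret Z: fun_alg Z B by (rule algZ)
  interpret C: fun_alg C "sub_fun XT C" by (rule algC)
  interpret C': fun_alg ?C' "sub_fun XG ?C'" by (rule algC')
  have inf: "infinite (UNIV :: 'k set)" by (rule infinite_alg_closed)
  have smq: "smooth_morphism (affine_kspace Z B) (affine_kspace ?C' (sub_fun XG ?C')) q"
  proof (rule smooth_morphism_affine[OF Z affC' _ qpull])
    show "q ` Z \<subseteq> ?C'" using q(1) by blast
    show "standard_smooth ?C' (sub_fun XG ?C') Z B q"
    proof (rule standard_smooth_localized[OF inf algC' algZ _ qpull, where n = 0 and \<xi> = "\<lambda>_. w" and D = "\<lambda>v. single 0 (\<Delta> v)"])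
      show "q ` Z \<subseteq> ?C'" using q(1) by blast
      show "B \<subseteq> gen_alg Z ({\<lambda>u. a (q u) |a. a \<in> sub_fun XG ?C'} \<union> (\<lambda>_. w) ` {..0::nat})" using Bgen by simp
      have "regf ?C' (sub_fun XG ?C') \<Delta>" using D by (simp add: regf_def)
      then show "(\<lambda>v. single 0 (\<Delta> v)) \<in> rel_poly ?C' (sub_fun XG ?C') (Suc 0)"
        by (rule C'.rel_poly_single) simp
      show "w u * mpoly_eval (single 0 (\<Delta> (q u))) (\<lambda>i. w u) = 1" if "u \<in> Z" for u
        using wD'[OF that] by (simp add: mpoly_eval_single)
      fix v and x :: "nat => 'k" assume v: "v \<in> ?C'" "x 0 * mpoly_eval (single 0 (\<Delta> v)) x = 1"
      then have x0: "x 0 * \<Delta> v = 1" by (simp add: mpoly_eval_single)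
      then obtain z where z: "z \<in> Z" "q z = v" using qsurj[OF v(1)] by fastforce
      have "w z * \<Delta> v = x 0 * \<Delta> v" "\<Delta> v \<noteq> 0" using wD'[OF z(1)] z(2) x0 by auto
      then have "w z = x 0" by simp
      then show "\<exists>u\<in>Z. q u = v \<and> (\<forall>i\<le>0. w u = x i)" using z by (intro bexI[of _ z]) auto
    qed (use w in \<open>auto split: if_splits\<close>)
  qed
  define p where "p z = r (q z)" for z
  have p: "p z \<in> C" if "z \<in> Z" for z unfolding p_def by (rule sat_retract[OF C q(1,2)[OF that]])
  have ppull: "regf Z B (\<lambda>z. b (p z))" if b: "b \<in> sub_fun XT C" for b
  proof -
    obtain b' where b': "b' \<in> pts_fun XT" "b = restrict b' C" by (rule T.sub_funE[OF b])
    have "restrict (\<lambda>x. b' (r x)) ?C' \<in> sub_fun XG ?C'"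
      using regf_restrict[OF r_regf[OF b'(1)] CX'] by (simp add: regf_def sub_fun_def)
    from qpull[OF this] show ?thesis
    proof (rule regf_cong)
      fix z assume "z \<in> Z"
      then show "restrict (\<lambda>x. b' (r x)) ?C' (q z) = b (p z)" using p[of z] q(1)[of z] by (simp add: b'(2) p_def)
    qed
  qed
  \<comment> \<open>The variable with index \<open>0\<close> is the inverse of \<open>\<Delta>\<close>, the others are the coordinates \<open>\<xi>\<close>.\<close>
  define \<zeta> where "\<zeta> i = (if i = 0 then w else (\<lambda>z\<in>Z. \<xi> i (q z)))" for i
  have \<zeta>B: "\<zeta> i \<in> B" if "i \<le> n" for i
  proof (cases "i = 0")
    case False
    then have "restrict (\<xi> i) ?C' \<in> sub_fun XG ?C'"
      using regf_restrict[OF xi_regf CX', of i] that by (simp add: regf_def sub_fun_def)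
    from qpull[OF this] have "regf Z B (\<lambda>z. \<xi> i (q z))" by (rule regf_cong) (use q(1) in simp)
    then show ?thesis using False by (simp add: \<zeta>_def regf_def)
  qed (use w in \<open>simp add: \<zeta>_def\<close>)
  have evP: "mpoly_eval P (\<lambda>i. \<zeta> i z) = \<Delta> (q z)" if "z \<in> Z" for z
  proof -
    have "mpoly_eval P (\<lambda>i. \<zeta> i z) = mpoly_eval P (\<lambda>i. \<xi> i (q z))"
      by (rule mpoly_eval_cong) (use P_keys that in \<open>fastforce simp: \<zeta>_def\<close>)
    then show ?thesis using Delta_P[OF q(3)[OF that]] by simp
  qed
  have smp: "smooth_morphism (affine_kspace Z B) (affine_kspace C (sub_fun XT C)) p"
  proof (rule smooth_morphism_affine[OF Z affC _ ppull])
    show "p ` Z \<subseteq> C" using p by blast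
    show "standard_smooth C (sub_fun XT C) Z B p"
    proof (rule standard_smooth_localized[OF inf algC algZ _ ppull \<zeta>B, where n = n and D = "\<lambda>v. P"])
      show "p ` Z \<subseteq> C" using p by blast
      let ?G = "{\<lambda>u. a (p u) |a. a \<in> sub_fun XT C} \<union> \<zeta> ` {..n}"
      interpret W: fun_alg Z "gen_alg Z ?G" by blast
      have wG: "regf Z (gen_alg Z ?G) w" by (rule regf_gen) (auto simp: \<zeta>_def intro!: image_eqI[of _ _ 0])
      let ?X0 = "{x\<in>pts XG. \<Delta> x \<noteq> 0}"
      have qX0: "q ` Z \<subseteq> ?X0" using q(2,3) by blast
      have fG: "regf Z (gen_alg Z ?G) (\<lambda>z. f (q z))" if f: "f \<in> sub_fun XG ?C'" for f
      proof -
        obtain a where a: "a \<in> pts_fun XG" "f = restrict a ?C'" by (rule G.sub_funE[OF f])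
        have "regf Z (gen_alg Z ?G) (\<lambda>z. a (q z))"
        proof (rule regf_pullback[where p = q and f = a, OF coordinates_gen[OF a(1)] W.fun_alg_axioms qX0])
          fix c assume "c \<in> {\<lambda>x. b (r x) | b. b \<in> pts_fun XT} \<union> \<xi> ` {1..n} \<union> {\<lambda>x. inverse (\<Delta> x)}"
          then consider b where "b \<in> pts_fun XT" "c = (\<lambda>x. b (r x))" | i where "i \<in> {1..n}" "c = \<xi> i" | "c = (\<lambda>x. inverse (\<Delta> x))"
            by blast
          then show "regf Z (gen_alg Z ?G) (\<lambda>z. c (q z))"
          proof cases
            case 1
            then have "restrict b C \<in> sub_fun XT C" by (simp add: sub_fun_def)
            then have "(\<lambda>u. restrict b C (p u)) \<in> ?G" by blast
            from regf_gen[OF this] show ?thesis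
              by (rule regf_cong) (use p 1(2) in \<open>simp add: p_def\<close>)
          next
            case 2
            then have "\<zeta> i \<in> ?G" by auto
            from regf_gen[OF this] show ?thesis
              by (rule regf_cong) (use 2 in \<open>simp add: \<zeta>_def\<close>)
          next
            case 3
            show ?thesis
            proof (rule regf_cong[OF wG])
              fix z assume "z \<in> Z"
              then show "w z = c (q z)" using wD'[of z] q(2)[of z] 3 by (simp add: field_simps)
            qed
          qed
        qed
        then show ?thesis by (rule regf_cong) (use q(1) a(2) in simp)
      qed
      show "B \<subseteq> gen_alg Z ?G"
      proof
        fix b assume b: "b \<in> B"
        have "regf Z (gen_alg Z (insert w {\<lambda>z. f (q z) | f. f \<in> sub_fun XG ?C'})) b"
          using fun_alg.regf_mem[OF fun_alg_gen_alg subsetD[OF Bgen b]] .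
        then have "regf Z (gen_alg Z ?G) (\<lambda>z. b (id z))"
          by (rule regf_pullback[where p = id and f = b, OF _ W.fun_alg_axioms]) (use wG fG in auto)
        then show "b \<in> gen_alg Z ?G" using W.mem_regf[OF Z.ext[OF b]] by simp
      qed
      have "(\<lambda>v. \<Sum>\<alpha>\<in>keys P. single \<alpha> (lookup P \<alpha>)) \<in> rel_poly C (sub_fun XT C) (Suc n)"
        by (intro C.rel_poly_sum C.rel_poly_single C.regf_const) (use P_keys in fastforce)
      then show "(\<lambda>v. P) \<in> rel_poly C (sub_fun XT C) (Suc n)" using sum_singles[of "keys P" P] by simp
      show "0 \<notin> keys \<alpha>" if "\<alpha> \<in> keys P" for \<alpha> using P_keys[OF that] by auto
      show "\<zeta> 0 u * mpoly_eval P (\<lambda>i. \<zeta> i u) = 1" if "u \<in> Z" for u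
        using evP[OF that] wD'[OF that] by (simp add: \<zeta>_def)
      fix v and x :: "nat => 'k" assume v: "v \<in> C" "x 0 * mpoly_eval P x = 1"
      then have "mpoly_eval P x \<noteq> 0" by auto
      then obtain u where u: "u \<in> pts XG" "r u = v" "\<forall>i\<in>{1..n}. \<xi> i u = x i" using coordinates_onto v(1) CX by blast
      have du: "\<Delta> u = mpoly_eval P x"
        unfolding Delta_P[OF u(1)] by (rule mpoly_eval_cong) (use P_keys u(3) in blast)
      then have du0: "\<Delta> u \<noteq> 0" using v(2) by auto
      have "gact XG (\<sigma> u) (\<iota> v) \<in> ?C'"
        using st' iota_sat[OF CX v(1)] sigma_closed[OF u(1) du0] by (simp add: G.stable_def)
      then have "u \<in> ?C'" using sigma_act[OF u(1) du0] u(2) by simp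
      then obtain z where z: "z \<in> Z" "q z = u" using qsurj du0 by blast
      have "w z * \<Delta> u = x 0 * \<Delta> u" using wD'[OF z(1)] z(2) du v(2) by simp
      then have "w z = x 0" using du0 by simp
      then have "\<zeta> i z = x i" if "i \<le> n" for i using u(3) z that by (simp add: \<zeta>_def)
      then show "\<exists>z\<in>Z. p z = v \<and> (\<forall>i\<le>n. \<zeta> i z = x i)" using z u(2) by (intro bexI[of _ z]) (auto simp: p_def)
    qed
  qed
  have yX: "y \<in> pts XT" using y CX by blast
  obtain z where z: "z \<in> Z" "q z = \<iota> y" using qsurj[OF iota_sat[OF CX y]] Delta_iota[OF yX] by auto
  have "p z = y" using z(2) r_iota[OF yX] by (simp add: p_def)
  moreover have "topspace (ktop (affine_kspace Z B)) = Z" by (simp add: affine_kspace_def Z.topspace_zariski)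
  ultimately show ?thesis unfolding smoothly_equivalent_def closed_sub_def
    using variety_affine[OF Z] smp smq z by blast
qed

end

section \<open>Matrix-valued functions and general linear groups\<close>

abbreviation gl_inv :: "nat => 'k::field mat => 'k mat" where
  "gl_inv n g \<equiv> inv\<^bsub>GL n\<^esub> g"

lemma GL_carrier: "g \<in> carrier (GL n) \<longleftrightarrow> g \<in> carrier_mat n n \<and> det g \<noteq> (0::'k::field)"
proof
  assume g: "g \<in> carrier (GL n)"
  then have u: "g \<in> Units (ring_mat TYPE('k) n ())" by (simp add: GL_def units_of_def)
  then have "g \<in> carrier_mat n n" by (simp add: Units_def ring_mat_def)
  then show "g \<in> carrier_mat n n \<and> det g \<noteq> 0" using unit_imp_det_non_zero[OF u] by simp
next
  assume "g \<in> carrier_mat n n \<and> det g \<noteq> 0"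
  then show "g \<in> carrier (GL n)" using det_non_zero_imp_unit[of g n "()"] by (simp add: GL_def units_of_def)
qed

lemma GL_mult [simp]: "g \<otimes>\<^bsub>GL n\<^esub> h = g * h"
  by (simp add: GL_def units_of_def ring_mat_def)

lemma GL_one [simp]: "\<one>\<^bsub>GL n\<^esub> = 1\<^sub>m n"
  by (simp add: GL_def units_of_def ring_mat_def)

lemma GL_group: "group (GL n :: 'k::field mat monoid)"
proof -
  interpret R: ring "ring_mat TYPE('k) n ()" by (rule ring_mat)
  show ?thesis unfolding GL_def by (rule R.units_group)
qed

lemma GL_inv:
  assumes "g \<in> carrier (GL n)"
  shows "gl_inv n g \<in> carrier (GL n)" "gl_inv n g \<in> carrier_mat n n"
    "g * gl_inv n g = 1\<^sub>m n" "gl_inv n g * g = 1\<^sub>m n"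
proof -
  interpret group "GL n :: 'a mat monoid" by (rule GL_group)
  show "gl_inv n g \<in> carrier (GL n)" using assms by simp
  then show "gl_inv n g \<in> carrier_mat n n" by (simp add: GL_carrier)
  show "g * gl_inv n g = 1\<^sub>m n" "gl_inv n g * g = 1\<^sub>m n" using r_inv[OF assms] l_inv[OF assms] by simp_all
qed

lemma GL_I:
  fixes g :: "'k::field mat"
  assumes "g \<in> carrier_mat n n" "h \<in> carrier_mat n n" "g * h = 1\<^sub>m n"
  shows "g \<in> carrier (GL n)" "gl_inv n g = h" "h \<in> carrier (GL n)" "gl_inv n h = g"
proof -
  interpret group "GL n :: 'k mat monoid" by (rule GL_group)
  have "det g * det h = 1" using det_mult[OF assms(1,2)] assms(3) by simp
  then show c: "g \<in> carrier (GL n)" "h \<in> carrier (GL n)" using assms by (auto simp: GL_carrier)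
  show "gl_inv n h = g" using inv_equality[of g h] assms c by simp
  then show "gl_inv n g = h" using inv_inv[OF c(2)] by simp
qed

lemma GL_inv_mult:
  fixes g :: "'k::field mat"
  assumes "g \<in> carrier (GL n)" "h \<in> carrier (GL n)"
  shows "g * h \<in> carrier (GL n)" "gl_inv n (g * h) = gl_inv n h * gl_inv n g"
proof -
  interpret group "GL n :: 'k mat monoid" by (rule GL_group)
  show "g * h \<in> carrier (GL n)" "gl_inv n (g * h) = gl_inv n h * gl_inv n g"
    using m_closed[OF assms] inv_mult_group[OF assms] by simp_all
qed

lemma GL_one_closed: "1\<^sub>m n \<in> carrier (GL n)" "gl_inv n (1\<^sub>m n) = 1\<^sub>m n"
  by (rule GL_I[where h = "1\<^sub>m n"]; simp)+

lemma GL_inv_inv: "g \<in> carrier (GL n) ==> gl_inv n (gl_inv n g) = g"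
  using group.inv_inv[OF GL_group] by blast

lemma GL_transpose:
  assumes "g \<in> carrier (GL n)"
  shows "transpose_mat g \<in> carrier (GL n)" "gl_inv n (transpose_mat g) = transpose_mat (gl_inv n g)"
proof -
  have g: "g \<in> carrier_mat n n" using assms by (simp add: GL_carrier)
  have "transpose_mat g * transpose_mat (gl_inv n g) = transpose_mat (gl_inv n g * g)"
    using transpose_mult[OF GL_inv(2)[OF assms] g] by simp
  also have "\<dots> = 1\<^sub>m n" using GL_inv(4)[OF assms] by simp
  finally have e: "transpose_mat g * transpose_mat (gl_inv n g) = 1\<^sub>m n" .
  show "transpose_mat g \<in> carrier (GL n)" "gl_inv n (transpose_mat g) = transpose_mat (gl_inv n g)"
    using GL_I(1,2)[OF _ _ e] g GL_inv(2)[OF assms] by auto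
qed

lemma GL_inv_det: "g \<in> carrier (GL n) ==> det (gl_inv n g) = inverse (det g)"
proof -
  assume g: "g \<in> carrier (GL n)"
  have "det g * det (gl_inv n g) = 1"
    using det_mult[of g n "gl_inv n g"] GL_inv[OF g] g by (simp add: GL_carrier)
  then show ?thesis by (rule inverse_unique[symmetric])
qed

lemma GL_inv_adj: "g \<in> carrier (GL n) ==> gl_inv n g = inverse (det g) \<cdot>\<^sub>m adj_mat g"
proof -
  assume g: "g \<in> carrier (GL n)"
  then have c: "g \<in> carrier_mat n n" "det g \<noteq> 0" by (simp_all add: GL_carrier)
  note a = adj_mat[OF c(1)]
  have "g * (inverse (det g) \<cdot>\<^sub>m adj_mat g) = inverse (det g) \<cdot>\<^sub>m (g * adj_mat g)"
    using mult_smult_distrib[OF c(1) a(1)] by simp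
  also have "\<dots> = 1\<^sub>m n" unfolding a(2) using c(2) by (intro eq_matI) auto
  finally show ?thesis using GL_I(2)[OF c(1)] a(1) by simp
qed

definition regmat :: "'p set => ('p => 'k::comm_ring_1) set => nat => nat => ('p => 'k mat) => bool" where
  "regmat X A nr nc F \<longleftrightarrow> (\<forall>x\<in>X. F x \<in> carrier_mat nr nc) \<and> (\<forall>i<nr. \<forall>j<nc. regf X A (\<lambda>x. F x $$ (i, j)))"

lemma regmatI:
  "(\<And>x. x \<in> X ==> F x \<in> carrier_mat nr nc) ==> (\<And>i j. i < nr ==> j < nc ==> regf X A (\<lambda>x. F x $$ (i, j))) ==>
    regmat X A nr nc F"
  by (simp add: regmat_def)

lemma regmat_cong: "regmat X A nr nc F ==> (\<And>x. x \<in> X ==> F x = H x) ==> regmat X A nr nc H"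
  unfolding regmat_def using regf_cong[of X A "\<lambda>x. F x $$ (i, j)" "\<lambda>x. H x $$ (i, j)" for i j] by simp

lemma regmatD: "regmat X A nr nc F ==> x \<in> X ==> F x \<in> carrier_mat nr nc"
  "regmat X A nr nc F ==> i < nr ==> j < nc ==> regf X A (\<lambda>x. F x $$ (i, j))"
  by (simp_all add: regmat_def)

context fun_alg
begin

lemma regmat_mat: "(\<And>i j. i < nr ==> j < nc ==> regf X A (\<lambda>x. f x i j)) ==> regmat X A nr nc (\<lambda>x. mat nr nc (\<lambda>(i, j). f x i j))"
  by (simp add: regmat_def)

lemma regmat_mult:
  assumes "regmat X A nr n F" "regmat X A n nc H"
  shows "regmat X A nr nc (\<lambda>x. F x * H x)"
proof (rule regmatI)
  fix i j assume ij: "i < nr" "j < nc"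
  have "regf X A (\<lambda>x. \<Sum>k = 0..<n. F x $$ (i, k) * H x $$ (k, j))"
    by (intro regf_sum regf_mult) (use assms ij in \<open>auto simp: regmat_def\<close>)
  then show "regf X A (\<lambda>x. (F x * H x) $$ (i, j))"
  proof (rule regf_cong)
    fix x assume "x \<in> X"
    then have "F x \<in> carrier_mat nr n" "H x \<in> carrier_mat n nc" using assms by (auto simp: regmat_def)
    then show "(\<Sum>k = 0..<n. F x $$ (i, k) * H x $$ (k, j)) = (F x * H x) $$ (i, j)"
      using ij by (simp add: scalar_prod_def)
  qed
qed (use assms in \<open>auto simp: regmat_def\<close>)

lemma regmat_transpose: "regmat X A nr nc F ==> regmat X A nc nr (\<lambda>x. transpose_mat (F x))"
proof (rule regmatI)
  fix i j assume F: "regmat X A nr nc F" and ij: "i < nc" "j < nr"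
  show "regf X A (\<lambda>x. transpose_mat (F x) $$ (i, j))"
    by (rule regf_cong[OF regmatD(2)[OF F ij(2,1)]]) (use ij in \<open>simp add: carrier_matD[OF regmatD(1)[OF F]]\<close>)
qed (auto simp: regmat_def)

lemma regf_det:
  assumes "regmat X A n n F"
  shows "regf X A (\<lambda>x. det (F x))"
proof -
  have "regf X A (\<lambda>x. \<Sum>p | p permutes {0..<n}. signof p * (\<Prod>i = 0..<n. F x $$ (i, p i)))"
  proof (intro regf_sum regf_mult regf_const regf_prod)
    fix p i assume "p \<in> {p. p permutes {0..<n}}" "i \<in> {0..<n}"
    moreover from this have "p i \<in> {0..<n}" by (simp add: permutes_in_image)
    ultimately show "regf X A (\<lambda>x. F x $$ (i, p i))" using assms by (simp add: regmat_def)
  qed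
  then show ?thesis by (rule regf_cong) (use det_def'[OF regmatD(1)[OF assms]] in simp)
qed

lemma regmat_inverse:
  assumes F: "regmat X A n n F" and GL: "\<And>x. x \<in> X ==> F x \<in> carrier (GL n)"
    and inv: "regf X A (\<lambda>x. inverse (det (F x)))"
  shows "regmat X A n n (\<lambda>x. gl_inv n (F x))"
proof (rule regmatI)
  fix i j assume ij: "i < n" "j < n"
  have "regmat X A (n - 1) (n - 1) (\<lambda>x. mat_delete (F x) j i)"
  proof (rule regmatI)
    show "mat_delete (F x) j i \<in> carrier_mat (n - 1) (n - 1)" if "x \<in> X" for x
      by (rule mat_delete_carrier[OF regmatD(1)[OF F that]])
  next
    fix p q assume pq: "p < n - 1" "q < n - 1"
    have "regf X A (\<lambda>x. F x $$ (if p < j then p else Suc p, if q < i then q else Suc q))"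
      using F pq by (auto simp: regmat_def)
    then show "regf X A (\<lambda>x. mat_delete (F x) j i $$ (p, q))"
      by (rule regf_cong) (use F pq in \<open>auto simp: regmat_def mat_delete_def\<close>)
  qed
  then have "regf X A (\<lambda>x. inverse (det (F x)) * ((-1) ^ (j + i) * det (mat_delete (F x) j i)))"
    by (intro regf_mult inv regf_const regf_det)
  then show "regf X A (\<lambda>x. gl_inv n (F x) $$ (i, j))"
  proof (rule regf_cong)
    fix x assume x: "x \<in> X"
    then have "F x \<in> carrier_mat n n" using F by (simp add: regmat_def)
    then show "inverse (det (F x)) * ((-1) ^ (j + i) * det (mat_delete (F x) j i)) = gl_inv n (F x) $$ (i, j)"
      using GL_inv_adj[OF GL[OF x]] ij by (simp add: adj_mat_def cofactor_def)
  qed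
qed (use GL_inv(2)[OF GL] in simp)

end

text \<open>A rational action is one whose action map pulls regular functions back to functions on the product of the
  group with the variety; the latter are sums of products of functions on the factors.\<close>

lemma gen_alg_product_expansion:
  fixes A :: "('p => 'k::field) set" and B :: "('q => 'k) set"
  assumes A: "fun_alg X A" and B: "fun_alg Y B"
    and f: "regf (X \<times> Y) (gen_alg (X \<times> Y) ({\<lambda>p. a (fst p) | a. a \<in> A} \<union> {\<lambda>p. b (snd p) | b. b \<in> B})) f"
  shows "\<exists>(n::nat) c w. (\<forall>i<n. c i \<in> A \<and> w i \<in> B) \<and> (\<forall>x\<in>X. \<forall>y\<in>Y. f (x, y) = (\<Sum>i<n. c i x * w i y))"
  using f
proof (induction rule: regf_gen_alg_induct)
  interpret A: fun_alg X A by (rule A)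
  interpret B: fun_alg Y B by (rule B)
  have cA: "\<exists>a\<in>A. \<forall>x\<in>X. a x = c" for c using A.regf_const[of c] unfolding regf_def by (rule bexI[rotated]) simp
  have cB: "\<exists>b\<in>B. \<forall>y\<in>Y. b y = c" for c using B.regf_const[of c] unfolding regf_def by (rule bexI[rotated]) simp
  obtain u v where u: "u \<in> A" "\<forall>x\<in>X. u x = 1" and v: "v \<in> B" "\<forall>y\<in>Y. v y = 1" using cA[of 1] cB[of 1] by blast
  {
    case (cong f g)
    then show ?case by simp
  next
    case (const c)
    obtain a where "a \<in> A" "\<forall>x\<in>X. a x = c" using cA[of c] by blast
    then show ?case using v by (intro exI[of _ 1] exI[of _ "\<lambda>_. a"] exI[of _ "\<lambda>_. v"]) simp
  next
    case (gen f)
    then consider a where "a \<in> A" "f = (\<lambda>p. a (fst p))" | b where "b \<in> B" "f = (\<lambda>p. b (snd p))" by blast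
    then show ?case
    proof cases
      case 1
      then show ?thesis using v by (intro exI[of _ 1] exI[of _ "\<lambda>_. a"] exI[of _ "\<lambda>_. v"]) simp
    next
      case 2
      then show ?thesis using u by (intro exI[of _ 1] exI[of _ "\<lambda>_. u"] exI[of _ "\<lambda>_. b"]) simp
    qed
  next
    case (add f g)
    obtain n :: nat and c w where 1: "\<forall>i<n. c i \<in> A \<and> w i \<in> B" "\<forall>x\<in>X. \<forall>y\<in>Y. f (x, y) = (\<Sum>i<n. c i x * w i y)"
      using add(1) by (elim exE conjE) (rule that)
    obtain n' :: nat and c' w' where 2: "\<forall>i<n'. c' i \<in> A \<and> w' i \<in> B" "\<forall>x\<in>X. \<forall>y\<in>Y. g (x, y) = (\<Sum>i<n'. c' i x * w' i y)"
      using add(2) by (elim exE conjE) (rule that)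
    let ?c = "\<lambda>i. if i < n then c i else c' (i - n)" and ?w = "\<lambda>i. if i < n then w i else w' (i - n)"
    have s: "(\<Sum>i<n+n'. ?c i x * ?w i y) = (\<Sum>i<n. c i x * w i y) + (\<Sum>i<n'. c' i x * w' i y)" for x y
    proof -
      have "(\<Sum>i<n+n'. ?c i x * ?w i y) = (\<Sum>i<n. ?c i x * ?w i y) + (\<Sum>i=n..<n+n'. ?c i x * ?w i y)"
        unfolding lessThan_atLeast0 by (rule sum.atLeastLessThan_concat[symmetric]) simp_all
      also have "(\<Sum>i=n..<n+n'. ?c i x * ?w i y) = (\<Sum>i<n'. ?c (i + n) x * ?w (i + n) y)"
        using sum.shift_bounds_nat_ivl[of "\<lambda>i. ?c i x * ?w i y" 0 n n'] by (simp add: lessThan_atLeast0 add.commute)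
      finally show ?thesis by simp
    qed
    show ?case using 1 2 by (intro exI[of _ "n + n'"] exI[of _ ?c] exI[of _ ?w]) (auto simp: s)
  next
    case (mult f g)
    obtain n :: nat and c w where 1: "\<forall>i<n. c i \<in> A \<and> w i \<in> B" "\<forall>x\<in>X. \<forall>y\<in>Y. f (x, y) = (\<Sum>i<n. c i x * w i y)"
      using mult(1) by (elim exE conjE) (rule that)
    obtain n' :: nat and c' w' where 2: "\<forall>i<n'. c' i \<in> A \<and> w' i \<in> B" "\<forall>x\<in>X. \<forall>y\<in>Y. g (x, y) = (\<Sum>i<n'. c' i x * w' i y)"
      using mult(2) by (elim exE conjE) (rule that)
    obtain h where h: "bij_betw h {..<card ({..<n} \<times> {..<n'})} ({..<n} \<times> {..<n'})"
      using ex_bij_betw_nat_finite[of "{..<n} \<times> {..<n'}"] by (auto simp: lessThan_atLeast0)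
    let ?c = "\<lambda>k. \<lambda>x\<in>X. c (fst (h k)) x * c' (snd (h k)) x" and ?w = "\<lambda>k. \<lambda>y\<in>Y. w (fst (h k)) y * w' (snd (h k)) y"
    have hk: "fst (h k) < n \<and> snd (h k) < n'" if "k < card ({..<n} \<times> {..<n'})" for k
      using bij_betwE[OF h] that by (auto simp: mem_Times_iff)
    have mem: "?c k \<in> A \<and> ?w k \<in> B" if "k < card ({..<n} \<times> {..<n'})" for k
      using A.regf_mult[OF A.regf_mem A.regf_mem, of "c (fst (h k))" "c' (snd (h k))"]
        B.regf_mult[OF B.regf_mem B.regf_mem, of "w (fst (h k))" "w' (snd (h k))"] 1(1) 2(1) hk[OF that]
      by (simp add: regf_def)
    have eq: "f (x, y) * g (x, y) = (\<Sum>k<card ({..<n} \<times> {..<n'}). ?c k x * ?w k y)" if "x \<in> X" "y \<in> Y" for x y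
    proof -
      have "f (x, y) * g (x, y) = (\<Sum>(i, j)\<in>{..<n} \<times> {..<n'}. c i x * w i y * (c' j x * w' j y))"
        using 1(2) 2(2) that by (simp add: sum_product sum.cartesian_product)
      also have "\<dots> = (\<Sum>(i, j)\<in>{..<n} \<times> {..<n'}. c i x * c' j x * (w i y * w' j y))"
        by (intro sum.cong) (auto simp: mult_ac)
      also have "\<dots> = (\<Sum>k<card ({..<n} \<times> {..<n'}). case h k of (i, j) => c i x * c' j x * (w i y * w' j y))"
        by (rule sum.reindex_bij_betw[OF h, symmetric])
      finally show ?thesis using that by (simp add: case_prod_beta)
    qed
    show ?case by (intro exI[of _ "card ({..<n} \<times> {..<n'})"] exI[of _ ?c] exI[of _ ?w] conjI allI impI ballI
        mem[THEN conjunct1] mem[THEN conjunct2] eq) simp_all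
  }
qed

section \<open>Actions given by formulas\<close>

definition prod_alg :: "'p set => ('p => 'k::field) set => 'q set => ('q => 'k) set => ('p \<times> 'q => 'k) set" where
  "prod_alg X A Y B = gen_alg (X \<times> Y) ({\<lambda>p. a (fst p) | a. a \<in> A} \<union> {\<lambda>p. b (snd p) | b. b \<in> B})"

lemma fun_alg_prod_alg: "fun_alg (X \<times> Y) (prod_alg X A Y B)"
  unfolding prod_alg_def by (rule fun_alg_gen_alg)

lemma regmat_prod_alg:
  shows "regmat X A nr nc F ==> regmat (X \<times> Y) (prod_alg X A Y B) nr nc (\<lambda>p. F (fst p))"
    and "regmat Y B nr nc H ==> regmat (X \<times> Y) (prod_alg X A Y B) nr nc (\<lambda>p. H (snd p))"
proof -
  have 1: "regf (X \<times> Y) (prod_alg X A Y B) (\<lambda>p. a (fst p))" if "regf X A a" for a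
  proof -
    have "regf (X \<times> Y) (prod_alg X A Y B) (\<lambda>p. restrict a X (fst p))"
      unfolding prod_alg_def by (rule regf_gen) (use that in \<open>auto simp only: regf_def\<close>)
    then show ?thesis by (rule regf_cong) auto
  qed
  have 2: "regf (X \<times> Y) (prod_alg X A Y B) (\<lambda>p. b (snd p))" if "regf Y B b" for b
  proof -
    have "regf (X \<times> Y) (prod_alg X A Y B) (\<lambda>p. restrict b Y (snd p))"
      unfolding prod_alg_def by (rule regf_gen) (use that in \<open>auto simp only: regf_def\<close>)
    then show ?thesis by (rule regf_cong) auto
  qed
  show "regmat X A nr nc F ==> regmat (X \<times> Y) (prod_alg X A Y B) nr nc (\<lambda>p. F (fst p))"
    unfolding regmat_def using 1[of "\<lambda>x. F x $$ (i, j)" for i j] by simp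
  show "regmat Y B nr nc H ==> regmat (X \<times> Y) (prod_alg X A Y B) nr nc (\<lambda>p. H (snd p))"
    unfolding regmat_def using 2[of "\<lambda>x. H x $$ (i, j)" for i j] by simp
qed

lemma algebraic_actionI:
  fixes X :: "('h, 'p, 'k::field) gvar"
  assumes group: "group (grp X)" and alg: "fun_alg (carrier (grp X)) (grp_fun X)"
    and affine: "affine_variety (pts X) (pts_fun X)" and gen: "pts_fun X = gen_alg (pts X) C"
    and closed: "\<And>g x. g \<in> carrier (grp X) ==> x \<in> pts X ==> gact X g x \<in> pts X"
    and one: "\<And>x. x \<in> pts X ==> gact X \<one>\<^bsub>grp X\<^esub> x = x"
    and mult: "\<And>g h x. g \<in> carrier (grp X) ==> h \<in> carrier (grp X) ==> x \<in> pts X ==>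
      gact X (g \<otimes>\<^bsub>grp X\<^esub> h) x = gact X g (gact X h x)"
    and regular: "\<And>c. c \<in> C ==> regf (carrier (grp X) \<times> pts X) (prod_alg (carrier (grp X)) (grp_fun X) (pts X) (pts_fun X))
      (\<lambda>p. c (gact X (inv\<^bsub>grp X\<^esub> fst p) (snd p)))"
  shows "algebraic_action X"
proof (rule algebraic_action.intro)
  fix f assume f: "f \<in> pts_fun X"
  interpret A: fun_alg "pts X" "pts_fun X" by (rule affine_variety_fun_alg[OF affine])
  have "regf (pts X) (gen_alg (pts X) C) f" using A.regf_mem[OF f] by (simp add: gen)
  then have "regf (carrier (grp X) \<times> pts X) (prod_alg (carrier (grp X)) (grp_fun X) (pts X) (pts_fun X))
      (\<lambda>p. f (gact X (inv\<^bsub>grp X\<^esub> fst p) (snd p)))"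
  proof (rule regf_pullback[where p = "\<lambda>p. gact X (inv\<^bsub>grp X\<^esub> fst p) (snd p)" and f = f, OF _ fun_alg_prod_alg])
    show "(\<lambda>p. gact X (inv\<^bsub>grp X\<^esub> fst p) (snd p)) ` (carrier (grp X) \<times> pts X) \<subseteq> pts X"
      using closed group.inv_closed[OF group] by auto
  qed (rule regular)
  from gen_alg_product_expansion[OF alg affine_variety_fun_alg[OF affine] this[unfolded prod_alg_def]]
  show "\<exists>(n::nat) c w. (\<forall>i<n. c i \<in> grp_fun X \<and> w i \<in> pts_fun X) \<and>
      (\<forall>g\<in>carrier (grp X). \<forall>x\<in>pts X. f (gact X (inv\<^bsub>grp X\<^esub> g) x) = (\<Sum>i<n. c i g * w i x))"
    by simp
qed (rule group alg affine closed one mult; assumption)+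

lemma character_scale:
  assumes "character X A \<chi>" "fun_alg X A" "regf X A f"
  shows "\<chi> (\<lambda>x\<in>X. c * f x) = c * \<chi> (restrict f X)"
proof -
  interpret fun_alg X A by (rule assms(2))
  show ?thesis using character_regf(3)[OF assms(1,2) regf_const assms(3), of c] character_regf(1)[OF assms(1,2)] by simp
qed

lemma eps_symmetric_iff:
  assumes "A \<in> carrier_mat m m"
  shows "eps_symmetric s A \<longleftrightarrow> (\<forall>i<m. \<forall>j<m. A $$ (j, i) = of_int s * A $$ (i, j))"
proof -
  have "transpose_mat A = of_int s \<cdot>\<^sub>m A \<longleftrightarrow>
      (\<forall>i j. i < m \<longrightarrow> j < m \<longrightarrow> transpose_mat A $$ (i, j) = (of_int s \<cdot>\<^sub>m A) $$ (i, j))"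
    using assms by (subst mat_eq_iff) simp
  also have "\<dots> \<longleftrightarrow> (\<forall>i<m. \<forall>j<m. A $$ (j, i) = of_int s * A $$ (i, j))"
    using assms by (intro iff_allI imp_cong refl) simp
  finally show ?thesis by (simp add: eps_symmetric_def)
qed

text \<open>A character sends the entries of a regular family of (skew-)symmetric matrices to the entries of such a
  matrix.\<close>

lemma character_eps_mat:
  assumes \<chi>: "character X A \<chi>" "fun_alg X A" and F: "regmat X A m m F" and s: "\<And>x. x \<in> X ==> eps_symmetric s (F x)"
  shows "mat m m (\<lambda>(i, j). \<chi> (\<lambda>x\<in>X. F x $$ (i, j))) \<in> eps_mat s m"
proof -
  have e: "\<chi> (\<lambda>x\<in>X. F x $$ (j, i)) = of_int s * \<chi> (\<lambda>x\<in>X. F x $$ (i, j))" if ij: "i < m" "j < m" for i j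
  proof -
    have "F x $$ (j, i) = of_int s * F x $$ (i, j)" if "x \<in> X" for x
      using s[OF that] ij unfolding eps_symmetric_iff[OF regmatD(1)[OF F that]] by blast
    then have "\<chi> (\<lambda>x\<in>X. F x $$ (j, i)) = \<chi> (\<lambda>x\<in>X. of_int s * F x $$ (i, j))"
      by (intro arg_cong[of _ _ \<chi>] restrict_ext)
    also have "\<dots> = of_int s * \<chi> (\<lambda>x\<in>X. F x $$ (i, j))" by (rule character_scale[OF \<chi> regmatD(2)[OF F ij]])
    finally show ?thesis .
  qed
  have "mat m m (\<lambda>(i, j). \<chi> (\<lambda>x\<in>X. F x $$ (i, j))) $$ (j, i) =
      of_int s * mat m m (\<lambda>(i, j). \<chi> (\<lambda>x\<in>X. F x $$ (i, j))) $$ (i, j)" if ij: "i < m" "j < m" for i j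
    unfolding index_mat(1)[OF ij] index_mat(1)[OF ij(2,1)] prod.case by (rule e[OF ij])
  then show ?thesis unfolding eps_mat_def mem_Collect_eq eps_symmetric_iff[OF mat_carrier] by (intro conjI mat_carrier) blast
qed

lemma eps_symmetric_congruence:
  assumes A: "A \<in> eps_mat s m" and g: "g \<in> carrier_mat n m"
  shows "g * A * transpose_mat g \<in> eps_mat s n"
proof -
  have c: "A \<in> carrier_mat m m" and t: "transpose_mat A = of_int s \<cdot>\<^sub>m A"
    using A by (simp_all add: eps_mat_def eps_symmetric_def)
  have gA: "g * A \<in> carrier_mat n m" using g c by simp
  have "transpose_mat (g * A * transpose_mat g) = g * transpose_mat (g * A)"
    using transpose_mult[OF gA, of "transpose_mat g" n] g by simp
  also have "\<dots> = g * (of_int s \<cdot>\<^sub>m A * transpose_mat g)" using transpose_mult[OF g c] t by simp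
  also have "\<dots> = g * (of_int s \<cdot>\<^sub>m (A * transpose_mat g))"
    using c g by (subst mult_smult_assoc_mat[of _ m m _ n]) auto
  also have "\<dots> = of_int s \<cdot>\<^sub>m (g * (A * transpose_mat g))" using c g by (intro mult_smult_distrib) auto
  also have "g * (A * transpose_mat g) = g * A * transpose_mat g" using c g by (intro assoc_mult_mat[symmetric]) auto
  finally show ?thesis using gA g by (simp add: eps_mat_def eps_symmetric_def)
qed

section \<open>Congruence of matrices under a subgroup of the general linear group\<close>

lemma eps_mat_gvar_sel [simp]:
  "grp (eps_mat_gvar s m H) = GL m\<lparr>carrier := H\<rparr>"
  "grp_fun (eps_mat_gvar s m H) = gen_alg H ({\<lambda>g. g $$ (i, j) | i j. i < m \<and> j < m} \<union> {\<lambda>g. inverse (det g)})"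
  "pts (eps_mat_gvar s m H) = eps_mat s m"
  "pts_fun (eps_mat_gvar s m H) = gen_alg (eps_mat s m) {\<lambda>A. A $$ (i, j) | i j. i < m \<and> j < m}"
  "gact (eps_mat_gvar s m H) g A = g * A * transpose_mat g"
  by (simp_all add: eps_mat_gvar_def)

lemma regmat_eps_mat: "regmat (eps_mat s m) (gen_alg (eps_mat s m) {\<lambda>A. A $$ (i, j) | i j. i < m \<and> j < m}) m m (\<lambda>A. A)"
  by (rule regmatI) (auto simp: eps_mat_def intro!: regf_gen)

lemma finite_entries: "finite {\<lambda>A. A $$ (i, j) | i j. i < m \<and> j < (n::nat)}"
proof -
  have "finite ((\<lambda>p A. A $$ p) ` ({..<m} \<times> {..<n}))" by simp
  moreover have "{\<lambda>A. A $$ (i, j) | i j. i < m \<and> j < n} \<subseteq> (\<lambda>p A. A $$ p) ` ({..<m} \<times> {..<n})" by auto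
  ultimately show ?thesis by (rule finite_subset[rotated])
qed

lemma affine_eps_mat:
  "affine_variety (eps_mat s m) (gen_alg (eps_mat s m) {\<lambda>A::'k::field mat. A $$ (i, j) | i j. i < m \<and> j < m})"
proof (rule affine_variety_gen_algI[OF finite_entries])
  fix A B :: "'k mat" assume A: "A \<in> eps_mat s m" and B: "B \<in> eps_mat s m"
    and e: "\<And>c. c \<in> {\<lambda>A. A $$ (i, j) | i j. i < m \<and> j < m} ==> c A = c B"
  have "A $$ (i, j) = B $$ (i, j)" if "i < m" "j < m" for i j
    using e[of "\<lambda>A. A $$ (i, j)"] that by blast
  then show "A = B" using A B by (intro eq_matI) (auto simp: eps_mat_def)
next
  let ?X = "eps_mat s m :: 'k mat set" and ?C = "{\<lambda>A::'k mat. A $$ (i, j) | i j. i < m \<and> j < m}"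
  fix \<chi> assume \<chi>: "character ?X (gen_alg ?X ?C) \<chi>"
  let ?M = "mat m m (\<lambda>(i, j). \<chi> (\<lambda>A\<in>?X. A $$ (i, j)))"
  have "?M \<in> ?X"
    by (rule character_eps_mat[where F = "\<lambda>A. A", OF \<chi> fun_alg_gen_alg regmat_eps_mat]) (simp add: eps_mat_def)
  moreover have "\<forall>c\<in>?C. \<chi> (restrict c ?X) = c ?M" by auto
  ultimately show "\<exists>x\<in>?X. \<forall>c\<in>?C. \<chi> (restrict c ?X) = c x" by blast
qed

locale matrix_subgroup =
  fixes m :: nat and H :: "'k::field mat set"
  assumes subgroup: "subgroup H (GL m)"
begin

lemma H_GL: "g \<in> H ==> g \<in> carrier (GL m)"
  using subgroup.subset[OF subgroup] by blast

lemma H_inv: "g \<in> H ==> inv\<^bsub>GL m\<lparr>carrier := H\<rparr>\<^esub> g = gl_inv m g" "g \<in> H ==> gl_inv m g \<in> H"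
  using group.m_inv_consistent[OF GL_group subgroup] subgroup.m_inv_closed[OF subgroup] by auto

abbreviation H_alg :: "('k mat => 'k) set" where
  "H_alg \<equiv> gen_alg H ({\<lambda>g. g $$ (i, j) | i j. i < m \<and> j < m} \<union> {\<lambda>g. inverse (det g)})"

lemma regmat_H: "regmat H H_alg m m (\<lambda>g. g)" "regmat H H_alg m m (\<lambda>g. gl_inv m g)"
proof -
  interpret fun_alg H H_alg by (rule fun_alg_gen_alg)
  show 1: "regmat H H_alg m m (\<lambda>g. g)"
    by (rule regmatI) (use H_GL in \<open>auto simp: GL_carrier intro!: regf_gen\<close>)
  show "regmat H H_alg m m (\<lambda>g. gl_inv m g)"
    by (rule regmat_inverse[OF 1 H_GL]) (auto intro!: regf_gen)
qed

lemma algebraic_action_congruence: "algebraic_action (eps_mat_gvar s m H)"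
proof (rule algebraic_actionI)
  let ?X = "eps_mat_gvar s m H"
  show "group (grp ?X)" using subgroup.subgroup_is_group[OF subgroup GL_group] by simp
  show "fun_alg (carrier (grp ?X)) (grp_fun ?X)" by (simp add: fun_alg_gen_alg)
  show "affine_variety (pts ?X) (pts_fun ?X)" by (simp add: affine_eps_mat)
  show "pts_fun ?X = gen_alg (pts ?X) {\<lambda>A. A $$ (i, j) | i j. i < m \<and> j < m}" by simp
  show "gact ?X g A \<in> pts ?X" if "g \<in> carrier (grp ?X)" "A \<in> pts ?X" for g A
    using that H_GL[of g] by (simp add: eps_symmetric_congruence GL_carrier)
  show "gact ?X \<one>\<^bsub>grp ?X\<^esub> A = A" if "A \<in> pts ?X" for A
    using that left_mult_one_mat[of A m m] right_mult_one_mat[of A m m] by (simp add: eps_mat_def)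
  show "gact ?X (g \<otimes>\<^bsub>grp ?X\<^esub> h) A = gact ?X g (gact ?X h A)"
    if gh: "g \<in> carrier (grp ?X)" "h \<in> carrier (grp ?X)" and A: "A \<in> pts ?X" for g h A
  proof -
    have c: "g \<in> carrier_mat m m" "h \<in> carrier_mat m m" "A \<in> carrier_mat m m"
      using gh A H_GL by (auto simp: GL_carrier eps_mat_def)
    then show ?thesis using transpose_mult[OF c(1,2)] by (simp add: assoc_mult_mat[of _ m m _ m _ m])
  qed
  fix c :: "'k mat => 'k" assume "c \<in> {\<lambda>A. A $$ (i, j) | i j. i < m \<and> j < m}"
  then obtain i j where ij: "i < m" "j < m" "c = (\<lambda>A. A $$ (i, j))" by blast
  let ?P = "H \<times> eps_mat s m" and ?A = "prod_alg H H_alg (eps_mat s m) (pts_fun ?X)"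
  interpret P: fun_alg ?P ?A by (rule fun_alg_prod_alg)
  have "regmat ?P ?A m m (\<lambda>p. gl_inv m (fst p) * snd p * transpose_mat (gl_inv m (fst p)))"
    using regmat_prod_alg(1)[OF regmat_H(2)] regmat_prod_alg(2)[OF regmat_eps_mat[of s m]]
    by (intro P.regmat_mult[where n = m] P.regmat_transpose) simp_all
  from regmatD(2)[OF this ij(1,2)]
  show "regf (carrier (grp ?X) \<times> pts ?X) (prod_alg (carrier (grp ?X)) (grp_fun ?X) (pts ?X) (pts_fun ?X))
      (\<lambda>p. c (gact ?X (inv\<^bsub>grp ?X\<^esub> fst p) (snd p)))"
    by (simp add: ij(3)) (rule regf_cong, assumption, auto simp: H_inv)
qed

end

text \<open>The entries of the inverse above the diagonal vanish row by row, starting from the first row.\<close>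

lemma lower_borel_inv:
  fixes g :: "'k::field mat"
  assumes g: "g \<in> lower_borel m"
  shows "gl_inv m g \<in> lower_borel m"
proof -
  have G: "g \<in> carrier (GL m)" and l: "\<And>i j. i < j ==> j < m ==> g $$ (i, j) = 0"
    using g by (auto simp: lower_borel_def)
  have c: "g \<in> carrier_mat m m" "det g \<noteq> 0" using G by (simp_all add: GL_carrier)
  note N = GL_inv[OF G]
  have d: "g $$ (i, i) \<noteq> 0" if "i < m" for i
  proof
    assume "g $$ (i, i) = 0"
    then have "0 \<in> set (diag_mat g)" using that c(1) by (force simp: diag_mat_def)
    then show False using det_lower_triangular[OF l c(1)] c(2) by (simp add: prod_list_zero_iff)
  qed
  have "gl_inv m g $$ (i, j) = 0" if "i < j" "j < m" for i j
    using that
  proof (induction i rule: less_induct)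
    case (less i)
    have i: "i < m" using less by simp
    have "0 = (g * gl_inv m g) $$ (i, j)" using N(3) less i by simp
    also have "\<dots> = (\<Sum>k = 0..<m. g $$ (i, k) * gl_inv m g $$ (k, j))"
      using c(1) N(2) i less by (simp add: scalar_prod_def)
    also have "\<dots> = (\<Sum>k\<in>{i}. g $$ (i, k) * gl_inv m g $$ (k, j))"
    proof (rule sum.mono_neutral_right)
      show "\<forall>k\<in>{0..<m} - {i}. g $$ (i, k) * gl_inv m g $$ (k, j) = 0"
      proof
        fix k assume "k \<in> {0..<m} - {i}"
        then consider "k < i" | "i < k" "k < m" by fastforce
        then show "g $$ (i, k) * gl_inv m g $$ (k, j) = 0"
          by cases (use less l in auto)
      qed
    qed (use i in auto)
    finally show ?case using d[OF i] by simp
  qed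
  then show ?thesis using N(1) by (simp add: lower_borel_def)
qed

lemma lower_borel_subgroup: "subgroup (lower_borel m) (GL m :: 'k::field mat monoid)"
proof (rule group.subgroupI[OF GL_group])
  show "lower_borel m \<subseteq> carrier (GL m :: 'k mat monoid)" by (auto simp: lower_borel_def)
  show "lower_borel m \<noteq> ({} :: 'k mat set)"
    using GL_one_closed(1)[of m] by (auto simp: lower_borel_def intro!: exI[of _ "1\<^sub>m m"])
  fix g h :: "'k mat" assume g: "g \<in> lower_borel m"
  then show "gl_inv m g \<in> lower_borel m" by (rule lower_borel_inv)
  assume h: "h \<in> lower_borel m"
  have c: "g \<in> carrier_mat m m" "h \<in> carrier_mat m m" using g h by (auto simp: lower_borel_def GL_carrier)
  have "(g * h) $$ (i, j) = 0" if ij: "i < j" "j < m" for i j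
  proof -
    have "g $$ (i, k) * h $$ (k, j) = 0" if "k < m" for k
      using g h ij that by (cases "i < k") (auto simp: lower_borel_def)
    then have "(\<Sum>k = 0..<m. g $$ (i, k) * h $$ (k, j)) = 0" by (intro sum.neutral) simp
    then show ?thesis using c ij by (simp add: scalar_prod_def)
  qed
  then show "g \<otimes>\<^bsub>GL m\<^esub> h \<in> lower_borel m" using g h GL_inv_mult(1)[of g m h] by (simp add: lower_borel_def)
qed

lemma diag_torus_subset: "diag_torus m \<subseteq> lower_borel m"
  by (auto simp: diag_torus_def lower_borel_def diagonal_mat_def GL_carrier)

lemma diag_torus_iff: "g \<in> diag_torus m \<longleftrightarrow> g \<in> lower_borel m \<and> transpose_mat g \<in> lower_borel m"
proof
  assume g: "g \<in> diag_torus m"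
  then have "g \<in> carrier (GL m)" by (simp add: diag_torus_def)
  then have "transpose_mat g \<in> carrier (GL m)" "g \<in> carrier_mat m m" using GL_transpose(1) by (auto simp: GL_carrier)
  then show "g \<in> lower_borel m \<and> transpose_mat g \<in> lower_borel m"
    using g diag_torus_subset by (auto simp: lower_borel_def diag_torus_def diagonal_mat_def)
next
  assume g: "g \<in> lower_borel m \<and> transpose_mat g \<in> lower_borel m"
  then have c: "g \<in> carrier (GL m)" "g \<in> carrier_mat m m" by (auto simp: lower_borel_def GL_carrier)
  have "g $$ (i, j) = 0" if "i < m" "j < m" "i \<noteq> j" for i j
  proof (cases "i < j")
    case True
    then show ?thesis using g that by (simp add: lower_borel_def)
  next
    case False
    then have "transpose_mat g $$ (j, i) = 0" using g that by (simp add: lower_borel_def)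
    then show ?thesis using c(2) that by simp
  qed
  then show "g \<in> diag_torus m" using c by (simp add: diag_torus_def diagonal_mat_def)
qed

lemma diag_torus_subgroup: "subgroup (diag_torus m) (GL m :: 'k::field mat monoid)"
proof (rule group.subgroupI[OF GL_group])
  show "diag_torus m \<subseteq> carrier (GL m :: 'k mat monoid)" by (auto simp: diag_torus_def)
  have "1\<^sub>m m \<in> (diag_torus m :: 'k mat set)"
    using subgroup.one_closed[OF lower_borel_subgroup[of m]] by (simp add: diag_torus_iff)
  then show "diag_torus m \<noteq> ({} :: 'k mat set)" by blast
  fix g h :: "'k mat" assume g: "g \<in> diag_torus m" and h: "h \<in> diag_torus m"
  have G: "g \<in> carrier (GL m)" "g \<in> carrier_mat m m" "h \<in> carrier_mat m m"
    using g h by (simp_all add: diag_torus_def GL_carrier)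
  show "gl_inv m g \<in> diag_torus m"
    using g lower_borel_inv[of g m] lower_borel_inv[of "transpose_mat g" m] GL_transpose(2)[OF G(1)]
    by (simp add: diag_torus_iff)
  show "g \<otimes>\<^bsub>GL m\<^esub> h \<in> diag_torus m"
    using g h subgroup.m_closed[OF lower_borel_subgroup[of m]] transpose_mult[OF G(2,3)]
    by (fastforce simp: diag_torus_iff)
qed

section \<open>The quiver of flags\<close>

text \<open>The linearly oriented quiver \<open>0 \<rightarrow> 1 \<rightarrow> \<dots> \<rightarrow> 2m + 1\<close>, where the arrow \<open>a\<close> starts at the vertex \<open>a\<close>. It has an even number of
  vertices, so that the involution fixes the arrow \<open>m\<close> but no vertex.\<close>

definition flag_quiver :: "int => nat => (nat, nat) sym_quiver" where
  "flag_quiver s m = \<lparr>verts = {0..2 * m + 1}, arcs = {0..2 * m}, tail = id, head = Suc,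
     tau0 = (\<lambda>z. 2 * m + 1 - z), tau1 = (\<lambda>a. 2 * m - a), qsign = s, pos0 = {..m}, pos1 = {..<m}\<rparr>"

definition flag_dim :: "nat => nat => nat" where
  "flag_dim m z = (if z \<le> m then z else 2 * m + 1 - z)"

lemma flag_quiver_sel [simp]:
  "tail (flag_quiver s m) = id" "head (flag_quiver s m) = Suc" "tau0 (flag_quiver s m) z = 2 * m + 1 - z"
  "tau1 (flag_quiver s m) a = 2 * m - a"
  "qsign (flag_quiver s m) = s" "pos0 (flag_quiver s m) = {..m}" "pos1 (flag_quiver s m) = {..<m}"
  by (simp_all add: flag_quiver_def)

lemma flag_quiver_fix: "fix0 (flag_quiver s m) = {}" "fix1 (flag_quiver s m) = {m}"
  "pos0 (flag_quiver s m) \<union> fix0 (flag_quiver s m) = {..m}" "pos1 (flag_quiver s m) \<union> fix1 (flag_quiver s m) = {..m}"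
proof -
  have "2 * m + 1 - z \<noteq> z" if "z \<le> 2 * m + 1" for z :: nat using that by presburger
  then show f0: "fix0 (flag_quiver s m) = {}" unfolding fix0_def by (auto simp del: One_nat_def add_Suc_right simp: flag_quiver_def)
  show f1: "fix1 (flag_quiver s m) = {m}" by (auto simp: fix1_def flag_quiver_def)
  show "pos0 (flag_quiver s m) \<union> fix0 (flag_quiver s m) = {..m}" "pos1 (flag_quiver s m) \<union> fix1 (flag_quiver s m) = {..m}"
    unfolding f0 f1 by auto
qed

lemma symmetric_type_A_flag_quiver:
  assumes "s \<in> {1, -1}"
  shows "symmetric_type_A (flag_quiver s m)"
  unfolding symmetric_type_A_def
proof (intro conjI)
  let ?Q = "flag_quiver s m"
  have "wf_digraph (pre_digraph.truncate ?Q)"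
    by unfold_locales (auto simp: pre_digraph.truncate_def flag_quiver_def)
  then show "fin_digraph (pre_digraph.truncate ?Q)"
    by (rule fin_digraph.intro) (unfold_locales, auto simp: pre_digraph.truncate_def flag_quiver_def)
  show "qsign ?Q \<in> {1, -1}" using assms by simp
  show "\<forall>a\<in>arcs ?Q. tau0 ?Q (head ?Q a) = tail ?Q (tau1 ?Q a) \<and> tau0 ?Q (tail ?Q a) = head ?Q (tau1 ?Q a)"
    by (auto simp: flag_quiver_def)
  \<comment> \<open>Vertices and arrows are numbered from \<open>0\<close>, while the enumerations start at \<open>1\<close>.\<close>
  have b: "bij_betw (\<lambda>i. i - 1) {1..n} {0..n - 1}" "bij_betw (\<lambda>i. i - 1) {1..<n} {0..n - 2}" if "n \<ge> 2" for n :: nat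
    using that by (auto intro!: bij_betwI[where g = Suc])
  have p0: "{..m} = (\<lambda>i. i - 1) ` {i \<in> {1..2 * m + 2}. 2 * i < 2 * m + 2 + 1}"
    by (auto intro!: image_eqI[of _ _ "Suc i" for i])
  have p1: "{..<m} = (\<lambda>i. i - 1) ` {i \<in> {1..<2 * m + 2}. 2 * i < 2 * m + 2}"
    by (auto intro!: image_eqI[of _ _ "Suc i" for i])
  show "\<exists>(n::nat) v e. 2 \<le> n \<and> bij_betw v {1..n} (verts ?Q) \<and> bij_betw e {1..<n} (arcs ?Q) \<and>
       (\<forall>i\<in>{1..<n}. {tail ?Q (e i), head ?Q (e i)} = {v i, v (i + 1)}) \<and>
       (\<forall>i\<in>{1..n}. tau0 ?Q (v i) = v (n + 1 - i)) \<and>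
       (\<forall>i\<in>{1..<n}. tau1 ?Q (e i) = e (n - i)) \<and>
       pos0 ?Q = v ` {i\<in>{1..n}. 2 * i < n + 1} \<and>
       pos1 ?Q = e ` {i\<in>{1..<n}. 2 * i < n}"
  proof (intro exI[of _ "2 * m + 2"] exI[of _ "\<lambda>i. i - 1"] conjI)
    show "bij_betw (\<lambda>i. i - 1) {1..2 * m + 2} (verts ?Q)" "bij_betw (\<lambda>i. i - 1) {1..<2 * m + 2} (arcs ?Q)"
      using b[of "2 * m + 2"] by (simp_all add: flag_quiver_def)
    show "pos0 ?Q = (\<lambda>i. i - 1) ` {i \<in> {1..2 * m + 2}. 2 * i < 2 * m + 2 + 1}"
      "pos1 ?Q = (\<lambda>i. i - 1) ` {i \<in> {1..<2 * m + 2}. 2 * i < 2 * m + 2}" using p0 p1 by simp_all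
  qed auto
qed

lemma symmetric_dimvec_flag: "symmetric_dimvec (flag_quiver s m) (flag_dim m)"
  by (auto simp: symmetric_dimvec_def flag_quiver_def flag_dim_def)

lemma form_choice_flag: "form_choice (flag_quiver s m) (flag_dim m) \<Omega>"
  by (simp add: form_choice_def flag_quiver_fix)

definition flag_pts :: "int => nat => (nat => 'k::field mat) set" where
  "flag_pts s m = (\<Pi>\<^sub>E a\<in>{..m}. if a = m then eps_mat s m else carrier_mat (Suc a) a)"

definition flag_entries :: "nat => ((nat => 'k::field mat) => 'k) set" where
  "flag_entries m = {\<lambda>V. V a $$ (i, j) | a i j. a \<le> m \<and> i < min (Suc a) m \<and> j < a}"

definition flag_group :: "nat => (nat => 'k::field mat) monoid" where
  "flag_group m = product_group {..m} GL"

definition flag_group_gens :: "nat => ((nat => 'k::field mat) => 'k) set" where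
  "flag_group_gens m = {\<lambda>g. g z $$ (i, j) | z i j. z \<le> m \<and> i < z \<and> j < z} \<union> {\<lambda>g. inverse (det (g z)) | z. z \<le> m}"

abbreviation flag_fun :: "int => nat => ((nat => 'k::field mat) => 'k) set" where
  "flag_fun s m \<equiv> gen_alg (flag_pts s m) (flag_entries m)"

abbreviation flag_group_fun :: "nat => ((nat => 'k::field mat) => 'k) set" where
  "flag_group_fun m \<equiv> gen_alg (carrier (flag_group m)) (flag_group_gens m)"

definition flag_act :: "nat => (nat => 'k::field mat) => (nat => 'k mat) => (nat => 'k mat)" where
  "flag_act m g V = (\<lambda>a\<in>{..m}. if a = m then transpose_mat (gl_inv m (g m)) * V m * gl_inv m (g m)
     else g (Suc a) * V a * gl_inv a (g a))"

text \<open>The space of symmetric representations of the quiver, with the action of the twisted component at the vertex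
  \<open>m + 1\<close> on the middle arrow written out.\<close>

definition flag_gvar :: "int => nat => (nat => 'k::field mat, nat => 'k mat, 'k) gvar" where
  "flag_gvar s m = \<lparr>grp = flag_group m, grp_fun = flag_group_fun m,
     pts = flag_pts s m, pts_fun = flag_fun s m, gact = flag_act m\<rparr>"

lemma flag_gvar_sel [simp]:
  "grp (flag_gvar s m) = flag_group m" "grp_fun (flag_gvar s m) = flag_group_fun m"
  "pts (flag_gvar s m) = flag_pts s m" "pts_fun (flag_gvar s m) = flag_fun s m"
  "gact (flag_gvar s m) = flag_act m"
  by (simp_all add: flag_gvar_def)

lemma product_group_cong:
  assumes "\<And>i. i \<in> I ==> G i = H i"
  shows "product_group I G = product_group I H"
  unfolding product_group_def using assms by (simp cong: PiE_cong restrict_cong)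

lemma srep_gvar_flag_quiver: "srep_gvar (flag_quiver s m) (flag_dim m) \<Omega> = flag_gvar s m"
proof -
  let ?Q = "flag_quiver s m" and ?d = "flag_dim m"
  have d: "a \<le> m ==> ?d a = a" "a \<le> m ==> ?d (Suc a) = min (Suc a) m" for a by (auto simp: flag_dim_def)
  have grp: "quiver_group ?Q ?d \<Omega> = flag_group m"
    unfolding quiver_group_def flag_group_def flag_quiver_fix(3) by (rule product_group_cong) (simp add: d flag_quiver_fix(1))
  have pts: "srep ?Q ?d = flag_pts s m"
    unfolding srep_def flag_pts_def flag_quiver_fix(4) by (rule PiE_cong) (auto simp: d eps_mat_def flag_quiver_fix(2))
  have ents: "{\<lambda>V. V a $$ (i, j) | a i j. a \<in> {..m} \<and> i < ?d (Suc a) \<and> j < ?d a} = flag_entries m"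
    unfolding flag_entries_def by (intro Collect_cong ex_cong1 conj_cong refl) (simp_all add: d)
  have gfun: "{\<lambda>g. g z $$ (i, j) | z i j. z \<in> {..m} \<and> i < ?d z \<and> j < ?d z} \<union>
        {\<lambda>g. inverse (det (g z)) | z. z \<in> {..m}} = flag_group_gens m"
    unfolding flag_group_gens_def
    by (intro arg_cong2[of _ _ _ _ "(\<union>)"] Collect_cong ex_cong1 conj_cong refl) (simp_all add: d)
  have act: "(\<lambda>a\<in>{..m}. gcomp ?Q ?d g (Suc a) * V a * gl_inv (?d a) (gcomp ?Q ?d g a)) = flag_act m g V" for g V
    unfolding flag_act_def by (rule restrict_ext) (auto simp: gcomp_def flag_quiver_fix d)
  show ?thesis
    unfolding srep_gvar_def flag_gvar_def grp pts flag_quiver_fix(3,4) flag_quiver_sel(1,2) id_apply ents gfun act ..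
qed

lemma mat_assoc: "dim_col A = dim_row B ==> dim_col B = dim_row C ==> (A * B) * C = A * (B * C)"
  by (rule assoc_mult_mat[of A "dim_row A" "dim_row B" B "dim_row C" C "dim_col C"]) auto

lemma mat_assoc_conj:
  assumes "A \<in> carrier_mat n n" "B \<in> carrier_mat n n" "V \<in> carrier_mat n k" "C \<in> carrier_mat k k" "D \<in> carrier_mat k k"
  shows "(A * B) * V * (C * D) = A * (B * V * C) * D"
  using assms[THEN carrier_matD(1)] assms[THEN carrier_matD(2)] by (simp add: mat_assoc)

lemma group_flag_group: "group (flag_group m :: (nat => 'k::field mat) monoid)"
  unfolding flag_group_def by (rule product_group) (rule GL_group)

lemma flag_group_carrier: "g \<in> carrier (flag_group m) \<longleftrightarrow> g \<in> extensional {..m} \<and> (\<forall>z\<le>m. g z \<in> carrier (GL z))"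
  by (auto simp: flag_group_def PiE_iff)

lemma flag_group_mult: "g \<otimes>\<^bsub>flag_group m\<^esub> h = (\<lambda>z\<in>{..m}. g z * h z)"
  by (simp add: flag_group_def)

lemma flag_group_one: "\<one>\<^bsub>flag_group m\<^esub> = (\<lambda>z\<in>{..m}. 1\<^sub>m z)"
  by (simp add: flag_group_def)

lemma flag_group_inv:
  fixes g :: "nat => 'k::field mat"
  assumes "g \<in> carrier (flag_group m)"
  shows "inv\<^bsub>flag_group m\<^esub> g = (\<lambda>z\<in>{..m}. gl_inv z (g z))"
proof -
  have "g \<in> (\<Pi>\<^sub>E z\<in>{..m}. carrier (GL z))" using assms by (simp add: flag_group_def)
  moreover have "\<And>i. i \<in> {..m} ==> group (GL i :: 'k mat monoid)" by (rule GL_group)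
  ultimately show ?thesis unfolding flag_group_def by (rule inv_product_group)
qed

lemma flag_pts_iff: "V \<in> flag_pts s m \<longleftrightarrow>
    V \<in> extensional {..m} \<and> (\<forall>a<m. V a \<in> carrier_mat (Suc a) a) \<and> V m \<in> eps_mat s m"
proof -
  have "(\<forall>a\<in>{..m}. V a \<in> (if a = m then eps_mat s m else carrier_mat (Suc a) a)) \<longleftrightarrow>
      (\<forall>a<m. V a \<in> carrier_mat (Suc a) a) \<and> V m \<in> eps_mat s m"
    by (auto simp: le_less)
  then show ?thesis by (auto simp: flag_pts_def PiE_iff)
qed

lemma flag_pts_eqI:
  assumes "V \<in> flag_pts s m" "W \<in> flag_pts s m" "\<And>a. a < m ==> V a = W a" "V m = W m"
  shows "V = W"
proof (rule extensionalityI[of _ "{..m}"])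
  fix a assume "a \<in> {..m}"
  then show "V a = W a" using assms(3,4) by (cases "a = m") auto
qed (use assms in \<open>simp_all add: flag_pts_iff\<close>)

lemma regmat_flag:
  shows "a < m ==> regmat (flag_pts s m) (flag_fun s m) (Suc a) a (\<lambda>V. V a)"
    and "regmat (flag_pts s m) (flag_fun s m) m m (\<lambda>V. V m)"
proof -
  have r: "regf (flag_pts s m) (flag_fun s m) (\<lambda>V. V a $$ (i, j))"
    if "a \<le> m" "i < min (Suc a) m" "j < a" for a i j
    by (rule regf_gen) (unfold flag_entries_def, use that in blast)
  show "a < m ==> regmat (flag_pts s m) (flag_fun s m) (Suc a) a (\<lambda>V. V a)"
    by (rule regmatI) (auto simp: flag_pts_iff intro!: r)
  show "regmat (flag_pts s m) (flag_fun s m) m m (\<lambda>V. V m)"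
    by (rule regmatI) (auto simp: flag_pts_iff eps_mat_def intro!: r)
qed

lemma regmat_flag_group:
  fixes z m :: nat
  defines "G \<equiv> carrier (flag_group m) :: (nat => 'k::field mat) set"
  assumes "z \<le> m"
  shows "regmat G (gen_alg G (flag_group_gens m)) z z (\<lambda>g. g z)"
    and "regmat G (gen_alg G (flag_group_gens m)) z z (\<lambda>g. gl_inv z (g z))"
proof -
  interpret fun_alg G "gen_alg G (flag_group_gens m)" by (rule fun_alg_gen_alg)
  have GL: "g z \<in> carrier (GL z)" if "g \<in> G" for g using that assms by (simp add: flag_group_carrier)
  show 1: "regmat G (gen_alg G (flag_group_gens m)) z z (\<lambda>g. g z)"
  proof (rule regmatI)
    show "regf G (gen_alg G (flag_group_gens m)) (\<lambda>g. g z $$ (i, j))" if "i < z" "j < z" for i j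
      by (rule regf_gen) (unfold flag_group_gens_def, use that assms in blast)
  qed (use GL in \<open>simp add: GL_carrier\<close>)
  show "regmat G (gen_alg G (flag_group_gens m)) z z (\<lambda>g. gl_inv z (g z))"
  proof (rule regmat_inverse[where n = z and F = "\<lambda>g. g z", OF 1])
    show "g z \<in> carrier (GL z)" if "g \<in> G" for g by (rule GL[OF that])
    show "regf G (gen_alg G (flag_group_gens m)) (\<lambda>g. inverse (det (g z)))"
      by (rule regf_gen) (unfold flag_group_gens_def, use assms in blast)
  qed
qed

lemma finite_flag_entries: "finite (flag_entries m :: ((nat => 'k::field mat) => 'k) set)"
proof (rule finite_subset)
  show "finite ((\<lambda>(a, p) V. V a $$ p) ` ({..m} \<times> {..<m} \<times> {..<m}))" by simp
  show "(flag_entries m :: ((nat => 'k mat) => 'k) set) \<subseteq> (\<lambda>(a, p) V. V a $$ p) ` ({..m} \<times> {..<m} \<times> {..<m})"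
  proof
    fix c assume "c \<in> flag_entries m"
    then obtain a i j where "a \<le> m" "i < min (Suc a) m" "j < a" "c = (\<lambda>V. V a $$ (i, j))"
      unfolding flag_entries_def by blast
    then show "c \<in> (\<lambda>(a, p) V. V a $$ p) ` ({..m} \<times> {..<m} \<times> {..<m})"
      by (intro image_eqI[of _ _ "(a, i, j)"]) auto
  qed
qed

lemma affine_flag_pts:
  "affine_variety (flag_pts s m) (gen_alg (flag_pts s m) (flag_entries m :: ((nat => 'k::field mat) => 'k) set))"
proof (rule affine_variety_gen_algI[OF finite_flag_entries])
  fix V W :: "nat => 'k mat" assume V: "V \<in> flag_pts s m" and W: "W \<in> flag_pts s m"
    and e: "\<And>c. c \<in> flag_entries m ==> c V = c W"
  have e': "V a $$ (i, j) = W a $$ (i, j)" if "a \<le> m" "i < min (Suc a) m" "j < a" for a i j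
    using e[of "\<lambda>V. V a $$ (i, j)"] that unfolding flag_entries_def by blast
  show "V = W"
  proof (rule flag_pts_eqI[OF V W])
    show "V a = W a" if "a < m" for a
    proof (rule eq_matI)
      fix i j assume "i < dim_row (W a)" "j < dim_col (W a)"
      moreover have "W a \<in> carrier_mat (Suc a) a" using W that by (simp add: flag_pts_iff)
      ultimately show "V a $$ (i, j) = W a $$ (i, j)" using e'[of a i j] that by auto
    qed (use V W that in \<open>auto simp: flag_pts_iff dest!: spec[of _ a]\<close>)
    have "V m \<in> carrier_mat m m" "W m \<in> carrier_mat m m" using V W by (auto simp: flag_pts_iff eps_mat_def)
    then show "V m = W m" by (intro eq_matI) (use e'[of m] in auto)
  qed
next
  let ?X = "flag_pts s m :: (nat => 'k mat) set" and ?C = "flag_entries m :: ((nat => 'k mat) => 'k) set"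
  fix \<chi> assume \<chi>: "character ?X (gen_alg ?X ?C) \<chi>"
  let ?W = "\<lambda>a\<in>{..m}. mat (min (Suc a) m) a (\<lambda>(i, j). \<chi> (\<lambda>V\<in>?X. V a $$ (i, j)))"
  have "mat m m (\<lambda>(i, j). \<chi> (\<lambda>V\<in>?X. V m $$ (i, j))) \<in> eps_mat s m"
    by (rule character_eps_mat[OF \<chi> fun_alg_gen_alg regmat_flag(2)]) (simp add: flag_pts_iff eps_mat_def)
  then have W: "?W \<in> ?X" by (simp add: flag_pts_iff min_def)
  moreover have "\<chi> (restrict c ?X) = c ?W" if c: "c \<in> ?C" for c
  proof -
    obtain a i j where a: "a \<le> m" "i < min (Suc a) m" "j < a" "c = (\<lambda>V. V a $$ (i, j))"
      using c unfolding flag_entries_def by blast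
    then show ?thesis by simp
  qed
  ultimately show "\<exists>x\<in>?X. \<forall>c\<in>?C. \<chi> (restrict c ?X) = c x" by blast
qed

lemma flag_act_sel:
  "a < m ==> flag_act m g V a = g (Suc a) * V a * gl_inv a (g a)"
  "flag_act m g V m = transpose_mat (gl_inv m (g m)) * V m * gl_inv m (g m)"
  "flag_act m g V \<in> extensional {..m}"
  by (simp_all add: flag_act_def)

lemma flag_group_dims:
  assumes "g \<in> carrier (flag_group m)" "z \<le> m"
  shows "g z \<in> carrier (GL z)" "g z \<in> carrier_mat z z" "gl_inv z (g z) \<in> carrier_mat z z"
proof -
  show 1: "g z \<in> carrier (GL z)" using assms by (simp add: flag_group_carrier)
  then show "g z \<in> carrier_mat z z" by (simp add: GL_carrier)
  show "gl_inv z (g z) \<in> carrier_mat z z" by (rule GL_inv(2)[OF 1])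
qed

lemma flag_act_closed:
  assumes g: "g \<in> carrier (flag_group m)" and V: "V \<in> flag_pts s m"
  shows "flag_act m g V \<in> flag_pts s m"
  unfolding flag_pts_iff
proof (intro conjI allI impI)
  show "flag_act m g V a \<in> carrier_mat (Suc a) a" if "a < m" for a
    using carrier_matD[OF flag_group_dims(2)[OF g, of "Suc a"]] carrier_matD[OF flag_group_dims(3)[OF g, of a]] that
    by (intro carrier_matI) (simp_all add: flag_act_sel)
  have "transpose_mat (gl_inv m (g m)) * V m * transpose_mat (transpose_mat (gl_inv m (g m))) \<in> eps_mat s m"
    by (rule eps_symmetric_congruence) (use V flag_group_dims[OF g, of m] in \<open>simp_all add: flag_pts_iff\<close>)
  then show "flag_act m g V m \<in> eps_mat s m" by (simp add: flag_act_sel)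
qed (rule flag_act_sel)

lemma algebraic_action_flag: "algebraic_action (flag_gvar s m :: (nat => 'k::field mat, nat => 'k mat, 'k) gvar)"
proof (rule algebraic_actionI)
  let ?X = "flag_gvar s m :: (nat => 'k mat, nat => 'k mat, 'k) gvar"
  show "group (grp ?X)" by (simp add: group_flag_group)
  show "fun_alg (carrier (grp ?X)) (grp_fun ?X)" by (simp add: fun_alg_gen_alg)
  show "affine_variety (pts ?X) (pts_fun ?X)" by (simp add: affine_flag_pts)
  show "pts_fun ?X = gen_alg (pts ?X) (flag_entries m)" by simp
  show "gact ?X g V \<in> pts ?X" if "g \<in> carrier (grp ?X)" "V \<in> pts ?X" for g V
    using that by (simp add: flag_act_closed)
  then have cl: "flag_act m g V \<in> flag_pts s m" if "g \<in> carrier (flag_group m)" "V \<in> flag_pts s m" for g :: "nat => 'k mat" and V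
    using that by simp
  show "gact ?X \<one>\<^bsub>grp ?X\<^esub> V = V" if V: "V \<in> pts ?X" for V
  proof -
    interpret group "flag_group m :: (nat => 'k mat) monoid" by (rule group_flag_group)
    have V': "V \<in> flag_pts s m" using V by simp
    have "flag_act m \<one>\<^bsub>flag_group m\<^esub> V = V"
    proof (rule flag_pts_eqI[OF cl[OF one_closed V'] V'])
      fix a assume a: "a < m"
      then have "V a \<in> carrier_mat (Suc a) a" using V' by (simp add: flag_pts_iff)
      then show "flag_act m \<one>\<^bsub>flag_group m\<^esub> V a = V a"
        using a by (simp add: flag_act_sel flag_group_one GL_one_closed left_mult_one_mat right_mult_one_mat)
    next
      have "V m \<in> carrier_mat m m" using V' by (simp add: flag_pts_iff eps_mat_def)
      then show "flag_act m \<one>\<^bsub>flag_group m\<^esub> V m = V m"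
        by (simp add: flag_act_sel flag_group_one GL_one_closed left_mult_one_mat right_mult_one_mat)
    qed
    then show ?thesis by simp
  qed
  show "gact ?X (g \<otimes>\<^bsub>grp ?X\<^esub> h) V = gact ?X g (gact ?X h V)"
    if g: "g \<in> carrier (grp ?X)" and h: "h \<in> carrier (grp ?X)" and V: "V \<in> pts ?X" for g h V
  proof -
    interpret group "flag_group m :: (nat => 'k mat) monoid" by (rule group_flag_group)
    have g': "g \<in> carrier (flag_group m)" and h': "h \<in> carrier (flag_group m)" and V': "V \<in> flag_pts s m" using g h V by simp_all
    have "flag_act m (g \<otimes>\<^bsub>flag_group m\<^esub> h) V = flag_act m g (flag_act m h V)"
    proof (rule flag_pts_eqI[OF cl[OF m_closed[OF g' h'] V'] cl[OF g' cl[OF h' V']]])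
      fix a assume a: "a < m"
      note gs = flag_group_dims[OF g', of a] flag_group_dims[OF g', of "Suc a"]
        and hs = flag_group_dims[OF h', of a] flag_group_dims[OF h', of "Suc a"]
      have v: "V a \<in> carrier_mat (Suc a) a" using V' a by (simp add: flag_pts_iff)
      have "(g (Suc a) * h (Suc a)) * V a * (gl_inv a (h a) * gl_inv a (g a)) =
          g (Suc a) * (h (Suc a) * V a * gl_inv a (h a)) * gl_inv a (g a)"
        by (rule mat_assoc_conj[OF gs(5) hs(5) v hs(3) gs(3)]) (use a in simp_all)
      then show "flag_act m (g \<otimes>\<^bsub>flag_group m\<^esub> h) V a = flag_act m g (flag_act m h V) a"
        using a gs hs by (simp add: flag_act_sel flag_group_mult GL_inv_mult(2))
    next
      note gs = flag_group_dims[OF g', of m] and hs = flag_group_dims[OF h', of m]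
      have v: "V m \<in> carrier_mat m m" using V' by (simp add: flag_pts_iff eps_mat_def)
      have "transpose_mat (gl_inv m (h m) * gl_inv m (g m)) * V m * (gl_inv m (h m) * gl_inv m (g m)) =
          transpose_mat (gl_inv m (g m)) * (transpose_mat (gl_inv m (h m)) * V m * gl_inv m (h m)) * gl_inv m (g m)"
        unfolding transpose_mult[OF hs(3)[OF le_refl] gs(3)[OF le_refl]]
        by (rule mat_assoc_conj[OF _ _ v hs(3) gs(3)]) (use gs(3) hs(3) in simp_all)
      then show "flag_act m (g \<otimes>\<^bsub>flag_group m\<^esub> h) V m = flag_act m g (flag_act m h V) m"
        using gs hs by (simp add: flag_act_sel flag_group_mult GL_inv_mult(2))
    qed
    then show ?thesis by simp
  qed
  fix c :: "(nat => 'k mat) => 'k" assume "c \<in> flag_entries m"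
  then obtain a i j where a: "a \<le> m" "i < min (Suc a) m" "j < a" "c = (\<lambda>V. V a $$ (i, j))"
    unfolding flag_entries_def by blast
  let ?G = "carrier (flag_group m) :: (nat => 'k mat) set" and ?V = "flag_pts s m :: (nat => 'k mat) set"
  let ?P = "?G \<times> ?V" and ?A = "prod_alg ?G (grp_fun ?X) ?V (pts_fun ?X)"
  interpret P: fun_alg ?P ?A by (rule fun_alg_prod_alg)
  have rg: "regmat ?P ?A z z (\<lambda>p. fst p z)" "regmat ?P ?A z z (\<lambda>p. gl_inv z (fst p z))" if "z \<le> m" for z
    using regmat_prod_alg(1)[OF regmat_flag_group(1)[OF that]] regmat_prod_alg(1)[OF regmat_flag_group(2)[OF that]] by simp_all
  have "regmat ?P ?A (min (Suc a) m) a (\<lambda>p. flag_act m (inv\<^bsub>flag_group m\<^esub> fst p) (snd p) a)"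
  proof (cases "a = m")
    case True
    have "regmat ?P ?A m m (\<lambda>p. transpose_mat (fst p m) * snd p m * fst p m)"
      using regmat_prod_alg(2)[OF regmat_flag(2)[of s m]] rg(1)[of m]
      by (intro P.regmat_mult[where n = m] P.regmat_transpose) simp_all
    then have "regmat ?P ?A m m (\<lambda>p. flag_act m (inv\<^bsub>flag_group m\<^esub> fst p) (snd p) m)"
    proof (rule regmat_cong)
      fix p assume "p \<in> ?P"
      then show "transpose_mat (fst p m) * snd p m * fst p m = flag_act m (inv\<^bsub>flag_group m\<^esub> fst p) (snd p) m"
        by (auto simp: flag_act_sel flag_group_inv GL_inv_inv flag_group_dims)
    qed
    then show ?thesis by (simp add: True min_def)
  next
    case False
    have "regmat ?P ?A (Suc a) a (\<lambda>p. gl_inv (Suc a) (fst p (Suc a)) * snd p a * fst p a)"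
      using regmat_prod_alg(2)[OF regmat_flag(1)[of a m s]] rg(1)[of a] rg(2)[of "Suc a"] False a(1)
      by (intro P.regmat_mult[where n = a] P.regmat_mult[where n = "Suc a"]) simp_all
    then have "regmat ?P ?A (Suc a) a (\<lambda>p. flag_act m (inv\<^bsub>flag_group m\<^esub> fst p) (snd p) a)"
    proof (rule regmat_cong)
      fix p assume "p \<in> ?P"
      then show "gl_inv (Suc a) (fst p (Suc a)) * snd p a * fst p a = flag_act m (inv\<^bsub>flag_group m\<^esub> fst p) (snd p) a"
        using False a(1) by (auto simp: flag_act_sel flag_group_inv GL_inv_inv flag_group_dims)
    qed
    moreover have "min (Suc a) m = Suc a" using False a(1) by simp
    ultimately show ?thesis by (simp only:)
  qed
  from regmatD(2)[OF this a(2,3)]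
  show "regf (carrier (grp ?X) \<times> pts ?X) (prod_alg (carrier (grp ?X)) (grp_fun ?X) (pts ?X) (pts_fun ?X))
      (\<lambda>p. c (gact ?X (inv\<^bsub>grp ?X\<^esub> fst p) (snd p)))"
    by (simp add: a(4))
qed

section \<open>The slice of forms on the standard flag\<close>

definition incl_mat :: "nat => 'k::comm_ring_1 mat" where
  "incl_mat n = mat (Suc n) n (\<lambda>(i, j). if i = j then 1 else 0)"

lemma incl_mat_carrier [simp]: "incl_mat n \<in> carrier_mat (Suc n) n"
  by (simp add: incl_mat_def)

lemma mult_incl_mat:
  assumes "M \<in> carrier_mat nr (Suc n)" "i < nr" "j < n"
  shows "(M * incl_mat n) $$ (i, j) = M $$ (i, j)"
proof -
  have "(M * incl_mat n) $$ (i, j) = (\<Sum>k = 0..<Suc n. M $$ (i, k) * (if k = j then 1 else 0))"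
    using assms by (simp add: incl_mat_def scalar_prod_def)
  also have "\<dots> = (\<Sum>k = 0..<Suc n. if k = j then M $$ (i, k) else 0)" by (rule sum.cong) auto
  also have "\<dots> = M $$ (i, j)" using assms(3) by (subst sum.delta) auto
  finally show ?thesis .
qed

lemma incl_mat_mult:
  assumes "M \<in> carrier_mat n nc" "i < Suc n" "j < nc"
  shows "(incl_mat n * M) $$ (i, j) = (if i < n then M $$ (i, j) else 0)"
proof -
  have "(incl_mat n * M) $$ (i, j) = (\<Sum>k = 0..<n. (if i = k then 1 else 0) * M $$ (k, j))"
    using assms by (simp add: incl_mat_def scalar_prod_def)
  also have "\<dots> = (\<Sum>k = 0..<n. if k = i then M $$ (k, j) else 0)" by (rule sum.cong) auto
  also have "\<dots> = (if i < n then M $$ (i, j) else 0)" by (subst sum.delta) auto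
  finally show ?thesis .
qed

definition corner :: "nat => 'k mat => 'k mat" where
  "corner z U = mat z z (\<lambda>(i, j). U $$ (i, j))"

lemma corner_carrier [simp]: "corner z U \<in> carrier_mat z z"
  by (simp add: corner_def)

lemma corner_mult:
  assumes U: "U \<in> carrier_mat m m" and W: "W \<in> carrier_mat m m" "upper_triangular W" and z: "z \<le> m"
  shows "corner z (U * W) = corner z U * corner z W"
proof (rule eq_matI)
  fix i j assume "i < dim_row (corner z U * corner z W)" "j < dim_col (corner z U * corner z W)"
  then have ij: "i < z" "j < z" by (simp_all add: corner_def)
  have "(U * W) $$ (i, j) = (\<Sum>k = 0..<m. U $$ (i, k) * W $$ (k, j))"
    using U W ij z by (simp add: scalar_prod_def)
  also have "\<dots> = (\<Sum>k = 0..<z. U $$ (i, k) * W $$ (k, j))"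
    by (rule sum.mono_neutral_right) (use z W ij in \<open>auto simp: upper_triangular_def\<close>)
  finally show "corner z (U * W) $$ (i, j) = (corner z U * corner z W) $$ (i, j)"
    using ij by (simp add: corner_def scalar_prod_def)
qed (simp_all add: corner_def)

text \<open>A new standard basis vector is added at each vertex and the earlier ones are carried along by the arrows: the
  columns of \<open>flag_basis V i\<close> are the vectors \<open>V\<^sub>i\<^sub>-\<^sub>1 \<dots> V\<^sub>j e\<^sub>j\<close> for \<open>j \<le> i\<close>. In these bases each arrow becomes the standard inclusion
  (\<open>flag_basis_incl\<close>), as long as the columns are linearly independent.\<close>

fun flag_basis :: "(nat => 'k::field mat) => nat => 'k mat" where
  "flag_basis V 0 = 1\<^sub>m 0"
| "flag_basis V (Suc i) = mat (Suc i) (Suc i)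
    (\<lambda>(p, q). if q < i then (V i * flag_basis V i) $$ (p, q) else if p = i then 1 else 0)"

declare flag_basis.simps(2) [simp del]

lemma flag_basis_carrier [simp]: "flag_basis V i \<in> carrier_mat i i"
  by (cases i) (simp_all add: flag_basis.simps(2))

lemma flag_basis_incl:
  assumes "V i \<in> carrier_mat (Suc i) i"
  shows "flag_basis V (Suc i) * incl_mat i = V i * flag_basis V i"
proof (rule eq_matI)
  fix p q assume "p < dim_row (V i * flag_basis V i)" "q < dim_col (V i * flag_basis V i)"
  then have pq: "p < Suc i" "q < i" using assms carrier_matD(2)[OF flag_basis_carrier[of V i]] by auto
  then show "(flag_basis V (Suc i) * incl_mat i) $$ (p, q) = (V i * flag_basis V i) $$ (p, q)"
    unfolding mult_incl_mat[OF flag_basis_carrier pq] by (simp add: flag_basis.simps(2))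
qed (use assms carrier_matD[OF flag_basis_carrier[of V i]] carrier_matD[OF flag_basis_carrier[of V "Suc i"]] in
    \<open>auto simp: incl_mat_def\<close>)

lemma (in fun_alg) regmat_flag_basis:
  assumes "\<And>a. a < m ==> regmat X A (Suc a) a (\<lambda>x. F x a)" "i \<le> m"
  shows "regmat X A i i (\<lambda>x. flag_basis (F x) i)"
  using assms(2)
proof (induction i)
  case (Suc i)
  have "regmat X A (Suc i) i (\<lambda>x. F x i * flag_basis (F x) i)"
    by (rule regmat_mult[OF assms(1) Suc.IH]) (use Suc.prems in auto)
  then have "regf X A (\<lambda>x. if q < i then (F x i * flag_basis (F x) i) $$ (p, q) else if p = i then 1 else 0)"
    if "p < Suc i" "q < Suc i" for p q
    using that by (cases "q < i") (simp_all add: regmat_def regf_const)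
  from regmat_mat[OF this] show ?case by (simp add: flag_basis.simps(2))
qed (simp add: regmat_def)

definition flag_Delta :: "nat => (nat => 'k::field mat) => 'k" where
  "flag_Delta m V = (\<Prod>i\<le>m. det (flag_basis V i))"

definition flag_form :: "nat => (nat => 'k::field mat) => 'k mat" where
  "flag_form m V = transpose_mat (flag_basis V m) * V m * flag_basis V m"

definition flag_frame :: "nat => (nat => 'k::field mat) => nat => 'k mat" where
  "flag_frame m V = (\<lambda>i\<in>{..m}. flag_basis V i)"

definition flag_point :: "nat => 'k::field mat => nat => 'k mat" where
  "flag_point m A = (\<lambda>a\<in>{..m}. if a = m then A else incl_mat a)"

text \<open>The inverse transpose of a lower triangular matrix preserves the standard flag; its corners are its restrictions to
  the steps of the flag.\<close>

definition flag_hom :: "nat => 'k::field mat => nat => 'k mat" where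
  "flag_hom m b = (\<lambda>z\<in>{..m}. corner z (transpose_mat (gl_inv m b)))"

lemma flag_point_closed: "A \<in> eps_mat s m ==> flag_point m A \<in> flag_pts s m"
  by (simp add: flag_pts_iff flag_point_def)

lemma flag_basis_point: "i \<le> m ==> flag_basis (flag_point m A) i = 1\<^sub>m i"
proof (induction i)
  case (Suc i)
  have "flag_point m A i = incl_mat i" using Suc.prems by (simp add: flag_point_def)
  moreover have "flag_basis (flag_point m A) i = 1\<^sub>m i" by (rule Suc.IH) (use Suc.prems in simp)
  ultimately have "flag_point m A i * flag_basis (flag_point m A) i = incl_mat i"
    using right_mult_one_mat[OF incl_mat_carrier[of i]] by simp
  then show ?case by (intro eq_matI) (auto simp: flag_basis.simps(2) incl_mat_def)
qed simp

lemma flag_basis_GL: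
  assumes "flag_Delta m V \<noteq> 0" "i \<le> m"
  shows "flag_basis V i \<in> carrier (GL i)"
  using assms by (simp add: GL_carrier flag_Delta_def)

lemma flag_frame_closed: "flag_Delta m V \<noteq> 0 ==> flag_frame m V \<in> carrier (flag_group m)"
  by (simp add: flag_group_carrier flag_frame_def flag_basis_GL)

lemma flag_form_closed: "V \<in> flag_pts s m ==> flag_form m V \<in> eps_mat s m"
  using eps_symmetric_congruence[of "V m" s m "transpose_mat (flag_basis V m)" m] by (simp add: flag_form_def flag_pts_iff)

lemma flag_frame_act:
  fixes V :: "nat => 'k::field mat"
  assumes V: "V \<in> flag_pts s m" and D: "flag_Delta m V \<noteq> 0"
  shows "flag_act m (flag_frame m V) (flag_point m (flag_form m V)) = V"
proof (rule flag_pts_eqI[OF flag_act_closed[OF flag_frame_closed[OF D] flag_point_closed[OF flag_form_closed[OF V]]] V])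
  fix a assume a: "a < m"
  let ?M = "flag_basis V a"
  have v: "V a \<in> carrier_mat (Suc a) a" using V a by (simp add: flag_pts_iff)
  have M: "?M \<in> carrier (GL a)" by (rule flag_basis_GL[OF D]) (use a in simp)
  have "flag_act m (flag_frame m V) (flag_point m (flag_form m V)) a = flag_basis V (Suc a) * incl_mat a * gl_inv a ?M"
    using a by (simp add: flag_act_sel flag_frame_def flag_point_def)
  also have "\<dots> = V a * ?M * gl_inv a ?M" unfolding flag_basis_incl[of V a, OF v] ..
  also have "\<dots> = V a * (?M * gl_inv a ?M)" by (rule assoc_mult_mat[OF v flag_basis_carrier GL_inv(2)[OF M]])
  also have "\<dots> = V a" unfolding GL_inv(3)[OF M] by (rule right_mult_one_mat[OF v])
  finally show "flag_act m (flag_frame m V) (flag_point m (flag_form m V)) a = V a" .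
next
  let ?M = "flag_basis V m" and ?N = "gl_inv m (flag_basis V m)"
  have v: "V m \<in> carrier_mat m m" using V by (simp add: flag_pts_iff eps_mat_def)
  have M: "?M \<in> carrier (GL m)" by (rule flag_basis_GL[OF D]) simp
  note N = GL_inv(2)[OF M]
  have "flag_act m (flag_frame m V) (flag_point m (flag_form m V)) m =
      transpose_mat ?N * (transpose_mat ?M * V m * ?M) * ?N"
    by (simp add: flag_act_sel flag_frame_def flag_point_def flag_form_def)
  also have "\<dots> = (transpose_mat ?N * transpose_mat ?M) * V m * (?M * ?N)"
    by (rule mat_assoc_conj[OF _ _ v flag_basis_carrier N, symmetric]) (use N in simp_all)
  also have "transpose_mat ?N * transpose_mat ?M = transpose_mat (?M * ?N)"
    by (rule transpose_mult[OF flag_basis_carrier N, symmetric])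
  also have "?M * ?N = 1\<^sub>m m" by (rule GL_inv(3)[OF M])
  also have "transpose_mat (1\<^sub>m m) * V m * 1\<^sub>m m = V m"
    using left_mult_one_mat[OF v] right_mult_one_mat[OF v] by simp
  finally show "flag_act m (flag_frame m V) (flag_point m (flag_form m V)) m = V m" .
qed

lemma regmat_flag_frame:
  "i \<le> m ==> regmat (flag_pts s m) (flag_fun s m) i i (\<lambda>V. flag_basis V i)"
  by (rule fun_alg.regmat_flag_basis[OF fun_alg_gen_alg regmat_flag(1)])

lemma flag_hom_facts:
  fixes b :: "'k::field mat"
  assumes b: "b \<in> lower_borel m" and z: "z \<le> m"
  shows "corner z (transpose_mat (gl_inv m b)) \<in> carrier (GL z)"
    "gl_inv z (corner z (transpose_mat (gl_inv m b))) = corner z (transpose_mat b)"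
proof -
  have b': "b \<in> carrier (GL m)" "b \<in> carrier_mat m m" using b by (auto simp: lower_borel_def GL_carrier)
  have "upper_triangular (transpose_mat b)" using b b'(2) by (auto simp: upper_triangular_def lower_borel_def)
  then have "corner z (transpose_mat (gl_inv m b)) * corner z (transpose_mat b) =
      corner z (transpose_mat (gl_inv m b) * transpose_mat b)"
    using b' GL_inv(2)[OF b'(1)] by (intro corner_mult[symmetric, OF _ _ _ z]) auto
  also have "transpose_mat (gl_inv m b) * transpose_mat b = transpose_mat (b * gl_inv m b)"
    by (rule transpose_mult[OF b'(2) GL_inv(2)[OF b'(1)], symmetric])
  also have "\<dots> = 1\<^sub>m m" using GL_inv(3)[OF b'(1)] by simp
  also have "corner z (1\<^sub>m m) = 1\<^sub>m z" using z by (intro eq_matI) (auto simp: corner_def)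
  finally have e: "corner z (transpose_mat (gl_inv m b)) * corner z (transpose_mat b) = 1\<^sub>m z" .
  show "corner z (transpose_mat (gl_inv m b)) \<in> carrier (GL z)"
    "gl_inv z (corner z (transpose_mat (gl_inv m b))) = corner z (transpose_mat b)"
    using GL_I(1,2)[OF _ _ e] by simp_all
qed

lemma upper_inverse_transpose:
  fixes b :: "'k::field mat"
  assumes "b \<in> lower_borel m"
  shows "upper_triangular (transpose_mat (gl_inv m b))" "transpose_mat (gl_inv m b) \<in> carrier_mat m m"
proof -
  have "gl_inv m b \<in> lower_borel m" by (rule lower_borel_inv[OF assms])
  then show "transpose_mat (gl_inv m b) \<in> carrier_mat m m" "upper_triangular (transpose_mat (gl_inv m b))"
    by (auto simp: upper_triangular_def lower_borel_def GL_carrier)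
qed

lemma flag_hom_act:
  fixes b :: "'k::field mat"
  assumes b: "b \<in> lower_borel m" and A: "A \<in> eps_mat s m"
  shows "flag_point m (b * A * transpose_mat b) = flag_act m (flag_hom m b) (flag_point m A)"
proof -
  have b': "b \<in> carrier (GL m)" "b \<in> carrier_mat m m" using b by (auto simp: lower_borel_def GL_carrier)
  let ?U = "transpose_mat (gl_inv m b)"
  note U = upper_inverse_transpose[OF b]
  have hom: "flag_hom m b \<in> carrier (flag_group m)"
    using flag_hom_facts(1)[OF b] by (simp add: flag_group_carrier flag_hom_def)
  show ?thesis
  proof (rule flag_pts_eqI[OF flag_point_closed[OF eps_symmetric_congruence[OF A b'(2)]] flag_act_closed[OF hom flag_point_closed[OF A]]])
    fix a assume a: "a < m"
    let ?u = "corner a ?U"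
    have u: "?u \<in> carrier (GL a)" by (rule flag_hom_facts(1)[OF b]) (use a in simp)
    have "corner (Suc a) ?U * incl_mat a = incl_mat a * ?u"
    proof (rule eq_matI)
      fix p q assume "p < dim_row (incl_mat a * ?u)" "q < dim_col (incl_mat a * ?u)"
      then have pq: "p < Suc a" "q < a" by (simp_all add: incl_mat_def corner_def)
      have "corner (Suc a) ?U $$ (p, q) = (if p < a then ?u $$ (p, q) else 0)"
        using pq a U by (auto simp: corner_def upper_triangular_def)
      then show "(corner (Suc a) ?U * incl_mat a) $$ (p, q) = (incl_mat a * ?u) $$ (p, q)"
        unfolding mult_incl_mat[OF corner_carrier pq] incl_mat_mult[OF corner_carrier pq] .
    qed (simp_all add: incl_mat_def corner_def)
    then have "corner (Suc a) ?U * incl_mat a * gl_inv a ?u = incl_mat a * ?u * gl_inv a ?u" by simp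
    also have "\<dots> = incl_mat a * (?u * gl_inv a ?u)"
      by (rule assoc_mult_mat[OF incl_mat_carrier corner_carrier GL_inv(2)[OF u]])
    also have "\<dots> = incl_mat a" unfolding GL_inv(3)[OF u] by (rule right_mult_one_mat[OF incl_mat_carrier])
    finally show "flag_point m (b * A * transpose_mat b) a = flag_act m (flag_hom m b) (flag_point m A) a"
      using a by (simp add: flag_point_def flag_act_sel flag_hom_def)
  next
    have "corner m (transpose_mat b) = transpose_mat b" using b'(2) by (intro eq_matI) (auto simp: corner_def)
    then show "flag_point m (b * A * transpose_mat b) m = flag_act m (flag_hom m b) (flag_point m A) m"
      using flag_hom_facts(2)[OF b, of m] by (simp add: flag_point_def flag_act_sel flag_hom_def)
  qed
qed

lemma flag_hom_mult:
  fixes b c :: "'k::field mat"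
  assumes b: "b \<in> lower_borel m" and c: "c \<in> lower_borel m"
  shows "flag_hom m (b * c) = flag_hom m b \<otimes>\<^bsub>flag_group m\<^esub> flag_hom m c"
proof -
  have G: "b \<in> carrier (GL m)" "c \<in> carrier (GL m)" using b c by (auto simp: lower_borel_def)
  have "transpose_mat (gl_inv m (b * c)) = transpose_mat (gl_inv m b) * transpose_mat (gl_inv m c)"
    unfolding GL_inv_mult(2)[OF G] by (rule transpose_mult[OF GL_inv(2)[OF G(2)] GL_inv(2)[OF G(1)]])
  then have "corner z (transpose_mat (gl_inv m (b * c))) =
      corner z (transpose_mat (gl_inv m b)) * corner z (transpose_mat (gl_inv m c))" if "z \<le> m" for z
    using corner_mult[OF upper_inverse_transpose(2)[OF b] upper_inverse_transpose(2,1)[OF c] that] by simp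
  then show ?thesis unfolding flag_hom_def flag_group_mult by (intro restrict_ext) simp
qed

lemma regf_det_flag_basis:
  "i \<le> m ==> regf (flag_pts s m) (flag_fun s m) (\<lambda>V. det (flag_basis V i))"
  by (rule fun_alg.regf_det[OF fun_alg_gen_alg regmat_flag_frame])

lemma flag_Delta_regf: "regf (flag_pts s m) (flag_fun s m) (flag_Delta m)"
proof -
  interpret fun_alg "flag_pts s m :: (nat => 'a mat) set" "flag_fun s m" by (rule fun_alg_gen_alg)
  show ?thesis unfolding flag_Delta_def[abs_def] by (intro regf_prod regf_det_flag_basis) simp
qed

lemma regmat_flag_form:
  "regmat (flag_pts s m) (flag_fun s m) m m (flag_form m)"
proof -
  interpret fun_alg "flag_pts s m :: (nat => 'a mat) set" "flag_fun s m" by (rule fun_alg_gen_alg)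
  show ?thesis unfolding flag_form_def[abs_def]
    by (intro regmat_mult[where n = m] regmat_transpose regmat_flag_frame regmat_flag(2) order_refl)
qed

text \<open>The only denominators are the determinants of the bases, which divide \<open>\<Delta>\<close>. One more factor \<open>\<Delta>\<close> makes the function zero
  at the points where \<open>flag_frame\<close> does not lie in the group.\<close>

lemma flag_frame_regf:
  fixes m :: nat and c :: "(nat => 'k::field mat) => 'k"
  assumes c: "c \<in> flag_group_fun m"
  shows "\<exists>N0. \<forall>N\<ge>N0. regf (flag_pts s m) (flag_fun s m) (\<lambda>V. flag_Delta m V ^ N * c (flag_frame m V))"
proof -
  let ?X = "flag_pts s m :: (nat => 'k mat) set"
  let ?A = "gen_alg ?X (flag_entries m)" and ?D = "flag_Delta m :: (nat => 'k mat) => 'k"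
  interpret fun_alg ?X ?A by (rule fun_alg_gen_alg)
  have "regf (carrier (flag_group m)) (flag_group_fun m) c"
    by (rule fun_alg.regf_mem[OF fun_alg_gen_alg c])
  then have "\<exists>N0 u. regf ?X ?A u \<and> (\<forall>V\<in>?X. ?D V \<noteq> 0 \<longrightarrow> ?D V ^ N0 * c (flag_frame m V) = u V)"
  proof (induction rule: regf_gen_alg_induct)
    case (cong f g)
    then show ?case using flag_frame_closed by metis
  next
    case (const c)
    then show ?case by (intro exI[of _ 0] exI[of _ "\<lambda>_. c"]) (simp add: regf_const)
  next
    case (gen f)
    then consider z i j where "z \<le> m" "i < z" "j < z" "f = (\<lambda>g. g z $$ (i, j))" | z where "z \<le> m" "f = (\<lambda>g. inverse (det (g z)))"
      unfolding flag_group_gens_def by blast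
    then show ?case
    proof cases
      case 1
      have "regf ?X ?A (\<lambda>V. flag_basis V z $$ (i, j))" by (rule regmatD(2)[OF regmat_flag_frame[OF 1(1)] 1(2,3)])
      then show ?thesis using 1 by (intro exI[of _ 0] exI[of _ "\<lambda>V. flag_basis V z $$ (i, j)"]) (simp add: flag_frame_def)
    next
      case 2
      let ?u = "\<lambda>V. \<Prod>i\<in>{..m} - {z}. det (flag_basis V i)"
      have "regf ?X ?A ?u" by (intro regf_prod regf_det_flag_basis) simp
      moreover have "?D V ^ 1 * f (flag_frame m V) = ?u V" if "?D V \<noteq> 0" for V
      proof -
        have "?D V = det (flag_basis V z) * ?u V" unfolding flag_Delta_def by (rule prod.remove) (use 2 in auto)
        moreover have "det (flag_basis V z) \<noteq> 0" using flag_basis_GL[OF that 2(1)] by (simp add: GL_carrier)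
        ultimately show ?thesis using 2 by (simp add: flag_frame_def)
      qed
      ultimately show ?thesis by blast
    qed
  next
    case (add f g)
    obtain N u where 1: "regf ?X ?A u" "\<forall>V\<in>?X. ?D V \<noteq> 0 \<longrightarrow> ?D V ^ N * f (flag_frame m V) = u V" using add(1) by blast
    obtain N' u' where 2: "regf ?X ?A u'" "\<forall>V\<in>?X. ?D V \<noteq> 0 \<longrightarrow> ?D V ^ N' * g (flag_frame m V) = u' V" using add(2) by blast
    have "regf ?X ?A (\<lambda>V. ?D V ^ N' * u V + ?D V ^ N * u' V)"
      by (intro regf_add regf_mult regf_power flag_Delta_regf 1 2)
    moreover have "\<forall>V\<in>?X. ?D V \<noteq> 0 \<longrightarrow> ?D V ^ (N + N') * (f (flag_frame m V) + g (flag_frame m V)) = ?D V ^ N' * u V + ?D V ^ N * u' V"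
      using 1(2)[rule_format, symmetric] 2(2)[rule_format, symmetric] by (simp add: power_add algebra_simps)
    ultimately show ?case by blast
  next
    case (mult f g)
    obtain N u where 1: "regf ?X ?A u" "\<forall>V\<in>?X. ?D V \<noteq> 0 \<longrightarrow> ?D V ^ N * f (flag_frame m V) = u V" using mult(1) by blast
    obtain N' u' where 2: "regf ?X ?A u'" "\<forall>V\<in>?X. ?D V \<noteq> 0 \<longrightarrow> ?D V ^ N' * g (flag_frame m V) = u' V" using mult(2) by blast
    have "regf ?X ?A (\<lambda>V. u V * u' V)" by (intro regf_mult 1 2)
    moreover have "\<forall>V\<in>?X. ?D V \<noteq> 0 \<longrightarrow> ?D V ^ (N + N') * (f (flag_frame m V) * g (flag_frame m V)) = u V * u' V"
      using 1(2)[rule_format, symmetric] 2(2)[rule_format, symmetric] by (simp add: power_add algebra_simps)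
    ultimately show ?case by blast
  qed
  then obtain N0 u where u: "regf ?X ?A u" "\<forall>V\<in>?X. ?D V \<noteq> 0 \<longrightarrow> ?D V ^ N0 * c (flag_frame m V) = u V" by blast
  have "regf ?X ?A (\<lambda>V. ?D V ^ N * c (flag_frame m V))" if N: "N \<ge> Suc N0" for N
  proof -
    have "regf ?X ?A (\<lambda>V. ?D V ^ (N - N0) * u V)" by (intro regf_mult regf_power flag_Delta_regf u(1))
    then show ?thesis
    proof (rule regf_cong)
      fix V assume V: "V \<in> ?X"
      show "?D V ^ (N - N0) * u V = ?D V ^ N * c (flag_frame m V)"
      proof (cases "?D V = 0")
        case False
        then have "u V = ?D V ^ N0 * c (flag_frame m V)" using u(2) V by simp
        moreover have "?D V ^ N = ?D V ^ (N - N0) * ?D V ^ N0" using N by (simp flip: power_add)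
        ultimately show ?thesis by simp
      qed (use N in \<open>simp add: zero_power\<close>)
    qed
  qed
  then show ?thesis by blast
qed

lemma slice_flag:
  fixes H :: "'k::field mat set"
  assumes H: "subgroup H (GL m)" "H \<subseteq> lower_borel m"
  shows "slice (flag_gvar s m) (eps_mat_gvar s m H) (flag_point m) (flag_form m) (flag_Delta m) (flag_frame m) (flag_hom m)"
proof -
  interpret matrix_subgroup m H by (rule matrix_subgroup.intro[OF H(1)])
  let ?G = "flag_gvar s m :: (nat => 'k mat, nat => 'k mat, 'k) gvar" and ?T = "eps_mat_gvar s m H"
  interpret T: algebraic_action ?T by (rule algebraic_action_congruence)
  interpret G: algebraic_action ?G by (rule algebraic_action_flag)
  note Talg = T.pts.fun_alg_axioms[unfolded eps_mat_gvar_sel] and Galg = G.pts.fun_alg_axioms[unfolded flag_gvar_sel]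
  show ?thesis
  proof (unfold_locales; (unfold flag_gvar_sel eps_mat_gvar_sel)?)
    fix A :: "'k mat" assume A: "A \<in> eps_mat s m"
    show "flag_point m A \<in> flag_pts s m" by (rule flag_point_closed[OF A])
    have c: "A \<in> carrier_mat m m" using A by (simp add: eps_mat_def)
    then show "flag_form m (flag_point m A) = A"
      using left_mult_one_mat[OF c] right_mult_one_mat[OF c]
      by (simp add: flag_form_def flag_basis_point) (simp add: flag_point_def)
    show "flag_Delta m (flag_point m A) = 1" by (simp add: flag_Delta_def flag_basis_point)
    show "flag_frame m (flag_point m A) = \<one>\<^bsub>flag_group m\<^esub>"
      unfolding flag_frame_def flag_group_one by (rule restrict_ext) (simp add: flag_basis_point)
    fix b assume "b \<in> carrier (GL m\<lparr>carrier := H\<rparr>)"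
    then have b: "b \<in> lower_borel m" using H(2) by auto
    show "flag_point m (b * A * transpose_mat b) = flag_act m (flag_hom m b) (flag_point m A)"
      by (rule flag_hom_act[OF b A])
  next
    fix f :: "(nat => 'k mat) => 'k" assume f: "f \<in> flag_fun s m"
    show "regf (eps_mat s m) (gen_alg (eps_mat s m) {\<lambda>A. A $$ (i, j) | i j. i < m \<and> j < m}) (\<lambda>y. f (flag_point m y))"
    proof (rule regf_pullback[where p = "flag_point m" and f = f, OF G.pts.regf_mem[unfolded flag_gvar_sel, OF f] Talg])
      show "flag_point m ` eps_mat s m \<subseteq> flag_pts s m" using flag_point_closed by blast
      fix c :: "(nat => 'k mat) => 'k" assume "c \<in> flag_entries m"
      then obtain a i j where a: "a \<le> m" "i < min (Suc a) m" "j < a" "c = (\<lambda>V. V a $$ (i, j))"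
        unfolding flag_entries_def by blast
      then show "regf (eps_mat s m) (gen_alg (eps_mat s m) {\<lambda>A. A $$ (i, j) | i j. i < m \<and> j < m}) (\<lambda>y. c (flag_point m y))"
        using T.pts.regf_const[unfolded eps_mat_gvar_sel] regmatD(2)[OF regmat_eps_mat[of s m], of i j]
        by (cases "a = m") (simp_all add: flag_point_def)
    qed
  next
    fix V :: "nat => 'k mat" assume V: "V \<in> flag_pts s m"
    show "flag_form m V \<in> eps_mat s m" by (rule flag_form_closed[OF V])
    assume D: "flag_Delta m V \<noteq> 0"
    show "flag_frame m V \<in> carrier (flag_group m)" by (rule flag_frame_closed[OF D])
    show "flag_act m (flag_frame m V) (flag_point m (flag_form m V)) = V" by (rule flag_frame_act[OF V D])
  next
    fix b :: "'k mat => 'k" assume b: "b \<in> gen_alg (eps_mat s m) {\<lambda>A. A $$ (i, j) | i j. i < m \<and> j < m}"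
    show "regf (flag_pts s m) (flag_fun s m) (\<lambda>x. b (flag_form m x))"
    proof (rule regf_pullback[where p = "flag_form m" and f = b, OF T.pts.regf_mem[unfolded eps_mat_gvar_sel, OF b] Galg])
      show "flag_form m ` flag_pts s m \<subseteq> eps_mat s m" using flag_form_closed by blast
      fix c :: "'k mat => 'k" assume "c \<in> {\<lambda>A. A $$ (i, j) | i j. i < m \<and> j < m}"
      then obtain i j where ij: "i < m" "j < m" "c = (\<lambda>A. A $$ (i, j))" by blast
      show "regf (flag_pts s m) (flag_fun s m) (\<lambda>x. c (flag_form m x))"
        using regmatD(2)[OF regmat_flag_form ij(1,2)] by (simp add: ij(3))
    qed
  next
    show "regf (flag_pts s m) (flag_fun s m) (flag_Delta m :: _ => 'k)" by (rule flag_Delta_regf)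
  next
    fix c assume "c \<in> gen_alg (carrier (flag_group m)) (flag_group_gens m :: ((nat => 'k mat) => 'k) set)"
    then show "\<exists>N0. \<forall>N\<ge>N0. regf (flag_pts s m) (flag_fun s m) (\<lambda>x. flag_Delta m x ^ N * c (flag_frame m x))"
      by (rule flag_frame_regf)
  next
    fix b assume "b \<in> carrier (GL m\<lparr>carrier := H\<rparr>)"
    then have b: "b \<in> lower_borel m" using H(2) by auto
    show "flag_hom m b \<in> carrier (flag_group m)"
      using flag_hom_facts(1)[OF b] by (simp add: flag_group_carrier flag_hom_def)
    fix c assume "c \<in> carrier (GL m\<lparr>carrier := H\<rparr>)"
    then have c: "c \<in> lower_borel m" using H(2) by auto
    show "flag_hom m (b \<otimes>\<^bsub>GL m\<lparr>carrier := H\<rparr>\<^esub> c) = flag_hom m b \<otimes>\<^bsub>flag_group m\<^esub> flag_hom m c"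
      using flag_hom_mult[OF b c] by simp
  next
    let ?B = "gen_alg H ({\<lambda>g. g $$ (i, j) | i j. i < m \<and> j < m} \<union> {\<lambda>g. inverse (det g)})"
    interpret B: fun_alg H ?B by (rule fun_alg_gen_alg)
    fix c assume c: "c \<in> gen_alg (carrier (flag_group m)) (flag_group_gens m :: ((nat => 'k mat) => 'k) set)"
    have "regf H ?B (\<lambda>t. c (flag_hom m t))"
    proof (rule regf_pullback[where p = "flag_hom m" and f = c, OF fun_alg.regf_mem[OF fun_alg_gen_alg c] B.fun_alg_axioms])
      show "flag_hom m ` H \<subseteq> carrier (flag_group m)"
        using H(2) flag_hom_facts(1) by (fastforce simp: flag_group_carrier flag_hom_def)
      fix f :: "(nat => 'k mat) => 'k" assume "f \<in> flag_group_gens m"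
      then consider z i j where "z \<le> m" "i < z" "j < z" "f = (\<lambda>g. g z $$ (i, j))" | z where "z \<le> m" "f = (\<lambda>g. inverse (det (g z)))"
        unfolding flag_group_gens_def by blast
      then show "regf H ?B (\<lambda>t. f (flag_hom m t))"
      proof cases
        case 1
        have "regf H ?B (\<lambda>t. transpose_mat (gl_inv m t) $$ (i, j))"
          by (rule regmatD(2)[OF B.regmat_transpose[OF regmat_H(2)]]) (use 1 in simp_all)
        then show ?thesis using 1 by (simp add: flag_hom_def corner_def)
      next
        case 2
        have "regmat H ?B z z (\<lambda>t. corner z (transpose_mat t))"
          unfolding corner_def
          by (rule B.regmat_mat, rule regmatD(2)[OF B.regmat_transpose[OF regmat_H(1)]]) (use 2 in simp_all)
        from B.regf_det[OF this] show ?thesis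
        proof (rule regf_cong)
          fix t assume "t \<in> H"
          then have t: "t \<in> lower_borel m" using H(2) by blast
          show "det (corner z (transpose_mat t)) = f (flag_hom m t)"
            using GL_inv_det[OF flag_hom_facts(1)[OF t 2(1)]] 2 flag_hom_facts(2)[OF t 2(1)] by (simp add: flag_hom_def)
        qed
      qed
    qed
    then show "regf (carrier (GL m\<lparr>carrier := H\<rparr>)) ?B (\<lambda>t. c (flag_hom m t))" by simp
  qed
qed

section \<open>Transversality and coordinates of the slice\<close>

lemma regf_polynomial:
  fixes \<xi> :: "nat => 'p => 'k::field"
  assumes "regf X (gen_alg X (\<xi> ` I)) f"
  shows "\<exists>P. (\<forall>\<alpha>\<in>keys P. keys \<alpha> \<subseteq> I) \<and> (\<forall>x\<in>X. f x = mpoly_eval P (\<lambda>i. \<xi> i x))"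
  using assms
proof (induction rule: regf_gen_alg_induct)
  case (cong f g)
  then show ?case by simp
next
  case (const c)
  show ?case by (intro exI[of _ "single 0 c"]) (simp add: mpoly_eval_single)
next
  case (gen f)
  then obtain i where i: "i \<in> I" "f = \<xi> i" by blast
  then show ?case by (intro exI[of _ "single (single i 1) 1"]) (simp add: mpoly_eval_single monom_eval_single)
next
  case (add f g)
  obtain P where P: "\<forall>\<alpha>\<in>keys P. keys \<alpha> \<subseteq> I" "\<forall>x\<in>X. f x = mpoly_eval P (\<lambda>i. \<xi> i x)" using add(1) by blast
  obtain R where R: "\<forall>\<alpha>\<in>keys R. keys \<alpha> \<subseteq> I" "\<forall>x\<in>X. g x = mpoly_eval R (\<lambda>i. \<xi> i x)" using add(2) by blast
  have "\<forall>\<alpha>\<in>keys (P + R). keys \<alpha> \<subseteq> I" using P(1) R(1) Poly_Mapping.keys_add[of P R] by blast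
  then show ?case using P(2) R(2) by (intro exI[of _ "P + R"]) (simp add: mpoly_eval_add)
next
  case (mult f g)
  obtain P where P: "\<forall>\<alpha>\<in>keys P. keys \<alpha> \<subseteq> I" "\<forall>x\<in>X. f x = mpoly_eval P (\<lambda>i. \<xi> i x)" using mult(1) by blast
  obtain R where R: "\<forall>\<alpha>\<in>keys R. keys \<alpha> \<subseteq> I" "\<forall>x\<in>X. g x = mpoly_eval R (\<lambda>i. \<xi> i x)" using mult(2) by blast
  have "\<forall>\<alpha>\<in>keys (P * R). keys \<alpha> \<subseteq> I"
  proof
    fix \<gamma> assume "\<gamma> \<in> keys (P * R)"
    then obtain \<alpha> \<beta> where "\<alpha> \<in> keys P" "\<beta> \<in> keys R" "\<gamma> = \<alpha> + \<beta>" using keys_mult[of P R] by blast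
    then show "keys \<gamma> \<subseteq> I" using P(1) R(1) Poly_Mapping.keys_add[of \<alpha> \<beta>] by blast
  qed
  then show ?case using P(2) R(2) by (intro exI[of _ "P * R"]) (simp add: mpoly_eval_mult)
qed

lemma flag_basis_cong: "(\<And>a. a < i ==> V a = W a) ==> flag_basis V i = flag_basis W i"
proof (induction i)
  case (Suc i)
  then have "flag_basis V i = flag_basis W i" "V i = W i" by simp_all
  then show ?case by (simp add: flag_basis.simps(2) cong: if_cong)
qed simp

lemma mat_assoc_conj':
  assumes "A \<in> carrier_mat n n" "B \<in> carrier_mat n n" "V \<in> carrier_mat n k" "C \<in> carrier_mat k k" "D \<in> carrier_mat k k"
  shows "A * (B * V * C * D) = (A * B) * V * (C * D)"
  using assms[THEN carrier_matD(1)] assms[THEN carrier_matD(2)] by (simp add: mat_assoc)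

text \<open>If \<open>M\<^sub>i\<close> are the bases belonging to a translate of the standard flag by \<open>g\<close>, then the matrices \<open>u\<^sub>i = g\<^sub>i\<^sup>-\<^sup>1 M\<^sub>i\<close> commute with the
  standard inclusions. Hence they are upper triangular, and \<open>b\<close> is the transpose of \<open>u\<^sub>m\<close>.\<close>

lemma flag_transversal:
  fixes A :: "'k::field mat"
  assumes g: "g \<in> carrier (flag_group m)" and A: "A \<in> eps_mat s m" and D: "flag_Delta m (flag_act m g (flag_point m A)) \<noteq> 0"
  shows "\<exists>b\<in>lower_borel m. flag_form m (flag_act m g (flag_point m A)) = b * A * transpose_mat b"
proof -
  define V where "V = flag_act m g (flag_point m A)"
  define u where "u i = gl_inv i (g i) * flag_basis V i" for i
  note gd = flag_group_dims[OF g]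
  have u: "u i \<in> carrier_mat i i" if "i \<le> m" for i using gd(3)[OF that] by (simp add: u_def)
  have VX: "V \<in> flag_pts s m" unfolding V_def by (rule flag_act_closed[OF g flag_point_closed[OF A]])
  have step: "u (Suc i) * incl_mat i = incl_mat i * u i" if i: "i < m" for i
  proof -
    note g1 = gd[of "Suc i"] and g0 = gd[of i]
    have v: "V i \<in> carrier_mat (Suc i) i" using VX i by (simp add: flag_pts_iff)
    have Vi: "V i = g (Suc i) * incl_mat i * gl_inv i (g i)" using i by (simp add: V_def flag_act_sel flag_point_def)
    have "u (Suc i) * incl_mat i = gl_inv (Suc i) (g (Suc i)) * (flag_basis V (Suc i) * incl_mat i)"
      unfolding u_def by (rule assoc_mult_mat[OF g1(3) flag_basis_carrier incl_mat_carrier]) (use i in simp)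
    also have "\<dots> = gl_inv (Suc i) (g (Suc i)) * (V i * flag_basis V i)" unfolding flag_basis_incl[of V i, OF v] ..
    also have "\<dots> = (gl_inv (Suc i) (g (Suc i)) * g (Suc i)) * incl_mat i * (gl_inv i (g i) * flag_basis V i)"
      unfolding Vi by (rule mat_assoc_conj'[OF g1(3) g1(2) incl_mat_carrier g0(3) flag_basis_carrier]) (use i in simp_all)
    also have "gl_inv (Suc i) (g (Suc i)) * g (Suc i) = 1\<^sub>m (Suc i)" by (rule GL_inv(4)[OF g1(1)]) (use i in simp)
    also have "1\<^sub>m (Suc i) * incl_mat i = (incl_mat i :: 'k mat)" by (rule left_mult_one_mat[OF incl_mat_carrier])
    finally show ?thesis by (simp add: u_def)
  qed
  have up: "upper_triangular (u i)" if "i \<le> m" for i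
    using that
  proof (induction i)
    case 0
    then show ?case using u[of 0] by (auto simp: upper_triangular_def)
  next
    case (Suc i)
    have "u (Suc i) $$ (p, q) = 0" if pq: "q < p" "p < Suc i" for p q
    proof -
      have "u (Suc i) $$ (p, q) = (u (Suc i) * incl_mat i) $$ (p, q)"
        by (rule mult_incl_mat[OF u[OF Suc.prems], symmetric]) (use pq in simp_all)
      also have "\<dots> = (incl_mat i * u i) $$ (p, q)" using step[of i] Suc.prems by simp
      also have "\<dots> = (if p < i then u i $$ (p, q) else 0)"
        by (rule incl_mat_mult[OF u]) (use Suc.prems pq in simp_all)
      also have "\<dots> = 0" using Suc pq u[of i] by (auto simp: upper_triangular_def)
      finally show ?thesis .
    qed
    then show ?case using u[OF Suc.prems] by (auto simp: upper_triangular_def)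
  qed
  let ?M = "flag_basis V m" and ?N = "gl_inv m (g m)"
  note gm = gd[of m, OF order_refl]
  have um: "u m \<in> carrier_mat m m" by (rule u) simp
  have "u m \<in> carrier (GL m)" unfolding u_def
    by (rule GL_inv_mult(1)[OF GL_inv(1)[OF gm(1)] flag_basis_GL[OF D[folded V_def] order_refl]])
  then have "transpose_mat (u m) \<in> lower_borel m"
    using GL_transpose(1)[of "u m" m] up[of m] um by (auto simp: lower_borel_def upper_triangular_def)
  moreover have "flag_form m V = transpose_mat (u m) * A * transpose_mat (transpose_mat (u m))"
  proof -
    have Am: "A \<in> carrier_mat m m" using A by (simp add: eps_mat_def)
    have "V m = transpose_mat ?N * A * ?N" by (simp add: V_def flag_act_sel flag_point_def)
    then have "flag_form m V = transpose_mat ?M * (transpose_mat ?N * A * ?N) * ?M" by (simp add: flag_form_def)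
    also have "\<dots> = (transpose_mat ?M * transpose_mat ?N) * A * (?N * ?M)"
      by (rule mat_assoc_conj[symmetric, OF _ _ Am gm(3) flag_basis_carrier]) (use gm in simp_all)
    also have "transpose_mat ?M * transpose_mat ?N = transpose_mat (u m)"
      unfolding u_def by (rule transpose_mult[OF gm(3) flag_basis_carrier, symmetric])
    finally show ?thesis by (simp add: u_def)
  qed
  ultimately show ?thesis unfolding V_def[symmetric] by blast
qed

text \<open>The coordinates are the entries of all the arrows but the last. The form on the last arrow is determined by its
  value in the basis given by the flag.\<close>

definition arrow_index :: "nat => (nat \<times> nat \<times> nat) set" where
  "arrow_index m = {(a, i, j). a < m \<and> i \<le> a \<and> j < a}"

definition arrow_entry :: "nat \<times> nat \<times> nat => (nat => 'k mat) => 'k" where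
  "arrow_entry p V = (case p of (a, i, j) => V a $$ (i, j))"

lemma finite_arrow_index: "finite (arrow_index m)"
  by (rule finite_subset[of _ "{..m} \<times> {..m} \<times> {..m}"]) (auto simp: arrow_index_def)

lemma coordinate_slice_flag:
  fixes s :: int and m :: nat
  obtains n \<xi> P where "coordinate_slice (flag_gvar s m :: (nat => 'k::alg_closed_field mat, nat => 'k mat, 'k) gvar)
    (eps_mat_gvar s m (lower_borel m)) (flag_point m) (flag_form m) (flag_Delta m) (flag_frame m) (flag_hom m) n \<xi> P"
proof -
  let ?G = "flag_gvar s m :: (nat => 'k mat, nat => 'k mat, 'k) gvar"
    and ?T = "eps_mat_gvar s m (lower_borel m) :: ('k mat, 'k mat, 'k) gvar"
  let ?X = "flag_pts s m :: (nat => 'k mat) set"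
  interpret slice ?G ?T "flag_point m" "flag_form m" "flag_Delta m" "flag_frame m" "flag_hom m"
    by (rule slice_flag[OF lower_borel_subgroup order_refl])
  obtain h where h: "bij_betw h {1..card (arrow_index m)} (arrow_index m)"
    using ex_bij_betw_nat_finite_1[OF finite_arrow_index] by blast
  define n where "n = card (arrow_index m)"
  define \<xi> :: "nat => (nat => 'k mat) => 'k" where "\<xi> k = arrow_entry (h k)" for k
  have hn: "h ` {1..n} = arrow_index m" using h by (simp add: bij_betw_def n_def)
  have \<xi>: "\<exists>k\<in>{1..n}. \<xi> k = (\<lambda>V. V a $$ (i, j))" if "a < m" "i \<le> a" "j < a" for a i j
  proof -
    have "(a, i, j) \<in> h ` {1..n}" using that unfolding hn by (simp add: arrow_index_def)
    then obtain k where "k \<in> {1..n}" "h k = (a, i, j)" by (metis imageE)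
    then show ?thesis by (intro bexI[of _ k]) (simp_all add: \<xi>_def arrow_entry_def fun_eq_iff)
  qed
  have arrows: "regmat X (gen_alg X (\<xi> ` {1..n} \<union> C)) (Suc a) a (\<lambda>V. V a)" if X: "X \<subseteq> ?X" and a: "a < m" for X C a
  proof (rule regmatI)
    fix i j assume ij: "i < Suc a" "j < a"
    obtain k where "k \<in> {1..n}" "\<xi> k = (\<lambda>V. V a $$ (i, j))" using \<xi>[OF a, of i j] ij by auto
    then have "(\<lambda>V. V a $$ (i, j)) \<in> \<xi> ` {1..n} \<union> C" by (metis UnI1 imageI)
    then show "regf X (gen_alg X (\<xi> ` {1..n} \<union> C)) (\<lambda>V. V a $$ (i, j))" by (rule regf_gen)
  qed (use X a in \<open>auto simp: flag_pts_iff\<close>)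
  have dets: "regf X (gen_alg X (\<xi> ` {1..n} \<union> C)) (\<lambda>V. det (flag_basis V i))" if "X \<subseteq> ?X" "i \<le> m" for X C i
    by (rule fun_alg.regf_det[OF fun_alg_gen_alg fun_alg.regmat_flag_basis[OF fun_alg_gen_alg arrows[OF that(1)] that(2)]])
  have "regf ?X (gen_alg ?X (\<xi> ` {1..n} \<union> {})) (flag_Delta m)"
    unfolding flag_Delta_def[abs_def] by (intro fun_alg.regf_prod[OF fun_alg_gen_alg] dets) simp_all
  then obtain P where P: "\<forall>\<alpha>\<in>keys P. keys \<alpha> \<subseteq> {1..n}" "\<forall>V\<in>?X. flag_Delta m V = mpoly_eval P (\<lambda>i. \<xi> i V)"
    using regf_polynomial[of ?X \<xi> "{1..n}"] by (metis Un_empty_right)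
  have "coordinate_slice ?G ?T (flag_point m) (flag_form m) (flag_Delta m) (flag_frame m) (flag_hom m) n \<xi> P"
  proof (unfold_locales; (unfold flag_gvar_sel eps_mat_gvar_sel)?)
    fix g y assume g: "g \<in> carrier (flag_group m)" and "y \<in> eps_mat s m" "flag_Delta m (flag_act m g (flag_point m y)) \<noteq> (0::'k)"
    then show "\<exists>b\<in>carrier (GL m\<lparr>carrier := lower_borel m\<rparr>). flag_form m (flag_act m g (flag_point m y)) = b * y * transpose_mat b"
      using flag_transversal[OF g] by simp
  next
    fix k assume "k \<in> {1..n}"
    then have "h k \<in> arrow_index m" using hn by blast
    then obtain a i j where a: "a < m" "i \<le> a" "j < a" "h k = (a, i, j)" by (auto simp: arrow_index_def)
    show "regf ?X (gen_alg ?X (flag_entries m)) (\<xi> k)"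
      using regmatD(2)[OF regmat_flag(1)[OF a(1)], of i j] a by (simp add: \<xi>_def arrow_entry_def[abs_def])
  next
    show "keys \<alpha> \<subseteq> {1..n}" if "\<alpha> \<in> keys P" for \<alpha> using P(1) that by blast
    show "flag_Delta m V = mpoly_eval P (\<lambda>i. \<xi> i V)" if "V \<in> ?X" for V using P(2) that by blast
  next
    fix y :: "'k mat" and v assume y: "y \<in> eps_mat s m" and v: "mpoly_eval P v \<noteq> 0"
    define V0 where "V0 = (\<lambda>a\<in>{..m}. if a = m then y else mat (Suc a) a (\<lambda>(i, j). v (the_inv_into {1..n} h (a, i, j))))"
    have V0: "V0 \<in> ?X" using y by (simp add: flag_pts_iff V0_def)
    have \<xi>0: "\<xi> k V = v k" if k: "k \<in> {1..n}" and V: "\<And>a. a < m ==> V a = V0 a" for k V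
    proof -
      have "h k \<in> arrow_index m" using hn k by blast
      then obtain a i j where a: "a < m" "i \<le> a" "j < a" "h k = (a, i, j)" by (auto simp: arrow_index_def)
      have "\<xi> k V = v (the_inv_into {1..n} h (h k))" using a V[of a] by (simp add: \<xi>_def arrow_entry_def V0_def)
      then show ?thesis using h k by (simp add: the_inv_into_f_f bij_betw_def n_def)
    qed
    have "flag_Delta m V0 = mpoly_eval P (\<lambda>i. \<xi> i V0)" using P(2) V0 by blast
    also have "\<dots> = mpoly_eval P v" by (rule mpoly_eval_cong) (use P(1) \<xi>0 in blast)
    finally have D: "flag_Delta m V0 \<noteq> 0" using v by simp
    let ?M = "flag_basis V0 m" and ?N = "gl_inv m (flag_basis V0 m)"
    have M: "?M \<in> carrier (GL m)" by (rule flag_basis_GL[OF D]) simp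
    note N = GL_inv(2)[OF M]
    \<comment> \<open>The last arrow is chosen so that the form is \<open>y\<close> in the basis \<open>?M\<close>.\<close>
    define V where "V = V0(m := transpose_mat ?N * y * ?N)"
    have "transpose_mat ?N * y * transpose_mat (transpose_mat ?N) \<in> eps_mat s m"
      by (rule eps_symmetric_congruence[OF y]) (use N in simp)
    then have V: "V \<in> ?X" using V0 by (auto simp: flag_pts_iff V_def extensional_def)
    have bV: "flag_basis V m = ?M" by (rule flag_basis_cong) (simp add: V_def)
    have ym: "y \<in> carrier_mat m m" using y by (simp add: eps_mat_def)
    have "flag_form m V = transpose_mat ?M * (transpose_mat ?N * y * ?N) * ?M" by (simp add: flag_form_def bV) (simp add: V_def)
    also have "\<dots> = (transpose_mat ?M * transpose_mat ?N) * y * (?N * ?M)"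
      by (rule mat_assoc_conj[symmetric, OF _ _ ym N flag_basis_carrier]) (use N in simp_all)
    also have "transpose_mat ?M * transpose_mat ?N = transpose_mat (?N * ?M)"
      by (rule transpose_mult[OF N flag_basis_carrier, symmetric])
    also have "?N * ?M = 1\<^sub>m m" by (rule GL_inv(4)[OF M])
    finally have "flag_form m V = y" using left_mult_one_mat[OF ym] right_mult_one_mat[OF ym] by simp
    moreover have "\<xi> k V = v k" if "k \<in> {1..n}" for k by (rule \<xi>0[OF that]) (simp add: V_def)
    ultimately show "\<exists>x\<in>?X. flag_form m x = y \<and> (\<forall>i\<in>{1..n}. \<xi> i x = v i)" using V by blast
  next
    fix f :: "(nat => 'k mat) => 'k" assume f: "f \<in> gen_alg ?X (flag_entries m)"
    let ?B = "gen_alg (eps_mat s m) {\<lambda>A::'k mat. A $$ (i, j) | i j. i < m \<and> j < m}"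
    let ?X0 = "{x\<in>?X. flag_Delta m x \<noteq> 0}" and ?C = "{\<lambda>x. b (flag_form m x) | b. b \<in> ?B}" and ?D = "\<lambda>x. inverse (flag_Delta m x)"
    let ?E = "?C \<union> \<xi> ` {1..n} \<union> {?D}"
    have E: "?E = \<xi> ` {1..n} \<union> (?C \<union> {?D})" by blast
    interpret A0: fun_alg ?X0 "gen_alg ?X0 ?E" by (rule fun_alg_gen_alg)
    have sub: "?X0 \<subseteq> flag_pts s m" by blast
    note ar = arrows[OF sub, of _ "?C \<union> {?D}", folded E] and de = dets[OF sub, of _ "?C \<union> {?D}", folded E]
    have form: "regmat ?X0 (gen_alg ?X0 ?E) m m (flag_form m)"
    proof (rule regmatI)
      show "flag_form m V \<in> carrier_mat m m" if "V \<in> ?X0" for V using flag_form_closed[of V s m] that by (simp add: eps_mat_def)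
      fix i j assume ij: "i < m" "j < m"
      have "restrict (\<lambda>A. A $$ (i, j)) (eps_mat s m) \<in> ?B" by (rule gen_alg.gen) (use ij in blast)
      then have "(\<lambda>x. restrict (\<lambda>A. A $$ (i, j)) (eps_mat s m) (flag_form m x)) \<in> ?E" by blast
      from regf_gen[OF this] show "regf ?X0 (gen_alg ?X0 ?E) (\<lambda>x. flag_form m x $$ (i, j))"
        by (rule regf_cong) (use flag_form_closed in auto)
    qed
    have Mr: "regmat ?X0 (gen_alg ?X0 ?E) m m (\<lambda>V. flag_basis V m)" by (rule A0.regmat_flag_basis[where m = m, OF ar order_refl])
    have "regf ?X0 (gen_alg ?X0 ?E) (\<lambda>V. inverse (flag_Delta m V) * (\<Prod>i<m. det (flag_basis V i)))"
      by (intro A0.regf_mult A0.regf_prod de) (auto intro!: regf_gen)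
    then have inv: "regf ?X0 (gen_alg ?X0 ?E) (\<lambda>V. inverse (det (flag_basis V m)))"
    proof (rule regf_cong)
      fix V assume V: "V \<in> ?X0"
      have "flag_Delta m V = (\<Prod>i<m. det (flag_basis V i)) * det (flag_basis V m)"
        unfolding flag_Delta_def lessThan_Suc_atMost[symmetric] by (rule prod.lessThan_Suc)
      then show "inverse (flag_Delta m V) * (\<Prod>i<m. det (flag_basis V i)) = inverse (det (flag_basis V m))"
        using V by (auto simp: field_simps)
    qed
    have "regmat ?X0 (gen_alg ?X0 ?E) m m (\<lambda>V. gl_inv m (flag_basis V m))"
      by (rule A0.regmat_inverse[where F = "\<lambda>V. flag_basis V m", OF Mr _ inv]) (use flag_basis_GL in auto)
    then have "regmat ?X0 (gen_alg ?X0 ?E) m m (\<lambda>V. transpose_mat (gl_inv m (flag_basis V m)) * flag_form m V * gl_inv m (flag_basis V m))"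
      by (intro A0.regmat_mult[where n = m] A0.regmat_transpose form)
    then have last: "regmat ?X0 (gen_alg ?X0 ?E) m m (\<lambda>V. V m)"
    proof (rule regmat_cong)
      fix V assume V: "V \<in> ?X0"
      have "flag_act m (flag_frame m V) (flag_point m (flag_form m V)) m = V m" using flag_frame_act[of V s m] V by simp
      then show "transpose_mat (gl_inv m (flag_basis V m)) * flag_form m V * gl_inv m (flag_basis V m) = V m"
        by (simp add: flag_act_sel flag_frame_def flag_point_def)
    qed
    have "regf ?X0 (gen_alg ?X0 ?E) (\<lambda>x. f (id x))"
    proof (rule regf_pullback[where p = id and f = f, OF fun_alg.regf_mem[OF fun_alg_gen_alg f] A0.fun_alg_axioms])
      fix c :: "(nat => 'k mat) => 'k" assume "c \<in> flag_entries m"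
      then obtain a i j where a: "a \<le> m" "i < min (Suc a) m" "j < a" "c = (\<lambda>V. V a $$ (i, j))"
        unfolding flag_entries_def by blast
      show "regf ?X0 (gen_alg ?X0 ?E) (\<lambda>x. c (id x))"
      proof (cases "a = m")
        case True
        then show ?thesis using regmatD(2)[OF last, of i j] a by simp
      next
        case False
        then show ?thesis using regmatD(2)[OF ar[of a], of i j] a by simp
      qed
    qed auto
    then show "regf ?X0 (gen_alg ?X0 ?E) f" by simp
  qed
  then show thesis by (rule that)
qed

text \<open>Zero rows record a number in a matrix; this is the injection which \<open>K_restriction\<close> asks for.\<close>

lemma pad_rows_inj:
  "inj_on (\<lambda>(i, A). mat (m + i) m (\<lambda>(p, q). if p < m then A $$ (p, q) else (0::'k::field))) (UNIV \<times> eps_mat s m)"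
proof (rule inj_onI, clarify)
  fix i j :: nat and A B :: "'k mat"
  let ?e = "\<lambda>i A. mat (m + i) m (\<lambda>(p, q). if p < m then A $$ (p, q) else (0::'k))"
  assume "A \<in> eps_mat s m" "B \<in> eps_mat s m" and e: "?e i A = ?e j B"
  then have AB: "dim_row A = m" "dim_col A = m" "dim_row B = m" "dim_col B = m" by (auto simp: eps_mat_def)
  have "dim_row (?e i A) = dim_row (?e j B)" using e by (rule arg_cong)
  moreover have "A = B"
  proof (rule eq_matI)
    fix p q assume "p < dim_row B" "q < dim_col B"
    then have pq: "p < m" "q < m" by (simp_all add: AB)
    have "?e i A $$ (p, q) = ?e j B $$ (p, q)" using e by (rule arg_cong)
    then show "A $$ (p, q) = B $$ (p, q)" using pq by simp
  qed (simp_all add: AB)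
  ultimately show "i = j \<and> A = B" by simp
qed

theorem theorem8p7:
  fixes \<epsilon> :: int and d :: nat
  assumes "CHAR('k::alg_closed_field) \<noteq> 2"
    and "\<epsilon> \<in> {1, -1}"
  shows "let MB = eps_mat_gvar \<epsilon> (2 * d) (lower_borel (2 * d)) :: ('k mat, 'k mat, 'k) gvar;
             MT = eps_mat_gvar \<epsilon> (2 * d) (diag_torus (2 * d)) :: ('k mat, 'k mat, 'k) gvar
    in \<exists>(Q :: (nat, nat) sym_quiver) dv.
    symmetric_type_A Q \<and> symmetric_dimvec Q dv \<and>
    (\<exists>\<Omega> :: nat \<Rightarrow> 'k mat. form_choice Q dv \<Omega>) \<and>
    (\<forall>\<Omega> :: nat \<Rightarrow> 'k mat. form_choice Q dv \<Omega> \<longrightarrow>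
      (let R = srep_gvar Q dv \<Omega> in
       \<exists>U. openin (gvar_top R) U \<and> (\<forall>g\<in>carrier (grp R). \<forall>V\<in>U. gact R g V \<in> U) \<and>
         (\<exists>\<Phi>. inj_on \<Phi> (orbit_closures MB) \<and> mono_on (orbit_closures MB) \<Phi> \<and>
            \<Phi> ` orbit_closures MB = {C \<in> orbit_closures R. C \<inter> U \<noteq> {}} \<and>
            (\<forall>C\<in>orbit_closures MB. \<forall>x\<in>C. \<exists>y\<in>\<Phi> C.
               smoothly_equivalent (closed_sub MB C) x (closed_sub R (\<Phi> C)) y) \<and>
            (\<exists>f\<in>hom (K_group R) (K_group MT). \<forall>C\<in>orbit_closures MB.
               f (K_class R (structure_sheaf R (\<Phi> C))) = K_class MT (structure_sheaf MT C)))))"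
proof -
  define m where "m = 2 * d"
  let ?MB = "eps_mat_gvar \<epsilon> m (lower_borel m) :: ('k mat, 'k mat, 'k) gvar"
  let ?MT = "eps_mat_gvar \<epsilon> m (diag_torus m) :: ('k mat, 'k mat, 'k) gvar"
  let ?R = "flag_gvar \<epsilon> m :: (nat => 'k mat, nat => 'k mat, 'k) gvar"
  obtain n \<xi> P where "coordinate_slice ?R ?MB (flag_point m) (flag_form m) (flag_Delta m) (flag_frame m) (flag_hom m) n \<xi> P"
    by (rule coordinate_slice_flag)
  then interpret B: coordinate_slice ?R ?MB "flag_point m" "flag_form m" "flag_Delta m" "flag_frame m" "flag_hom m" n \<xi> P .
  interpret T: slice ?R ?MT "flag_point m" "flag_form m" "flag_Delta m" "flag_frame m" "flag_hom m"
    by (rule slice_flag[OF diag_torus_subgroup diag_torus_subset])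
  obtain f where f: "f \<in> hom (K_group ?R) (K_group ?MT)"
    and fres: "\<And>M \<kappa> N. T.restriction M \<kappa> N ==> f (K_class ?R M) = K_class ?MT N"
    by (rule T.K_restriction[OF pad_rows_inj[of m \<epsilon>, folded eps_mat_gvar_sel(3)[of \<epsilon> m "diag_torus m"]]]) (rule that)
  have st: "B.T.stable C" "B.T.closure C = C" "C \<subseteq> pts ?MB" if "C \<in> orbit_closures ?MB" for C
    using B.T.orbit_closure_stable[OF that] B.T.orbit_closure_closed[OF that] by (simp_all add: B.T.stable_def)
  have K: "f (K_class ?R (structure_sheaf ?R (B.sat C))) = K_class ?MT (structure_sheaf ?MT C)"
    if C: "C \<in> orbit_closures ?MB" for C
  proof (rule fres[OF T.restriction_structure_sheaf])
    show "T.T.stable C" using st(1)[OF C] diag_torus_subset[of m] unfolding T.T.stable_def B.T.stable_def by simp blast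
    show "B.G.stable (B.sat C)" by (rule B.stable_sat[OF st(3)[OF C]])
    show "flag_point m y \<in> B.sat C" if "y \<in> C" for y by (rule B.iota_sat[OF st(3)[OF C] that])
    show "flag_Delta m x * b (flag_form m x) = 0"
      if "b \<in> pts_fun ?MT" "\<And>y. y \<in> C ==> b y = 0" "x \<in> B.sat C" for b x
      by (rule B.sat_vanishing[OF st(1)[OF C] _ that(2,3)]) (use that(1) in simp_all)
  qed
  have smooth: "\<exists>y\<in>B.sat C. smoothly_equivalent (closed_sub ?MB C) x (closed_sub ?R (B.sat C)) y"
    if C: "C \<in> orbit_closures ?MB" and x: "x \<in> C" for C x
    using B.smoothly_equivalent_sat[OF st(1,2)[OF C] x] B.iota_sat[OF st(3)[OF C] x] by blast
  have mono: "mono_on (orbit_closures ?MB) B.sat" by (rule mono_onI) (rule B.sat_mono)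
  have main: "\<exists>U. openin (gvar_top ?R) U \<and> (\<forall>g\<in>carrier (grp ?R). \<forall>V\<in>U. gact ?R g V \<in> U) \<and>
         (\<exists>\<Phi>. inj_on \<Phi> (orbit_closures ?MB) \<and> mono_on (orbit_closures ?MB) \<Phi> \<and>
            \<Phi> ` orbit_closures ?MB = {C \<in> orbit_closures ?R. C \<inter> U \<noteq> {}} \<and>
            (\<forall>C\<in>orbit_closures ?MB. \<forall>x\<in>C. \<exists>y\<in>\<Phi> C.
               smoothly_equivalent (closed_sub ?MB C) x (closed_sub ?R (\<Phi> C)) y) \<and>
            (\<exists>f\<in>hom (K_group ?R) (K_group ?MT). \<forall>C\<in>orbit_closures ?MB.
               f (K_class ?R (structure_sheaf ?R (\<Phi> C))) = K_class ?MT (structure_sheaf ?MT C)))"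
    by (intro exI[of _ B.sat_open] exI[of _ B.sat] conjI ballI bexI[of _ f] B.openin_sat_open B.sat_open_stable
        B.inj_sat mono B.image_sat smooth f K)
  show ?thesis unfolding Let_def m_def[symmetric]
  proof (intro exI[of _ "flag_quiver \<epsilon> m"] exI[of _ "flag_dim m"] conjI allI impI)
    show "symmetric_type_A (flag_quiver \<epsilon> m)" by (rule symmetric_type_A_flag_quiver[OF assms(2)])
    show "symmetric_dimvec (flag_quiver \<epsilon> m) (flag_dim m)" by (rule symmetric_dimvec_flag)
    show "\<exists>\<Omega> :: nat => 'k mat. form_choice (flag_quiver \<epsilon> m) (flag_dim m) \<Omega>"
      using form_choice_flag by blast
  qed (unfold srep_gvar_flag_quiver, rule main)
qed

end
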